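(* Let $0<\Lambda<\Lambda_1/2$, let $\Omega\subset\mathbb{R}^{2m}$ be open, $m\ge 2$, and let $\varphi\in\mathcal{K}(\Omega,\emptyset)$. Let further $V_k:\Omega\to\mathbb{R}$, $k\in\mathbb{N}$, be functions for which there exists $x_0\in S_\varphi^*$ such that $$\liminf_{k\to+\infty}\int_{B_\varepsilon(x_0)\cap\Omega}V_k\,dx>0\quad\text{for every }\varepsilon>0,\qquad 0\le V_k\le b<\infty,$$ with $b$ a constant independent of $k$. Then there exists a sequence $(u_k)_{k\in\mathbb{N}}$ of solutions to $$(-\Delta)^m u_k=V_k e^{2mu_k}\quad\text{in }\Omega$$ with $$\int_\Omega V_k e^{2mu_k}\,dx=\Lambda,$$ such that, as $k\to\infty$, $$u_k\to-\infty\ \text{ locally uniformly in }\Omega\setminus S_\varphi,\qquad u_k\to+\infty\ \text{ locally uniformly on }S_\varphi^*.$$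
   Context: Notation: $m$ is an integer and $\Lambda_1:=(2m-1)!\,\mathrm{vol}(S^{2m})$, where $S^{2m}$ is the unit sphere in $\mathbb{R}^{2m+1}$. $\mathcal{K}(\Omega,\emptyset):=\{\varphi\in C^\infty(\Omega):\varphi\le 0,\ \varphi\not\equiv 0,\ \Delta^m\varphi\equiv 0\}$. For $\varphi\in\mathcal{K}(\Omega,\emptyset)$, $S_\varphi:=\{x\in\Omega:\varphi(x)=0\}$ and $S_\varphi^*:=S_\varphi\cup\{x\in\partial\Omega:\lim_{\Omega\ni y\to x}\varphi(y)=0\}$. $B_\varepsilon(x_0)$ is the ball of radius $\varepsilon$ centered at $x_0$. Solutions are of class $C^{2m-1}(\Omega)$, with the equation understood in the weak sense, and $u_k$ is regarded as defined on $\Omega\cup S_\varphi^*$ (by continuous extension at boundary points).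
   Formalization: φ is assumed not identically zero on each connected component of Ω (automatic for connected Ω; otherwise the claim can fail), and the integral equals Λ for every k such that V_k is not zero almost everywhere (for other k, finitely many, it is 0). *)

theory Defs
  imports "HOL-Analysis.Analysis"
begin

definition dir_deriv :: "'a::euclidean_space \<Rightarrow> ('a \<Rightarrow> real) \<Rightarrow> 'a \<Rightarrow> real" where
  "dir_deriv v f = (\<lambda>x. frechet_derivative f (at x) v)"

text \<open>All differential operators below act on total functions but are only ever evaluated on
  open sets where the function is regular enough; there the values outside are irrelevant.\<close>

definition laplacian :: "('a::euclidean_space \<Rightarrow> real) \<Rightarrow> 'a \<Rightarrow> real" where
  "laplacian f = (\<lambda>x. \<Sum>b\<in>Basis. dir_deriv b (dir_deriv b f) x)"

definition neg_laplacian :: "('a::euclidean_space \<Rightarrow> real) \<Rightarrow> 'a \<Rightarrow> real" where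
  "neg_laplacian f = (\<lambda>x. - laplacian f x)"

text \<open>The class \<open>C\<^sup>k(S)\<close>, meant for open \<open>S\<close>.\<close>

primrec Ck_on :: "nat \<Rightarrow> 'a::euclidean_space set \<Rightarrow> ('a \<Rightarrow> real) \<Rightarrow> bool" where
  "Ck_on 0 S f \<longleftrightarrow> continuous_on S f"
| "Ck_on (Suc k) S f \<longleftrightarrow>
     (\<forall>x\<in>S. f differentiable (at x)) \<and> (\<forall>b\<in>Basis. Ck_on k S (dir_deriv b f))"

definition smooth_on :: "'a::euclidean_space set \<Rightarrow> ('a \<Rightarrow> real) \<Rightarrow> bool" where
  "smooth_on S f \<longleftrightarrow> (\<forall>k. Ck_on k S f)"

text \<open>\<open>sphere_vol d\<close> is the \<open>d\<close>-dimensional surface measure of the unit sphere of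
  \<open>(d+1)\<close>-dimensional Euclidean space: the surface measure of a part \<open>A\<close> of that sphere is
  \<open>d + 1\<close> times the Lebesgue measure of the cone \<open>{t x | 0 < t < 1, x \<in> A}\<close>, which for the whole
  sphere is the punctured unit ball.\<close>

definition sphere_vol :: "nat \<Rightarrow> real" where
  "sphere_vol d = real (d + 1) * unit_ball_vol (real (d + 1))"

lemma sphere_vol_eq_content_ball:
  assumes "DIM('a::euclidean_space) = d + 1"
  shows "sphere_vol d = real (d + 1) * measure lebesgue (ball (0::'a) 1)"
  using assms content_ball[of 1 "0::'a"] by (simp add: sphere_vol_def)

lemma sphere_vol_1: "sphere_vol 1 = 2 * pi"
  and sphere_vol_2: "sphere_vol 2 = 4 * pi"
  by (simp_all add: sphere_vol_def unit_ball_vol_numeral fact_numeral)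

definition Lambda1 :: "nat \<Rightarrow> real" where
  "Lambda1 m = fact (2 * m - 1) * sphere_vol (2 * m)"

definition K_class :: "nat \<Rightarrow> 'a::euclidean_space set \<Rightarrow> ('a \<Rightarrow> real) set" where
  "K_class m \<Omega> = {\<phi>. smooth_on \<Omega> \<phi> \<and> (\<forall>x\<in>\<Omega>. \<phi> x \<le> 0) \<and> (\<exists>x\<in>\<Omega>. \<phi> x \<noteq> 0) \<and>
                     (\<forall>x\<in>\<Omega>. (laplacian ^^ m) \<phi> x = 0)}"

definition zero_set :: "'a::euclidean_space set \<Rightarrow> ('a \<Rightarrow> real) \<Rightarrow> 'a set" where
  "zero_set \<Omega> \<phi> = {x\<in>\<Omega>. \<phi> x = 0}"

definition zero_set_star :: "'a::euclidean_space set \<Rightarrow> ('a \<Rightarrow> real) \<Rightarrow> 'a set" where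
  "zero_set_star \<Omega> \<phi> = zero_set \<Omega> \<phi> \<union> {x\<in>frontier \<Omega>. (\<phi> \<longlongrightarrow> 0) (at x within \<Omega>)}"

definition test_function :: "'a::euclidean_space set \<Rightarrow> ('a \<Rightarrow> real) \<Rightarrow> bool" where
  "test_function \<Omega> \<psi> \<longleftrightarrow> smooth_on UNIV \<psi> \<and>
     (\<exists>K. compact K \<and> K \<subseteq> \<Omega> \<and> (\<forall>x. x \<notin> K \<longrightarrow> \<psi> x = 0))"

text \<open>Weak form of \<open>(-\<Delta>)\<^sup>m u = V exp (2 m u)\<close> in \<open>\<Omega>\<close>, for \<open>u\<close> of class \<open>C\<^bsup>2m-1\<^esup>(\<Omega>)\<close>.\<close>

definition liouville_solution ::
    "nat \<Rightarrow> 'a::euclidean_space set \<Rightarrow> ('a \<Rightarrow> real) \<Rightarrow> ('a \<Rightarrow> real) \<Rightarrow> bool" where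
  "liouville_solution m \<Omega> V u \<longleftrightarrow>
     Ck_on (2 * m - 1) \<Omega> u \<and>
     (\<forall>\<psi>. test_function \<Omega> \<psi> \<longrightarrow>
        set_integrable lebesgue \<Omega> (\<lambda>x. V x * exp (2 * real m * u x) * \<psi> x) \<and>
        (LINT x:\<Omega>|lebesgue. u x * (neg_laplacian ^^ m) \<psi> x) =
        (LINT x:\<Omega>|lebesgue. V x * exp (2 * real m * u x) * \<psi> x))"

definition diverges_to_infinity_locally_uniformly_on ::
    "'a::metric_space set \<Rightarrow> (nat \<Rightarrow> 'a \<Rightarrow> real) \<Rightarrow> bool" where
  "diverges_to_infinity_locally_uniformly_on S u \<longleftrightarrow>
     (\<forall>x\<in>S. \<exists>r>0. \<forall>M. \<forall>\<^sub>F k in sequentially. \<forall>y\<in>S \<inter> ball x r. u k y > M)"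

definition diverges_to_minus_infinity_locally_uniformly_on ::
    "'a::metric_space set \<Rightarrow> (nat \<Rightarrow> 'a \<Rightarrow> real) \<Rightarrow> bool" where
  "diverges_to_minus_infinity_locally_uniformly_on S u \<longleftrightarrow>
     (\<forall>x\<in>S. \<exists>r>0. \<forall>M. \<forall>\<^sub>F k in sequentially. \<forall>y\<in>S \<inter> ball x r. u k y < M)"

text \<open>
  Two degenerate situations have to be kept in mind when these notions are combined.

  \<^item> A function in \<open>K_class m \<Omega>\<close> may vanish identically on one connected component of a disconnected
    \<open>\<Omega>\<close>. If a sequence \<open>u k\<close> diverges to infinity locally uniformly on \<open>zero_set_star \<Omega> \<phi>\<close> and
    \<open>V k = 1\<close> on that component, the integrals of \<open>V k * exp (2 * m * u k)\<close> are unbounded. So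
    prescribing these integrals requires \<open>\<phi>\<close> to be nontrivial on every component, which for
    connected \<open>\<Omega>\<close> is already part of \<open>K_class m \<Omega>\<close>.

  \<^item> A positive lower limit of the integrals of \<open>V k\<close> does not exclude that finitely many \<open>V k\<close>
    vanish almost everywhere; for these \<open>k\<close> the integral of \<open>V k * exp (2 * m * u k)\<close> is \<open>0\<close>,
    whatever \<open>u k\<close> is, and cannot be prescribed.
\<close>

end

theory Submission
  imports Defs "HOL-Complex_Analysis.Great_Picard" "HOL-Real_Asymp.Real_Asymp"
begin

text \<open>
  The solutions are sought as \<open>u k = k * \<phi> - |x|\<^sup>2 + c k + (2 / \<Lambda>\<^sub>1) * log(1/|\<cdot>|) \<star> (V k * exp (2 * m * u k))\<close>
  with \<open>\<phi>\<close> extended by \<open>0\<close>. Since \<open>m \<ge> 2\<close>, the quadratic term is annihilated by \<open>\<Delta>\<^sup>m\<close>, and it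
  makes all weights integrable. In terms of the density \<open>f = V k * exp (2 * m * u k) / \<Lambda>\<close> this is a
  mean field equation with a logarithmic kernel. It is solved for bounded kernels as the
  Euler-Lagrange equation of a free energy on simple functions and then by approximation; the a
  priori bound is Jensen's inequality for \<open>exp\<close> of the potential of the probability density \<open>f\<close>, which applies because
  the resulting kernel \<open>|x - y| powr (- 2 * m * \<Lambda> / (\<Lambda>\<^sub>1 / 2))\<close> is locally integrable for \<open>\<Lambda> < \<Lambda>\<^sub>1 / 2\<close>.

  The zero set of \<open>\<phi>\<close> is null, so the weights \<open>exp (2 * m * k * \<phi>)\<close> tend to \<open>0\<close> in mean and the
  constant \<open>c k\<close> normalising the total mass to \<open>\<Lambda>\<close> tends to infinity: this gives divergence on the
  zero set. The hypothesis at \<open>x0\<close> prevents the weights from decaying exponentially, so \<open>c k\<close> and the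
  potential are at most \<open>o(k)\<close>, which is beaten by \<open>k * \<phi>\<close> where \<open>\<phi> < 0\<close>.
\<close>

section \<open>Calculus of \<open>C\<^sup>k\<close> functions\<close>

text \<open>The constant \<gamma> = \<open>Lambda1 m / 2\<close> is the mass of (-\<Delta>)^m
  log(1/|x|) in dimension 2m: for -ln(|x|^2 + \<epsilon>^2)/2 the result is (2m-1)!/2 times a
  rescaled copy of (2/(1+|x|^2))^(2m), the Jacobian of inverse stereographic projection, whose
  integral is the volume of S^(2m). The exponent in the mean field equation is \<alpha> =
  2m\<Lambda>/\<gamma>, and \<alpha> < 2m leaves room for some \<beta> strictly between \<alpha> and
  2m. This gap does all the work: it turns exponential integrability with exponent \<beta> into a
  supremum bound for the potential that is only logarithmic in the mass of the weight, and it
  controls the part of the normalising integral where the potential is large. The obstacle is a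
  kernel unbounded above on the diagonal and below at infinity. A shift makes it nonnegative and
  truncation makes it bounded; the estimates then have to be independent of the truncation.
  Compactness comes from the kernel alone: translates of the logarithm are continuous in a weighted
  L^1 sense, so potentials of uniformly bounded densities are equicontinuous.\<close>

lemma dir_deriv_eq:
  assumes "(f has_derivative f') (at x)"
  shows "dir_deriv b f x = f' b"
  using frechet_derivative_at[OF assms] by (simp add: dir_deriv_def)

lemma dir_deriv_has_derivative:
  assumes "f differentiable (at x)"
  shows "(f has_derivative (\<lambda>v. \<Sum>b\<in>Basis. (v \<bullet> b) * dir_deriv b f x)) (at x)"
proof -
  let ?D = "frechet_derivative f (at x)"
  have D: "(f has_derivative ?D) (at x)" using assms frechet_derivative_works by blast
  then interpret linear ?D by (rule has_derivative_linear)
  have "?D v = (\<Sum>b\<in>Basis. (v \<bullet> b) * dir_deriv b f x)" for v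
  proof -
    have "?D v = ?D (\<Sum>b\<in>Basis. (v \<bullet> b) *\<^sub>R b)" by (simp add: euclidean_representation)
    then show ?thesis by (simp add: sum scale dir_deriv_def)
  qed
  then have "?D = (\<lambda>v. \<Sum>b\<in>Basis. (v \<bullet> b) * dir_deriv b f x)" by blast
  with D show ?thesis by simp
qed

lemma dir_deriv_cong:
  assumes "open S" "x \<in> S" "\<And>y. y \<in> S \<Longrightarrow> f y = g y"
  shows "dir_deriv b f x = dir_deriv b g x"
proof -
  have "(f has_derivative D) (at x) \<longleftrightarrow> (g has_derivative D) (at x)" for D
    using assms has_derivative_transform_within_open[of f D x UNIV S g]
      has_derivative_transform_within_open[of g D x UNIV S f] by auto
  then show ?thesis by (simp add: dir_deriv_def frechet_derivative_def)
qed

lemma differentiable_cong_open: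
  assumes "open S" "x \<in> S" "\<And>y. y \<in> S \<Longrightarrow> f y = g y"
  shows "f differentiable (at x) \<longleftrightarrow> g differentiable (at x)"
proof -
  have "(f has_derivative D) (at x) \<longleftrightarrow> (g has_derivative D) (at x)" for D
    using assms has_derivative_transform_within_open[of f D x UNIV S g]
      has_derivative_transform_within_open[of g D x UNIV S f] by auto
  then show ?thesis by (simp add: differentiable_def)
qed

lemma Ck_on_cong:
  assumes "open S" "\<And>y. y \<in> S \<Longrightarrow> f y = g y"
  shows "Ck_on k S f \<longleftrightarrow> Ck_on k S g"
  using assms(2)
proof (induction k arbitrary: f g)
  case 0
  then show ?case using continuous_on_cong[of S S f g] by simp
next
  case (Suc k)
  have "Ck_on k S (dir_deriv b f) \<longleftrightarrow> Ck_on k S (dir_deriv b g)" for b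
    by (rule Suc.IH) (use dir_deriv_cong[OF assms(1)] Suc.prems in blast)
  moreover have "\<forall>x\<in>S. f differentiable (at x) \<longleftrightarrow> g differentiable (at x)"
    using differentiable_cong_open[OF assms(1)] Suc.prems by blast
  ultimately show ?case by auto
qed

lemma Ck_on_subset: "Ck_on k T f \<Longrightarrow> S \<subseteq> T \<Longrightarrow> Ck_on k S f"
  by (induction k arbitrary: f) (auto intro: continuous_on_subset)

lemma Ck_on_SucD: "Ck_on (Suc k) S f \<Longrightarrow> Ck_on k S f"
proof (induction k arbitrary: f)
  case 0
  then show ?case
    by (auto intro!: continuous_at_imp_continuous_on differentiable_imp_continuous_within)
next
  case (Suc k)
  then show ?case by (metis Ck_on.simps(2))
qed

lemma Ck_on_mono: "Ck_on l S f \<Longrightarrow> k \<le> l \<Longrightarrow> Ck_on k S f"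
  by (induction l) (auto simp: le_Suc_eq dest: Ck_on_SucD simp del: Ck_on.simps)

lemma Ck_on_imp_continuous: "Ck_on k S f \<Longrightarrow> continuous_on S f"
  using Ck_on_mono[of k S f 0] by simp

lemma dir_deriv_const: "dir_deriv b (\<lambda>x. c) = (\<lambda>x. 0)"
  by (rule ext) (rule dir_deriv_eq[OF has_derivative_const])

lemma Ck_on_const: "Ck_on k S (\<lambda>x. c)"
  by (induction k arbitrary: c) (auto simp: dir_deriv_const)

lemma Ck_on_linear:
  assumes "bounded_linear f" shows "Ck_on k S f"
proof (cases k)
  case 0
  then show ?thesis using assms by (simp add: linear_continuous_on)
next
  case (Suc l)
  have d: "(f has_derivative f) (at x)" for x
    using assms by (rule bounded_linear_imp_has_derivative)
  then have "dir_deriv b f = (\<lambda>x. f b)" for b by (auto simp: dir_deriv_eq)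
  then show ?thesis using Suc d by (auto simp: Ck_on_const differentiable_def)
qed

lemma dir_deriv_add:
  assumes "f differentiable (at x)" "g differentiable (at x)"
  shows "dir_deriv b (\<lambda>x. f x + g x) x = dir_deriv b f x + dir_deriv b g x"
  using dir_deriv_eq[OF has_derivative_add[OF assms[unfolded frechet_derivative_works]]]
  by (simp add: dir_deriv_def)

lemma dir_deriv_mult:
  assumes "f differentiable (at x)" "g differentiable (at x)"
  shows "dir_deriv b (\<lambda>x. f x * g x) x = f x * dir_deriv b g x + dir_deriv b f x * g x"
  using dir_deriv_eq[OF has_derivative_mult[OF assms[unfolded frechet_derivative_works]]]
  by (simp add: dir_deriv_def)

lemma dir_deriv_cmult:
  assumes "f differentiable (at x)"
  shows "dir_deriv b (\<lambda>x. c * f x) x = c * dir_deriv b f x"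
  using dir_deriv_mult[of "\<lambda>x. c" x f b] assms by (simp add: dir_deriv_const)

lemma dir_deriv_chain:
  assumes "f differentiable (at x)" "(g has_real_derivative g') (at (f x))"
  shows "dir_deriv b (\<lambda>x. g (f x)) x = dir_deriv b f x * g'"
proof -
  have "((\<lambda>x. g (f x)) has_derivative (\<lambda>v. frechet_derivative f (at x) v * g')) (at x)"
    using assms(1)[unfolded frechet_derivative_works] assms(2)
    by (intro DERIV_compose_FDERIV)
  from dir_deriv_eq[OF this] show ?thesis by (simp add: dir_deriv_def)
qed

lemma Ck_on_add:
  assumes "open S" "Ck_on k S f" "Ck_on k S g"
  shows "Ck_on k S (\<lambda>x. f x + g x)"
  using assms(2,3)
proof (induction k arbitrary: f g)
  case 0
  then show ?case by (auto intro: continuous_on_add)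
next
  case (Suc k)
  have "Ck_on k S (dir_deriv b (\<lambda>x. f x + g x))" if "b \<in> Basis" for b
    using Ck_on_cong[OF assms(1), of "dir_deriv b (\<lambda>x. f x + g x)"
        "\<lambda>x. dir_deriv b f x + dir_deriv b g x"] Suc that by (auto simp: dir_deriv_add)
  then show ?case using Suc.prems by auto
qed

lemma Ck_on_mult:
  assumes "open S" "Ck_on k S f" "Ck_on k S g"
  shows "Ck_on k S (\<lambda>x. f x * g x)"
  using assms(2,3)
proof (induction k arbitrary: f g)
  case 0
  then show ?case by (auto intro: continuous_on_mult)
next
  case (Suc k)
  have "Ck_on k S (dir_deriv b (\<lambda>x. f x * g x))" if b: "b \<in> Basis" for b
  proof -
    have "Ck_on k S (\<lambda>x. f x * dir_deriv b g x + dir_deriv b f x * g x)"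
      using Suc b Ck_on_SucD[of k S] by (intro Ck_on_add assms Suc.IH) auto
    then show ?thesis
      using Ck_on_cong[OF assms(1), of "dir_deriv b (\<lambda>x. f x * g x)"
        "\<lambda>x. f x * dir_deriv b g x + dir_deriv b f x * g x"] Suc.prems
      by (auto simp: dir_deriv_mult)
  qed
  then show ?case using Suc.prems by auto
qed

lemma Ck_on_cmult: "open S \<Longrightarrow> Ck_on k S f \<Longrightarrow> Ck_on k S (\<lambda>x. c * f x)"
  by (intro Ck_on_mult Ck_on_const)

lemma Ck_on_sum:
  assumes "open S" "\<And>i. i \<in> I \<Longrightarrow> Ck_on k S (f i)"
  shows "Ck_on k S (\<lambda>x. \<Sum>i\<in>I. f i x)"
  using assms(2)
  by (induction I rule: infinite_finite_induct) (auto intro: Ck_on_add assms(1) Ck_on_const)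

lemma Ck_on_power: "open S \<Longrightarrow> Ck_on k S f \<Longrightarrow> Ck_on k S (\<lambda>x. f x ^ n)"
  by (induction n) (auto intro: Ck_on_mult Ck_on_const)

text \<open>The outer function comes as a family \<open>g\<close> in which each member is the
  derivative of the previous one. The derivative of a composite is then a product with another
  composite of the same family, so a single induction over the order, general in \<open>i\<close>,
  closes.\<close>

lemma Ck_on_chain:
  assumes "open S" "\<And>k. Ck_on k S f"
    and "\<And>i x. x \<in> S \<Longrightarrow> (g i has_real_derivative g (Suc i) (f x)) (at (f x))"
  shows "Ck_on k S (\<lambda>x. g i (f x))"
proof (induction k arbitrary: i)
  case 0
  have "isCont (g i) (f x)" if "x \<in> S" for x using assms(3)[OF that] by (rule DERIV_isCont)
  moreover have "isCont f x" if "x \<in> S" for x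
    using assms(2)[of 0] that \<open>open S\<close> by (simp add: continuous_on_eq_continuous_at)
  ultimately show ?case
    by (auto simp: continuous_on_eq_continuous_at[OF \<open>open S\<close>] intro: isCont_o2)
next
  case (Suc k)
  have df: "f differentiable (at x)" if "x \<in> S" for x using assms(2)[of 1] that by auto
  have "Ck_on k S (dir_deriv b (\<lambda>x. g i (f x)))" if b: "b \<in> Basis" for b
  proof -
    have "Ck_on k S (\<lambda>x. dir_deriv b f x * g (Suc i) (f x))"
      using assms(2)[of "Suc k"] b by (intro Ck_on_mult Suc assms(1)) auto
    then show ?thesis
      using Ck_on_cong[OF assms(1), of "dir_deriv b (\<lambda>x. g i (f x))"
        "\<lambda>x. dir_deriv b f x * g (Suc i) (f x)"]
      by (auto simp: dir_deriv_chain[OF df assms(3)])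
  qed
  moreover have "(\<lambda>x. g i (f x)) differentiable (at x)" if "x \<in> S" for x
    using df[OF that] assms(3)[OF that]
    by (metis DERIV_compose_FDERIV differentiable_def)
  ultimately show ?case by auto
qed

lemma smooth_onD: "smooth_on S f \<Longrightarrow> Ck_on k S f"
  by (simp add: smooth_on_def)

lemma smooth_on_differentiable: "smooth_on S f \<Longrightarrow> x \<in> S \<Longrightarrow> f differentiable (at x)"
  using smooth_onD[of S f 1] by auto

lemma smooth_on_continuous_on: "smooth_on S f \<Longrightarrow> continuous_on S f"
  using smooth_onD[of S f 0] by auto

lemma smooth_on_dir_deriv:
  assumes "smooth_on S f" "b \<in> Basis" shows "smooth_on S (dir_deriv b f)"
  using assms(2) smooth_onD[OF assms(1), of "Suc k" for k] by (auto simp: smooth_on_def)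

lemma smooth_on_subset: "smooth_on T f \<Longrightarrow> S \<subseteq> T \<Longrightarrow> smooth_on S f"
  by (auto simp: smooth_on_def intro: Ck_on_subset)

lemma smooth_on_const: "smooth_on S (\<lambda>x. c)"
  by (simp add: smooth_on_def Ck_on_const)

lemma smooth_on_linear: "bounded_linear f \<Longrightarrow> smooth_on S f"
  by (simp add: smooth_on_def Ck_on_linear)

lemma smooth_on_add: "open S \<Longrightarrow> smooth_on S f \<Longrightarrow> smooth_on S g \<Longrightarrow> smooth_on S (\<lambda>x. f x + g x)"
  by (simp add: smooth_on_def Ck_on_add)

lemma smooth_on_mult: "open S \<Longrightarrow> smooth_on S f \<Longrightarrow> smooth_on S g \<Longrightarrow> smooth_on S (\<lambda>x. f x * g x)"
  by (simp add: smooth_on_def Ck_on_mult)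

lemma smooth_on_cmult: "open S \<Longrightarrow> smooth_on S f \<Longrightarrow> smooth_on S (\<lambda>x. c * f x)"
  by (simp add: smooth_on_def Ck_on_cmult)

lemma smooth_on_sum:
  "open S \<Longrightarrow> (\<And>i. i \<in> I \<Longrightarrow> smooth_on S (f i)) \<Longrightarrow> smooth_on S (\<lambda>x. \<Sum>i\<in>I. f i x)"
  by (simp add: smooth_on_def Ck_on_sum)

lemma smooth_on_power: "open S \<Longrightarrow> smooth_on S f \<Longrightarrow> smooth_on S (\<lambda>x. f x ^ n)"
  by (simp add: smooth_on_def Ck_on_power)

lemma smooth_on_laplacian:
  assumes "open S" "smooth_on S f" shows "smooth_on S (laplacian f)"
  unfolding laplacian_def using assms by (intro smooth_on_sum smooth_on_dir_deriv)

lemma smooth_on_inverse: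
  assumes S: "open S" "smooth_on S f" and f: "\<And>x. x \<in> S \<Longrightarrow> f x \<noteq> 0"
  shows "smooth_on S (\<lambda>x. inverse (f x))"
proof -
  \<comment> \<open>\<open>g i\<close> is the i-th derivative of 1/t.\<close>
  define g :: "nat \<Rightarrow> real \<Rightarrow> real" where "g i t = (-1)^i * fact i * inverse t ^ Suc i" for i t
  have "(g i has_real_derivative g (Suc i) t) (at t)" if "t \<noteq> 0" for i t
  proof -
    have "((\<lambda>t. inverse t ^ Suc i) has_real_derivative
        of_nat (Suc i) * (inverse t ^ i * - (inverse t ^ Suc (Suc 0)))) (at t)"
      using DERIV_power[OF DERIV_inverse[OF that, of UNIV], of "Suc i"] by (simp add: mult_ac)
    from DERIV_cmult[OF this, of "(-1)^i * fact i"] show ?thesis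
      unfolding g_def by (simp add: algebra_simps)
  qed
  then have "Ck_on k S (\<lambda>x. g 0 (f x))" for k
    using Ck_on_chain[where f = f and g = g and S = S and i = 0 and k = k] S(1) smooth_onD[OF S(2)] f
    by presburger
  then show ?thesis by (simp add: smooth_on_def g_def)
qed

text \<open>The derivative of the composite is the derivative of \<open>f\<close> times 1/f, which
  is smooth by the previous lemma; only the first differentiation involves the logarithm
  itself.\<close>

lemma smooth_on_ln:
  assumes S: "open S" "smooth_on S f" and f: "\<And>x. x \<in> S \<Longrightarrow> f x > 0"
  shows "smooth_on S (\<lambda>x. ln (f x))"
  unfolding smooth_on_def
proof
  fix k
  have df: "f differentiable (at x)" if "x \<in> S" for x using smooth_on_differentiable S that by blast
  have dln: "(ln has_real_derivative inverse (f x)) (at (f x))" if "x \<in> S" for x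
    using f[OF that] by (rule DERIV_ln)
  show "Ck_on k S (\<lambda>x. ln (f x))"
  proof (cases k)
    case 0
    have "f x \<noteq> 0" if "x \<in> S" for x using f[OF that] by simp
    then show ?thesis using 0 smooth_on_continuous_on[OF S(2)]
      by (auto intro!: continuous_on_ln)
  next
    case (Suc l)
    have "Ck_on l S (dir_deriv b (\<lambda>x. ln (f x)))" if b: "b \<in> Basis" for b
    proof -
      have "smooth_on S (\<lambda>x. dir_deriv b f x * inverse (f x))"
        using S b f by (intro smooth_on_mult smooth_on_inverse smooth_on_dir_deriv) force+
      then show ?thesis
        using Ck_on_cong[OF S(1), of "dir_deriv b (\<lambda>x. ln (f x))"
          "\<lambda>x. dir_deriv b f x * inverse (f x)" l]
        by (auto simp: dir_deriv_chain[OF df dln] smooth_on_def)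
    qed
    moreover have "(\<lambda>x. ln (f x)) differentiable (at x)" if "x \<in> S" for x
      using df[OF that] dln[OF that] by (metis DERIV_compose_FDERIV differentiable_def)
    ultimately show ?thesis using Suc by auto
  qed
qed

section \<open>Locality and linearity of iterated Laplacians\<close>

lemma laplacian_cong:
  assumes "open S" "\<And>y. y \<in> S \<Longrightarrow> f y = g y" "x \<in> S"
  shows "laplacian f x = laplacian g x"
proof -
  have "dir_deriv b f y = dir_deriv b g y" if "y \<in> S" for b y
    using dir_deriv_cong[OF assms(1) that assms(2)] .
  from dir_deriv_cong[OF assms(1,3) this] show ?thesis by (simp add: laplacian_def)
qed

lemma laplacian_power_cong:
  assumes "open S" "\<And>y. y \<in> S \<Longrightarrow> f y = g y" "x \<in> S"
  shows "(laplacian ^^ n) f x = (laplacian ^^ n) g x"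
  using assms(3)
proof (induction n arbitrary: x)
  case 0
  then show ?case using assms by simp
next
  case (Suc n)
  show ?case using laplacian_cong[OF assms(1) Suc.IH Suc.prems] by simp
qed

lemma laplacian_add:
  assumes "open S" "smooth_on S f" "smooth_on S g" "x \<in> S"
  shows "laplacian (\<lambda>x. f x + g x) x = laplacian f x + laplacian g x"
proof -
  note d = smooth_on_differentiable[OF assms(2)] smooth_on_differentiable[OF assms(3)]
  have "dir_deriv b (dir_deriv b (\<lambda>x. f x + g x)) x = dir_deriv b (dir_deriv b f) x + dir_deriv b (dir_deriv b g) x"
    if b: "b \<in> Basis" for b
  proof -
    have "dir_deriv b (dir_deriv b (\<lambda>x. f x + g x)) x = dir_deriv b (\<lambda>x. dir_deriv b f x + dir_deriv b g x) x"
      by (rule dir_deriv_cong[OF assms(1,4)]) (simp add: dir_deriv_add d)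
    also have "\<dots> = dir_deriv b (dir_deriv b f) x + dir_deriv b (dir_deriv b g) x"
      using assms b by (intro dir_deriv_add smooth_on_differentiable[OF smooth_on_dir_deriv])
    finally show ?thesis .
  qed
  then show ?thesis by (simp add: laplacian_def sum.distrib)
qed

lemma laplacian_cmult:
  assumes "open S" "smooth_on S f" "x \<in> S"
  shows "laplacian (\<lambda>x. c * f x) x = c * laplacian f x"
proof -
  note d = smooth_on_differentiable[OF assms(2)]
  have "dir_deriv b (dir_deriv b (\<lambda>x. c * f x)) x = c * dir_deriv b (dir_deriv b f) x"
    if b: "b \<in> Basis" for b
  proof -
    have "dir_deriv b (dir_deriv b (\<lambda>x. c * f x)) x = dir_deriv b (\<lambda>x. c * dir_deriv b f x) x"
      by (rule dir_deriv_cong[OF assms(1,3)]) (simp add: dir_deriv_cmult d)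
    also have "\<dots> = c * dir_deriv b (dir_deriv b f) x"
      using assms b by (intro dir_deriv_cmult smooth_on_differentiable[OF smooth_on_dir_deriv])
    finally show ?thesis .
  qed
  then show ?thesis by (simp add: laplacian_def sum_distrib_left)
qed

lemma laplacian_const: "laplacian (\<lambda>x. c) = (\<lambda>x. 0)"
  by (simp add: laplacian_def dir_deriv_const)

lemma laplacian_sum:
  assumes "open S" "\<And>i. i \<in> I \<Longrightarrow> smooth_on S (f i)" "x \<in> S"
  shows "laplacian (\<lambda>x. \<Sum>i\<in>I. f i x) x = (\<Sum>i\<in>I. laplacian (f i) x)"
  using assms(2)
proof (induction I rule: infinite_finite_induct)
  case (insert i I)
  have "smooth_on S (\<lambda>x. \<Sum>i\<in>I. f i x)" using insert.prems by (intro smooth_on_sum assms(1)) auto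
  then show ?case
    using insert by (simp add: laplacian_add[OF assms(1) _ _ assms(3)])
qed (simp_all add: laplacian_const)

lemma smooth_on_laplacian_power:
  "open S \<Longrightarrow> smooth_on S f \<Longrightarrow> smooth_on S ((laplacian ^^ n) f)"
  by (induction n) (auto intro: smooth_on_laplacian)

lemma laplacian_power_add:
  assumes "open S" "smooth_on S f" "smooth_on S g" "x \<in> S"
  shows "(laplacian ^^ n) (\<lambda>x. f x + g x) x = (laplacian ^^ n) f x + (laplacian ^^ n) g x"
  using assms(4)
proof (induction n arbitrary: x)
  case (Suc n)
  have "(laplacian ^^ Suc n) (\<lambda>x. f x + g x) x =
      laplacian (\<lambda>x. (laplacian ^^ n) f x + (laplacian ^^ n) g x) x"
    using laplacian_cong[OF assms(1) Suc.IH Suc.prems] by simp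
  then show ?case using assms Suc by (simp add: laplacian_add[OF assms(1)] smooth_on_laplacian_power)
qed simp

lemma laplacian_power_cmult:
  assumes "open S" "smooth_on S f" "x \<in> S"
  shows "(laplacian ^^ n) (\<lambda>x. c * f x) x = c * (laplacian ^^ n) f x"
  using assms(3)
proof (induction n arbitrary: x)
  case (Suc n)
  have "(laplacian ^^ Suc n) (\<lambda>x. c * f x) x = laplacian (\<lambda>x. c * (laplacian ^^ n) f x) x"
    using laplacian_cong[OF assms(1) Suc.IH Suc.prems] by simp
  then show ?case using assms Suc by (simp add: laplacian_cmult[OF assms(1)] smooth_on_laplacian_power)
qed simp

text \<open>The operators act on arbitrary functions, for which a sign need not commute with formal
  derivatives; smoothness on an open set is what allows the signs to be collected.\<close>

lemma neg_laplacian_power: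
  assumes "open S" "smooth_on S f" "x \<in> S"
  shows "(neg_laplacian ^^ n) f x = (-1)^n * (laplacian ^^ n) f x"
  using assms(3)
proof (induction n arbitrary: x)
  case (Suc n)
  have "(neg_laplacian ^^ Suc n) f x = - laplacian ((neg_laplacian ^^ n) f) x"
    by (simp add: neg_laplacian_def)
  also have "laplacian ((neg_laplacian ^^ n) f) x = laplacian (\<lambda>x. (-1)^n * (laplacian ^^ n) f x) x"
    by (rule laplacian_cong[OF assms(1) _ Suc.prems]) (rule Suc.IH)
  also have "\<dots> = (-1)^n * laplacian ((laplacian ^^ n) f) x"
    by (rule laplacian_cmult[OF assms(1) smooth_on_laplacian_power[OF assms(1,2)] Suc.prems])
  finally show ?case by simp
qed simp

section \<open>Translations and integration by parts\<close>

lemma nn_integral_lborel_shift: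
  fixes g :: "'a::euclidean_space \<Rightarrow> ennreal"
  assumes [measurable]: "g \<in> borel_measurable borel"
  shows "(\<integral>\<^sup>+x. g (x + c) \<partial>lborel) = (\<integral>\<^sup>+x. g x \<partial>lborel)"
proof -
  have "(\<integral>\<^sup>+x. g x \<partial>lborel) = (\<integral>\<^sup>+x. g x \<partial>distr lborel borel ((+) c))"
    by (simp add: lborel_distr_plus)
  also have "\<dots> = (\<integral>\<^sup>+x. g (x + c) \<partial>lborel)"
    by (subst nn_integral_distr) (auto simp: add.commute)
  finally show ?thesis ..
qed

lemma nn_integral_lborel_reflect:
  fixes g :: "'a::euclidean_space \<Rightarrow> ennreal"
  assumes [measurable]: "g \<in> borel_measurable borel"
  shows "(\<integral>\<^sup>+x. g (c - x) \<partial>lborel) = (\<integral>\<^sup>+x. g x \<partial>lborel)"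
proof -
  have "(\<integral>\<^sup>+x. g x \<partial>lborel) = (\<integral>\<^sup>+x. g x \<partial>density (distr lborel borel (\<lambda>x. c + (-1) *\<^sub>R x)) (\<lambda>_. ennreal (\<bar>-1\<bar>^DIM('a))))"
    by (subst lborel_affine[of "-1" c]) (simp_all add: one_ennreal_def[symmetric])
  also have "\<dots> = (\<integral>\<^sup>+x. g (c - x) \<partial>lborel)"
    by (subst nn_integral_density, simp, simp, subst nn_integral_distr) auto
  finally show ?thesis ..
qed

lemma integrable_lborel_shift:
  fixes g :: "'a::euclidean_space \<Rightarrow> real"
  assumes "integrable lborel g"
  shows "integrable lborel (\<lambda>x. g (x + c))"
    and "(\<integral>x. g (x + c) \<partial>lborel) = (\<integral>x. g x \<partial>lborel)"
proof -
  have [measurable]: "g \<in> borel_measurable borel" using assms by simp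
  have "integrable (distr lborel borel ((+) c)) g" using assms by (simp add: lborel_distr_plus)
  then show "integrable lborel (\<lambda>x. g (x + c))"
    by (subst (asm) integrable_distr_eq) (auto simp: add.commute)
  have "(\<integral>x. g x \<partial>lborel) = (\<integral>x. g x \<partial>distr lborel borel ((+) c))"
    by (simp add: lborel_distr_plus)
  also have "\<dots> = (\<integral>x. g (x + c) \<partial>lborel)"
    by (subst integral_distr) (auto simp: add.commute)
  finally show "(\<integral>x. g (x + c) \<partial>lborel) = (\<integral>x. g x \<partial>lborel)" ..
qed

text \<open>Averaging over translates along a segment replaces Fubini's theorem in coordinates.\<close>

lemma integral_segment_translates:
  fixes g :: "'a::euclidean_space \<Rightarrow> real"
  assumes g: "integrable lborel g"
  shows "integrable lborel (\<lambda>x. \<integral>s. indicator {0..1} s * g (x + s *\<^sub>R v) \<partial>(lborel :: real measure))"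
    and "(\<integral>x. \<integral>s. indicator {0..1} s * g (x + s *\<^sub>R v) \<partial>(lborel :: real measure) \<partial>lborel) = (\<integral>x. g x \<partial>lborel)"
proof -
  have [measurable]: "g \<in> borel_measurable borel" using g by simp
  let ?f = "\<lambda>(s::real) x. indicator {0..1} s * g (x + s *\<^sub>R v)"
  have eq1: "(\<integral>x. norm (?f s x) \<partial>lborel) = indicator {0..1} s * (\<integral>x. \<bar>g x\<bar> \<partial>lborel)" for s
    using integrable_lborel_shift(2)[of "\<lambda>x. \<bar>g x\<bar>" "s *\<^sub>R v"] g by (simp add: abs_mult)
  have i01: "integrable (lborel :: real measure) (\<lambda>s. indicator {0..1} s * c)" for c :: real
    using borel_integrable_compact[of "{0..1::real}" "\<lambda>_. c"] by simp
  have int: "integrable (lborel \<Otimes>\<^sub>M lborel) (case_prod ?f)"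
  proof (rule lborel_pair.Fubini_integrable)
    show "case_prod ?f \<in> borel_measurable (lborel \<Otimes>\<^sub>M lborel)" by measurable
    show "integrable lborel (\<lambda>s. \<integral>x. norm (case_prod ?f (s, x)) \<partial>lborel)"
      using i01 by (simp only: prod.case eq1)
    show "AE s in lborel. integrable lborel (\<lambda>x. case_prod ?f (s, x))"
      using integrable_lborel_shift(1)[OF g] by simp
  qed
  show "integrable lborel (\<lambda>x. \<integral>s. ?f s x \<partial>(lborel :: real measure))"
    using lborel_pair.integrable_snd[OF int] .
  have "(\<integral>x. \<integral>s. ?f s x \<partial>lborel \<partial>lborel) = (\<integral>s. \<integral>x. ?f s x \<partial>lborel \<partial>lborel)"
    by (rule lborel_pair.Fubini_integral[OF int])
  also have "\<dots> = (\<integral>s. indicator {0..1::real} s * (\<integral>x. g x \<partial>lborel) \<partial>lborel)"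
    by (simp add: integrable_lborel_shift(2)[OF g])
  also have "\<dots> = (\<integral>x. g x \<partial>lborel)"
    by simp
  finally show "(\<integral>x. \<integral>s. ?f s x \<partial>(lborel :: real measure) \<partial>lborel) = (\<integral>x. g x \<partial>lborel)" .
qed

text \<open>The fundamental theorem of calculus on [x, x + v]. The derivative is an explicit family
  \<open>D\<close> and the parameter interval an indicator, so that the result fits the segment
  averages above as well as kernels that are differentiable only off the origin.\<close>

lemma integral_along_segment:
  fixes F :: "'a::euclidean_space \<Rightarrow> real"
  assumes F: "\<And>s. s \<in> {0..1} \<Longrightarrow> (F has_derivative D (x + s *\<^sub>R v)) (at (x + s *\<^sub>R v))"
    and cont: "continuous_on {0..1} (\<lambda>s. D (x + s *\<^sub>R v) v)"
  shows "(\<integral>s. indicator {0..1} s * D (x + s *\<^sub>R v) v \<partial>(lborel :: real measure)) = F (x + v) - F x"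
proof -
  have "((\<lambda>s. F (x + s *\<^sub>R v)) has_vector_derivative D (x + s *\<^sub>R v) v) (at s within {0..1})"
    if s: "0 \<le> s" "s \<le> 1" for s
  proof -
    have "((\<lambda>s. x + s *\<^sub>R v) has_derivative (\<lambda>t. t *\<^sub>R v)) (at s within {0..1})"
      by (auto intro!: derivative_eq_intros)
    from has_derivative_compose[OF this F]
    have d: "((\<lambda>s. F (x + s *\<^sub>R v)) has_derivative (\<lambda>t. D (x + s *\<^sub>R v) (t *\<^sub>R v))) (at s within {0..1})"
      using s by simp
    interpret linear "D (x + s *\<^sub>R v)" using F[of s] s has_derivative_linear by auto
    show ?thesis using d by (simp add: has_vector_derivative_def scale)
  qed
  from integral_FTC_atLeastAtMost[OF _ this cont] show ?thesis by simp
qed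

lemma integrable_continuous_compact_support:
  fixes f :: "'a::euclidean_space \<Rightarrow> real"
  assumes "compact K" "continuous_on K f" "\<And>x. x \<notin> K \<Longrightarrow> f x = 0"
  shows "integrable lborel f"
proof -
  have "f = (\<lambda>x. indicator K x *\<^sub>R f x)" using assms(3) by (force simp: indicator_def)
  with borel_integrable_compact[OF assms(1,2)] show ?thesis by simp
qed

lemma dir_deriv_zero_outside:
  assumes "compact K" "\<And>x. x \<notin> K \<Longrightarrow> f x = 0" "x \<notin> K"
  shows "dir_deriv b f x = 0"
  using dir_deriv_cong[of "- K" x f "\<lambda>_. 0" b] assms
  by (simp add: dir_deriv_const compact_imp_closed open_Compl)

text \<open>Averaged along segments in direction \<open>b\<close>, the derivative becomes the
  difference f(x + b) - f(x), and translation invariance of Lebesgue measure makes the integral of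
  that difference vanish.\<close>

lemma integral_dir_deriv_compact_support:
  fixes f :: "'a::euclidean_space \<Rightarrow> real"
  assumes f: "Ck_on 1 UNIV f" and K: "compact K" "\<And>x. x \<notin> K \<Longrightarrow> f x = 0" and b: "b \<in> Basis"
  shows "(\<integral>x. dir_deriv b f x \<partial>lborel) = 0"
proof -
  have diff: "f differentiable (at x)" for x using f by simp
  have cont: "continuous_on UNIV (dir_deriv b f)" using f b by simp
  have cf: "continuous_on UNIV f" using Ck_on_imp_continuous[OF f] .
  have int: "integrable lborel (dir_deriv b f)"
    by (rule integrable_continuous_compact_support[OF K(1) continuous_on_subset[OF cont]])
      (auto intro: dir_deriv_zero_outside[OF K])
  have intf: "integrable lborel f"
    by (rule integrable_continuous_compact_support[OF K(1) continuous_on_subset[OF cf]])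
      (auto intro: K)
  have "(\<integral>x. dir_deriv b f x \<partial>lborel) =
      (\<integral>x. \<integral>s. indicator {0..1} s * dir_deriv b f (x + s *\<^sub>R b) \<partial>(lborel :: real measure) \<partial>lborel)"
    by (rule integral_segment_translates(2)[OF int, symmetric])
  also have "\<dots> = (\<integral>x. f (x + b) - f x \<partial>lborel)"
  proof (rule Bochner_Integration.integral_cong[OF refl])
    fix x
    have "((\<lambda>s. dir_deriv b f (x + s *\<^sub>R b)) \<longlongrightarrow> dir_deriv b f (x + t *\<^sub>R b)) (at t within {0..1})" for t
      using cont by (intro continuous_on_tendsto_compose[OF cont]) (auto intro!: tendsto_eq_intros)
    then have "continuous_on {0..1} (\<lambda>s. dir_deriv b f (x + s *\<^sub>R b))"
      by (simp add: continuous_on_def)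
    then show "(\<integral>s. indicator {0..1} s * dir_deriv b f (x + s *\<^sub>R b) \<partial>(lborel :: real measure)) = f (x + b) - f x"
      using integral_along_segment[of f "\<lambda>x. frechet_derivative f (at x)" x b] diff
      by (simp add: frechet_derivative_works dir_deriv_def)
  qed
  also have "\<dots> = 0"
    using integrable_lborel_shift[OF intf, of b] intf by simp
  finally show ?thesis .
qed

text \<open>The open sets \<Omega> and -K cover the space. On the first the product is
  \<open>f\<close>, on the second it is identically 0, and continuity and differentiation are
  local.\<close>

lemma Ck_on_extend_zero:
  assumes "open \<Omega>" "Ck_on k \<Omega> f" "compact K" "K \<subseteq> \<Omega>" "\<And>x. x \<in> \<Omega> - K \<Longrightarrow> f x = 0"
  shows "Ck_on k UNIV (\<lambda>x. indicator \<Omega> x * f x)"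
  using assms(2,5)
proof (induction k arbitrary: f)
  have K: "open (- K)" using assms(3) by (simp add: compact_imp_closed open_Compl)
  have U: "UNIV = \<Omega> \<union> (- K)" using assms(4) by auto
  {
    case 0
    have "continuous_on \<Omega> (\<lambda>x. indicator \<Omega> x * f x)"
      by (rule continuous_on_cong[THEN iffD1, OF refl]) (use 0 in auto)
    moreover have "continuous_on (-K) (\<lambda>x. indicator \<Omega> x * f x)"
      by (rule continuous_on_cong[THEN iffD1, OF refl _ continuous_on_const[of _ 0]])
        (use 0 in \<open>auto simp: indicator_def\<close>)
    ultimately show ?case unfolding U Ck_on.simps
      by (intro continuous_on_open_Un assms(1) K) 
  next
    case (Suc k)
    have z: "indicator \<Omega> x * f x = 0" if "x \<in> - K" for x
      using Suc.prems that by (auto simp: indicator_def)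
    have fz: "dir_deriv b f x = 0" if "x \<in> \<Omega> - K" for b x
    proof -
      have "open (\<Omega> - K)" using assms by (simp add: compact_imp_closed open_Diff)
      from dir_deriv_cong[OF this that, of f "\<lambda>_. 0"] Suc.prems(2) show ?thesis
        by (simp add: dir_deriv_const)
    qed
    have eq: "dir_deriv b (\<lambda>x. indicator \<Omega> x * f x) x = indicator \<Omega> x * dir_deriv b f x" for b x
    proof (cases "x \<in> \<Omega>")
      case True
      then show ?thesis using dir_deriv_cong[OF assms(1) True, of "\<lambda>x. indicator \<Omega> x * f x" f] by simp
    next
      case False
      then have "x \<in> - K" using assms by auto
      from dir_deriv_cong[OF K this, of "\<lambda>x. indicator \<Omega> x * f x" "\<lambda>_. 0" b] z False
      show ?thesis by (simp add: dir_deriv_const)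
    qed
    have "(\<lambda>x. indicator \<Omega> x * f x) differentiable (at x)" for x
    proof (cases "x \<in> \<Omega>")
      case True
      then show ?thesis using differentiable_cong_open[OF assms(1) True, of "\<lambda>x. indicator \<Omega> x * f x" f]
         Suc.prems by simp
    next
      case False
      then have "x \<in> - K" using assms by auto
      from differentiable_cong_open[OF K this, of "\<lambda>x. indicator \<Omega> x * f x" "\<lambda>_. 0"] z
      show ?thesis by simp
    qed
    moreover have "Ck_on k UNIV (\<lambda>x. indicator \<Omega> x * dir_deriv b f x)" if "b \<in> Basis" for b
      using Suc.prems that by (intro Suc.IH fz) auto
    ultimately show ?case by (simp add: eq[abs_def])
  }
qed

lemma set_integrable_mult_compact_support:
  fixes h \<psi> :: "'a::euclidean_space \<Rightarrow> real"
  assumes "continuous_on \<Omega> h" "continuous_on UNIV \<psi>" "compact K" "K \<subseteq> \<Omega>"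
    "\<And>x. x \<notin> K \<Longrightarrow> \<psi> x = 0"
  shows "set_integrable lborel \<Omega> (\<lambda>x. h x * \<psi> x)"
  unfolding set_integrable_def
proof (rule integrable_continuous_compact_support[OF assms(3)])
  have "continuous_on K (\<lambda>x. h x * \<psi> x)"
    by (intro continuous_intros continuous_on_subset[OF assms(1)] continuous_on_subset[OF assms(2)])
      (use assms in auto)
  then show "continuous_on K (\<lambda>x. indicator \<Omega> x *\<^sub>R (h x * \<psi> x))"
    by (rule continuous_on_cong[THEN iffD1, rotated -1]) (use assms in auto)
qed (use assms in auto)

text \<open>The product h \<psi>, extended by 0, is C^1 on the whole space with support in
  \<open>K\<close>, so its derivative has integral 0. The function \<open>h\<close> may be singular
  at the boundary of \<Omega>, because \<psi> vanishes near it.\<close>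

lemma integral_by_parts:
  fixes h \<psi> :: "'a::euclidean_space \<Rightarrow> real"
  assumes \<Omega>: "open \<Omega>" and h: "Ck_on 1 \<Omega> h" and \<psi>: "Ck_on 1 UNIV \<psi>"
    and K: "compact K" "K \<subseteq> \<Omega>" "\<And>x. x \<notin> K \<Longrightarrow> \<psi> x = 0" and b: "b \<in> Basis"
  shows "(LINT x:\<Omega>|lborel. h x * dir_deriv b \<psi> x) = - (LINT x:\<Omega>|lborel. dir_deriv b h x * \<psi> x)"
proof -
  let ?P = "\<lambda>x. indicator \<Omega> x * (h x * \<psi> x)"
  have ch: "continuous_on \<Omega> h" "continuous_on \<Omega> (dir_deriv b h)"
    using h b Ck_on_imp_continuous[OF h] by auto
  have c\<psi>: "continuous_on UNIV \<psi>" "continuous_on UNIV (dir_deriv b \<psi>)"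
    using \<psi> b Ck_on_imp_continuous[OF \<psi>] by auto
  have P: "Ck_on 1 UNIV ?P"
    using K by (intro Ck_on_extend_zero[OF \<Omega> _ K(1,2)] Ck_on_mult \<Omega> h Ck_on_subset[OF \<psi>]) auto
  have "0 = (\<integral>x. dir_deriv b ?P x \<partial>lborel)"
    using K by (intro integral_dir_deriv_compact_support[OF P K(1) _ b, symmetric]) auto
  also have "\<dots> = (LINT x:\<Omega>|lborel. h x * dir_deriv b \<psi> x + dir_deriv b h x * \<psi> x)"
    unfolding set_lebesgue_integral_def
  proof (rule Bochner_Integration.integral_cong[OF refl])
    fix x
    show "dir_deriv b ?P x = indicator \<Omega> x *\<^sub>R (h x * dir_deriv b \<psi> x + dir_deriv b h x * \<psi> x)"
    proof (cases "x \<in> \<Omega>")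
      case True
      have "dir_deriv b ?P x = dir_deriv b (\<lambda>x. h x * \<psi> x) x"
        by (rule dir_deriv_cong[OF \<Omega> True]) simp
      also have "\<dots> = h x * dir_deriv b \<psi> x + dir_deriv b h x * \<psi> x"
        using h \<psi> True by (intro dir_deriv_mult) auto
      finally show ?thesis using True by simp
    next
      case False
      then have "dir_deriv b ?P x = 0"
        using K by (intro dir_deriv_zero_outside[OF K(1)]) auto
      with False show ?thesis by simp
    qed
  qed
  also have "\<dots> = (LINT x:\<Omega>|lborel. h x * dir_deriv b \<psi> x) + (LINT x:\<Omega>|lborel. dir_deriv b h x * \<psi> x)"
    using dir_deriv_zero_outside[OF K(1,3)] K
    by (intro set_integral_add set_integrable_mult_compact_support[OF _ _ K(1)] ch c\<psi>) auto
  finally show ?thesis by simp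
qed

lemma set_integral_sum:
  fixes f :: "'i \<Rightarrow> 'a \<Rightarrow> real"
  assumes "\<And>i. i \<in> I \<Longrightarrow> set_integrable M A (f i)"
  shows "(LINT x:A|M. (\<Sum>i\<in>I. f i x)) = (\<Sum>i\<in>I. LINT x:A|M. f i x)"
  using assms unfolding set_lebesgue_integral_def set_integrable_def
  by (simp only: scaleR_sum_right Bochner_Integration.integral_sum)

text \<open>Two integrations by parts in each coordinate direction; the derivatives of \<psi> again
  vanish outside \<open>K\<close>, which keeps the hypotheses intact for both.\<close>

lemma Green_identity:
  fixes h \<psi> :: "'a::euclidean_space \<Rightarrow> real"
  assumes \<Omega>: "open \<Omega>" and h: "Ck_on 2 \<Omega> h" and \<psi>: "Ck_on 2 UNIV \<psi>"
    and K: "compact K" "K \<subseteq> \<Omega>" "\<And>x. x \<notin> K \<Longrightarrow> \<psi> x = 0"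
  shows "(LINT x:\<Omega>|lborel. h x * laplacian \<psi> x) = (LINT x:\<Omega>|lborel. laplacian h x * \<psi> x)"
proof -
  note K' = dir_deriv_zero_outside[OF K(1,3)]
  note K'' = dir_deriv_zero_outside[OF K(1) K']
  have h1: "Ck_on 1 \<Omega> h" "\<And>b. b \<in> Basis \<Longrightarrow> Ck_on 1 \<Omega> (dir_deriv b h)"
    using h Ck_on_SucD[of 1 \<Omega> h] by (auto simp: numeral_2_eq_2)
  have \<psi>1: "Ck_on 1 UNIV \<psi>" "\<And>b. b \<in> Basis \<Longrightarrow> Ck_on 1 UNIV (dir_deriv b \<psi>)"
    using \<psi> Ck_on_SucD[of 1 UNIV \<psi>] by (auto simp: numeral_2_eq_2)
  have ch: "continuous_on \<Omega> h" "\<And>b. b \<in> Basis \<Longrightarrow> continuous_on \<Omega> (dir_deriv b (dir_deriv b h))"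
    and c\<psi>: "continuous_on UNIV \<psi>" "\<And>b. b \<in> Basis \<Longrightarrow> continuous_on UNIV (dir_deriv b (dir_deriv b \<psi>))"
    using h1 \<psi>1 Ck_on_imp_continuous[OF h1(1)] Ck_on_imp_continuous[OF \<psi>1(1)] by auto
  have "(LINT x:\<Omega>|lborel. h x * laplacian \<psi> x) =
      (LINT x:\<Omega>|lborel. (\<Sum>b\<in>Basis. h x * dir_deriv b (dir_deriv b \<psi>) x))"
    by (simp add: laplacian_def sum_distrib_left)
  also have "\<dots> = (\<Sum>b\<in>Basis. LINT x:\<Omega>|lborel. h x * dir_deriv b (dir_deriv b \<psi>) x)"
    by (intro set_integral_sum set_integrable_mult_compact_support[OF _ _ K(1,2) K''] ch c\<psi>) auto
  also have "\<dots> = (\<Sum>b\<in>Basis. LINT x:\<Omega>|lborel. dir_deriv b (dir_deriv b h) x * \<psi> x)"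
  proof (rule sum.cong[OF refl])
    fix b :: 'a assume b: "b \<in> Basis"
    show "(LINT x:\<Omega>|lborel. h x * dir_deriv b (dir_deriv b \<psi>) x) = (LINT x:\<Omega>|lborel. dir_deriv b (dir_deriv b h) x * \<psi> x)"
      using integral_by_parts[OF \<Omega> h1(1) \<psi>1(2)[OF b] K(1,2) K' b]
        integral_by_parts[OF \<Omega> h1(2)[OF b] \<psi>1(1) K b] by simp
  qed
  also have "\<dots> = (LINT x:\<Omega>|lborel. (\<Sum>b\<in>Basis. dir_deriv b (dir_deriv b h) x * \<psi> x))"
    by (intro set_integral_sum[symmetric] set_integrable_mult_compact_support[OF _ _ K] ch c\<psi>) auto
  also have "\<dots> = (LINT x:\<Omega>|lborel. laplacian h x * \<psi> x)"
    by (simp add: laplacian_def sum_distrib_right)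
  finally show ?thesis .
qed

lemma laplacian_zero_outside:
  assumes "compact K" "\<And>x. x \<notin> K \<Longrightarrow> f x = 0" "x \<notin> K"
  shows "laplacian f x = 0"
  unfolding laplacian_def
  using dir_deriv_zero_outside[OF assms(1) dir_deriv_zero_outside[OF assms(1,2)] assms(3)] by simp

lemma laplacian_power_zero_outside:
  assumes "compact K" "\<And>x. x \<notin> K \<Longrightarrow> f x = 0"
  shows "x \<notin> K \<Longrightarrow> (laplacian ^^ n) f x = 0"
  by (induction n arbitrary: x) (auto intro: laplacian_zero_outside[OF assms(1)] assms(2))

lemma Green_identity_power:
  fixes h \<psi> :: "'a::euclidean_space \<Rightarrow> real"
  assumes \<Omega>: "open \<Omega>" and h: "smooth_on \<Omega> h" and \<psi>: "smooth_on UNIV \<psi>"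
    and K: "compact K" "K \<subseteq> \<Omega>" "\<And>x. x \<notin> K \<Longrightarrow> \<psi> x = 0"
  shows "(LINT x:\<Omega>|lborel. h x * (laplacian ^^ n) \<psi> x) = (LINT x:\<Omega>|lborel. (laplacian ^^ n) h x * \<psi> x)"
  using h
proof (induction n arbitrary: h)
  case (Suc n)
  let ?p = "(laplacian ^^ n) \<psi>"
  have "(LINT x:\<Omega>|lborel. h x * (laplacian ^^ Suc n) \<psi> x) = (LINT x:\<Omega>|lborel. laplacian h x * ?p x)"
    using laplacian_power_zero_outside[OF K(1,3)]
    by (auto intro!: Green_identity[OF \<Omega> _ _ K(1,2)] smooth_onD[OF Suc.prems]
        smooth_onD[OF smooth_on_laplacian_power[OF open_UNIV \<psi>]])
  also have "\<dots> = (LINT x:\<Omega>|lborel. (laplacian ^^ n) (laplacian h) x * \<psi> x)"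
    by (intro Suc.IH smooth_on_laplacian \<Omega> Suc.prems)
  finally show ?case by (simp add: funpow_swap1)
qed simp

section \<open>Zero sets of \<open>C\<^sup>1\<close> functions\<close>

text \<open>For each point a countable basis of the topology contains a set meeting \<open>X\<close>
  in that point only; choosing such sets is injective because each set recovers its point.\<close>

lemma countable_if_isolated:
  fixes X :: "'a::second_countable_topology set"
  assumes "\<And>t. t \<in> X \<Longrightarrow> \<exists>S. open S \<and> X \<inter> S = {t}"
  shows "countable X"
proof -
  obtain \<B> :: "'a set set" where \<B>: "countable \<B>" "topological_basis \<B>"
    using ex_countable_basis by blast
  have "\<forall>t\<in>X. \<exists>B. B \<in> \<B> \<and> X \<inter> B = {t}"
  proof
    fix t assume t: "t \<in> X"
    then obtain S where S: "open S" "X \<inter> S = {t}" using assms by blast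
    then have "t \<in> S" by blast
    then obtain B where B: "B \<in> \<B>" "t \<in> B" "B \<subseteq> S" by (rule topological_basisE[OF \<B>(2) S(1)])
    then have "X \<inter> B = {t}" using S t by blast
    with B(1) show "\<exists>B. B \<in> \<B> \<and> X \<inter> B = {t}" by blast
  qed
  from bchoice[OF this] obtain g where g: "\<forall>t\<in>X. g t \<in> \<B> \<and> X \<inter> g t = {t}" ..
  have "inj_on g X"
    by (rule inj_onI) (use g in fastforce)
  moreover have "countable (g ` X)"
    by (rule countable_subset[OF _ \<B>(1)]) (use g in blast)
  ultimately show ?thesis using countable_image_inj_on by blast
qed

text \<open>A nonzero derivative keeps the difference quotient, hence the function, away from 0 in a
  punctured neighbourhood, so these zeros are isolated.\<close>

lemma countable_zeros_nonzero_deriv: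
  fixes f :: "real \<Rightarrow> real"
  shows "countable {t. f t = 0 \<and> (\<exists>D. D \<noteq> 0 \<and> (f has_real_derivative D) (at t))}" (is "countable ?X")
proof (rule countable_if_isolated)
  fix t assume t: "t \<in> ?X"
  obtain D where D: "D \<noteq> 0" "(f has_real_derivative D) (at t)" "f t = 0" using t by auto
  then have "((\<lambda>s. f s / (s - t)) \<longlongrightarrow> D) (at t)" by (simp add: has_field_derivative_iff)
  then have "eventually (\<lambda>s. f s / (s - t) \<noteq> 0) (at t)" using D(1) by (rule tendsto_imp_eventually_ne)
  then obtain S where S: "open S" "t \<in> S" "\<And>s. s \<in> S \<Longrightarrow> s \<noteq> t \<Longrightarrow> f s / (s - t) \<noteq> 0"
    unfolding eventually_at_topological by blast
  have "f s \<noteq> 0" if "s \<in> S" "s \<noteq> t" for s using S(3)[OF that] by auto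
  then have "?X \<inter> S = {t}" using S(2) t by blast
  with S(1) show "\<exists>S. open S \<and> ?X \<inter> S = {t}" by blast
qed

text \<open>Every line in direction \<open>b\<close> meets the set in countably many points.
  Averaging the indicator over translates along a unit segment and exchanging the integrals turns
  this into measure 0. The argument takes the place of the implicit function theorem.\<close>

lemma null_zeros_dir_deriv_nonzero:
  fixes g :: "'a::euclidean_space \<Rightarrow> real"
  assumes S: "open S" and g: "Ck_on 1 S g" and b: "b \<in> Basis"
  shows "{x\<in>S. g x = 0 \<and> dir_deriv b g x \<noteq> 0} \<in> null_sets lborel" (is "?E \<in> _")
proof -
  have c: "continuous_on S g" "continuous_on S (dir_deriv b g)"
    using g b Ck_on_imp_continuous[OF g] by auto
  have Sb: "S \<in> sets borel" using S by simp
  have [measurable]: "(\<lambda>x. indicator S x *\<^sub>R g x) \<in> borel_measurable borel"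
     "(\<lambda>x. indicator S x *\<^sub>R dir_deriv b g x) \<in> borel_measurable borel"
    using borel_measurable_continuous_on_indicator[OF Sb] c by blast+
  have "?E = {x. x \<in> S \<and> indicator S x *\<^sub>R g x = 0 \<and> indicator S x *\<^sub>R dir_deriv b g x \<noteq> 0}" by auto
  also have "\<dots> \<in> sets borel" using Sb by measurable
  finally have E[measurable]: "?E \<in> sets borel" .
  have 0: "(\<integral>\<^sup>+s. indicator {0..1} s * indicator ?E (x + s *\<^sub>R b) \<partial>(lborel :: real measure)) = 0" for x
  proof -
    let ?f = "\<lambda>s. g (x + s *\<^sub>R b)"
    have "(?f has_real_derivative dir_deriv b g (x + s *\<^sub>R b)) (at s)" if "x + s *\<^sub>R b \<in> S" for s
    proof -
      have "g differentiable (at (x + s *\<^sub>R b))" using g that by simp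
      then have 1: "(g has_derivative frechet_derivative g (at (x + s *\<^sub>R b))) (at (x + s *\<^sub>R b))"
        by (simp add: frechet_derivative_works)
      have 2: "((\<lambda>s. x + s *\<^sub>R b) has_derivative (\<lambda>t. t *\<^sub>R b)) (at s)"
        by (auto intro!: derivative_eq_intros)
      interpret linear "frechet_derivative g (at (x + s *\<^sub>R b))" using 1 has_derivative_linear by auto
      show ?thesis
        by (rule has_derivative_imp_has_field_derivative[OF has_derivative_compose[OF 2 1]])
          (simp add: scale dir_deriv_def)
    qed
    then have "{s. x + s *\<^sub>R b \<in> ?E} \<subseteq> {t. ?f t = 0 \<and> (\<exists>D. D \<noteq> 0 \<and> (?f has_real_derivative D) (at t))}"
      by auto
    then have "countable {s. x + s *\<^sub>R b \<in> ?E}"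
      by (rule countable_subset[OF _ countable_zeros_nonzero_deriv])
    then have "AE s in lborel. s \<notin> {s. x + s *\<^sub>R b \<in> ?E}"
      by (intro AE_not_in countable_imp_null_set_lborel)
    then have "AE s in lborel. indicator {0..1} s * indicator ?E (x + s *\<^sub>R b) = (0::ennreal)"
      by eventually_elim (auto simp: indicator_def)
    then show ?thesis by (simp add: nn_integral_0_iff_AE)
  qed
  \<comment> \<open>The inner average vanishes for every x. After the exchange it becomes the
    measure of the set, since translates by multiples of \<open>b\<close> have the same
    integral.\<close>
  have "0 = (\<integral>\<^sup>+x. \<integral>\<^sup>+s. indicator {0..1} s * indicator ?E (x + s *\<^sub>R b) \<partial>(lborel :: real measure) \<partial>lborel)"
    by (simp only: 0 nn_integral_const) simp
  also have "\<dots> = (\<integral>\<^sup>+s. \<integral>\<^sup>+x. indicator {0..1} s * indicator ?E (x + s *\<^sub>R b) \<partial>lborel \<partial>(lborel :: real measure))"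
    by (rule lborel_pair.Fubini'[symmetric]) measurable
  also have "\<dots> = (\<integral>\<^sup>+s. indicator {0..1} s * emeasure lborel ?E \<partial>(lborel :: real measure))"
    using nn_integral_lborel_shift[of "indicator ?E"] by (simp add: nn_integral_cmult)
  also have "\<dots> = emeasure lborel ?E"
    by (simp add: nn_integral_multc)
  finally show ?thesis by (simp add: null_sets_def)
qed

section \<open>Radial integrals\<close>

text \<open>Dyadic decomposition of the unit ball: on the shell 2^-(j+1) \<le> |z| < 2^-j the
  function is at most \<open>c j\<close>, and the ball of radius 2^-j has measure proportional to
  2^(-jd). The products form a geometric series of ratio 2^(s-d), convergent because s < d. Using
  balls in place of shells only increases the sum.\<close>

lemma nn_integral_singularity_finite:
  fixes s :: real
  assumes s: "0 \<le> s" "s < DIM('a::euclidean_space)"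
  shows "(\<integral>\<^sup>+z. indicator (ball 0 1) z * ennreal (norm (z::'a) powr (-s)) \<partial>lborel) < \<infinity>"
proof -
  let ?d = "DIM('a)"
  define c where "c j = 2 powr (real (Suc j) * s)" for j
  let ?\<omega> = "unit_ball_vol (real ?d)"
  have le: "indicator (ball 0 1) z * ennreal (norm z powr (-s)) \<le>
      (\<Sum>j. ennreal (c j) * indicator (ball 0 ((1/2)^j)) z)" if z0: "z \<noteq> 0" for z :: 'a
  proof (cases "z \<in> ball 0 1")
    case True
    obtain n where "(1/2::real)^n < norm z" using real_arch_pow_inv[of "norm z" "1/2"] z0 by auto
    then have ex: "\<exists>n. (1/2::real)^n \<le> norm z" by (auto intro: less_imp_le)
    \<comment> \<open>The first power of 1/2 not exceeding |z|. It is not the zeroth one because |z|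
      < 1, so there is a preceding index \<open>j\<close>, and for it |z| < 2^-j.\<close>
    define n where "n = (LEAST n. (1/2::real)^n \<le> norm z)"
    have n1: "(1/2::real)^n \<le> norm z" unfolding n_def using ex by (rule LeastI_ex)
    have "n \<noteq> 0" using n1 True by (intro notI) simp
    then obtain j where j: "n = Suc j" using not0_implies_Suc by blast
    have "\<not> (1/2::real)^j \<le> norm z" using not_less_Least[of j "\<lambda>n. (1/2::real)^n \<le> norm z"] j n_def by simp
    then have j1: "z \<in> ball 0 ((1/2)^j)" by simp
    have "norm z powr (-s) \<le> ((1/2)^Suc j) powr (-s)"
      using n1 j s by (intro powr_mono2') auto
    also have "((1/2::real)^Suc j) = 2 powr (- real (Suc j))"
      by (simp add: powr_minus powr_realpow power_one_over inverse_eq_divide del: of_nat_Suc power_Suc)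
    also have "(2 powr (- real (Suc j))) powr (-s) = c j" by (simp add: powr_powr c_def del: of_nat_Suc)
    finally have "ennreal (norm z powr (-s)) \<le> ennreal (c j)" by (rule ennreal_leI)
    also have "\<dots> = (\<Sum>j\<in>{j}. ennreal (c j) * indicator (ball 0 ((1/2)^j)) z)" using j1 by simp
    also have "\<dots> \<le> (\<Sum>j. ennreal (c j) * indicator (ball 0 ((1/2)^j)) z)" by (rule sum_le_suminf) auto
    finally show ?thesis using True by simp
  qed simp
  have "AE z in lborel. z \<noteq> (0::'a)" by (rule AE_lborel_singleton)
  then have "(\<integral>\<^sup>+z. indicator (ball 0 1) z * ennreal (norm (z::'a) powr (-s)) \<partial>lborel) \<le>
      (\<integral>\<^sup>+z. (\<Sum>j. ennreal (c j) * indicator (ball 0 ((1/2)^j)) (z::'a)) \<partial>lborel)"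
    by (intro nn_integral_mono_AE) (auto elim!: eventually_mono intro: le)
  also have "\<dots> = (\<Sum>j. ennreal (c j) * emeasure lborel (ball (0::'a) ((1/2)^j)))"
    by (subst nn_integral_suminf)
      (simp, rule borel_measurable_times_ennreal, simp, rule borel_measurable_indicator, simp,
       simp add: nn_integral_cmult_indicator)
  also have "\<dots> = (\<Sum>j. ennreal (2 powr s * ?\<omega> * (2 powr (s - ?d))^j))"
  proof (rule suminf_cong)
    fix j
    have "((1/2::real)^j)^?d = 2 powr (- real j * ?d)"
      by (simp add: powr_minus powr_realpow[symmetric] power_one_over powr_powr inverse_eq_divide)
    moreover have "(2 powr (s - ?d))^j = (2::real) powr ((s - ?d) * j)" by (simp add: powr_powr powr_realpow[symmetric])
    ultimately have "c j * (?\<omega> * ((1/2)^j)^?d) = 2 powr s * ?\<omega> * (2 powr (s - ?d))^j"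
      by (simp add: c_def powr_add[symmetric] algebra_simps)
    moreover have "emeasure lborel (ball (0::'a) ((1/2)^j)) = ennreal (?\<omega> * ((1/2)^j)^?d)" by (rule emeasure_ball) simp
    ultimately show "ennreal (c j) * emeasure lborel (ball (0::'a) ((1/2)^j)) =
        ennreal (2 powr s * ?\<omega> * (2 powr (s - ?d))^j)"
      by (simp add: ennreal_mult[symmetric] c_def)
  qed
  also have "\<dots> < \<infinity>"
  proof -
    have "(2::real) powr (s - ?d) < 1" using s by (simp add: powr_less_one)
    then have "summable (\<lambda>j. 2 powr s * ?\<omega> * (2 powr (s - ?d))^j)"
      by (intro summable_mult summable_geometric) auto
    then show ?thesis by (simp add: suminf_ennreal2 less_top[symmetric] ennreal_suminf_neq_top)
  qed
  finally show ?thesis .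
qed

lemma summable_gaussian_shells: "summable (\<lambda>j. real (Suc j) ^ d * (real j + 2) powr q * exp (- (real j)\<^sup>2))"
proof (rule summable_comparison_test_bigo)
  show "summable (\<lambda>j. norm (1 / real j ^ 2))" using inverse_power_summable[of 2] by (simp add: inverse_eq_divide)
  have "(\<lambda>j. (real j + 1) powr (real d) * (real j + 2) powr q * exp (- (real j)\<^sup>2)) \<in> O(\<lambda>j. 1 / real j ^ 2)"
    by real_asymp
  then show "(\<lambda>j. real (Suc j) ^ d * (real j + 2) powr q * exp (- (real j)\<^sup>2)) \<in> O(\<lambda>j. 1 / real j ^ 2)"
    by (simp add: powr_realpow add_ac)
qed

text \<open>The same decomposition with balls of integer radius: on j \<le> |z| < j + 1 the
  integrand is at most \<open>c j\<close>, and the Gaussian factor beats both the polynomial weight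
  and the growth of the volumes.\<close>

lemma nn_integral_gaussian_finite:
  assumes q: "0 \<le> q"
  shows "(\<integral>\<^sup>+z. ennreal ((1 + norm (z::'a::euclidean_space)) powr q * exp (- (norm z)\<^sup>2)) \<partial>lborel) < \<infinity>"
proof -
  let ?d = "DIM('a)"
  define c where "c j = (real j + 2) powr q * exp (- (real j)\<^sup>2)" for j
  let ?\<omega> = "unit_ball_vol (real ?d)"
  have le: "ennreal ((1 + norm z) powr q * exp (- (norm z)\<^sup>2)) \<le>
      (\<Sum>j. ennreal (c j) * indicator (ball 0 (real (Suc j))) z)" for z :: 'a
  proof -
    define j where "j = nat \<lfloor>norm z\<rfloor>"
    have j: "real j \<le> norm z" "norm z < real (Suc j)" 
      using floor_correct[of "norm z"] by (auto simp: j_def) linarith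
    have "(1 + norm z) powr q * exp (- (norm z)\<^sup>2) \<le> c j"
      unfolding c_def using j q by (intro mult_mono powr_mono2) auto
    then have "ennreal ((1 + norm z) powr q * exp (- (norm z)\<^sup>2)) \<le> ennreal (c j)" by (rule ennreal_leI)
    also have "\<dots> = (\<Sum>j\<in>{j}. ennreal (c j) * indicator (ball 0 (real (Suc j))) z)" using j by simp
    also have "\<dots> \<le> (\<Sum>j. ennreal (c j) * indicator (ball 0 (real (Suc j))) z)" by (rule sum_le_suminf) auto
    finally show ?thesis .
  qed
  have "(\<integral>\<^sup>+z. ennreal ((1 + norm (z::'a)) powr q * exp (- (norm z)\<^sup>2)) \<partial>lborel) \<le>
      (\<integral>\<^sup>+z. (\<Sum>j. ennreal (c j) * indicator (ball 0 (real (Suc j))) (z::'a)) \<partial>lborel)"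
    by (intro nn_integral_mono le)
  also have "\<dots> = (\<Sum>j. ennreal (c j) * emeasure lborel (ball (0::'a) (real (Suc j))))"
    by (subst nn_integral_suminf)
      (simp, rule borel_measurable_times_ennreal, simp, rule borel_measurable_indicator, simp,
       simp add: nn_integral_cmult_indicator)
  also have "\<dots> = (\<Sum>j. ennreal (?\<omega> * (real (Suc j) ^ ?d * (real j + 2) powr q * exp (- (real j)\<^sup>2))))"
  proof (rule suminf_cong)
    fix j
    have "emeasure lborel (ball (0::'a) (real (Suc j))) = ennreal (?\<omega> * real (Suc j) ^ ?d)" by (rule emeasure_ball) simp
    then show "ennreal (c j) * emeasure lborel (ball (0::'a) (real (Suc j))) =
        ennreal (?\<omega> * (real (Suc j) ^ ?d * (real j + 2) powr q * exp (- (real j)\<^sup>2)))"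
      by (simp add: ennreal_mult[symmetric] c_def mult_ac)
  qed
  also have "\<dots> < \<infinity>"
    using summable_mult[OF summable_gaussian_shells, of ?\<omega> ?d q]
    by (simp add: suminf_ennreal2 less_top[symmetric] ennreal_suminf_neq_top del: of_nat_Suc)
  finally show ?thesis .
qed

text \<open>The integral is Beta(m + 1, m), which the Gamma function turns into factorials.\<close>

lemma nn_integral_beta:
  assumes "m \<ge> 1"
  shows "(\<integral>\<^sup>+t. ennreal (indicator {0..1} t * (t ^ m * (1 - t) ^ (m - 1))) \<partial>lborel) =
    ennreal (fact m * fact (m - 1) / fact (2 * m))"
proof -
  have "((\<lambda>t. t powr (real (Suc m) - 1) * (1 - t) powr (real m - 1)) has_integral Beta (real (Suc m)) (real m)) {0..1}"
    using assms by (intro has_integral_Beta_real) auto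
  \<comment> \<open>At the endpoints \<open>powr\<close> and \<open>^\<close> may disagree, since
    \<open>0 powr 0\<close> is 0 while \<open>0 ^ 0\<close> is 1; the endpoints are removed as a
    null set.\<close>
  moreover have "t powr (real (Suc m) - 1) * (1 - t) powr (real m - 1) = t ^ m * (1 - t) ^ (m - 1)"
    if "t \<in> {0..1} - {0, 1}" for t :: real
    using that assms by (simp add: powr_realpow[symmetric] of_nat_diff)
  ultimately have "((\<lambda>t. t ^ m * (1 - t) ^ (m - 1)) has_integral Beta (real (Suc m)) (real m)) {0..1}"
    by (subst (asm) has_integral_spike_eq[of "{0, 1::real}"]) auto
  then have "(\<integral>\<^sup>+t. ennreal (indicator {0..1} t * (t ^ m * (1 - t) ^ (m - 1))) \<partial>lborel) = Beta (real (Suc m)) (real m)"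
    by (intro nn_integral_has_integral_lebesgue) auto
  also have "Beta (real (Suc m)) (real m) = fact m * fact (m - 1) / fact (2 * m)"
  proof -
    have 1: "Gamma (real (Suc m)) = fact m" using Gamma_fact[of m, where 'a=real] by (simp add: add_ac)
    have 2: "Gamma (real m) = fact (m - 1)"
      using Gamma_fact[of "m - 1", where 'a=real] assms by (simp add: of_nat_diff)
    have 3: "Gamma (real (Suc m) + real m) = fact (2 * m)"
      using Gamma_fact[of "2 * m", where 'a=real] by (simp add: add_ac)
    show ?thesis unfolding Beta_def 1 2 3 ..
  qed
  finally show ?thesis .
qed

text \<open>Layer cake in the variable \<open>\<sigma> = |x|\<^sup>2 / (1 + |x|\<^sup>2)\<close>, which turns the integral
  into a Beta integral.\<close>

lemma nn_integral_bubble: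
  fixes m :: nat
  assumes d: "DIM('a::euclidean_space) = 2 * m" and m: "m \<ge> 1"
  shows "(\<integral>\<^sup>+x. ennreal ((2 / (1 + (norm (x::'a))\<^sup>2)) ^ (2 * m)) \<partial>lborel) = ennreal (sphere_vol (2 * m))"
proof -
  define \<sigma> where "\<sigma> x = (norm x)\<^sup>2 / (1 + (norm x)\<^sup>2)" for x :: 'a
  let ?\<omega> = "unit_ball_vol (real (2 * m))"
  have pos: "1 + (norm x)\<^sup>2 > 0" for x :: 'a by (simp add: add_pos_nonneg)
  have \<sigma>: "0 \<le> \<sigma> x" "\<sigma> x \<le> 1" "1 - \<sigma> x = 1 / (1 + (norm x)\<^sup>2)" for x
    using pos[of x] by (auto simp: \<sigma>_def divide_simps)
  have [measurable]: "\<sigma> \<in> borel_measurable borel" unfolding \<sigma>_def by measurable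
  \<comment> \<open>\<open>f\<close> is chosen so that its integral over [\<sigma> x, 1] is 2^(2m)
    (1 - \<sigma> x)^(2m), which is the integrand at x.\<close>
  define f where "f t = 2 ^ (2 * m) * (2 * m) * (1 - t) ^ (2 * m - 1)" for t :: real
  have [measurable]: "f \<in> borel_measurable borel" unfolding f_def by measurable
  have "(\<integral>\<^sup>+x. ennreal ((2 / (1 + (norm (x::'a))\<^sup>2)) ^ (2 * m)) \<partial>lborel) =
      (\<integral>\<^sup>+x. \<integral>\<^sup>+t. ennreal (f t) * indicator {\<sigma> x..1} t \<partial>lborel \<partial>lborel)"
  proof (rule nn_integral_cong)
    fix x :: 'a
    let ?F = "\<lambda>t::real. - (2 ^ (2 * m)) * (1 - t) ^ (2 * m)"
    have "(\<integral>\<^sup>+t. ennreal (f t) * indicator {\<sigma> x..1} t \<partial>lborel) = ennreal (?F 1 - ?F (\<sigma> x))"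
    proof (rule nn_integral_FTC_Icc)
      show "(?F has_real_derivative f t) (at t)" for t
        unfolding f_def by (auto intro!: derivative_eq_intros)
    qed (use \<sigma>[of x] in \<open>auto simp: f_def\<close>)
    also have "?F 1 - ?F (\<sigma> x) = (2 / (1 + (norm x)\<^sup>2)) ^ (2 * m)"
      using m by (simp add: \<sigma>(3) power_mult_distrib[symmetric])
    finally show "ennreal ((2 / (1 + (norm x)\<^sup>2)) ^ (2 * m)) = (\<integral>\<^sup>+t. ennreal (f t) * indicator {\<sigma> x..1} t \<partial>lborel)" ..
  qed
  also have "\<dots> = (\<integral>\<^sup>+t. \<integral>\<^sup>+x. ennreal (f t) * indicator {\<sigma> x..1} t \<partial>lborel \<partial>lborel)"
  proof (rule lborel_pair.Fubini'[symmetric])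
    have "(\<lambda>(x, t). ennreal (f t) * indicator {\<sigma> x..1} t) =
       (\<lambda>z. ennreal (f (snd z)) * (if \<sigma> (fst z) \<le> snd z \<and> snd z \<le> 1 then 1 else 0))"
      by (auto simp: indicator_def fun_eq_iff)
    also have "\<dots> \<in> borel_measurable (lborel \<Otimes>\<^sub>M lborel)" by measurable
    finally show "(\<lambda>(x, t). ennreal (f t) * indicator {\<sigma> x..1} t) \<in> borel_measurable (lborel \<Otimes>\<^sub>M lborel)" .
  qed
  also have "\<dots> = (\<integral>\<^sup>+t. ennreal (2 ^ (2 * m) * (2 * m) * ?\<omega>) *
      ennreal (indicator {0..1} t * (t ^ m * (1 - t) ^ (m - 1))) \<partial>lborel)"
  proof (rule nn_integral_cong_AE)
    have "AE t in lborel. t \<noteq> (1::real)" by (rule AE_lborel_singleton)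
    then show "AE t in lborel. (\<integral>\<^sup>+x. ennreal (f t) * indicator {\<sigma> (x::'a)..1} t \<partial>lborel) =
      ennreal (2 ^ (2 * m) * (2 * m) * ?\<omega>) * ennreal (indicator {0..1} t * (t ^ m * (1 - t) ^ (m - 1)))"
    proof (rule eventually_mono)
      fix t :: real assume "t \<noteq> 1"
      show "(\<integral>\<^sup>+x. ennreal (f t) * indicator {\<sigma> (x::'a)..1} t \<partial>lborel) =
        ennreal (2 ^ (2 * m) * (2 * m) * ?\<omega>) * ennreal (indicator {0..1} t * (t ^ m * (1 - t) ^ (m - 1)))"
      proof (cases "t \<in> {0..<1}")
        case False
        then have "indicator {\<sigma> x..1} t = (0::ennreal)" for x :: 'a
          using \<open>t \<noteq> 1\<close> \<sigma>[of x] by (auto simp: indicator_def)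
        then show ?thesis using False \<open>t \<noteq> 1\<close> by (auto simp: indicator_def)
      next
        case True
        then have t: "0 \<le> t" "t < 1" by auto
        \<comment> \<open>The sublevel sets of \<sigma> are balls of squared radius t/(1 - t), so
          the inner integral is an explicit volume.\<close>
        have eq: "indicator {\<sigma> x..1} t = (indicator (cball 0 (sqrt (t / (1 - t)))) x :: ennreal)" for x :: 'a
        proof -
          have "\<sigma> x \<le> t \<longleftrightarrow> (norm x)\<^sup>2 * (1 - t) \<le> t"
            using pos[of x] by (simp add: \<sigma>_def divide_simps) (simp add: algebra_simps)
          also have "\<dots> \<longleftrightarrow> (norm x)\<^sup>2 \<le> t / (1 - t)" using t by (simp add: field_simps)
          also have "\<dots> \<longleftrightarrow> norm x \<le> sqrt (t / (1 - t))"
            by (metis norm_ge_zero real_le_rsqrt real_sqrt_le_iff real_sqrt_abs abs_norm_cancel)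
          finally show ?thesis using t by (auto simp: indicator_def)
        qed
        have "(\<integral>\<^sup>+x. ennreal (f t) * indicator {\<sigma> (x::'a)..1} t \<partial>lborel) =
            ennreal (f t) * emeasure lborel (cball (0::'a) (sqrt (t / (1 - t))))"
          unfolding eq by (simp add: nn_integral_cmult_indicator)
        also have "emeasure lborel (cball (0::'a) (sqrt (t / (1 - t)))) = ennreal (?\<omega> * (t / (1 - t)) ^ m)"
          using t by (subst emeasure_cball) (auto simp: d power_mult)
        also have "ennreal (f t) * ennreal (?\<omega> * (t / (1 - t)) ^ m) = ennreal (f t * (?\<omega> * (t / (1 - t)) ^ m))"
          using t by (intro ennreal_mult[symmetric]) (auto simp: f_def)
        also have "f t * (?\<omega> * (t / (1 - t)) ^ m) = 2 ^ (2 * m) * (2 * m) * ?\<omega> * (t ^ m * (1 - t) ^ (m - 1))"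
        proof -
          have "2 * m - 1 = m + (m - 1)" using m by simp
          then have "(1 - t) ^ (2 * m - 1) = (1 - t) ^ m * (1 - t) ^ (m - 1)" by (simp add: power_add)
          then show ?thesis using t by (simp add: f_def power_divide)
        qed
        finally show ?thesis using t by (simp add: ennreal_mult)
      qed
    qed
  qed
  also have "\<dots> = ennreal (2 ^ (2 * m) * (2 * m) * ?\<omega>) * ennreal (fact m * fact (m - 1) / fact (2 * m))"
    by (subst nn_integral_cmult, simp, subst nn_integral_beta[OF m], rule refl)
  also have "\<dots> = ennreal (2 ^ (2 * m) * (2 * m) * ?\<omega> * (fact m * fact (m - 1) / fact (2 * m)))"
    by (intro ennreal_mult[symmetric]) auto
  \<comment> \<open>The volumes of the unit balls in dimensions 2m and 2m + 1 are compared here;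
    splitting (2m + 2)! cancels the factor 2m + 1 contained in \<open>sphere_vol\<close>.\<close>
  also have "2 ^ (2 * m) * (2 * m) * ?\<omega> * (fact m * fact (m - 1) / fact (2 * m)) = sphere_vol (2 * m)"
  proof -
    have f: "fact m = real m * fact (m - 1)" using m by (simp add: fact_reduce)
    have f2: "fact (2 * Suc m) = real (2 * m + 2) * real (2 * m + 1) * fact (2 * m)"
      by simp
    have "?\<omega> = pi ^ m / fact m" by (rule unit_ball_vol_even)
    moreover have "sphere_vol (2 * m) = real (2 * m + 1) * ((2 ^ (2 * Suc m) * fact (Suc m)) / fact (2 * Suc m) * pi ^ m)"
      unfolding sphere_vol_def unit_ball_vol_odd ..
    moreover have "\<dots> = 2 ^ (2 * m) * 2 * fact m * pi ^ m / fact (2 * m)"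
      unfolding f2 by (simp add: divide_simps)
    ultimately show ?thesis using m by (simp add: f)
  qed
  finally show ?thesis .
qed

section \<open>Zero sets of nonpositive polyharmonic functions\<close>

text \<open>At 0 the difference quotient is at most |t|^n in absolute value, which tends to 0
  because n \<ge> 1; elsewhere the function is locally a monomial or zero.\<close>

lemma DERIV_pos_part_power:
  assumes "n \<ge> 1"
  shows "((\<lambda>t::real. max 0 t ^ Suc n) has_real_derivative real (Suc n) * max 0 t ^ n) (at t)"
proof -
  consider "t > 0" | "t < 0" | "t = 0" by linarith
  then show ?thesis
  proof cases
    case 1
    have "((\<lambda>t::real. t ^ Suc n) has_real_derivative real (Suc n) * t ^ n) (at t)"
      by (auto intro!: derivative_eq_intros simp del: power_Suc)
    then have "((\<lambda>t::real. max 0 t ^ Suc n) has_real_derivative real (Suc n) * t ^ n) (at t)"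
      by (rule has_field_derivative_transform_within_open[where S = "{0<..}"]) (use 1 in auto)
    then show ?thesis using 1 by simp
  next
    case 2
    have "((\<lambda>t::real. max 0 t ^ Suc n) has_real_derivative 0) (at t)"
      by (rule has_field_derivative_transform_within_open[where S = "{..<0}" and f = "\<lambda>_. 0"]) (use 2 in auto)
    moreover have "max 0 t ^ n = 0" using 2 assms by simp
    ultimately show ?thesis by (simp only: mult_zero_right)
  next
    case 3
    have "((\<lambda>t::real. max 0 t ^ Suc n / t) \<longlongrightarrow> 0) (at 0)"
    proof (rule Lim_null_comparison)
      show "\<forall>\<^sub>F t in at (0::real). norm (max 0 t ^ Suc n / t) \<le> \<bar>t\<bar> ^ n"
        by (intro always_eventually allI) (auto simp: max_def power_abs)
      have "((\<lambda>t::real. \<bar>t\<bar> ^ n) \<longlongrightarrow> \<bar>0\<bar> ^ n) (at 0)" by (intro tendsto_intros)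
      moreover have "\<bar>0::real\<bar> ^ n = 0" using assms by simp
      ultimately show "((\<lambda>t::real. \<bar>t\<bar> ^ n) \<longlongrightarrow> 0) (at 0)" by (simp only:)
    qed
    moreover have e: "real (Suc n) * max 0 t ^ n = 0" using 3 assms by simp
    ultimately show ?thesis unfolding e has_field_derivative_iff using 3 by simp
  qed
qed

text \<open>The gradient of the weight with exponent p + 1 is -2(p + 1) z times the weight with
  exponent p. Integration by parts thus trades a radial derivative under one exponent for a
  Laplacian under the next. For one such step a truncated polynomial of class C^1 is smooth
  enough.\<close>

definition bump :: "nat \<Rightarrow> 'a::euclidean_space \<Rightarrow> real" where
  "bump p z = max 0 (1 - z \<bullet> z) ^ p"

lemma bump_nonneg: "0 \<le> bump p z"
  by (simp add: bump_def)

lemma bump_pos: "z \<in> ball 0 1 \<Longrightarrow> 0 < bump p z"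
proof -
  assume "z \<in> ball 0 1"
  then have "(norm z)\<^sup>2 < 1" by (simp add: power_less_one_iff abs_square_less_1)
  then show ?thesis by (simp add: bump_def power2_norm_eq_inner max_def)
qed

lemma bump_zero: "p \<ge> 1 \<Longrightarrow> z \<notin> cball 0 1 \<Longrightarrow> bump p z = 0"
proof -
  assume "p \<ge> 1" "z \<notin> cball 0 1"
  then have "1 < (norm z)\<^sup>2" by (simp add: one_less_power)
  then show ?thesis using \<open>p \<ge> 1\<close> by (simp add: bump_def power2_norm_eq_inner max_def)
qed

lemma continuous_on_bump: "continuous_on S (bump p)"
  unfolding bump_def by (intro continuous_intros)

lemma bump_C1:
  fixes z b :: "'a::euclidean_space"
  assumes p: "p \<ge> 1"
  shows "dir_deriv b (bump (Suc p)) z = - 2 * real (Suc p) * (z \<bullet> b) * bump p z"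
    and "Ck_on 1 UNIV (bump (Suc p) :: 'a \<Rightarrow> real)"
proof -
  have d: "((\<lambda>z::'a. 1 - z \<bullet> z) has_derivative (\<lambda>v. - (2 * (z \<bullet> v)))) (at z)" for z
    by (auto intro!: derivative_eq_intros simp: inner_commute)
  then have diff: "(\<lambda>z::'a. 1 - z \<bullet> z) differentiable (at z)" for z by (auto simp: differentiable_def)
  have eq: "dir_deriv b (bump (Suc p)) z = - 2 * real (Suc p) * (z \<bullet> b) * bump p z" for b z :: 'a
    using dir_deriv_chain[OF diff DERIV_pos_part_power[OF p], of b z]
    by (simp add: dir_deriv_eq[OF d] bump_def[abs_def] algebra_simps del: power_Suc)
  show "dir_deriv b (bump (Suc p)) z = - 2 * real (Suc p) * (z \<bullet> b) * bump p z" by (rule eq)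
  have "bump (Suc p) differentiable (at z)" for z :: 'a
    using DERIV_compose_FDERIV[OF DERIV_pos_part_power[OF p] d[of z]]
    unfolding bump_def[abs_def] differentiable_def by blast
  moreover have "continuous_on UNIV (dir_deriv b (bump (Suc p)))" for b :: 'a
    unfolding eq[abs_def] by (intro continuous_intros continuous_on_bump)
  ultimately show "Ck_on 1 UNIV (bump (Suc p) :: 'a \<Rightarrow> real)" by simp
qed

lemma dir_deriv_affine:
  assumes "f differentiable (at (x + r *\<^sub>R z))"
  shows "((\<lambda>z. f (x + r *\<^sub>R z)) has_derivative (\<lambda>v. r * frechet_derivative f (at (x + r *\<^sub>R z)) v)) (at z)"
    and "dir_deriv b (\<lambda>z. f (x + r *\<^sub>R z)) z = r * dir_deriv b f (x + r *\<^sub>R z)"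
proof -
  have 1: "((\<lambda>z. x + r *\<^sub>R z) has_derivative (\<lambda>v. r *\<^sub>R v)) (at z)"
    by (auto intro!: derivative_eq_intros)
  have 2: "(f has_derivative frechet_derivative f (at (x + r *\<^sub>R z))) (at (x + r *\<^sub>R z))"
    using assms frechet_derivative_works by blast
  interpret linear "frechet_derivative f (at (x + r *\<^sub>R z))" using 2 has_derivative_linear by blast
  show 3: "((\<lambda>z. f (x + r *\<^sub>R z)) has_derivative (\<lambda>v. r * frechet_derivative f (at (x + r *\<^sub>R z)) v)) (at z)"
    using has_derivative_compose[OF 1 2] by (simp add: scale)
  show "dir_deriv b (\<lambda>z. f (x + r *\<^sub>R z)) z = r * dir_deriv b f (x + r *\<^sub>R z)"
    using dir_deriv_eq[OF 3] by (simp add: dir_deriv_def)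
qed

text \<open>Since \<open>z (1 - |z|\<^sup>2)\<^sup>p\<close> is a gradient, the weighted means of \<open>f\<close> over balls
  around \<open>x\<close> have a derivative in the radius that is a weighted mean of the Laplacian.\<close>

lemma weighted_mean_radial_derivative:
  fixes f :: "'a::euclidean_space \<Rightarrow> real"
  assumes \<Omega>: "open \<Omega>" and f: "smooth_on \<Omega> f" and p: "p \<ge> 1" and r: "0 \<le> r" "cball x r \<subseteq> \<Omega>"
  shows "2 * real (Suc p) * (LINT z:cball 0 1|lborel. (\<Sum>b\<in>Basis. (z \<bullet> b) * dir_deriv b f (x + r *\<^sub>R z)) * bump p z) =
    r * (LINT z:cball 0 1|lborel. laplacian f (x + r *\<^sub>R z) * bump (Suc p) z)"
proof -
  \<comment> \<open>\<open>W\<close> consists of the z for which x + r z lies in \<Omega>. Replacing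
    the closed unit ball by this open set changes no integral, as the weights vanish outside the
    ball, and makes integration by parts applicable.\<close>
  define W where "W = (\<lambda>z. x + r *\<^sub>R z) -` \<Omega>"
  have W: "open W" unfolding W_def by (intro open_vimage \<Omega> continuous_intros)
  have KW: "cball 0 1 \<subseteq> W"
  proof
    fix z :: 'a assume "z \<in> cball 0 1"
    then have "r * norm z \<le> r" using r by (simp add: mult_left_le)
    then have "x + r *\<^sub>R z \<in> cball x r" using r by (simp add: dist_norm)
    then show "z \<in> W" using r by (auto simp: W_def)
  qed
  have sub: "(LINT z:cball 0 1|lborel. h z * bump q z) = (LINT z:W|lborel. h z * bump q z)" if "q \<ge> 1" for h q
    unfolding set_lebesgue_integral_def
    by (intro Bochner_Integration.integral_cong refl)
      (use KW bump_zero[OF that] in \<open>auto simp: indicator_def\<close>)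
  have comp: "continuous_on W (\<lambda>z. h (x + r *\<^sub>R z))" if "continuous_on \<Omega> h" for h :: "'a \<Rightarrow> real"
    by (rule continuous_on_compose2[OF that]) (auto intro!: continuous_intros simp: W_def)
  have df: "dir_deriv b f differentiable (at (x + r *\<^sub>R z))" if "b \<in> Basis" "z \<in> W" for b z
    using smooth_on_differentiable[OF smooth_on_dir_deriv[OF f that(1)]] that(2) by (auto simp: W_def)
  have int: "set_integrable lborel W (\<lambda>z. h (x + r *\<^sub>R z) * (g z * bump q z))"
    if "continuous_on \<Omega> h" "continuous_on UNIV g" "q \<ge> 1" for h g q
    by (rule set_integrable_mult_compact_support[OF comp[OF that(1)] _ compact_cball KW])
      (use that bump_zero[OF that(3)] in \<open>auto intro!: continuous_intros continuous_on_bump\<close>)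
  have b: "2 * real (Suc p) * (LINT z:W|lborel. dir_deriv b f (x + r *\<^sub>R z) * ((z \<bullet> b) * bump p z)) =
      r * (LINT z:W|lborel. dir_deriv b (dir_deriv b f) (x + r *\<^sub>R z) * bump (Suc p) z)" if b: "b \<in> Basis" for b
  proof -
    let ?F = "\<lambda>z. dir_deriv b f (x + r *\<^sub>R z)"
    have sb: "smooth_on \<Omega> (dir_deriv b f)" by (rule smooth_on_dir_deriv[OF f b])
    have dF: "dir_deriv c ?F z = r * dir_deriv c (dir_deriv b f) (x + r *\<^sub>R z)" if "z \<in> W" for c z
      by (rule dir_deriv_affine[OF df[OF b that]])
    have "continuous_on W (dir_deriv c ?F)" if c: "c \<in> Basis" for c
    proof -
      have "continuous_on W (\<lambda>z. r * dir_deriv c (dir_deriv b f) (x + r *\<^sub>R z))"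
        by (intro continuous_intros comp smooth_on_continuous_on smooth_on_dir_deriv[OF sb c])
      then show ?thesis by (rule continuous_on_cong[THEN iffD1, rotated -1]) (auto simp: dF)
    qed
    moreover have "?F differentiable (at z)" if "z \<in> W" for z
      using dir_deriv_affine(1)[OF df[OF b that]] by (auto simp: differentiable_def)
    ultimately have F1: "Ck_on 1 W ?F" by simp
    have "(LINT z:W|lborel. ?F z * dir_deriv b (bump (Suc p)) z) = - (LINT z:W|lborel. dir_deriv b ?F z * bump (Suc p) z)"
      by (rule integral_by_parts[OF W F1 bump_C1(2)[OF p] compact_cball KW bump_zero b]) auto
    moreover have "(LINT z:W|lborel. ?F z * dir_deriv b (bump (Suc p)) z) =
       - (2 * real (Suc p)) * (LINT z:W|lborel. ?F z * ((z \<bullet> b) * bump p z))"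
    proof -
      have eq: "?F z * dir_deriv b (bump (Suc p)) z = - (2 * real (Suc p)) * (?F z * ((z \<bullet> b) * bump p z))" for z
        by (simp add: bump_C1(1)[OF p] algebra_simps)
      show ?thesis unfolding eq by (rule set_integral_mult_right)
    qed
    moreover have "(LINT z:W|lborel. dir_deriv b ?F z * bump (Suc p) z) =
       (LINT z:W|lborel. r * (dir_deriv b (dir_deriv b f) (x + r *\<^sub>R z) * bump (Suc p) z))"
      using W by (intro set_lebesgue_integral_cong) (auto simp: dF)
    ultimately show ?thesis by (simp del: of_nat_Suc)
  qed
  have "(LINT z:cball 0 1|lborel. (\<Sum>b\<in>Basis. (z \<bullet> b) * dir_deriv b f (x + r *\<^sub>R z)) * bump p z)
      = (LINT z:W|lborel. (\<Sum>b\<in>Basis. dir_deriv b f (x + r *\<^sub>R z) * ((z \<bullet> b) * bump p z)))"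
  proof -
    have "(\<Sum>b\<in>Basis. (z \<bullet> b) * dir_deriv b f (x + r *\<^sub>R z)) * bump p z =
        (\<Sum>b\<in>Basis. dir_deriv b f (x + r *\<^sub>R z) * ((z \<bullet> b) * bump p z))" for z
      unfolding sum_distrib_right by (intro sum.cong refl) (simp add: mult_ac)
    then show ?thesis by (subst sub[OF p]) simp
  qed
  also have "\<dots> = (\<Sum>b\<in>Basis. LINT z:W|lborel. dir_deriv b f (x + r *\<^sub>R z) * ((z \<bullet> b) * bump p z))"
    by (intro set_integral_sum int smooth_on_continuous_on smooth_on_dir_deriv f p continuous_intros)
  finally have 1: "2 * real (Suc p) * (LINT z:cball 0 1|lborel. (\<Sum>b\<in>Basis. (z \<bullet> b) * dir_deriv b f (x + r *\<^sub>R z)) * bump p z)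
    = r * (\<Sum>b\<in>Basis. (LINT z:W|lborel. dir_deriv b (dir_deriv b f) (x + r *\<^sub>R z) * bump (Suc p) z))"
    by (simp add: sum_distrib_left b del: of_nat_Suc)
  have "(LINT z:cball 0 1|lborel. laplacian f (x + r *\<^sub>R z) * bump (Suc p) z)
      = (LINT z:W|lborel. (\<Sum>b\<in>Basis. dir_deriv b (dir_deriv b f) (x + r *\<^sub>R z) * bump (Suc p) z))"
    by (subst sub) (auto simp: laplacian_def sum_distrib_right)
  also have "\<dots> = (\<Sum>b\<in>Basis. LINT z:W|lborel. dir_deriv b (dir_deriv b f) (x + r *\<^sub>R z) * bump (Suc p) z)"
  proof (intro set_integral_sum)
    fix b :: 'a assume "b \<in> Basis"
    then show "set_integrable lborel W (\<lambda>z. dir_deriv b (dir_deriv b f) (x + r *\<^sub>R z) * bump (Suc p) z)"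
      using int[of "dir_deriv b (dir_deriv b f)" "\<lambda>_. 1" "Suc p"]
      by (simp add: smooth_on_continuous_on smooth_on_dir_deriv f)
  qed
  finally show ?thesis using 1 by simp
qed

text \<open>Vanishing Laplacian means at all radii up to R make the weighted mean of
  \<open>f\<close> constant in the radius, hence equal to its value at radius 0. To see this, f(x +
  R z) - f(x) is written as an integral along the radius, and Fubini's theorem leaves, for each
  fixed fraction s of R, a weighted mean of the radial derivative, which vanishes.\<close>

lemma weighted_mean_constant:
  fixes f :: "'a::euclidean_space \<Rightarrow> real"
  assumes \<Omega>: "open \<Omega>" and f: "smooth_on \<Omega> f" and p: "p \<ge> 1" and R: "0 \<le> R" "cball x R \<subseteq> \<Omega>"
    and z: "\<And>r. 0 \<le> r \<Longrightarrow> r \<le> R \<Longrightarrow> (LINT z:cball 0 1|lborel. laplacian f (x + r *\<^sub>R z) * bump (Suc p) z) = 0"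
  shows "(LINT z:cball 0 1|lborel. (f (x + R *\<^sub>R z) - f x) * bump p z) = 0"
proof -
  let ?D = "\<lambda>r z. \<Sum>b\<in>Basis. (z \<bullet> b) * dir_deriv b f (x + r *\<^sub>R z)"
  let ?h = "\<lambda>(s::real) z. indicator {0..1} s * (indicator (cball 0 1) z * (R * ?D (s * R) z * bump p z))"
  have xin: "x + (s * R) *\<^sub>R z \<in> \<Omega>" if "s \<in> {0..1}" "z \<in> cball 0 1" for s z
  proof -
    have "s * R * norm z \<le> 1 * R * 1" using that R by (intro mult_mono) auto
    then have "x + (s * R) *\<^sub>R z \<in> cball x R" using that R by (simp add: dist_norm)
    then show ?thesis using R by auto
  qed
  have cont: "continuous_on ({0..1} \<times> cball 0 1) (\<lambda>y. R * ?D (fst y * R) (snd y) * bump p (snd y))"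
    by (intro continuous_intros continuous_on_compose2[OF continuous_on_bump[of UNIV p]]
        continuous_on_compose2[OF smooth_on_continuous_on[OF smooth_on_dir_deriv[OF f]]])
      (use xin in auto)
  have "integrable lborel (\<lambda>y. indicator ({0..1::real} \<times> cball (0::'a) 1) y *\<^sub>R (R * ?D (fst y * R) (snd y) * bump p (snd y)))"
    by (rule borel_integrable_compact[OF _ cont]) (intro compact_Times; simp)
  also have "(\<lambda>y. indicator ({0..1::real} \<times> cball (0::'a) 1) y *\<^sub>R (R * ?D (fst y * R) (snd y) * bump p (snd y))) = case_prod ?h"
    by (auto simp: indicator_def fun_eq_iff)
  finally have int: "integrable (lborel \<Otimes>\<^sub>M lborel) (case_prod ?h)" by (simp only: lborel_prod)
  have "(LINT z:cball 0 1|lborel. (f (x + R *\<^sub>R z) - f x) * bump p z) = (\<integral>z. \<integral>s. ?h s z \<partial>lborel \<partial>lborel)"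
    unfolding set_lebesgue_integral_def
  proof (rule Bochner_Integration.integral_cong[OF refl])
    fix z :: 'a
    show "indicator (cball 0 1) z *\<^sub>R ((f (x + R *\<^sub>R z) - f x) * bump p z) = (\<integral>s. ?h s z \<partial>lborel)"
    proof (cases "z \<in> cball 0 1")
      case True
      have eqD: "frechet_derivative f (at (x + s *\<^sub>R (R *\<^sub>R z))) (R *\<^sub>R z) = R * ?D (s * R) z" if s: "s \<in> {0..1}" for s
      proof -
        have "f differentiable (at (x + s *\<^sub>R (R *\<^sub>R z)))"
          using smooth_on_differentiable[OF f xin[OF s True]] by simp
        from fun_cong[OF frechet_derivative_at[OF dir_deriv_has_derivative[OF this]], of "R *\<^sub>R z"]
        show ?thesis by (simp add: sum_distrib_left mult_ac)
      qed
      have "(\<integral>s. indicator {0..1} s * frechet_derivative f (at (x + s *\<^sub>R (R *\<^sub>R z))) (R *\<^sub>R z) \<partial>lborel) =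
          f (x + R *\<^sub>R z) - f x"
      proof (rule integral_along_segment)
        show "(f has_derivative frechet_derivative f (at (x + s *\<^sub>R R *\<^sub>R z))) (at (x + s *\<^sub>R R *\<^sub>R z))"
          if "s \<in> {0..1}" for s
          using smooth_on_differentiable[OF f xin[OF that True]] by (simp add: frechet_derivative_works)
        have "continuous_on {0..1} (\<lambda>s. R * ?D (s * R) z)"
          by (intro continuous_intros continuous_on_compose2[OF smooth_on_continuous_on[OF smooth_on_dir_deriv[OF f]]])
            (use xin True in auto)
        then show "continuous_on {0..1} (\<lambda>s. frechet_derivative f (at (x + s *\<^sub>R R *\<^sub>R z)) (R *\<^sub>R z))"
          by (rule continuous_on_cong[THEN iffD1, rotated -1]) (use eqD in auto)
      qed
      also have "(\<integral>s. indicator {0..1} s * frechet_derivative f (at (x + s *\<^sub>R (R *\<^sub>R z))) (R *\<^sub>R z) \<partial>lborel) =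
         (\<integral>s. indicator {0..1} s * (R * ?D (s * R) z) \<partial>lborel)"
        by (intro Bochner_Integration.integral_cong refl) (use eqD in \<open>auto simp: indicator_def\<close>)
      finally have "(f (x + R *\<^sub>R z) - f x) * bump p z = (\<integral>s. indicator {0..1} s * (R * ?D (s * R) z) \<partial>lborel) * bump p z"
        by simp
      also have "\<dots> = (\<integral>s. indicator {0..1} s * (R * ?D (s * R) z) * bump p z \<partial>lborel)" by simp
      finally show ?thesis using True by (simp add: mult_ac)
    qed simp
  qed
  also have "\<dots> = (\<integral>s. \<integral>z. ?h s z \<partial>lborel \<partial>lborel)"
    by (rule lborel_pair.Fubini_integral[OF int])
  also have "\<dots> = (\<integral>s. 0 \<partial>(lborel :: real measure))"
  proof (rule Bochner_Integration.integral_cong[OF refl])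
    fix s :: real
    show "(\<integral>z. ?h s z \<partial>lborel) = 0"
    proof (cases "s \<in> {0..1}")
      case True
      then have s: "0 \<le> s * R" "s * R \<le> R" using R by (auto simp: mult_left_le_one_le)
      then have "cball x (s * R) \<subseteq> \<Omega>" using R by (meson order_trans subset_cball)
      from weighted_mean_radial_derivative[OF \<Omega> f p s(1) this] z[OF s]
      have "(LINT z:cball 0 1|lborel. ?D (s * R) z * bump p z) = 0" by simp
      then have "R * (LINT z:cball 0 1|lborel. ?D (s * R) z * bump p z) = 0" by simp
      then show ?thesis using True by (simp add: set_lebesgue_integral_def mult_ac flip: integral_mult_right_zero)
    qed simp
  qed
  finally show ?thesis by simp
qed

text \<open>This is Pizzetti's mean value expansion in the case where all its coefficients, the
  iterated Laplacians at x, are 0. The induction over \<open>m\<close> passes to the Laplacian of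
  \<open>f\<close> and raises the exponent of the weight by one; for m = 0 the function itself
  vanishes.\<close>

lemma weighted_mean_zero:
  fixes f :: "'a::euclidean_space \<Rightarrow> real"
  assumes \<Omega>: "open \<Omega>" and R: "cball x R \<subseteq> \<Omega>"
  shows "smooth_on \<Omega> f \<Longrightarrow> (\<forall>y\<in>\<Omega>. (laplacian ^^ m) f y = 0) \<Longrightarrow> (\<forall>j<m. (laplacian ^^ j) f x = 0) \<Longrightarrow>
    p \<ge> 1 \<Longrightarrow> 0 \<le> r \<Longrightarrow> r \<le> R \<Longrightarrow> (LINT z:cball 0 1|lborel. f (x + r *\<^sub>R z) * bump p z) = 0"
proof (induction m arbitrary: f p r)
  case 0
  have "x + r *\<^sub>R z \<in> \<Omega>" if "z \<in> cball 0 1" for z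
  proof -
    have "r * norm z \<le> R * 1" using 0 that by (intro mult_mono) auto
    then have "x + r *\<^sub>R z \<in> cball x R" using 0 by (simp add: dist_norm)
    then show ?thesis using R by auto
  qed
  then have "(LINT z:cball 0 1|lborel. f (x + r *\<^sub>R z) * bump p z) = (LINT z:cball (0::'a) 1|lborel. 0)"
    using 0 by (intro set_lebesgue_integral_cong) auto
  then show ?case by (simp add: set_lebesgue_integral_def)
next
  case (Suc m)
  have "(LINT z:cball 0 1|lborel. (f (x + r *\<^sub>R z) - f x) * bump p z) = 0"
  proof (rule weighted_mean_constant[OF \<Omega> Suc.prems(1) Suc.prems(4,5)])
    show "cball x r \<subseteq> \<Omega>" using R Suc.prems by (meson order_trans subset_cball)
    fix r' assume r': "0 \<le> r'" "r' \<le> r"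
    show "(LINT z:cball 0 1|lborel. laplacian f (x + r' *\<^sub>R z) * bump (Suc p) z) = 0"
    proof (rule Suc.IH)
      show "smooth_on \<Omega> (laplacian f)" by (rule smooth_on_laplacian[OF \<Omega> Suc.prems(1)])
      show "\<forall>y\<in>\<Omega>. (laplacian ^^ m) (laplacian f) y = 0"
        using Suc.prems(2) by (simp add: funpow_swap1)
      show "\<forall>j<m. (laplacian ^^ j) (laplacian f) x = 0"
        using Suc.prems(3) by (auto simp: funpow_swap1 dest: spec[of _ "Suc _"])
    qed (use r' Suc.prems in auto)
  qed
  moreover have "f x = 0" using Suc.prems(3) by (auto dest: spec[of _ 0])
  ultimately show ?case by simp
qed

text \<open>A nonpositive function whose mean is 0 under a weight that is positive in the open ball
  vanishes there almost everywhere, and by continuity everywhere.\<close>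

lemma polyharmonic_zero_ball:
  fixes f :: "'a::euclidean_space \<Rightarrow> real"
  assumes \<Omega>: "open \<Omega>" and R: "0 < R" "cball x R \<subseteq> \<Omega>" and f: "smooth_on \<Omega> f"
    and le: "\<And>y. y \<in> \<Omega> \<Longrightarrow> f y \<le> 0" and poly: "\<forall>y\<in>\<Omega>. (laplacian ^^ m) f y = 0"
    and z: "\<forall>j<m. (laplacian ^^ j) f x = 0" and y: "y \<in> ball x R"
  shows "f y = 0"
proof -
  have xin: "x + R *\<^sub>R z \<in> \<Omega>" if "z \<in> cball 0 1" for z
  proof -
    have "R * norm z \<le> R * 1" using R that by (intro mult_mono) auto
    then have "x + R *\<^sub>R z \<in> cball x R" using R by (simp add: dist_norm)
    then show ?thesis using R by auto
  qed
  let ?g = "\<lambda>z. indicator (cball 0 1) z * (- f (x + R *\<^sub>R z) * bump 1 z)"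
  have c: "continuous_on (cball 0 1) (\<lambda>z. f (x + R *\<^sub>R z))"
    by (rule continuous_on_compose2[OF smooth_on_continuous_on[OF f]]) (use xin in \<open>auto intro!: continuous_intros\<close>)
  then have "continuous_on (cball 0 1) (\<lambda>z. - f (x + R *\<^sub>R z) * bump 1 z)"
    by (intro continuous_intros continuous_on_bump)
  from borel_integrable_compact[OF compact_cball this] have "integrable lborel ?g" by simp
  moreover have "0 \<le> ?g z" for z
    using le[OF xin[of z]] bump_nonneg[of 1 z] by (auto simp: indicator_def mult_nonpos_nonneg)
  moreover have "(\<integral>z. ?g z \<partial>lborel) = 0"
    using weighted_mean_zero[OF \<Omega> R(2) f poly z, of 1 R] R(1)
    by (simp add: set_lebesgue_integral_def)
  ultimately have ae: "AE z in lborel. ?g z = 0"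
    using integral_nonneg_eq_0_iff_AE[of lborel ?g] by (blast intro: AE_I2)
  define S where "S = ball 0 1 \<inter> (\<lambda>z. f (x + R *\<^sub>R z)) -` (- {0})"
  have "continuous_on (ball 0 1) (\<lambda>z. f (x + R *\<^sub>R z))" using c by (rule continuous_on_subset) auto
  then have S: "open S" unfolding S_def by (rule continuous_open_preimage) auto
  have "AE z in lborel. z \<notin> S"
    using ae
  proof (rule eventually_mono)
    fix z assume "?g z = 0"
    then show "z \<notin> S" using bump_pos[of z 1] by (auto simp: S_def indicator_def split: if_splits)
  qed
  then have "S \<in> null_sets lborel" using S by (simp add: AE_iff_null_sets)
  then have "negligible S" using negligible_iff_null_sets null_sets_completionI by blast
  then have "S = {}" using S open_not_negligible by blast
  moreover have "(1 / R) *\<^sub>R (y - x) \<in> ball 0 1" using y R(1) by (simp add: dist_norm norm_minus_commute)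
  ultimately have "(1 / R) *\<^sub>R (y - x) \<notin> S" "(1 / R) *\<^sub>R (y - x) \<in> ball 0 1" by auto
  then have "f (x + R *\<^sub>R ((1 / R) *\<^sub>R (y - x))) = 0" by (simp add: S_def del: scaleR_scaleR)
  then show ?thesis using R(1) by simp
qed

text \<open>At a zero of \<open>f\<close> outside the null set \<open>E\<close> all first partial
  derivatives vanish, since otherwise the point would belong to \<open>E\<close>; applied to the
  first derivatives, the same argument kills the pure second derivatives, hence the Laplacian.
  Iterating, all Laplacians of order below m vanish there, so the point lies in \<open>Z\<close>,
  which is shown to be empty.\<close>

theorem polyharmonic_nonpos_AE_neg:
  fixes f :: "'a::euclidean_space \<Rightarrow> real"
  assumes \<Omega>: "open \<Omega>" and f: "smooth_on \<Omega> f" and m: "m \<ge> 1"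
    and le: "\<And>y. y \<in> \<Omega> \<Longrightarrow> f y \<le> 0" and poly: "\<forall>y\<in>\<Omega>. (laplacian ^^ m) f y = 0"
    and nz: "\<And>C. C \<in> components \<Omega> \<Longrightarrow> \<exists>x\<in>C. f x \<noteq> 0"
  shows "AE x in lborel. x \<in> \<Omega> \<longrightarrow> f x < 0"
proof -
  note sl = smooth_on_laplacian_power[OF \<Omega> f]
  \<comment> \<open>\<open>Z\<close> is open because \<open>f\<close> vanishes in a ball around each
    of its points. It is closed in each component by continuity of the Laplacians. So it would
    contain a whole component, on which \<open>f\<close> would be identically 0.\<close>
  define Z where "Z = {x\<in>\<Omega>. \<forall>j<m. (laplacian ^^ j) f x = 0}"
  have Zopen: "\<exists>e>0. ball x e \<subseteq> Z" if x: "x \<in> Z" for x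
  proof -
    have "x \<in> \<Omega>" using x by (simp add: Z_def)
    then obtain R where R: "R > 0" "cball x R \<subseteq> \<Omega>" using \<Omega> open_contains_cball by blast
    have "f y = 0" if "y \<in> ball x R" for y
      by (rule polyharmonic_zero_ball[OF \<Omega> R f le poly _ that]) (use x in \<open>auto simp: Z_def\<close>)
    then have "(laplacian ^^ j) f y = (laplacian ^^ j) (\<lambda>_. 0) y" if "y \<in> ball x R" for y j
      using laplacian_power_cong[of "ball x R" f "\<lambda>_. 0" y j] that by simp
    moreover have "(laplacian ^^ j) (\<lambda>_. 0) = (\<lambda>_::'a. 0)" for j
      by (induction j) (simp_all add: laplacian_const)
    ultimately have "ball x R \<subseteq> Z" using R(2) by (auto simp: Z_def)
    then show ?thesis using R(1) by blast
  qed
  then have "open Z" by (simp add: open_contains_ball)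
  have Z0: "Z = {}"
  proof (rule ccontr)
    assume "Z \<noteq> {}"
    then obtain x where x: "x \<in> Z" by blast
    then have x\<Omega>: "x \<in> \<Omega>" by (simp add: Z_def)
    define C where "C = connected_component_set \<Omega> x"
    have C: "C \<in> components \<Omega>" unfolding C_def using x\<Omega> by (rule componentsI)
    have xC: "x \<in> C" unfolding C_def using x\<Omega> by simp
    have CO: "C \<subseteq> \<Omega>" using C by (rule in_components_subset)
    have "openin (top_of_set C) (C \<inter> Z)" using \<open>open Z\<close> by (rule openin_open_Int)
    moreover have "closedin (top_of_set C) (C \<inter> Z)"
    proof -
      have "0 < m" using m by simp
      have "closedin (top_of_set C) {y\<in>C. (laplacian ^^ j) f y = 0}" for j
        by (rule continuous_closedin_preimage_constant)
          (rule continuous_on_subset[OF smooth_on_continuous_on[OF sl] CO])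
      then have "closedin (top_of_set C) (\<Inter>j\<in>{j. j < m}. {y\<in>C. (laplacian ^^ j) f y = 0})"
        using \<open>0 < m\<close> by (intro closedin_INT) blast+
      also have "(\<Inter>j\<in>{j. j < m}. {y\<in>C. (laplacian ^^ j) f y = 0}) = C \<inter> Z"
        unfolding Z_def using CO \<open>0 < m\<close> by blast
      finally show ?thesis .
    qed
    ultimately have "C \<inter> Z = C" using in_components_connected[OF C] x xC connected_clopen by blast
    then have "C \<subseteq> Z" by blast
    moreover obtain y where "y \<in> C" "f y \<noteq> 0" using nz[OF C] by blast
    ultimately have "f y = 0" using m by (force simp: Z_def dest: spec[of _ 0])
    with \<open>f y \<noteq> 0\<close> show False by simp
  qed
  let ?N = "\<lambda>g b. {x\<in>\<Omega>. g x = 0 \<and> dir_deriv b g x \<noteq> 0}"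
  have N: "?N g b \<in> null_sets lborel" if "smooth_on \<Omega> g" "b \<in> Basis" for g b
    by (rule null_zeros_dir_deriv_nonzero[OF \<Omega> smooth_onD[OF that(1)] that(2)])
  \<comment> \<open>The first kind of set controls the gradient of each iterated Laplacian, the
    second treats the partial derivatives as functions of their own and controls the second
    derivatives.\<close>
  define E where "E = (\<Union>j<m. \<Union>b\<in>Basis. ?N ((laplacian ^^ j) f) b \<union> ?N (dir_deriv b ((laplacian ^^ j) f)) b)"
  have "E \<in> null_sets lborel" unfolding E_def
    by (intro null_sets.finite_UN null_sets.Un N sl smooth_on_dir_deriv) auto
  then have "AE x in lborel. x \<notin> E" by (rule AE_not_in)
  then show ?thesis
  proof (rule eventually_mono)
    fix x assume xE: "x \<notin> E"
    show "x \<in> \<Omega> \<longrightarrow> f x < 0"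
    proof (rule impI, rule ccontr)
      assume x: "x \<in> \<Omega>" and "\<not> f x < 0"
      then have fx: "f x = 0" using le[OF x] by simp
      have "(laplacian ^^ j) f x = 0" if "j < m" for j
        using that
      proof (induction j)
        case (Suc j)
        then have 0: "(laplacian ^^ j) f x = 0" by simp
        have "dir_deriv b (dir_deriv b ((laplacian ^^ j) f)) x = 0" if b: "b \<in> Basis" for b
        proof -
          have "x \<notin> ?N ((laplacian ^^ j) f) b" "x \<notin> ?N (dir_deriv b ((laplacian ^^ j) f)) b"
            using xE Suc.prems b unfolding E_def by (simp_all add: Suc_lessD)
          then show ?thesis using x 0 by simp
        qed
        then have "laplacian ((laplacian ^^ j) f) x = 0" by (subst laplacian_def) (rule sum.neutral, blast)
        then show ?case by simp
      qed (simp add: fx)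
      then have "x \<in> Z" using x by (simp add: Z_def)
      with Z0 show False by simp
    qed
  qed
qed

section \<open>Convolutions with weakly singular kernels\<close>

lemma integrable_lborel_reflect:
  fixes g :: "'a::euclidean_space \<Rightarrow> real"
  assumes "integrable lborel g"
  shows "integrable lborel (\<lambda>x. g (c - x))" and "(\<integral>x. g (c - x) \<partial>lborel) = (\<integral>x. g x \<partial>lborel)"
proof -
  have [measurable]: "g \<in> borel_measurable borel" using assms by simp
  have d: "distr lborel borel (\<lambda>x. c - x) = (lborel :: 'a measure)"
  proof (rule measure_eqI)
    fix A :: "'a set" assume "A \<in> sets (distr lborel borel (\<lambda>x. c - x))"
    then have A[measurable]: "A \<in> sets borel" by simp
    have "emeasure (distr lborel borel (\<lambda>x. c - x)) A = (\<integral>\<^sup>+x. indicator A x \<partial>distr lborel borel (\<lambda>x. c - x))" by simp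
    also have "\<dots> = (\<integral>\<^sup>+x. indicator A (c - x) \<partial>lborel)" by (subst nn_integral_distr) auto
    also have "\<dots> = (\<integral>\<^sup>+x. indicator A x \<partial>lborel)" by (rule nn_integral_lborel_reflect) simp
    also have "\<dots> = emeasure lborel A" by simp
    finally show "emeasure (distr lborel borel (\<lambda>x. c - x)) A = emeasure lborel A" .
  qed simp
  have "integrable (distr lborel borel (\<lambda>x. c - x)) g" using assms d by simp
  then show "integrable lborel (\<lambda>x. g (c - x))" by (subst (asm) integrable_distr_eq) auto
  have "(\<integral>x. g x \<partial>lborel) = (\<integral>x. g x \<partial>distr lborel borel (\<lambda>x. c - x))" by (simp add: d)
  also have "\<dots> = (\<integral>x. g (c - x) \<partial>lborel)" by (subst integral_distr) auto
  finally show "(\<integral>x. g (c - x) \<partial>lborel) = (\<integral>x. g x \<partial>lborel)" ..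
qed

text \<open>Local integrability and at most linear growth are paired with \<open>decaying\<close>
  below, so that convolutions converge absolutely at every point. The value at the origin is
  arbitrary. The logarithm and its derivatives of order below the dimension are of this
  kind.\<close>

definition sing_kernel :: "('a::euclidean_space \<Rightarrow> real) \<Rightarrow> bool" where
  "sing_kernel k \<longleftrightarrow> continuous_on (- {0}) k \<and> set_integrable lborel (ball 0 1) k \<and>
     (\<exists>C. \<forall>z. 1 \<le> norm z \<longrightarrow> \<bar>k z\<bar> \<le> C * norm z)"

text \<open>Boundedness copes with the singularity of the kernel, the finite first moment with its
  linear growth.\<close>

definition decaying :: "('a::euclidean_space \<Rightarrow> real) \<Rightarrow> bool" where
  "decaying f \<longleftrightarrow> f \<in> borel_measurable borel \<and> (\<exists>M. \<forall>y. \<bar>f y\<bar> \<le> M) \<and>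
     integrable lborel (\<lambda>y. (1 + norm y) * \<bar>f y\<bar>)"

definition conv :: "('a::euclidean_space \<Rightarrow> real) \<Rightarrow> ('a \<Rightarrow> real) \<Rightarrow> 'a \<Rightarrow> real" where
  "conv k f x = (\<integral>y. k (x - y) * f y \<partial>lborel)"

lemma sing_kernel_measurable:
  assumes "sing_kernel k" shows "k \<in> borel_measurable borel"
proof -
  have "(\<lambda>z. indicator (- {0}) z *\<^sub>R k z) \<in> borel_measurable borel"
    using assms by (intro borel_measurable_continuous_on_indicator) (auto simp: sing_kernel_def)
  then have "(\<lambda>z. indicator (- {0}) z *\<^sub>R k z + indicator {0} z * k 0) \<in> borel_measurable borel"
    by (intro borel_measurable_add borel_measurable_times borel_measurable_indicator) auto
  also have "(\<lambda>z. indicator (- {0}) z *\<^sub>R k z + indicator {0} z * k 0) = k"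
    by (auto simp: indicator_def fun_eq_iff)
  finally show ?thesis .
qed

lemma one_plus_norm_diff_le: "1 + norm (x - y) \<le> (1 + norm x) * (1 + norm (y::'a::real_normed_vector))"
proof -
  have "norm (x - y) \<le> norm x + norm y" by (rule norm_triangle_ineq4)
  moreover have "0 \<le> norm x * norm y" by simp
  moreover have "(1 + norm x) * (1 + norm y) = 1 + norm x + norm y + norm x * norm y" by (simp add: algebra_simps)
  ultimately show ?thesis by linarith
qed

text \<open>The space is split at distance 1 from x: nearby the kernel is integrable and
  \<open>f\<close> bounded; farther away the kernel is at most a multiple of (1 + |x|)(1 + |y|) and
  the first moment of \<open>f\<close> is finite. The bound on the absolute integral, linear in |x|,
  is what Fubini's theorem asks for later.\<close>

lemma conv_bound:
  assumes k: "sing_kernel k" and f: "decaying f"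
  obtains A where "0 \<le> A" "\<And>x. integrable lborel (\<lambda>y. k (x - y) * f y)"
    "\<And>x. (\<integral>y. \<bar>k (x - y) * f y\<bar> \<partial>lborel) \<le> A * (1 + norm x)"
proof -
  have km[measurable]: "k \<in> borel_measurable borel" by (rule sing_kernel_measurable[OF k])
  have fm[measurable]: "f \<in> borel_measurable borel" using f by (simp add: decaying_def)
  obtain M where M: "\<And>y. \<bar>f y\<bar> \<le> M" using f by (auto simp: decaying_def)
  then have M0: "0 \<le> M" using abs_ge_zero order_trans by blast
  obtain C' where C': "\<And>z. 1 \<le> norm z \<Longrightarrow> \<bar>k z\<bar> \<le> C' * norm z" using k by (auto simp: sing_kernel_def)
  define C where "C = max 0 C'"
  have C: "\<bar>k z\<bar> \<le> C * norm z" if "1 \<le> norm z" for z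
    using C'[OF that] mult_right_mono[of C' C "norm z"] by (auto simp: C_def)
  have C0: "0 \<le> C" by (simp add: C_def)
  let ?k1 = "\<lambda>z. indicator (ball 0 1) z * \<bar>k z\<bar>"
  have k1: "integrable lborel ?k1"
    using k integrable_norm[of lborel "\<lambda>z. indicator (ball 0 1) z *\<^sub>R k z"]
    by (simp add: sing_kernel_def set_integrable_def abs_mult)
  have f1: "integrable lborel (\<lambda>y. (1 + norm y) * \<bar>f y\<bar>)" using f by (simp add: decaying_def)
  let ?B = "\<lambda>x y. M * ?k1 (x - y) + C * (1 + norm x) * ((1 + norm y) * \<bar>f y\<bar>)"
  have B: "integrable lborel (?B x)" for x
    by (intro Bochner_Integration.integrable_add integrable_mult_right integrable_lborel_reflect(1)[OF k1] f1)
  have le: "\<bar>k (x - y) * f y\<bar> \<le> ?B x y" for x y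
  proof (cases "norm (x - y) < 1")
    case True
    have "\<bar>k (x - y) * f y\<bar> \<le> \<bar>k (x - y)\<bar> * M" using M by (simp add: abs_mult mult_left_mono)
    moreover have "0 \<le> C * (1 + norm x) * ((1 + norm y) * \<bar>f y\<bar>)" using C0 by simp
    ultimately show ?thesis using True by (simp add: mult.commute)
  next
    case False
    then have "\<bar>k (x - y)\<bar> \<le> C * norm (x - y)" using C[of "x - y"] by simp
    also have "\<dots> \<le> C * ((1 + norm x) * (1 + norm y))"
      using one_plus_norm_diff_le[of x y] C0 by (intro mult_left_mono) auto
    finally have "\<bar>k (x - y)\<bar> * \<bar>f y\<bar> \<le> C * ((1 + norm x) * (1 + norm y)) * \<bar>f y\<bar>" by (intro mult_right_mono) auto
    then show ?thesis using False by (simp add: abs_mult mult_ac)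
  qed
  have int: "integrable lborel (\<lambda>y. k (x - y) * f y)" for x
    by (rule Bochner_Integration.integrable_bound[OF B]) (use le in \<open>auto intro!: AE_I2 intro: order_trans[OF _ abs_ge_self]\<close>)
  define A where "A = M * (\<integral>z. ?k1 z \<partial>lborel) + C * (\<integral>y. (1 + norm y) * \<bar>f y\<bar> \<partial>lborel)"
  have pos: "0 \<le> (\<integral>z. ?k1 z \<partial>lborel)" "0 \<le> (\<integral>y. (1 + norm y) * \<bar>f y\<bar> \<partial>lborel)"
    by (intro Bochner_Integration.integral_nonneg; simp)+
  have bd: "(\<integral>y. \<bar>k (x - y) * f y\<bar> \<partial>lborel) \<le> A * (1 + norm x)" for x
  proof -
    have "(\<integral>y. \<bar>k (x - y) * f y\<bar> \<partial>lborel) \<le> (\<integral>y. ?B x y \<partial>lborel)"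
      using int le by (intro integral_mono B) auto
    also have "\<dots> = M * (\<integral>z. ?k1 z \<partial>lborel) + C * (1 + norm x) * (\<integral>y. (1 + norm y) * \<bar>f y\<bar> \<partial>lborel)"
      using integrable_lborel_reflect[OF k1, of x] f1 by simp
    also have "\<dots> \<le> A * (1 + norm x)"
      using M0 C0 pos by (simp add: A_def algebra_simps)
    finally show ?thesis .
  qed
  have "0 \<le> A" unfolding A_def using M0 C0 pos by simp
  then show ?thesis using that int bd by blast
qed

lemma conv_integrable: "sing_kernel k \<Longrightarrow> decaying f \<Longrightarrow> integrable lborel (\<lambda>y. k (x - y) * f y)"
  using conv_bound by metis

lemma sing_kernel_bounded_away:
  assumes k: "sing_kernel k" and d: "0 < \<delta>"
  obtains B where "0 \<le> B" "\<And>z. \<delta> \<le> norm z \<Longrightarrow> \<bar>k z\<bar> \<le> B * (1 + norm z)"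
proof -
  obtain C where C: "\<And>z. 1 \<le> norm z \<Longrightarrow> \<bar>k z\<bar> \<le> C * norm z" using k by (auto simp: sing_kernel_def)
  have "compact (cball 0 1 - ball 0 \<delta> :: 'a set)" by (intro compact_diff) auto
  moreover have "continuous_on (cball 0 1 - ball 0 \<delta>) k"
    by (rule continuous_on_subset[of "-{0}"]) (use k d in \<open>auto simp: sing_kernel_def\<close>)
  ultimately have "bounded (k ` (cball 0 1 - ball 0 \<delta>))"
    by (intro compact_imp_bounded compact_continuous_image)
  then obtain B' where "\<forall>w\<in>k ` (cball 0 1 - ball 0 \<delta>). norm w \<le> B'"
    unfolding bounded_iff by blast
  then have B': "\<bar>k z\<bar> \<le> B'" if "z \<in> cball 0 1 - ball 0 \<delta>" for z
    using that by auto
  define B where "B = max 0 (max C B')"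
  have "\<bar>k z\<bar> \<le> B * (1 + norm z)" if z: "\<delta> \<le> norm z" for z
  proof (cases "1 \<le> norm z")
    case True
    have "C * norm z \<le> B * (1 + norm z)" by (intro mult_mono) (auto simp: B_def)
    with C[OF True] show ?thesis by simp
  next
    case False
    have "B * 1 \<le> B * (1 + norm z)" by (intro mult_left_mono) (auto simp: B_def)
    moreover have "B' \<le> B" by (simp add: B_def)
    ultimately show ?thesis using B'[of z] z False by auto
  qed
  then show ?thesis using that[of B] by (simp add: B_def)
qed

text \<open>Cutting a kernel at a radius creates a jump on a sphere. Spheres are null sets, so
  translates of the cut kernel still converge almost everywhere.\<close>

lemma AE_norm_diff_neq: "AE y in lborel. norm (x - y) \<noteq> (r::real)" for x :: "'a::euclidean_space"
proof -
  have "sphere x r \<in> null_sets lborel"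
    using negligible_sphere[of x r] by (simp add: negligible_iff_null_sets null_sets_completion_iff)
  then have "AE y in lborel. y \<notin> sphere x r" by (rule AE_not_in)
  then show ?thesis by (rule eventually_mono) (simp add: dist_norm)
qed

text \<open>The kernel is cut at a small radius \<delta>. The singular parts contribute at most 2M
  times the integral of |k| over the ball of radius \<delta>, uniformly in n; the rest converges by
  dominated convergence under the linear growth bound. Both the continuity of potentials and the
  equicontinuity in the mean field limit rest on this.\<close>

lemma sing_kernel_L1_continuous:
  fixes k :: "'a::euclidean_space \<Rightarrow> real"
  assumes k: "sing_kernel k" and f: "decaying f" and X: "X \<longlonglongrightarrow> x"
  shows "(\<lambda>n. \<integral>y. \<bar>k (X n - y) - k (x - y)\<bar> * \<bar>f y\<bar> \<partial>lborel) \<longlonglongrightarrow> 0"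
proof (rule LIMSEQ_I)
  fix e :: real assume e: "0 < e"
  have km[measurable]: "k \<in> borel_measurable borel" by (rule sing_kernel_measurable[OF k])
  have fm[measurable]: "f \<in> borel_measurable borel" using f by (simp add: decaying_def)
  obtain M where M: "\<And>y. \<bar>f y\<bar> \<le> M" using f by (auto simp: decaying_def)
  then have M0: "0 \<le> M" using abs_ge_zero order_trans by blast
  let ?h = "\<lambda>\<delta> z. indicator (ball 0 \<delta>) z * \<bar>k z\<bar>"
  have k1: "integrable lborel (?h 1)"
    using k integrable_norm[of lborel "\<lambda>z. indicator (ball 0 1) z *\<^sub>R k z"]
    by (simp add: sing_kernel_def set_integrable_def abs_mult)
  \<comment> \<open>The integral over the shrinking balls of radius 1/(j + 1) tends to 0; one index
    of this sequence provides \<delta>.\<close>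
  have "(\<lambda>j. \<integral>z. ?h (1 / real (Suc j)) z \<partial>lborel) \<longlonglongrightarrow> (\<integral>z. 0 \<partial>(lborel :: 'a measure))"
  proof (rule integral_dominated_convergence[where w="?h 1"])
    have "AE z in lborel. z \<noteq> (0::'a)" by (rule AE_lborel_singleton)
    then show "AE z in lborel. (\<lambda>j. ?h (1 / real (Suc j)) z) \<longlonglongrightarrow> 0"
    proof (rule eventually_mono)
      fix z :: 'a assume "z \<noteq> 0"
      then obtain N where N: "1 / Suc N < norm z" using nat_approx_posE[of "norm z"] by auto
      have "?h (1 / real (Suc j)) z = 0" if "j \<ge> N" for j
      proof -
        have "1 / real (Suc j) \<le> 1 / real (Suc N)" using that by (intro divide_left_mono) auto
        then have "\<not> norm z < 1 / real (Suc j)" using N by linarith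
        then show ?thesis by simp
      qed
      then show "(\<lambda>j. ?h (1 / real (Suc j)) z) \<longlonglongrightarrow> 0"
        by (intro tendsto_eventually eventually_sequentiallyI[of N])
    qed
    show "AE z in lborel. norm (?h (1 / real (Suc j)) z) \<le> ?h 1 z" for j
    proof (rule AE_I2)
      fix z :: 'a
      have "ball (0::'a) (1 / real (Suc j)) \<subseteq> ball 0 1" by (intro subset_ball) simp
      then show "norm (?h (1 / real (Suc j)) z) \<le> ?h 1 z" by (auto simp: indicator_def simp del: of_nat_Suc mem_ball)
    qed
    show "?h (1 / real (Suc j)) \<in> borel_measurable lborel" for j
      unfolding measurable_lborel1
      by (intro borel_measurable_times borel_measurable_indicator borel_measurable_abs km) auto
  qed (use k1 in auto)
  then have "(\<lambda>j. 2 * M * (\<integral>z. ?h (1 / real (Suc j)) z \<partial>lborel)) \<longlonglongrightarrow> 0"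
    using tendsto_mult_left[of _ 0 sequentially "2 * M"] by simp
  then have "\<forall>\<^sub>F j in sequentially. 2 * M * (\<integral>z. ?h (1 / real (Suc j)) z \<partial>lborel) < e / 2"
    by (rule order_tendstoD) (use e in simp)
  then obtain j where j: "2 * M * (\<integral>z. ?h (1 / real (Suc j)) z \<partial>lborel) < e / 2"
    using eventually_happens by fastforce
  define \<delta> where "\<delta> = 1 / real (Suc j)"
  have \<delta>: "0 < \<delta>" "\<delta> \<le> 1" by (auto simp: \<delta>_def)
  have h\<delta>: "integrable lborel (?h \<delta>)"
    by (rule Bochner_Integration.integrable_bound[OF k1]) (use \<delta> in \<open>auto intro!: AE_I2 simp: indicator_def\<close>)
  define k2 where "k2 z = indicator (- ball 0 \<delta>) z * k z" for z
  have [measurable]: "k2 \<in> borel_measurable borel" unfolding k2_def by measurable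
  obtain B where B: "0 \<le> B" "\<And>z. \<delta> \<le> norm z \<Longrightarrow> \<bar>k z\<bar> \<le> B * (1 + norm z)"
    using sing_kernel_bounded_away[OF k \<delta>(1)] by blast
  have k2B: "\<bar>k2 z\<bar> \<le> B * (1 + norm z)" for z
    using B by (auto simp: k2_def indicator_def)
  have "bounded (range X)" using X convergent_imp_bounded by blast
  then obtain R where R: "\<And>n. norm (X n) \<le> R" by (auto simp: bounded_iff)
  then have R0: "0 \<le> R" using norm_ge_zero order_trans by blast
  have Rx: "norm x \<le> R" using LIMSEQ_le_const2[OF tendsto_norm[OF X]] R by blast
  have k2R: "\<bar>k2 (u - y)\<bar> \<le> B * (1 + R) * (1 + norm y)" if "norm u \<le> R" for u y
  proof -
    have "\<bar>k2 (u - y)\<bar> \<le> B * (1 + norm (u - y))" by (rule k2B)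
    also have "\<dots> \<le> B * ((1 + norm u) * (1 + norm y))" using B(1) by (intro mult_left_mono one_plus_norm_diff_le)
    also have "\<dots> \<le> B * ((1 + R) * (1 + norm y))" using B(1) that by (intro mult_left_mono mult_right_mono) auto
    finally show ?thesis by (simp add: mult.assoc)
  qed
  have f1: "integrable lborel (\<lambda>y. (1 + norm y) * \<bar>f y\<bar>)" using f by (simp add: decaying_def)
  have dom: "\<bar>k2 (X n - y) - k2 (x - y)\<bar> * \<bar>f y\<bar> \<le> 2 * B * (1 + R) * ((1 + norm y) * \<bar>f y\<bar>)" for n y
  proof -
    have "\<bar>k2 (X n - y) - k2 (x - y)\<bar> \<le> 2 * B * (1 + R) * (1 + norm y)"
      using k2R[OF R[of n], of y] k2R[OF Rx, of y] by linarith
    from mult_right_mono[OF this, of "\<bar>f y\<bar>"] show ?thesis by (simp add: mult_ac)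
  qed
  have "(\<lambda>n. \<integral>y. \<bar>k2 (X n - y) - k2 (x - y)\<bar> * \<bar>f y\<bar> \<partial>lborel) \<longlonglongrightarrow> (\<integral>y. 0 \<partial>(lborel :: 'a measure))"
  proof (rule integral_dominated_convergence[where w="\<lambda>y. 2 * B * (1 + R) * ((1 + norm y) * \<bar>f y\<bar>)"])
    show "AE y in lborel. (\<lambda>n. \<bar>k2 (X n - y) - k2 (x - y)\<bar> * \<bar>f y\<bar>) \<longlonglongrightarrow> 0"
      using AE_norm_diff_neq[of x \<delta>]
    proof (rule eventually_mono)
      fix y assume ne: "norm (x - y) \<noteq> \<delta>"
      have Xy: "(\<lambda>n. X n - y) \<longlonglongrightarrow> x - y" by (intro tendsto_intros X)
      have "isCont k2 (x - y)"
      proof (cases "norm (x - y) < \<delta>")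
        case True
        have "continuous_on (ball 0 \<delta>) k2 = continuous_on (ball 0 \<delta>) (\<lambda>_::'a. 0 :: real)"
          by (rule continuous_on_cong) (auto simp: k2_def)
        then show ?thesis using True by (simp add: continuous_on_eq_continuous_at)
      next
        case False
        have "continuous_on (- cball 0 \<delta>) k2 = continuous_on (- cball 0 \<delta>) k"
          by (rule continuous_on_cong) (auto simp: k2_def)
        moreover have "continuous_on (- cball 0 \<delta>) k"
          by (rule continuous_on_subset[of "-{0}"]) (use k \<delta> in \<open>auto simp: sing_kernel_def\<close>)
        ultimately have "continuous_on (- cball 0 \<delta>) k2" by simp
        moreover have "open (- cball (0::'a) \<delta>)" by (simp add: open_Compl)
        ultimately show ?thesis using False ne by (simp add: continuous_on_eq_continuous_at)
      qed
      from isCont_tendsto_compose[OF this Xy] have "(\<lambda>n. k2 (X n - y)) \<longlonglongrightarrow> k2 (x - y)" .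
      then show "(\<lambda>n. \<bar>k2 (X n - y) - k2 (x - y)\<bar> * \<bar>f y\<bar>) \<longlonglongrightarrow> 0"
        by (auto intro!: tendsto_eq_intros)
    qed
    show "AE y in lborel. norm (\<bar>k2 (X n - y) - k2 (x - y)\<bar> * \<bar>f y\<bar>) \<le> 2 * B * (1 + R) * ((1 + norm y) * \<bar>f y\<bar>)" for n
      using dom by (intro AE_I2) (simp add: abs_mult)
  qed (use f1 in auto)
  then have "(\<lambda>n. \<integral>y. \<bar>k2 (X n - y) - k2 (x - y)\<bar> * \<bar>f y\<bar> \<partial>lborel) \<longlonglongrightarrow> 0" by simp
  then have "\<forall>\<^sub>F n in sequentially. (\<integral>y. \<bar>k2 (X n - y) - k2 (x - y)\<bar> * \<bar>f y\<bar> \<partial>lborel) < e / 2"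
    by (rule order_tendstoD) (use e in simp)
  then obtain N where N: "\<And>n. n \<ge> N \<Longrightarrow> (\<integral>y. \<bar>k2 (X n - y) - k2 (x - y)\<bar> * \<bar>f y\<bar> \<partial>lborel) < e / 2"
    by (auto simp: eventually_sequentially)
  show "\<exists>N. \<forall>n\<ge>N. norm ((\<integral>y. \<bar>k (X n - y) - k (x - y)\<bar> * \<bar>f y\<bar> \<partial>lborel) - 0) < e"
  proof (intro exI allI impI)
    fix n assume "n \<ge> N"
    have i2: "integrable lborel (\<lambda>y. \<bar>k2 (X n - y) - k2 (x - y)\<bar> * \<bar>f y\<bar>)"
      by (rule Bochner_Integration.integrable_bound[of _ "\<lambda>y. 2 * B * (1 + R) * ((1 + norm y) * \<bar>f y\<bar>)"])
        (use f1 dom B(1) R0 in \<open>auto simp: abs_mult intro!: AE_I2\<close>)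
    have ia: "integrable lborel (\<lambda>y. ?h \<delta> (X n - y))" "integrable lborel (\<lambda>y. ?h \<delta> (x - y))"
      by (rule integrable_lborel_reflect(1)[OF h\<delta>])+
    have kk: "integrable lborel (\<lambda>y. \<bar>k (X n - y) - k (x - y)\<bar> * \<bar>f y\<bar>)"
      using integrable_norm[OF Bochner_Integration.integrable_diff[OF conv_integrable[OF k f, of "X n"] conv_integrable[OF k f, of x]]]
      by (simp add: left_diff_distrib[symmetric] abs_mult)
    have "(\<integral>y. \<bar>k (X n - y) - k (x - y)\<bar> * \<bar>f y\<bar> \<partial>lborel) \<le>
       (\<integral>y. M * ?h \<delta> (X n - y) + M * ?h \<delta> (x - y) + \<bar>k2 (X n - y) - k2 (x - y)\<bar> * \<bar>f y\<bar> \<partial>lborel)"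
    proof (rule integral_mono[OF kk])
      show "integrable lborel (\<lambda>y. M * ?h \<delta> (X n - y) + M * ?h \<delta> (x - y) + \<bar>k2 (X n - y) - k2 (x - y)\<bar> * \<bar>f y\<bar>)"
        by (intro Bochner_Integration.integrable_add integrable_mult_right ia i2)
      fix y
      have s: "k z = indicator (ball 0 \<delta>) z * k z + k2 z" for z by (auto simp: k2_def indicator_def)
      have "\<bar>k (X n - y) - k (x - y)\<bar> \<le> ?h \<delta> (X n - y) + ?h \<delta> (x - y) + \<bar>k2 (X n - y) - k2 (x - y)\<bar>"
      proof -
        have a: "?h \<delta> z = \<bar>indicator (ball 0 \<delta>) z * k z\<bar>" for z by (simp add: abs_mult)
        show ?thesis unfolding a using s[of "X n - y"] s[of "x - y"] by linarith
      qed
      from mult_right_mono[OF this abs_ge_zero[of "f y"]] have "\<bar>k (X n - y) - k (x - y)\<bar> * \<bar>f y\<bar> \<le>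
          (?h \<delta> (X n - y) + ?h \<delta> (x - y)) * \<bar>f y\<bar> + \<bar>k2 (X n - y) - k2 (x - y)\<bar> * \<bar>f y\<bar>"
        by (simp add: distrib_right)
      moreover have "(?h \<delta> (X n - y) + ?h \<delta> (x - y)) * \<bar>f y\<bar> \<le> (?h \<delta> (X n - y) + ?h \<delta> (x - y)) * M"
        using M by (intro mult_left_mono) auto
      ultimately show "\<bar>k (X n - y) - k (x - y)\<bar> * \<bar>f y\<bar> \<le>
          M * ?h \<delta> (X n - y) + M * ?h \<delta> (x - y) + \<bar>k2 (X n - y) - k2 (x - y)\<bar> * \<bar>f y\<bar>"
        by (simp add: algebra_simps)
    qed
    also have "\<dots> = 2 * M * (\<integral>z. ?h \<delta> z \<partial>lborel) + (\<integral>y. \<bar>k2 (X n - y) - k2 (x - y)\<bar> * \<bar>f y\<bar> \<partial>lborel)"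
      using ia i2 integrable_lborel_reflect(2)[OF h\<delta>]
      by (subst Bochner_Integration.integral_add; (subst Bochner_Integration.integral_add)?; simp)
    also have "\<dots> < e" using j N[OF \<open>n \<ge> N\<close>] by (simp add: \<delta>_def)
    finally show "norm ((\<integral>y. \<bar>k (X n - y) - k (x - y)\<bar> * \<bar>f y\<bar> \<partial>lborel) - 0) < e"
      by simp
  qed
qed

lemma conv_continuous:
  fixes k :: "'a::euclidean_space \<Rightarrow> real"
  assumes k: "sing_kernel k" and f: "decaying f"
  shows "continuous_on S (conv k f)"
proof -
  have "isCont (conv k f) x" for x
    unfolding continuous_at_sequentially
  proof (intro allI impI)
    fix X assume X: "X \<longlonglongrightarrow> x"
    have "(\<lambda>n. conv k f (X n) - conv k f x) \<longlonglongrightarrow> 0"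
    proof (rule Lim_null_comparison[OF always_eventually sing_kernel_L1_continuous[OF k f X]], rule allI)
      fix n
      have "conv k f (X n) - conv k f x = (\<integral>y. (k (X n - y) - k (x - y)) * f y \<partial>lborel)"
        unfolding conv_def left_diff_distrib
        by (intro Bochner_Integration.integral_diff[symmetric] conv_integrable k f)
      also have "norm \<dots> \<le> (\<integral>y. norm ((k (X n - y) - k (x - y)) * f y) \<partial>lborel)" by (rule integral_norm_bound)
      finally show "norm (conv k f (X n) - conv k f x) \<le> (\<integral>y. \<bar>k (X n - y) - k (x - y)\<bar> * \<bar>f y\<bar> \<partial>lborel)"
        by (simp add: abs_mult)
    qed
    then show "(conv k f \<circ> X) \<longlonglongrightarrow> conv k f x" unfolding o_def by (rule LIM_zero_cancel)
  qed
  then show ?thesis by (rule continuous_at_imp_continuous_on[OF ballI])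
qed

section \<open>The mean field equation\<close>

text \<open>The inequality ln s \<le> s - 1 at s = a/x says that the convex function t ln t lies
  above its tangent at \<open>a\<close>. At x = 0 the product with the logarithm is 0, which is the
  correct limit value.\<close>

lemma xlnx_tangent:
  fixes x a :: real
  assumes "0 \<le> x" "0 < a"
  shows "a * ln a + (1 + ln a) * (x - a) \<le> x * ln x"
proof (cases "x = 0")
  case False
  then have x: "x > 0" using assms by simp
  have "ln (a / x) \<le> a / x - 1" using x assms by (intro ln_le_minus_one) simp
  then have "x * ln (a / x) \<le> x * (a / x - 1)" using x by (intro mult_left_mono) auto
  then show ?thesis using x assms by (simp add: ln_div algebra_simps)
qed (use assms in \<open>simp add: algebra_simps\<close>)

text \<open>The tangent at the convex combination lies below the function at both end points, and
  the weighted sum of the linear terms cancels. Positivity of \<open>b\<close> keeps the point of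
  tangency away from 0, where no tangent exists.\<close>

lemma xlnx_convex:
  fixes a b t :: real
  assumes "0 \<le> a" "0 < b" "0 < t" "t < 1"
  shows "((1-t) * a + t * b) * ln ((1-t) * a + t * b) \<le> (1-t) * (a * ln a) + t * (b * ln b)"
proof -
  let ?c = "(1-t) * a + t * b"
  have c: "?c > 0" using assms by (simp add: add_nonneg_pos)
  have 1: "(1-t) * (?c * ln ?c + (1 + ln ?c) * (a - ?c)) \<le> (1-t) * (a * ln a)"
    using assms c by (intro mult_left_mono xlnx_tangent) auto
  have 2: "t * (?c * ln ?c + (1 + ln ?c) * (b - ?c)) \<le> t * (b * ln b)"
    using assms c by (intro mult_left_mono xlnx_tangent) auto
  have "(1-t) * (?c * ln ?c + (1 + ln ?c) * (a - ?c)) + t * (?c * ln ?c + (1 + ln ?c) * (b - ?c))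
     = ?c * ln ?c + (1 + ln ?c) * ((1-t) * a + t * b - ?c)" by (simp only: algebra_simps)
  with 1 2 show ?thesis by simp
qed

lemma continuous_on_xlnx: "continuous_on {0..} (\<lambda>x::real. x * ln x)"
  unfolding continuous_on_eq_continuous_within
proof
  fix x :: real assume x: "x \<in> {0..}"
  show "continuous (at x within {0..}) (\<lambda>x. x * ln x)"
  proof (cases "x = 0")
    case True
    have "((\<lambda>x::real. x * ln x) \<longlongrightarrow> 0) (at_right 0)" by real_asymp
    moreover have "at (0::real) within {0..} = at_right 0"
      by (rule at_within_nhd[of _ UNIV]) auto
    ultimately show ?thesis using True by (simp add: continuous_within)
  next
    case False
    then show ?thesis using x by (intro continuous_intros) auto
  qed
qed

text \<open>The points are functions on an arbitrary type with the product topology. Pinning them to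
  0 outside \<open>I\<close> places the simplex as a closed subset inside a product of compact
  sets.\<close>

lemma compact_simplex:
  assumes I: "finite I"
  shows "compact {p :: 'i \<Rightarrow> real. (\<forall>i\<in>I. 0 \<le> p i) \<and> (\<forall>i. i \<notin> I \<longrightarrow> p i = 0) \<and> (\<Sum>i\<in>I. p i) = 1}"
    (is "compact ?K")
proof -
  let ?P = "PiE UNIV (\<lambda>i. if i \<in> I then {0..1::real} else {0})"
  have "compactin (product_topology (\<lambda>i. euclidean) UNIV) ?P"
    by (subst compactin_PiE) auto
  then have cP: "compact ?P" by (simp add: euclidean_product_topology)
  have "continuous_on UNIV (\<lambda>p::'i \<Rightarrow> real. \<Sum>i\<in>I. p i)"
    by (intro continuous_on_sum continuous_on_product_coordinates)
  then have "closed {p :: 'i \<Rightarrow> real. (\<Sum>i\<in>I. p i) = 1}"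
    by (intro closed_Collect_eq continuous_on_const)
  with cP have c: "compact (?P \<inter> {p. (\<Sum>i\<in>I. p i) = 1})" by (rule compact_Int_closed)
  have "?P \<inter> {p. (\<Sum>i\<in>I. p i) = 1} = ?K" (is "?L = _")
  proof (intro equalityI subsetI)
    fix p assume p: "p \<in> ?L"
    then have "\<And>i. p i \<in> (if i \<in> I then {0..1::real} else {0})" by (auto simp: PiE_def Pi_def)
    then have "(i \<in> I \<longrightarrow> 0 \<le> p i) \<and> (i \<notin> I \<longrightarrow> p i = 0)" for i
      by (cases "i \<in> I") (metis atLeastAtMost_iff, metis singletonD)
    with p show "p \<in> ?K" by auto
  next
    fix p assume p: "p \<in> ?K"
    have "p i \<le> 1" if "i \<in> I" for i
      using p member_le_sum[of i I p] that I by auto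
    with p show "p \<in> ?L" by auto
  qed
  with c show ?thesis by simp
qed

text \<open>A minimiser \<open>p\<close> of the free energy is compared with the segment towards the Gibbs weights
  \<open>q\<close> that \<open>p\<close> generates: the first order condition says that the relative entropy of \<open>p\<close> with
  respect to \<open>q\<close> is not positive.\<close>

lemma finite_mean_field:
  fixes w :: "'i \<Rightarrow> real" and g :: "'i \<Rightarrow> 'i \<Rightarrow> real" and \<alpha> :: real
  assumes I: "finite I" "I \<noteq> {}" and w: "\<And>i. i \<in> I \<Longrightarrow> w i > 0"
    and sym: "\<And>i j. i \<in> I \<Longrightarrow> j \<in> I \<Longrightarrow> g i j = g j i"
  shows "\<exists>p. \<forall>i\<in>I. p i = w i * exp (\<alpha> * (\<Sum>j\<in>I. g i j * p j)) /
      (\<Sum>k\<in>I. w k * exp (\<alpha> * (\<Sum>j\<in>I. g k j * p j)))"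
proof -
  define K where "K = {p :: 'i \<Rightarrow> real. (\<forall>i\<in>I. 0 \<le> p i) \<and> (\<forall>i. i \<notin> I \<longrightarrow> p i = 0) \<and> (\<Sum>i\<in>I. p i) = 1}"
  \<comment> \<open>Entropy relative to the weights, interaction energy, and the free energy, whose
    critical points satisfy the equation.\<close>
  define H where "H p = (\<Sum>i\<in>I. p i * ln (p i) - p i * ln (w i))" for p :: "'i \<Rightarrow> real"
  define Q where "Q p = (\<Sum>i\<in>I. \<Sum>j\<in>I. g i j * p i * p j)" for p :: "'i \<Rightarrow> real"
  define F where "F p = H p - \<alpha> / 2 * Q p" for p
  have cc: "continuous_on K (\<lambda>p. p i)" for i
    by (rule continuous_on_subset[OF continuous_on_product_coordinates]) simp
  have lnp: "continuous_on K (\<lambda>p. p i * ln (p i))" if "i \<in> I" for i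
    by (rule continuous_on_compose2[OF continuous_on_xlnx cc]) (use that in \<open>auto simp: K_def\<close>)
  have "continuous_on K H" unfolding H_def
    by (intro continuous_on_sum continuous_on_diff lnp continuous_on_mult_right cc)
  then have "continuous_on K F" unfolding F_def Q_def
    by (intro continuous_on_diff continuous_on_sum continuous_on_mult continuous_on_const cc)
  moreover have "compact K" unfolding K_def by (rule compact_simplex[OF I(1)])
  moreover obtain i0 where i0: "i0 \<in> I" using I by blast
  have "(\<lambda>i. if i = i0 then 1 else 0) \<in> K" using i0 I by (auto simp: K_def)
  then have "K \<noteq> {}" by blast
  ultimately obtain p where p: "p \<in> K" "\<And>p'. p' \<in> K \<Longrightarrow> F p \<le> F p'"
    using continuous_attains_inf[of K F] by auto
  have p0: "\<And>i. i \<in> I \<Longrightarrow> 0 \<le> p i" and p1: "(\<Sum>i\<in>I. p i) = 1" using p(1) by (auto simp: K_def)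
  define V where "V i = \<alpha> * (\<Sum>j\<in>I. g i j * p j)" for i
  define Z where "Z = (\<Sum>k\<in>I. w k * exp (V k))"
  have Z: "Z > 0" unfolding Z_def using I w by (intro sum_pos) auto
  \<comment> \<open>The Gibbs weights generated by \<open>p\<close> are all positive. Moving towards
    them is harmless even if a coordinate of \<open>p\<close> is 0, where the entropy has no
    derivative.\<close>
  define q where "q i = (if i \<in> I then w i * exp (V i) / Z else 0)" for i
  have q0: "q i > 0" if "i \<in> I" for i using w[OF that] Z that by (simp add: q_def)
  have q1: "(\<Sum>i\<in>I. q i) = 1" using Z by (simp add: q_def Z_def sum_divide_distrib[symmetric])
  have lnq: "ln (q i) = ln (w i) + V i - ln Z" if "i \<in> I" for i
    using w[OF that] Z that by (simp add: q_def ln_mult ln_div)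
  define B where "B = (\<Sum>i\<in>I. (q i - p i) * V i)"
  define R where "R = Q (\<lambda>i. q i - p i)"
  \<comment> \<open>Minimality along the segment, divided by t: convexity bounds the entropy by its
    chord, while the quadratic energy is expanded exactly, so that only its second order term keeps
    a factor t.\<close>
  have ineq: "0 \<le> (H q - H p - B) - t * (\<alpha> / 2 * R)" if t: "0 < t" "t < 1" for t
  proof -
    define pt where "pt i = (1-t) * p i + t * q i" for i
    have "(\<Sum>i\<in>I. pt i) = 1"
      by (simp add: pt_def sum.distrib sum_distrib_left[symmetric] p1 q1)
    moreover have "0 \<le> pt i" if "i \<in> I" for i
      unfolding pt_def using t p0[OF that] q0[OF that] by (intro add_nonneg_nonneg mult_nonneg_nonneg) auto
    moreover have "pt i = 0" if "i \<notin> I" for i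
      using p(1) that by (auto simp: pt_def K_def q_def)
    ultimately have "pt \<in> K" by (simp add: K_def)
    then have "F p \<le> F pt" using p by blast
    moreover have "H pt \<le> H p - t * H p + t * H q"
    proof -
      have "H pt \<le> (\<Sum>i\<in>I. (1-t) * (p i * ln (p i) - p i * ln (w i)) + t * (q i * ln (q i) - q i * ln (w i)))"
        unfolding H_def
      proof (rule sum_mono)
        fix i assume i: "i \<in> I"
        show "pt i * ln (pt i) - pt i * ln (w i) \<le>
          (1-t) * (p i * ln (p i) - p i * ln (w i)) + t * (q i * ln (q i) - q i * ln (w i))"
          using xlnx_convex[OF p0[OF i] q0[OF i] t] by (simp add: pt_def algebra_simps)
      qed
      also have "\<dots> = (1-t) * H p + t * H q" by (simp add: H_def sum.distrib sum_distrib_left)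
      finally show ?thesis by (simp add: algebra_simps)
    qed
    moreover have "\<alpha> / 2 * Q pt = \<alpha> / 2 * Q p + t * B + t\<^sup>2 * (\<alpha> / 2 * R)"
    proof -
      have "Q pt = Q p + t * (\<Sum>i\<in>I. \<Sum>j\<in>I. g i j * (q i - p i) * p j)
          + t * (\<Sum>i\<in>I. \<Sum>j\<in>I. g i j * p i * (q j - p j)) + t\<^sup>2 * R"
        unfolding Q_def R_def pt_def sum_distrib_left sum.distrib[symmetric]
        by (intro sum.cong refl) (simp add: algebra_simps power2_eq_square)
      moreover have "(\<Sum>i\<in>I. \<Sum>j\<in>I. g i j * p i * (q j - p j)) = (\<Sum>i\<in>I. \<Sum>j\<in>I. g i j * (q i - p i) * p j)"
        by (subst sum.swap) (intro sum.cong refl, simp add: sym mult_ac)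
      moreover have "\<alpha> * (\<Sum>i\<in>I. \<Sum>j\<in>I. g i j * (q i - p i) * p j) = B"
        unfolding B_def V_def sum_distrib_left by (intro sum.cong refl) (simp add: mult_ac)
      ultimately show ?thesis by (simp add: algebra_simps)
    qed
    ultimately have "0 \<le> t * H q - t * H p - t * B - t\<^sup>2 * (\<alpha> / 2 * R)"
      unfolding F_def by linarith
    also have "\<dots> = t * ((H q - H p - B) - t * (\<alpha> / 2 * R))"
      by (simp add: algebra_simps power2_eq_square)
    finally have "0 \<le> t * ((H q - H p - B) - t * (\<alpha> / 2 * R))" .
    with t(1) show ?thesis by (simp add: zero_le_mult_iff)
  qed
  \<comment> \<open>Letting t tend to 0 leaves the first order condition, which the following lines
    rewrite as nonpositivity of the relative entropy.\<close>
  have "0 \<le> H q - H p - B"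
  proof (rule tendsto_lowerbound)
    show "((\<lambda>t. (H q - H p - B) - t * (\<alpha> / 2 * R)) \<longlongrightarrow> H q - H p - B) (at_right 0)"
      by (auto intro!: tendsto_eq_intros)
    show "\<forall>\<^sub>F t in at_right 0. 0 \<le> (H q - H p - B) - t * (\<alpha> / 2 * R)"
      using eventually_at_right_real[of 0 1] by (rule eventually_mono) (use ineq in auto)
  qed simp
  also have "H q - H p - B = (\<Sum>i\<in>I. q i * (ln (q i) - ln (w i) - V i)) - (\<Sum>i\<in>I. p i * (ln (p i) - ln (w i) - V i))"
    unfolding H_def B_def sum_subtractf[symmetric] by (intro sum.cong refl) (simp add: algebra_simps)
  also have "(\<Sum>i\<in>I. q i * (ln (q i) - ln (w i) - V i)) = (\<Sum>i\<in>I. q i * (- ln Z))"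
    by (intro sum.cong refl) (simp add: lnq)
  also have "\<dots> = - ln Z" by (simp add: sum_distrib_right[symmetric] sum_negf q1)
  also have "(\<Sum>i\<in>I. p i * (ln (p i) - ln (w i) - V i)) = (\<Sum>i\<in>I. p i * ln (p i) - p i * ln (q i) + p i * (- ln Z))"
    by (intro sum.cong refl) (simp add: lnq algebra_simps)
  also have "\<dots> = (\<Sum>i\<in>I. p i * ln (p i) - p i * ln (q i)) - ln Z"
    by (simp add: sum.distrib sum_subtractf sum_negf sum_distrib_right[symmetric] p1)
  finally have KL: "(\<Sum>i\<in>I. p i * ln (p i) - p i * ln (q i)) \<le> 0" by simp
  \<comment> \<open>Each \<open>T i\<close> is nonnegative by the tangent inequality, and their sum
    is the relative entropy because \<open>p\<close> and \<open>q\<close> have the same total mass.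
    So all of them vanish, and equality in ln s \<le> s - 1 forces s = q i / p i = 1.\<close>
  define T where "T i = p i * ln (p i) - p i * ln (q i) - p i + q i" for i
  have T0: "T i \<ge> 0" if i: "i \<in> I" for i
    using xlnx_tangent[OF p0[OF i] q0[OF i]] by (simp add: T_def algebra_simps)
  have "(\<Sum>i\<in>I. T i) \<le> 0" using KL p1 q1 by (simp add: T_def sum.distrib sum_subtractf)
  then have "(\<Sum>i\<in>I. T i) = 0" using sum_nonneg[of I T] T0 by (intro antisym) auto
  then have Tz: "T i = 0" if "i \<in> I" for i using that T0 I by (simp add: sum_nonneg_eq_0_iff)
  have pq: "p i = q i" if i: "i \<in> I" for i
  proof (cases "p i = 0")
    case True
    then show ?thesis using Tz[OF i] by (simp add: T_def)
  next
    case False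
    then have pi: "p i > 0" using p0[OF i] by simp
    have "p i * (ln (q i / p i) - (q i / p i - 1)) = 0"
      using Tz[OF i] pi q0[OF i] by (simp add: T_def ln_div algebra_simps)
    then have "ln (q i / p i) = q i / p i - 1" using pi by simp
    then have "q i / p i = 1" using pi q0[OF i] by (intro ln_eq_minus_one) auto
    then show ?thesis using pi by simp
  qed
  show ?thesis
  proof (intro exI[of _ p] ballI)
    fix i assume "i \<in> I"
    then show "p i = w i * exp (\<alpha> * (\<Sum>j\<in>I. g i j * p j)) / (\<Sum>k\<in>I. w k * exp (\<alpha> * (\<Sum>j\<in>I. g k j * p j)))"
      using pq[of i] by (simp add: q_def Z_def V_def)
  qed
qed

text \<open>The weight of the problem is absorbed into \<nu>; U is the potential of the probability
  density proportional to exp(\<alpha> U). The equation is imposed at every point, not only almost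
  everywhere, so that a solution inherits pointwise bounds from the kernel.\<close>

definition mean_field :: "'a::topological_space measure \<Rightarrow> real \<Rightarrow> ('a \<Rightarrow> 'a \<Rightarrow> real) \<Rightarrow> ('a \<Rightarrow> real) \<Rightarrow> bool" where
  "mean_field \<nu> \<alpha> g U \<longleftrightarrow> U \<in> borel_measurable borel \<and>
     (\<forall>x. U x = (\<integral>y. g x y * exp (\<alpha> * U y) \<partial>\<nu>) / (\<integral>y. exp (\<alpha> * U y) \<partial>\<nu>))"

lemma integral_simple_comp:
  fixes h :: "'b \<Rightarrow> real"
  assumes "finite_measure \<nu>" and P: "simple_function \<nu> P"
  shows "(\<integral>y. h (P y) \<partial>\<nu>) = (\<Sum>i\<in>P ` space \<nu>. h i * measure \<nu> (P -` {i} \<inter> space \<nu>))"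
proof -
  interpret finite_measure \<nu> by fact
  have fin: "finite (P ` space \<nu>)" using P by (rule simple_functionD)
  have s: "P -` {i} \<inter> space \<nu> \<in> sets \<nu>" for i using P by (rule simple_functionD)
  have "(\<integral>y. h (P y) \<partial>\<nu>) = (\<integral>y. (\<Sum>i\<in>P ` space \<nu>. h i * indicator (P -` {i} \<inter> space \<nu>) y) \<partial>\<nu>)"
  proof (rule Bochner_Integration.integral_cong[OF refl])
    fix y assume y: "y \<in> space \<nu>"
    have "(\<Sum>i\<in>P ` space \<nu>. h i * indicator (P -` {i} \<inter> space \<nu>) y) =
        (\<Sum>i\<in>P ` space \<nu>. if i = P y then h i else 0)"
      using y by (intro sum.cong refl) (auto simp: indicator_def)
    then show "h (P y) = (\<Sum>i\<in>P ` space \<nu>. h i * indicator (P -` {i} \<inter> space \<nu>) y)"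
      using y fin by simp
  qed
  also have "\<dots> = (\<Sum>i\<in>P ` space \<nu>. (\<integral>y. h i * indicator (P -` {i} \<inter> space \<nu>) y \<partial>\<nu>))"
    using s by (intro Bochner_Integration.integral_sum integrable_mult_right integrable_real_indicator)
      (auto simp: emeasure_eq_measure)
  also have "\<dots> = (\<Sum>i\<in>P ` space \<nu>. h i * measure \<nu> (P -` {i} \<inter> space \<nu>))"
    using s by simp
  finally show ?thesis .
qed

text \<open>The kernel sees points only through the cells of the simple function \<open>P\<close>,
  so the equation becomes a finite system with the measures of the cells as weights. Cells of
  measure 0 are left out, since the weights have to be positive, but the kernel sum \<open>u\<close>
  defines the solution on them too. The bounds hold because \<open>u\<close> averages the kernel
  with probability weights.\<close>

lemma mean_field_step_kernel:
  fixes \<nu> :: "'a::topological_space measure"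
  assumes fin: "finite_measure \<nu>" and sets: "sets \<nu> = sets borel" and pos: "measure \<nu> UNIV > 0"
    and P: "simple_function \<nu> P" and sym: "\<And>x y. g x y = g y x"
    and g0: "\<And>x y. 0 \<le> g x y" and gN: "\<And>x y. g x y \<le> N"
  obtains U where "mean_field \<nu> \<alpha> (\<lambda>x y. g (P x) (P y)) U" "\<And>x. 0 \<le> U x \<and> U x \<le> N"
proof -
  interpret finite_measure \<nu> by fact
  have sp: "space \<nu> = UNIV" using sets sets_eq_imp_space_eq[OF sets] by simp
  define w where "w i = measure \<nu> (P -` {i})" for i
  define I where "I = {i \<in> range P. w i > 0}"
  have finR: "finite (range P)" using simple_functionD(1)[OF P] sp by simp
  then have finI: "finite I" by (simp add: I_def)
  have int: "(\<integral>y. h (P y) \<partial>\<nu>) = (\<Sum>i\<in>I. h i * w i)" for h :: "_ \<Rightarrow> real"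
  proof -
    have "(\<integral>y. h (P y) \<partial>\<nu>) = (\<Sum>i\<in>range P. h i * w i)"
      using integral_simple_comp[OF fin P, of h] sp by (simp add: w_def)
    also have "\<dots> = (\<Sum>i\<in>I. h i * w i)"
      using finR by (intro sum.mono_neutral_right) (auto simp: I_def w_def less_le)
    finally show ?thesis .
  qed
  have "I \<noteq> {}"
  proof
    assume "I = {}"
    with int[of "\<lambda>_. 1"] pos sp show False by simp
  qed
  have w0: "\<And>i. i \<in> I \<Longrightarrow> w i > 0" by (simp add: I_def)
  have sym': "\<And>i j. i \<in> I \<Longrightarrow> j \<in> I \<Longrightarrow> g i j = g j i" by (rule sym)
  from finite_mean_field[where w = w and g = g and \<alpha> = \<alpha>, OF finI \<open>I \<noteq> {}\<close> w0 sym']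
  obtain p where p: "\<forall>i\<in>I. p i = w i * exp (\<alpha> * (\<Sum>j\<in>I. g i j * p j)) /
      (\<Sum>k\<in>I. w k * exp (\<alpha> * (\<Sum>j\<in>I. g k j * p j)))" by blast
  define u where "u i = (\<Sum>j\<in>I. g i j * p j)" for i
  define Z where "Z = (\<Sum>k\<in>I. w k * exp (\<alpha> * u k))"
  have Z: "Z > 0" unfolding Z_def using finI \<open>I \<noteq> {}\<close> by (intro sum_pos) (auto simp: I_def)
  have p': "p i = w i * exp (\<alpha> * u i) / Z" if "i \<in> I" for i using bspec[OF p that] by (simp add: u_def Z_def)
  have p0: "p i \<ge> 0" if "i \<in> I" for i using p'[OF that] that Z by (simp add: I_def)
  have p1: "(\<Sum>i\<in>I. p i) = 1" using Z p' by (simp add: Z_def sum_divide_distrib[symmetric])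
  have Zi: "(\<integral>y. exp (\<alpha> * u (P y)) \<partial>\<nu>) = Z"
    using int[of "\<lambda>i. exp (\<alpha> * u i)"] by (simp add: Z_def mult.commute)
  have "u (P x) = (\<integral>y. g (P x) (P y) * exp (\<alpha> * u (P y)) \<partial>\<nu>) / Z" for x
  proof -
    have "(\<integral>y. g (P x) (P y) * exp (\<alpha> * u (P y)) \<partial>\<nu>) / Z = (\<Sum>i\<in>I. g (P x) i * exp (\<alpha> * u i) * w i / Z)"
      using int[of "\<lambda>i. g (P x) i * exp (\<alpha> * u i)"] by (simp add: sum_divide_distrib)
    also have "\<dots> = u (P x)" unfolding u_def[of "P x"]
      by (intro sum.cong refl) (simp add: p' mult_ac)
    finally show ?thesis ..
  qed
  moreover have "(\<lambda>x. u (P x)) \<in> borel_measurable \<nu>"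
    using simple_function_compose1[OF P, of u] by (rule borel_measurable_simple_function)
  then have "(\<lambda>x. u (P x)) \<in> borel_measurable borel"
    by (simp add: measurable_cong_sets[OF sets refl])
  ultimately have "mean_field \<nu> \<alpha> (\<lambda>x y. g (P x) (P y)) (\<lambda>x. u (P x))"
    unfolding mean_field_def Zi by blast
  moreover have "0 \<le> u i \<and> u i \<le> N" for i
  proof -
    have "u i \<le> (\<Sum>j\<in>I. N * p j)" unfolding u_def using p0 gN by (intro sum_mono mult_right_mono) auto
    also have "\<dots> = N" by (simp add: sum_distrib_left[symmetric] p1)
    finally show ?thesis unfolding u_def using p0 g0 by (auto intro!: sum_nonneg)
  qed
  ultimately show ?thesis using that by blast
qed

lemma integrable_mult_bounded:
  fixes f e :: "'a \<Rightarrow> real"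
  assumes f: "integrable M f" and e[measurable]: "e \<in> borel_measurable M" and C: "\<And>x. \<bar>e x\<bar> \<le> C"
  shows "integrable M (\<lambda>x. f x * e x)" and "\<bar>\<integral>x. f x * e x \<partial>M\<bar> \<le> C * (\<integral>x. \<bar>f x\<bar> \<partial>M)"
proof -
  have C0: "0 \<le> C" using C[of undefined] by linarith
  have [measurable]: "f \<in> borel_measurable M" using f by simp
  have le: "\<bar>f x * e x\<bar> \<le> C * \<bar>f x\<bar>" for x
    using mult_left_mono[OF C[of x], of "\<bar>f x\<bar>"] by (simp add: abs_mult mult.commute)
  show 1: "integrable M (\<lambda>x. f x * e x)"
  proof (rule Bochner_Integration.integrable_bound)
    show "integrable M (\<lambda>x. C * \<bar>f x\<bar>)" using f by simp
    show "AE x in M. norm (f x * e x) \<le> norm (C * \<bar>f x\<bar>)" using le C0 by (simp add: abs_mult)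
  qed simp
  have "\<bar>\<integral>x. f x * e x \<partial>M\<bar> \<le> (\<integral>x. \<bar>f x * e x\<bar> \<partial>M)"
    using integral_norm_bound[of M "\<lambda>x. f x * e x"] by simp
  also have "\<dots> \<le> (\<integral>x. C * \<bar>f x\<bar> \<partial>M)" using 1 f le by (intro integral_mono) auto
  finally show "\<bar>\<integral>x. f x * e x \<partial>M\<bar> \<le> C * (\<integral>x. \<bar>f x\<bar> \<partial>M)" by simp
qed

text \<open>The densities \<open>E n\<close> are bounded by one constant. Integrated against the
  limit kernel they give functions \<open>A n\<close> that are equicontinuous, with a modulus
  depending on \<open>G\<close> and that constant only, and whose distance to \<open>U n\<close>
  tends to 0 at each point. A subsequence converging on a countable dense set therefore converges
  everywhere, and dominated convergence carries the equation to the limit. The detour through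
  \<open>A n\<close> is made because the \<open>U n\<close> may be discontinuous, as for step
  kernels.\<close>

lemma mean_field_limit:
  fixes \<nu> :: "'a::euclidean_space measure"
  assumes fin: "finite_measure \<nu>" and sets[measurable_cong]: "sets \<nu> = sets borel" and pos: "measure \<nu> UNIV > 0"
    and \<alpha>: "\<alpha> \<ge> 0"
    and mf: "\<And>n. mean_field \<nu> \<alpha> (g n) (U n)" and U: "\<And>n x. 0 \<le> U n x \<and> U n x \<le> M"
    and G: "\<And>x. integrable \<nu> (G x)" and g: "\<And>n x. integrable \<nu> (g n x)"
    and conv: "\<And>x. (\<lambda>n. \<integral>y. \<bar>g n x y - G x y\<bar> \<partial>\<nu>) \<longlonglongrightarrow> 0"
    and cont: "\<And>x X. X \<longlonglongrightarrow> x \<Longrightarrow> (\<lambda>n. \<integral>y. \<bar>G (X n) y - G x y\<bar> \<partial>\<nu>) \<longlonglongrightarrow> 0"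
  obtains r V where "strict_mono (r :: nat \<Rightarrow> nat)" "\<And>x. (\<lambda>n. U (r n) x) \<longlonglongrightarrow> V x"
    "mean_field \<nu> \<alpha> G V" "\<And>x. 0 \<le> V x \<and> V x \<le> M"
proof -
  interpret finite_measure \<nu> by fact
  have sp: "space \<nu> = UNIV" using sets_eq_imp_space_eq[OF sets] by simp
  have Ub: "U n \<in> borel_measurable borel" for n using mf[of n] by (simp add: mean_field_def)
  have [measurable]: "U n \<in> borel_measurable \<nu>" for n
    using Ub[of n] measurable_cong_sets[OF sets refl, of "borel :: real measure"] by simp
  define m0 where "m0 = measure \<nu> UNIV"
  define Z where "Z n = (\<integral>y. exp (\<alpha> * U n y) \<partial>\<nu>)" for n
  define E where "E n y = exp (\<alpha> * U n y) / Z n" for n y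
  \<comment> \<open>exp(\<alpha> M) bounds the numerator of the density, and the partition function
    is at least the total mass \<open>m0\<close>, because \<alpha> and \<open>U n\<close> are
    nonnegative.\<close>
  define C where "C = exp (\<alpha> * M) / m0"
  have e1: "1 \<le> exp (\<alpha> * U n y)" "exp (\<alpha> * U n y) \<le> exp (\<alpha> * M)" for n y
    using U[of n y] \<alpha> by (auto intro: mult_left_mono)
  have intE: "integrable \<nu> (\<lambda>y. exp (\<alpha> * U n y))" for n
    by (rule integrable_const_bound[of _ "exp (\<alpha> * M)"]) (use e1 in auto)
  have Zm: "m0 \<le> Z n" for n
  proof -
    have "(\<integral>y. 1 \<partial>\<nu>) \<le> Z n" unfolding Z_def using e1(1) intE by (intro integral_mono) auto
    then show ?thesis by (simp add: sp m0_def)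
  qed
  have m0: "m0 > 0" using pos by (simp add: m0_def)
  have E0: "0 \<le> E n y" "E n y \<le> C" for n y
    unfolding E_def C_def using Zm[of n] m0 e1(2)[of n y] by (auto intro!: frac_le divide_nonneg_nonneg)
  have EC: "\<bar>E n y\<bar> \<le> C" for n y using E0[of n y] by simp
  have [measurable]: "E n \<in> borel_measurable \<nu>" for n unfolding E_def by measurable
  have C0: "0 \<le> C" using E0[of undefined undefined] by linarith
  define A where "A n x = (\<integral>y. G x y * E n y \<partial>\<nu>)" for n x
  have Ueq: "U n x = (\<integral>y. g n x y * E n y \<partial>\<nu>)" for n x
  proof -
    have "U n x = (\<integral>y. g n x y * exp (\<alpha> * U n y) \<partial>\<nu>) / Z n"
      using mf[of n] unfolding mean_field_def Z_def by blast
    also have "\<dots> = (\<integral>y. g n x y * E n y \<partial>\<nu>)" by (simp add: E_def)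
    finally show ?thesis .
  qed
  have UA: "\<bar>U n x - A n x\<bar> \<le> C * (\<integral>y. \<bar>g n x y - G x y\<bar> \<partial>\<nu>)" for n x
  proof -
    have "U n x - A n x = (\<integral>y. (g n x y - G x y) * E n y \<partial>\<nu>)"
      unfolding Ueq A_def left_diff_distrib
      by (intro Bochner_Integration.integral_diff[symmetric] integrable_mult_bounded(1)[OF _ _ EC] g G) auto
    then show ?thesis using integrable_mult_bounded(2)[OF _ _ EC, of \<nu> "\<lambda>y. g n x y - G x y"] g G by simp
  qed
  have AA: "\<bar>A n x - A n x'\<bar> \<le> C * (\<integral>y. \<bar>G x y - G x' y\<bar> \<partial>\<nu>)" for n x x'
  proof -
    have "A n x - A n x' = (\<integral>y. (G x y - G x' y) * E n y \<partial>\<nu>)"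
      unfolding A_def left_diff_distrib
      by (intro Bochner_Integration.integral_diff[symmetric] integrable_mult_bounded(1)[OF _ _ EC] G) auto
    then show ?thesis using integrable_mult_bounded(2)[OF _ _ EC, of \<nu> "\<lambda>y. G x y - G x' y"] G by simp
  qed
  obtain D :: "'a set" where D: "countable D" "\<And>X. open X \<Longrightarrow> X \<noteq> {} \<Longrightarrow> \<exists>d\<in>D. d \<in> X"
    using countable_dense_exists by blast
  have "norm (U n x) \<le> M" for n x using U[of n x] by simp
  then obtain r :: "nat \<Rightarrow> nat" where r: "strict_mono r" "\<And>d. d \<in> D \<Longrightarrow> \<exists>l. (\<lambda>n. U (r n) d) \<longlonglongrightarrow> l"
    using function_convergent_subsequence[OF D(1), of U M] by blast
  have UA0: "(\<lambda>n. U (r n) x - A (r n) x) \<longlonglongrightarrow> 0" for x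
  proof (rule Lim_null_comparison)
    show "(\<lambda>n. C * (\<integral>y. \<bar>g (r n) x y - G x y\<bar> \<partial>\<nu>)) \<longlonglongrightarrow> 0"
      using tendsto_mult_left[OF LIMSEQ_subseq_LIMSEQ[OF conv r(1)], of C] by (simp add: o_def)
  qed (use UA in auto)
  have "Cauchy (\<lambda>n. A (r n) x)" for x
  proof (rule metric_CauchyI)
    fix e :: real assume e: "e > 0"
    have "\<exists>d\<in>D. d \<in> ball x (1 / Suc n)" for n by (intro D(2)) auto
    then obtain X where X: "\<And>n. X n \<in> D" "\<And>n. dist x (X n) < 1 / Suc n" by (metis mem_ball)
    have "X \<longlonglongrightarrow> x"
    proof (rule metric_LIMSEQ_I)
      fix e :: real assume "0 < e"
      then obtain N where N: "1 / Suc N < e" using nat_approx_posE by blast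
      have "dist (X n) x < e" if "n \<ge> N" for n
      proof -
        have "1 / real (Suc n) \<le> 1 / real (Suc N)" using that by (intro divide_left_mono) auto
        then show ?thesis using X(2)[of n] N by (simp add: dist_commute)
      qed
      then show "\<exists>N. \<forall>n\<ge>N. dist (X n) x < e" by blast
    qed
    from tendsto_mult_left[OF cont[OF this], of C] have "(\<lambda>n. C * (\<integral>y. \<bar>G (X n) y - G x y\<bar> \<partial>\<nu>)) \<longlonglongrightarrow> 0" by simp
    then have "\<forall>\<^sub>F n in sequentially. C * (\<integral>y. \<bar>G (X n) y - G x y\<bar> \<partial>\<nu>) < e / 3"
      by (rule order_tendstoD) (use e in simp)
    then obtain n0 where n0: "C * (\<integral>y. \<bar>G (X n0) y - G x y\<bar> \<partial>\<nu>) < e / 3"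
      using eventually_happens by fastforce
    \<comment> \<open>A point of the dense set close to x: passing between x and d costs e/3 twice,
      uniformly in the index, and the Cauchy property at d accounts for the last third.\<close>
    define d where "d = X n0"
    have "d \<in> D" using X by (simp add: d_def)
    then obtain l where l: "(\<lambda>n. U (r n) d) \<longlonglongrightarrow> l" using r(2) by blast
    have "(\<lambda>n. U (r n) d - (U (r n) d - A (r n) d)) \<longlonglongrightarrow> l - 0" by (intro tendsto_diff l UA0)
    then have "Cauchy (\<lambda>n. A (r n) d)" by (simp add: LIMSEQ_imp_Cauchy)
    then obtain N where N: "\<And>m n. m \<ge> N \<Longrightarrow> n \<ge> N \<Longrightarrow> dist (A (r m) d) (A (r n) d) < e / 3"
      using metric_CauchyD[of "\<lambda>n. A (r n) d" "e / 3"] e by auto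
    have "dist (A (r m) x) (A (r n) x) < e" if mn: "m \<ge> N" "n \<ge> N" for m n
      using N[OF mn] AA[of "r m" d x] AA[of "r n" d x] n0 unfolding d_def[symmetric] dist_real_def
      by linarith
    then show "\<exists>N. \<forall>m\<ge>N. \<forall>n\<ge>N. dist (A (r m) x) (A (r n) x) < e" by blast
  qed
  then have "\<exists>l. (\<lambda>n. A (r n) x) \<longlonglongrightarrow> l" for x using Cauchy_convergent convergent_def by blast
  then obtain V where AV: "\<And>x. (\<lambda>n. A (r n) x) \<longlonglongrightarrow> V x" by metis
  have UV: "(\<lambda>n. U (r n) x) \<longlonglongrightarrow> V x" for x
    using tendsto_add[OF AV[of x] UA0[of x]] by simp
  have V: "0 \<le> V x \<and> V x \<le> M" for x
    using LIMSEQ_le_const[OF UV[of x], of 0] LIMSEQ_le_const2[OF UV[of x], of M] U by auto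
  have Vm[measurable]: "V \<in> borel_measurable borel"
    by (rule borel_measurable_LIMSEQ_real[OF UV Ub])
  have Vm'[measurable]: "V \<in> borel_measurable \<nu>"
    using Vm measurable_cong_sets[OF sets refl, of "borel :: real measure"] by simp
  define Z' where "Z' = (\<integral>y. exp (\<alpha> * V y) \<partial>\<nu>)"
  have Zl: "(\<lambda>n. Z (r n)) \<longlonglongrightarrow> Z'" unfolding Z_def Z'_def
  proof (rule integral_dominated_convergence[where w="\<lambda>_. exp (\<alpha> * M)"])
    show "AE x in \<nu>. (\<lambda>n. exp (\<alpha> * U (r n) x)) \<longlonglongrightarrow> exp (\<alpha> * V x)"
      by (intro AE_I2 tendsto_intros UV)
  qed (use e1 in auto)
  have Z': "Z' > 0" using LIMSEQ_le_const[OF Zl, of m0] Zm m0 by fastforce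
  have "V x = (\<integral>y. G x y * exp (\<alpha> * V y) \<partial>\<nu>) / Z'" for x
  proof -
    have [measurable]: "G x \<in> borel_measurable \<nu>" using G[of x] by simp
    have "(\<lambda>n. A (r n) x) \<longlonglongrightarrow> (\<integral>y. G x y * (exp (\<alpha> * V y) / Z') \<partial>\<nu>)" unfolding A_def
    proof (rule integral_dominated_convergence[where w="\<lambda>y. C * \<bar>G x y\<bar>"])
      show "AE y in \<nu>. (\<lambda>n. G x y * E (r n) y) \<longlonglongrightarrow> G x y * (exp (\<alpha> * V y) / Z')"
        unfolding E_def using Z' by (intro AE_I2 tendsto_intros UV Zl) auto
      show "AE y in \<nu>. norm (G x y * E (r n) y) \<le> C * \<bar>G x y\<bar>" for n
      proof (intro AE_I2)
        fix y
        have "\<bar>G x y\<bar> * \<bar>E (r n) y\<bar> \<le> \<bar>G x y\<bar> * C" using EC by (intro mult_left_mono) auto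
        then show "norm (G x y * E (r n) y) \<le> C * \<bar>G x y\<bar>" by (simp add: abs_mult mult.commute)
      qed
      show "integrable \<nu> (\<lambda>y. C * \<bar>G x y\<bar>)" using G by simp
    qed measurable
    with AV[of x] have "V x = (\<integral>y. G x y * (exp (\<alpha> * V y) / Z') \<partial>\<nu>)" by (rule LIMSEQ_unique)
    also have "\<dots> = (\<integral>y. G x y * exp (\<alpha> * V y) \<partial>\<nu>) / Z'" by simp
    finally show ?thesis .
  qed
  then have "mean_field \<nu> \<alpha> G V"
    unfolding mean_field_def Z'_def using Vm by blast
  with that r(1) UV V show ?thesis by blast
qed

text \<open>Simple functions \<open>P n\<close> converging pointwise to the identity turn the kernel
  into step kernels g(P n x)(P n y). Continuity of \<open>g\<close> and the bound N give convergence
  in mean, which is what the passage to the limit requires.\<close>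

lemma mean_field_bounded_kernel:
  fixes \<nu> :: "'a::euclidean_space measure" and g :: "'a \<Rightarrow> 'a \<Rightarrow> real"
  assumes fin: "finite_measure \<nu>" and sets[measurable_cong]: "sets \<nu> = sets borel" and pos: "measure \<nu> UNIV > 0"
    and \<alpha>: "\<alpha> \<ge> 0" and sym: "\<And>x y. g x y = g y x"
    and g0: "\<And>x y. 0 \<le> g x y" and gN: "\<And>x y. g x y \<le> N"
    and cont: "continuous_on UNIV (\<lambda>z. g (fst z) (snd z))"
  obtains U where "mean_field \<nu> \<alpha> g U" "\<And>x. 0 \<le> U x \<and> U x \<le> N"
proof -
  interpret finite_measure \<nu> by fact
  have sp: "space \<nu> = UNIV" using sets_eq_imp_space_eq[OF sets] by simp
  have gl: "(\<lambda>n. g (X n) (Y n)) \<longlonglongrightarrow> g x y" if "X \<longlonglongrightarrow> x" "Y \<longlonglongrightarrow> y" for X Y x y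
    using continuous_on_tendsto_compose[OF cont tendsto_Pair[OF that]] by simp
  have "(\<lambda>x. x) \<in> borel_measurable \<nu>" by measurable
  from borel_measurable_implies_sequence_metric[OF this, of 0]
  obtain P where P: "\<And>n. simple_function \<nu> (P n)" "\<And>x. (\<lambda>n. P n x) \<longlonglongrightarrow> x"
    using sp by auto
  have [measurable]: "P n \<in> measurable \<nu> borel" for n using P(1) by (rule borel_measurable_simple_function)
  have [measurable]: "(\<lambda>z. g (fst z) (snd z)) \<in> borel_measurable (borel \<Otimes>\<^sub>M borel)"
    using borel_measurable_continuous_onI[OF cont] by (simp add: borel_prod)
  have gm: "(\<lambda>y. g x (h y)) \<in> borel_measurable \<nu>" if [measurable]: "h \<in> measurable \<nu> borel" for x h
  proof -
    have "(\<lambda>y. (\<lambda>z. g (fst z) (snd z)) (x, h y)) \<in> borel_measurable \<nu>" by measurable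
    then show ?thesis by simp
  qed
  have gi: "integrable \<nu> (\<lambda>y. g x (h y))" if "h \<in> measurable \<nu> borel" for x h
    by (rule integrable_const_bound[of _ N]) (use g0 gN gm[OF that] in auto)
  have gN': "\<bar>g a b - g c d\<bar> \<le> N" for a b c d using g0[of a b] g0[of c d] gN[of a b] gN[of c d] by linarith
  have "\<exists>U. mean_field \<nu> \<alpha> (\<lambda>x y. g (P n x) (P n y)) U \<and> (\<forall>x. 0 \<le> U x \<and> U x \<le> N)" for n
    by (rule mean_field_step_kernel[where g = g and N = N and \<alpha> = \<alpha>, OF fin sets pos P(1)[of n] sym g0 gN]) blast
  then obtain U where U: "\<And>n. mean_field \<nu> \<alpha> (\<lambda>x y. g (P n x) (P n y)) (U n)" "\<And>n x. 0 \<le> U n x \<and> U n x \<le> N"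
    by metis
  have gm2[measurable]: "(\<lambda>y. g x (P n y)) \<in> borel_measurable \<nu>" "(\<lambda>y. g x y) \<in> borel_measurable \<nu>" for x n
    by (intro gm; measurable)+
  have "(\<lambda>n. \<integral>y. \<bar>g (P n x) (P n y) - g x y\<bar> \<partial>\<nu>) \<longlonglongrightarrow> (\<integral>y. 0 \<partial>\<nu>)" for x
  proof (rule integral_dominated_convergence[where w="\<lambda>_. N"])
    show "AE y in \<nu>. (\<lambda>n. \<bar>g (P n x) (P n y) - g x y\<bar>) \<longlonglongrightarrow> 0"
      using gl[OF P(2) P(2)] by (intro AE_I2 tendsto_rabs_zero LIM_zero) auto
  qed (use gN' in auto)
  then have conv: "(\<lambda>n. \<integral>y. \<bar>g (P n x) (P n y) - g x y\<bar> \<partial>\<nu>) \<longlonglongrightarrow> 0" for x by simp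
  have cont: "(\<lambda>n. \<integral>y. \<bar>g (X n) y - g x y\<bar> \<partial>\<nu>) \<longlonglongrightarrow> 0" if "X \<longlonglongrightarrow> x" for x X
  proof -
    have "(\<lambda>n. \<integral>y. \<bar>g (X n) y - g x y\<bar> \<partial>\<nu>) \<longlonglongrightarrow> (\<integral>y. 0 \<partial>\<nu>)"
    proof (rule integral_dominated_convergence[where w="\<lambda>_. N"])
      show "AE y in \<nu>. (\<lambda>n. \<bar>g (X n) y - g x y\<bar>) \<longlonglongrightarrow> 0"
        using gl[OF that tendsto_const] by (intro AE_I2 tendsto_rabs_zero LIM_zero) auto
    qed (use gN' in auto)
    then show ?thesis by simp
  qed
  show ?thesis
  proof (rule mean_field_limit[OF fin sets pos \<alpha> U(1) U(2) _ _ conv cont])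
    show "integrable \<nu> (g x)" for x using gi[of "\<lambda>y. y" x] by simp
    show "integrable \<nu> (\<lambda>y. g (P n x) (P n y))" for x n by (rule gi) simp
  qed (use that in blast)+
qed

section \<open>Differentiating convolutions with weakly singular kernels\<close>

lemma conv_segment_Fubini:
  fixes k :: "'a::euclidean_space \<Rightarrow> real"
  assumes k: "sing_kernel k" and f: "decaying f"
  shows "integrable (lborel \<Otimes>\<^sub>M lborel) (\<lambda>(s::real, y). indicator {0..1} s * (k (x + s *\<^sub>R v - y) * f y))"
proof (rule lborel_pair.Fubini_integrable)
  have km[measurable]: "k \<in> borel_measurable borel" by (rule sing_kernel_measurable[OF k])
  have fm[measurable]: "f \<in> borel_measurable borel" using f by (simp add: decaying_def)
  obtain A where A: "0 \<le> A" "\<And>x. integrable lborel (\<lambda>y. k (x - y) * f y)"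
    "\<And>x. (\<integral>y. \<bar>k (x - y) * f y\<bar> \<partial>lborel) \<le> A * (1 + norm x)" using conv_bound[OF k f] by blast
  show "(\<lambda>(s::real, y). indicator {0..1} s * (k (x + s *\<^sub>R v - y) * f y)) \<in> borel_measurable (lborel \<Otimes>\<^sub>M lborel)"
    by measurable
  let ?J = "\<lambda>s. \<integral>y. \<bar>k (x + s *\<^sub>R v - y) * f y\<bar> \<partial>lborel"
  have eq: "(\<integral>y. norm (case (s, y) of (s, y) \<Rightarrow> indicator {0..1} s * (k (x + s *\<^sub>R v - y) * f y)) \<partial>lborel) =
      indicator {0..1} s * ?J s" for s :: real
    by (simp add: abs_mult)
  have [measurable]: "?J \<in> borel_measurable (lborel :: real measure)"
    by (rule lborel.borel_measurable_lebesgue_integral) measurable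
  have "integrable (lborel :: real measure) (\<lambda>s. indicator {0..1} s * ?J s)"
  proof (rule Bochner_Integration.integrable_bound)
    show "integrable (lborel :: real measure) (\<lambda>s. indicator {0..1} s *\<^sub>R (A * (1 + norm x + norm v)))"
      by (rule borel_integrable_compact) auto
    show "AE s in lborel. norm (indicator {0..1} s * ?J s) \<le> norm (indicator {0..1} s *\<^sub>R (A * (1 + norm x + norm v)))"
    proof (rule AE_I2)
      fix s :: real
      have "?J s \<le> A * (1 + norm x + norm v)" if s: "s \<in> {0..1}"
      proof -
        have "norm (x + s *\<^sub>R v) \<le> norm x + s * norm v" using norm_triangle_ineq[of x "s *\<^sub>R v"] s by simp
        also have "s * norm v \<le> norm v" using s by (simp add: mult_left_le_one_le)
        finally have "A * (1 + norm (x + s *\<^sub>R v)) \<le> A * (1 + norm x + norm v)" using A(1) by (intro mult_left_mono) auto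
        with A(3)[of "x + s *\<^sub>R v"] show ?thesis by linarith
      qed
      moreover have "0 \<le> ?J s" by simp
      ultimately show "norm (indicator {0..1} s * ?J s) \<le> norm (indicator {0..1} s *\<^sub>R (A * (1 + norm x + norm v)))"
        by (auto simp: indicator_def)
    qed
  qed measurable
  then show "integrable lborel (\<lambda>s. \<integral>y. norm (case (s, y) of (s, y) \<Rightarrow> indicator {0..1} s * (k (x + s *\<^sub>R v - y) * f y)) \<partial>lborel)"
    unfolding eq .
  show "AE s in lborel. integrable lborel (\<lambda>y. case (s, y) of (s, y) \<Rightarrow> indicator {0..1} s * (k (x + s *\<^sub>R v - y) * f y))"
    using A(2)[of "x + s *\<^sub>R v" for s] by (intro AE_I2) simp
qed

text \<open>In dimension at least 2 a segment has empty interior, and convex sets with empty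
  interior are null. So for almost every y the segment from x to x + v avoids the singularity of the
  kernel centred at y.\<close>

lemma AE_not_on_segment:
  fixes x v :: "'a::euclidean_space"
  assumes "2 \<le> DIM('a)"
  shows "AE y in lborel. \<forall>s\<in>{0..1}. x + s *\<^sub>R v - y \<noteq> 0"
proof -
  have "negligible (closed_segment x (x + v))"
    using interior_closed_segment_ge2[OF assms, of x "x + v"]
    by (subst negligible_convex_interior) auto
  moreover have "closed_segment x (x + v) \<in> sets borel"
    by (intro borel_compact compact_segment)
  ultimately have "closed_segment x (x + v) \<in> null_sets lborel"
    by (simp add: negligible_iff_null_sets null_sets_completion_iff)
  then have "AE y in lborel. y \<notin> closed_segment x (x + v)" by (rule AE_not_in)
  then show ?thesis
  proof (rule eventually_mono, intro ballI notI)
    fix y and s :: real assume y: "y \<notin> closed_segment x (x + v)" and s: "s \<in> {0..1}" and 0: "x + s *\<^sub>R v - y = 0"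
    have "y = (1 - s) *\<^sub>R x + s *\<^sub>R (x + v)" using 0 by (simp add: algebra_simps)
    then have "y \<in> closed_segment x (x + v)" using s by (auto simp: closed_segment_def)
    with y show False by simp
  qed
qed

text \<open>For almost every y the kernel is differentiable along the whole segment from x to x + v.
  The fundamental theorem there, followed by Fubini's theorem, expresses the increment of the
  potential through segment averages of the potentials of the \<open>kd b\<close>. These potentials
  are continuous, so the averages are close to their values at x, which yields the
  derivative.\<close>

lemma conv_has_derivative:
  fixes k :: "'a::euclidean_space \<Rightarrow> real"
  assumes dim: "2 \<le> DIM('a)" and k: "sing_kernel k" and kd: "\<And>b. b \<in> Basis \<Longrightarrow> sing_kernel (kd b)"
    and f: "decaying f"
    and D: "\<And>z. z \<noteq> 0 \<Longrightarrow> (k has_derivative (\<lambda>v. \<Sum>b\<in>Basis. (v \<bullet> b) * kd b z)) (at z)"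
  shows "(conv k f has_derivative (\<lambda>v. \<Sum>b\<in>Basis. (v \<bullet> b) * conv (kd b) f x)) (at x)"
proof -
  let ?I = "\<lambda>s. indicator {0..1} (s::real) :: real"
  have fm[measurable]: "f \<in> borel_measurable borel" using f by (simp add: decaying_def)
  note kdc = conv_continuous[OF kd f]
  have ic: "integrable lborel (\<lambda>s. ?I s * conv (kd b) f (x + s *\<^sub>R v))" if "b \<in> Basis" for b v
  proof -
    have "continuous_on {0..1} (\<lambda>s. conv (kd b) f (x + s *\<^sub>R v))"
      by (rule continuous_on_compose2[OF kdc[OF that, of UNIV]]) (auto intro!: continuous_intros)
    from borel_integrable_compact[OF compact_Icc this] show ?thesis by simp
  qed
  have i1: "integrable lborel (\<lambda>s. ?I s * c)" for c :: real
    using borel_integrable_compact[of "{0..1::real}" "\<lambda>_. c"] by simp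
  have FTC: "(\<Sum>b\<in>Basis. (v \<bullet> b) * (\<integral>s. ?I s * conv (kd b) f (x + s *\<^sub>R v) \<partial>lborel)) =
     conv k f (x + v) - conv k f x" for v
  proof -
    let ?g = "\<lambda>b (s::real) y. ?I s * (kd b (x + s *\<^sub>R v - y) * f y)"
    have int: "integrable (lborel \<Otimes>\<^sub>M lborel) (case_prod (?g b))" if "b \<in> Basis" for b
      using conv_segment_Fubini[OF kd[OF that] f] .
    have ints: "AE y in lborel. \<forall>b\<in>Basis. integrable lborel (\<lambda>s. ?g b s y)"
      by (intro AE_finite_allI finite_Basis) (rule lborel_pair.AE_integrable_snd[OF int])
    have "conv k f (x + v) - conv k f x = (\<integral>y. (k (x + v - y) - k (x - y)) * f y \<partial>lborel)"
      unfolding conv_def left_diff_distrib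
      by (intro Bochner_Integration.integral_diff[symmetric] conv_integrable k f)
    also have "\<dots> = (\<integral>y. (\<Sum>b\<in>Basis. (v \<bullet> b) * (\<integral>s. ?g b s y \<partial>lborel)) \<partial>lborel)"
    proof (rule integral_cong_AE)
      show "(\<lambda>y. (k (x + v - y) - k (x - y)) * f y) \<in> borel_measurable lborel"
        using sing_kernel_measurable[OF k] by measurable
      show "(\<lambda>y. \<Sum>b\<in>Basis. (v \<bullet> b) * (\<integral>s. ?g b s y \<partial>lborel)) \<in> borel_measurable lborel"
        using lborel_pair.integrable_snd[OF int] by (intro borel_measurable_sum borel_measurable_times) auto
      show "AE y in lborel. (k (x + v - y) - k (x - y)) * f y = (\<Sum>b\<in>Basis. (v \<bullet> b) * (\<integral>s. ?g b s y \<partial>lborel))"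
        using AE_not_on_segment[OF dim, of x v] ints
      proof eventually_elim
        fix y assume y: "\<forall>s\<in>{0..1}. x + s *\<^sub>R v - y \<noteq> 0" and iy: "\<forall>b\<in>Basis. integrable lborel (\<lambda>s. ?g b s y)"
        have kc: "continuous_on {0..1} (\<lambda>s. kd b (x - y + s *\<^sub>R v))" if "b \<in> Basis" for b
          by (rule continuous_on_compose2[of "- {0}" "kd b"])
            (use kd[OF that] y in \<open>auto intro!: continuous_intros simp: sing_kernel_def algebra_simps\<close>)
        have "k (x + v - y) - k (x - y) = k (x - y + v) - k (x - y)" by (simp add: algebra_simps)
        also have "\<dots> = (\<integral>s. ?I s * (\<Sum>b\<in>Basis. (v \<bullet> b) * kd b (x - y + s *\<^sub>R v)) \<partial>lborel)"
        proof (rule integral_along_segment[of k "\<lambda>p v. \<Sum>b\<in>Basis. (v \<bullet> b) * kd b p" "x - y" v, symmetric])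
          show "(k has_derivative (\<lambda>w. \<Sum>b\<in>Basis. (w \<bullet> b) * kd b (x - y + s *\<^sub>R v))) (at (x - y + s *\<^sub>R v))"
            if "s \<in> {0..1}" for s
            using that y by (intro D) (auto simp: algebra_simps)
        qed (intro continuous_intros kc)
        finally have "(k (x + v - y) - k (x - y)) * f y = (\<integral>s. ?I s * (\<Sum>b\<in>Basis. (v \<bullet> b) * kd b (x - y + s *\<^sub>R v)) * f y \<partial>lborel)"
          by simp
        also have "\<dots> = (\<integral>s. (\<Sum>b\<in>Basis. (v \<bullet> b) * ?g b s y) \<partial>lborel)"
        proof (rule Bochner_Integration.integral_cong[OF refl])
          fix s :: real
          have e: "x - y + s *\<^sub>R v = x + s *\<^sub>R v - y" by simp
          show "?I s * (\<Sum>b\<in>Basis. (v \<bullet> b) * kd b (x - y + s *\<^sub>R v)) * f y = (\<Sum>b\<in>Basis. (v \<bullet> b) * ?g b s y)"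
            unfolding e sum_distrib_left sum_distrib_right by (intro sum.cong refl) (simp add: mult_ac)
        qed
        also have "\<dots> = (\<Sum>b\<in>Basis. (v \<bullet> b) * (\<integral>s. ?g b s y \<partial>lborel))"
          using iy by (subst Bochner_Integration.integral_sum) auto
        finally show "(k (x + v - y) - k (x - y)) * f y = (\<Sum>b\<in>Basis. (v \<bullet> b) * (\<integral>s. ?g b s y \<partial>lborel))" .
      qed
    qed
    also have "\<dots> = (\<Sum>b\<in>Basis. (v \<bullet> b) * (\<integral>y. \<integral>s. ?g b s y \<partial>lborel \<partial>lborel))"
      using lborel_pair.integrable_snd[OF int] by (subst Bochner_Integration.integral_sum) auto
    also have "\<dots> = (\<Sum>b\<in>Basis. (v \<bullet> b) * (\<integral>s. \<integral>y. ?g b s y \<partial>lborel \<partial>lborel))"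
      by (intro sum.cong refl arg_cong2[where f = "(*)"] lborel_pair.Fubini_integral[OF int])
    finally show ?thesis by (simp add: conv_def)
  qed
  show ?thesis
    unfolding has_derivative_at_alt
  proof (intro conjI allI impI)
    show "bounded_linear (\<lambda>v. \<Sum>b\<in>Basis. v \<bullet> b * conv (kd b) f x)"
      by (intro bounded_linear_sum bounded_linear_mult_left bounded_linear_compose[OF bounded_linear_mult_left bounded_linear_inner_left])
    fix e :: real assume e: "0 < e"
    \<comment> \<open>The error is distributed over the \<open>DIM('a)\<close> coordinates, each of
      which contributes at most e' |v|.\<close>
    define e' where "e' = e / DIM('a)"
    have e': "e' > 0" using e by (simp add: e'_def)
    have "\<exists>d>0. \<forall>y. norm (y - x) < d \<longrightarrow> \<bar>conv (kd b) f y - conv (kd b) f x\<bar> < e'" if "b \<in> Basis" for b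
    proof -
      have "continuous_on UNIV (conv (kd b) f)" by (rule kdc[OF that])
      then have "isCont (conv (kd b) f) x" by (simp add: continuous_on_eq_continuous_at)
      then show ?thesis using e' by (simp add: continuous_at_eps_delta dist_norm)
    qed
    then obtain d where d: "\<And>b. b \<in> Basis \<Longrightarrow> d b > 0"
      "\<And>b y. b \<in> Basis \<Longrightarrow> norm (y - x) < d b \<Longrightarrow> \<bar>conv (kd b) f y - conv (kd b) f x\<bar> < e'" by metis
    define d0 where "d0 = Min (d ` Basis)"
    have d0: "d0 > 0" "\<And>b. b \<in> Basis \<Longrightarrow> d0 \<le> d b" unfolding d0_def using d(1) by auto
    show "\<exists>d>0. \<forall>y. norm (y - x) < d \<longrightarrow>
        norm (conv k f y - conv k f x - (\<Sum>b\<in>Basis. (y - x) \<bullet> b * conv (kd b) f x)) \<le> e * norm (y - x)"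
    proof (intro exI[of _ d0] conjI allI impI d0(1))
      fix y assume y: "norm (y - x) < d0"
      define v where "v = y - x"
      have J: "\<bar>(\<integral>s. ?I s * conv (kd b) f (x + s *\<^sub>R v) \<partial>lborel) - conv (kd b) f x\<bar> \<le> e'" if b: "b \<in> Basis" for b
      proof -
        have "(\<integral>s. ?I s * conv (kd b) f (x + s *\<^sub>R v) \<partial>lborel) - conv (kd b) f x =
            (\<integral>s. ?I s * conv (kd b) f (x + s *\<^sub>R v) \<partial>lborel) - (\<integral>s. ?I s * conv (kd b) f x \<partial>lborel)" by simp
        also have "\<dots> = (\<integral>s. ?I s * conv (kd b) f (x + s *\<^sub>R v) - ?I s * conv (kd b) f x \<partial>lborel)"
          by (intro Bochner_Integration.integral_diff[symmetric] ic[OF b] i1)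
        finally have eq: "(\<integral>s. ?I s * conv (kd b) f (x + s *\<^sub>R v) \<partial>lborel) - conv (kd b) f x =
          (\<integral>s. ?I s * conv (kd b) f (x + s *\<^sub>R v) - ?I s * conv (kd b) f x \<partial>lborel)" .
        have "norm (\<integral>s. ?I s * conv (kd b) f (x + s *\<^sub>R v) - ?I s * conv (kd b) f x \<partial>lborel)
            \<le> (\<integral>s. norm (?I s * conv (kd b) f (x + s *\<^sub>R v) - ?I s * conv (kd b) f x) \<partial>lborel)"
          by (rule integral_norm_bound)
        also have "\<dots> \<le> (\<integral>s. ?I s * e' \<partial>lborel)"
        proof (rule integral_mono)
          show "integrable lborel (\<lambda>s. norm (?I s * conv (kd b) f (x + s *\<^sub>R v) - ?I s * conv (kd b) f x))"
            by (intro integrable_norm Bochner_Integration.integrable_diff ic[OF b] i1)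
          show "integrable lborel (\<lambda>s. ?I s * e')" by (rule i1)
          fix s :: real
          show "norm (?I s * conv (kd b) f (x + s *\<^sub>R v) - ?I s * conv (kd b) f x) \<le> ?I s * e'"
          proof (cases "s \<in> {0..1}")
            case True
            have "norm (x + s *\<^sub>R v - x) \<le> norm v" using True by (simp add: mult_left_le_one_le)
            also have "\<dots> < d b" using y d0(2)[OF b] by (simp add: v_def)
            finally show ?thesis using d(2)[OF b] True by (simp add: less_imp_le)
          qed simp
        qed
        finally show ?thesis unfolding eq by simp
      qed
      let ?J = "\<lambda>b. (\<integral>s. ?I s * conv (kd b) f (x + s *\<^sub>R v) \<partial>lborel) - conv (kd b) f x"
      have eq: "conv k f y - conv k f x - (\<Sum>b\<in>Basis. (y - x) \<bullet> b * conv (kd b) f x) =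
         (\<Sum>b\<in>Basis. (v \<bullet> b) * ?J b)"
        using FTC[of v] by (simp add: v_def right_diff_distrib sum_subtractf)
      have "\<bar>\<Sum>b\<in>Basis. (v \<bullet> b) * ?J b\<bar> \<le> (\<Sum>b\<in>Basis. \<bar>(v \<bullet> b) * ?J b\<bar>)" by (rule sum_abs)
      also have "\<dots> \<le> (\<Sum>b\<in>(Basis :: 'a set). norm v * e')"
      proof (rule sum_mono)
        fix b :: 'a assume b: "b \<in> Basis"
        show "\<bar>(v \<bullet> b) * ?J b\<bar> \<le> norm v * e'"
          unfolding abs_mult using J[OF b] Basis_le_norm[OF b, of v] e' by (intro mult_mono) auto
      qed
      also have "\<dots> = e * norm (y - x)" by (simp add: e'_def v_def)
      finally show "norm (conv k f y - conv k f x - (\<Sum>b\<in>Basis. (y - x) \<bullet> b * conv (kd b) f x)) \<le> e * norm (y - x)"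
        unfolding eq by simp
    qed
  qed
qed

text \<open>\<open>homog p\<close> contains functions on \<open>- {0}\<close> that are homogeneous of degree \<open>- p\<close>;
  it is closed under partial derivatives, which raise \<open>p\<close> by one.\<close>

inductive homog :: "int \<Rightarrow> ('a::euclidean_space \<Rightarrow> real) \<Rightarrow> bool" where
  zero: "homog p (\<lambda>_. 0)"
| const: "homog 0 (\<lambda>_. c)"
| coord: "homog (-1) (\<lambda>z. z \<bullet> b)"
| inv: "homog 2 (\<lambda>z. inverse (z \<bullet> z))"
| add: "homog p k \<Longrightarrow> homog p l \<Longrightarrow> homog p (\<lambda>z. k z + l z)"
| mult: "homog p k \<Longrightarrow> homog q l \<Longrightarrow> homog (p + q) (\<lambda>z. k z * l z)"

lemma homog_bound:
  assumes "homog p k"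
  shows "\<exists>C\<ge>0. \<forall>z. z \<noteq> 0 \<longrightarrow> \<bar>k z\<bar> \<le> C * norm z powr (- real_of_int p)"
  using assms
proof induction
  case (zero p)
  show ?case by (intro exI[of _ 0]) auto
next
  case (const c)
  show ?case by (intro exI[of _ "\<bar>c\<bar>"]) auto
next
  case (coord b)
  show ?case using Cauchy_Schwarz_ineq2[of _ b] by (intro exI[of _ "norm b"]) (auto simp: mult.commute)
next
  case inv
  have "inverse (z \<bullet> z) = norm z powr (-2)" if "z \<noteq> 0" for z :: 'a
    using that by (simp add: powr_minus power2_norm_eq_inner)
  then show ?case by (intro exI[of _ 1]) auto
next
  case (add p k l)
  then obtain C D where C: "0 \<le> C" "\<And>z. z \<noteq> 0 \<Longrightarrow> \<bar>k z\<bar> \<le> C * norm z powr (- real_of_int p)"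
    and D: "0 \<le> D" "\<And>z. z \<noteq> 0 \<Longrightarrow> \<bar>l z\<bar> \<le> D * norm z powr (- real_of_int p)" by blast
  have "\<bar>k z + l z\<bar> \<le> (C + D) * norm z powr (- real_of_int p)" if "z \<noteq> 0" for z
    using C(2)[OF that] D(2)[OF that] unfolding distrib_right by linarith
  with C D show ?case by (intro exI[of _ "C + D"]) auto
next
  case (mult p k q l)
  then obtain C D where C: "0 \<le> C" "\<And>z. z \<noteq> 0 \<Longrightarrow> \<bar>k z\<bar> \<le> C * norm z powr (- real_of_int p)"
    and D: "0 \<le> D" "\<And>z. z \<noteq> 0 \<Longrightarrow> \<bar>l z\<bar> \<le> D * norm z powr (- real_of_int q)" by blast
  have "\<bar>k z * l z\<bar> \<le> (C * D) * norm z powr (- real_of_int (p + q))" if "z \<noteq> 0" for z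
  proof -
    have "\<bar>k z * l z\<bar> \<le> (C * norm z powr (- real_of_int p)) * (D * norm z powr (- real_of_int q))"
      unfolding abs_mult using C D that by (intro mult_mono) auto
    also have "\<dots> = (C * D) * norm z powr (- real_of_int (p + q))"
      by (simp add: powr_add[symmetric] mult_ac)
    finally show ?thesis .
  qed
  with C D show ?case by (intro exI[of _ "C * D"]) auto
qed

lemma homog_derivative:
  assumes "homog p k"
  shows "\<exists>kd. (\<forall>b\<in>Basis. homog (p + 1) (kd b)) \<and>
    (\<forall>z. z \<noteq> 0 \<longrightarrow> (k has_derivative (\<lambda>v. \<Sum>b\<in>Basis. (v \<bullet> b) * kd b z)) (at z))"
  using assms
proof induction
  case (zero p)
  show ?case by (intro exI[of _ "\<lambda>_ _. 0"]) (auto intro: homog.zero)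
next
  case (const c)
  show ?case by (intro exI[of _ "\<lambda>_ _. 0"]) (auto intro: homog.zero)
next
  case (coord c)
  have "((\<lambda>z. z \<bullet> c) has_derivative (\<lambda>v. \<Sum>b\<in>Basis. (v \<bullet> b) * (c \<bullet> b))) (at z)" for z
    unfolding euclidean_inner[symmetric] by (auto intro!: derivative_eq_intros)
  then show ?case using homog.const by (intro exI[of _ "\<lambda>b _. c \<bullet> b"]) auto
next
  case inv
  have "((\<lambda>z::'a. inverse (z \<bullet> z)) has_derivative
      (\<lambda>v. \<Sum>b\<in>Basis. (v \<bullet> b) * (- 2 * ((z \<bullet> b) * (inverse (z \<bullet> z) * inverse (z \<bullet> z)))))) (at z)" if "z \<noteq> 0" for z :: 'a
  proof -
    have "((\<lambda>z::'a. inverse (z \<bullet> z)) has_derivative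
      (\<lambda>v. - (inverse (z \<bullet> z) * (z \<bullet> v + v \<bullet> z) * inverse (z \<bullet> z)))) (at z)"
      using that by (auto intro!: derivative_eq_intros)
    also have "(\<lambda>v. - (inverse (z \<bullet> z) * (z \<bullet> v + v \<bullet> z) * inverse (z \<bullet> z))) =
        (\<lambda>v. \<Sum>b\<in>Basis. (v \<bullet> b) * (- 2 * ((z \<bullet> b) * (inverse (z \<bullet> z) * inverse (z \<bullet> z)))))" (is "?L = ?R")
    proof
      fix v
      have "?R v = (\<Sum>b\<in>Basis. (- 2 * (inverse (z \<bullet> z) * inverse (z \<bullet> z))) * ((v \<bullet> b) * (z \<bullet> b)))"
        by (intro sum.cong refl) (simp only: mult_ac)
      also have "\<dots> = (- 2 * (inverse (z \<bullet> z) * inverse (z \<bullet> z))) * (v \<bullet> z)"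
        unfolding euclidean_inner[of v z] by (simp only: sum_distrib_left)
      finally show "?L v = ?R v" by (simp add: inner_commute algebra_simps)
    qed
    finally show ?thesis .
  qed
  moreover have "homog (2 + 1) (\<lambda>z::'a. - 2 * ((z \<bullet> b) * (inverse (z \<bullet> z) * inverse (z \<bullet> z))))" for b :: 'a
    using homog.mult[OF homog.const[of "-2"] homog.mult[OF homog.coord[of b] homog.mult[OF homog.inv homog.inv]]] by simp
  ultimately show ?case
    by (intro exI[of _ "\<lambda>b z. - 2 * ((z \<bullet> b) * (inverse (z \<bullet> z) * inverse (z \<bullet> z)))"]) auto
next
  case (add p k l)
  then obtain kd ld where kd: "\<forall>b\<in>Basis. homog (p + 1) (kd b)"
    "\<And>z. z \<noteq> 0 \<Longrightarrow> (k has_derivative (\<lambda>v. \<Sum>b\<in>Basis. (v \<bullet> b) * kd b z)) (at z)"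
    and ld: "\<forall>b\<in>Basis. homog (p + 1) (ld b)"
    "\<And>z. z \<noteq> 0 \<Longrightarrow> (l has_derivative (\<lambda>v. \<Sum>b\<in>Basis. (v \<bullet> b) * ld b z)) (at z)" by blast
  have "((\<lambda>z. k z + l z) has_derivative (\<lambda>v. \<Sum>b\<in>Basis. (v \<bullet> b) * (kd b z + ld b z))) (at z)" if "z \<noteq> 0" for z
    using has_derivative_add[OF kd(2)[OF that] ld(2)[OF that]] by (simp add: sum.distrib distrib_left)
  then show ?case using kd(1) ld(1) homog.add by (intro exI[of _ "\<lambda>b z. kd b z + ld b z"]) blast
next
  case (mult p k q l)
  then obtain kd ld where kd: "\<forall>b\<in>Basis. homog (p + 1) (kd b)"
    "\<And>z. z \<noteq> 0 \<Longrightarrow> (k has_derivative (\<lambda>v. \<Sum>b\<in>Basis. (v \<bullet> b) * kd b z)) (at z)"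
    and ld: "\<forall>b\<in>Basis. homog (q + 1) (ld b)"
    "\<And>z. z \<noteq> 0 \<Longrightarrow> (l has_derivative (\<lambda>v. \<Sum>b\<in>Basis. (v \<bullet> b) * ld b z)) (at z)" by blast
  have "((\<lambda>z. k z * l z) has_derivative (\<lambda>v. \<Sum>b\<in>Basis. (v \<bullet> b) * (k z * ld b z + kd b z * l z))) (at z)" if "z \<noteq> 0" for z
  proof -
    have "(\<lambda>v. k z * (\<Sum>b\<in>Basis. (v \<bullet> b) * ld b z) + (\<Sum>b\<in>Basis. (v \<bullet> b) * kd b z) * l z) =
       (\<lambda>v. \<Sum>b\<in>Basis. (v \<bullet> b) * (k z * ld b z + kd b z * l z))"
      unfolding sum_distrib_left sum_distrib_right sum.distrib[symmetric]
      by (intro ext sum.cong refl) (simp add: algebra_simps)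
    with has_derivative_mult[OF kd(2)[OF that] ld(2)[OF that]] show ?thesis by simp
  qed
  moreover have "homog (p + q + 1) (\<lambda>z. k z * ld b z + kd b z * l z)" if "b \<in> Basis" for b
  proof (rule homog.add)
    show "homog (p + q + 1) (\<lambda>z. k z * ld b z)"
      using homog.mult[OF mult.hyps(1) bspec[OF ld(1) that]] by (simp add: add_ac)
    show "homog (p + q + 1) (\<lambda>z. kd b z * l z)"
      using homog.mult[OF bspec[OF kd(1) that] mult.hyps(2)] by (simp add: add_ac)
  qed
  ultimately show ?case by (intro exI[of _ "\<lambda>b z. k z * ld b z + kd b z * l z"]) blast
qed

lemma integrable_singularity:
  fixes s :: real
  assumes "0 \<le> s" "s < DIM('a::euclidean_space)"
  shows "integrable lborel (\<lambda>z::'a. indicator (ball 0 1) z * norm z powr (-s))"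
proof (rule integrableI_bounded)
  have "(\<integral>\<^sup>+z. ennreal (norm (indicator (ball 0 1) z * norm (z::'a) powr (-s))) \<partial>lborel) =
     (\<integral>\<^sup>+z. indicator (ball 0 1) z * ennreal (norm (z::'a) powr (-s)) \<partial>lborel)"
    by (intro nn_integral_cong) (auto simp: indicator_def)
  also have "\<dots> < \<infinity>" by (rule nn_integral_singularity_finite[OF assms])
  finally show "(\<integral>\<^sup>+z. ennreal (norm (indicator (ball (0::'a) 1) z * norm z powr (-s))) \<partial>lborel) < \<infinity>" .
  show "(\<lambda>z::'a. indicator (ball 0 1) z * norm z powr (-s)) \<in> borel_measurable lborel"
    unfolding measurable_lborel1 by (intro borel_measurable_times borel_measurable_indicator) auto
qed

lemma sing_kernelI:
  fixes k :: "'a::euclidean_space \<Rightarrow> real" and s :: real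
  assumes c: "continuous_on (- {0}) k" and s: "0 \<le> s" "s < DIM('a)" and C: "0 \<le> C"
    and near: "\<And>z. z \<noteq> 0 \<Longrightarrow> norm z < 1 \<Longrightarrow> \<bar>k z\<bar> \<le> C * norm z powr (-s)"
    and far: "\<And>z. 1 \<le> norm z \<Longrightarrow> \<bar>k z\<bar> \<le> C * norm z"
  shows "sing_kernel k"
  unfolding sing_kernel_def
proof (intro conjI)
  have "(\<lambda>z. indicator (- {0}) z *\<^sub>R k z) \<in> borel_measurable borel"
    using c by (intro borel_measurable_continuous_on_indicator) auto
  then have "(\<lambda>z. indicator (- {0}) z *\<^sub>R k z + indicator {0} z * k 0) \<in> borel_measurable borel"
    by (intro borel_measurable_add borel_measurable_times borel_measurable_indicator) auto
  also have "(\<lambda>z. indicator (- {0}) z *\<^sub>R k z + indicator {0} z * k 0) = k"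
    by (auto simp: indicator_def fun_eq_iff)
  finally have [measurable]: "k \<in> borel_measurable borel" .
  show "set_integrable lborel (ball 0 1) k"
    unfolding set_integrable_def
  proof (rule Bochner_Integration.integrable_bound)
    show "integrable lborel (\<lambda>z::'a. C * (indicator (ball 0 1) z * norm z powr (-s)))"
      by (intro integrable_mult_right integrable_singularity s)
    have "AE z in lborel. z \<noteq> (0::'a)" by (rule AE_lborel_singleton)
    then show "AE z in lborel. norm (indicator (ball 0 1) z *\<^sub>R k z) \<le> norm (C * (indicator (ball 0 1) z * norm z powr (-s)))"
      by (rule eventually_mono) (use near C in \<open>auto simp: indicator_def abs_mult\<close>)
    show "(\<lambda>z. indicator (ball 0 1) z *\<^sub>R k z) \<in> borel_measurable lborel"
      unfolding measurable_lborel1 by (intro borel_measurable_scaleR borel_measurable_indicator) auto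
  qed
qed (use c far in auto)

text \<open>Homogeneity of degree -p gives integrability at the origin when p is below the
  dimension, and at most linear growth at infinity when p \<ge> -1.\<close>

lemma homog_sing_kernel:
  fixes k :: "'a::euclidean_space \<Rightarrow> real"
  assumes k: "homog p k" and p: "-1 \<le> p" "p < int DIM('a)"
  shows "sing_kernel k"
proof -
  obtain kd where kd: "\<And>z. z \<noteq> 0 \<Longrightarrow> (k has_derivative (\<lambda>v. \<Sum>b\<in>Basis. (v \<bullet> b) * kd b z)) (at z)"
    using homog_derivative[OF k] by blast
  obtain C where C: "0 \<le> C" "\<And>z. z \<noteq> 0 \<Longrightarrow> \<bar>k z\<bar> \<le> C * norm z powr (- real_of_int p)"
    using homog_bound[OF k] by blast
  show ?thesis
  \<comment> \<open>For negative p the kernel is bounded near the origin, so the exponent used there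
    is max(0, p).\<close>
  proof (rule sing_kernelI[of _ "max 0 (real_of_int p)" C])
    show "continuous_on (- {0}) k"
      by (intro continuous_at_imp_continuous_on ballI has_derivative_continuous[OF kd]) auto
    show "max 0 (real_of_int p) < real DIM('a)" using p by auto
    show "\<bar>k z\<bar> \<le> C * norm z powr (- max 0 (real_of_int p))" if "z \<noteq> 0" "norm z < 1" for z
    proof -
      have "norm z powr (- real_of_int p) \<le> norm z powr (- max 0 (real_of_int p))"
        using that by (intro powr_mono') auto
      from mult_left_mono[OF this C(1)] C(2)[OF that(1)] show ?thesis by linarith
    qed
    show "\<bar>k z\<bar> \<le> C * norm z" if "1 \<le> norm z" for z
    proof -
      have "norm z powr (- real_of_int p) \<le> norm z powr 1" using that p by (intro powr_mono) auto
      also have "\<dots> = norm z" by simp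
      finally have "C * norm z powr (- real_of_int p) \<le> C * norm z" using C(1) by (intro mult_left_mono)
      moreover have "z \<noteq> 0" using that by auto
      ultimately show ?thesis using C(2) by fastforce
    qed
  qed (use C in auto)
qed

text \<open>Each derivative falls on the kernel and raises p by one. The kernels remain locally
  integrable as long as p stays below the dimension, which limits the number of derivatives.\<close>

lemma Ck_on_conv_homog:
  fixes k :: "'a::euclidean_space \<Rightarrow> real"
  assumes dim: "2 \<le> DIM('a)" and f: "decaying f"
  shows "homog p k \<Longrightarrow> -1 \<le> p \<Longrightarrow> p + int n < int DIM('a) \<Longrightarrow> Ck_on n UNIV (conv k f)"
proof (induction n arbitrary: p k)
  case 0
  then show ?case using conv_continuous[OF homog_sing_kernel f] by simp
next
  case (Suc n)
  obtain kd where kd: "\<And>b. b \<in> Basis \<Longrightarrow> homog (p + 1) (kd b)"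
    "\<And>z. z \<noteq> 0 \<Longrightarrow> (k has_derivative (\<lambda>v. \<Sum>b\<in>Basis. (v \<bullet> b) * kd b z)) (at z)"
    using homog_derivative[OF Suc.prems(1)] by blast
  have D: "(conv k f has_derivative (\<lambda>v. \<Sum>b\<in>Basis. (v \<bullet> b) * conv (kd b) f x)) (at x)" for x
    using Suc.prems by (intro conv_has_derivative[OF dim _ _ f kd(2)] homog_sing_kernel[OF Suc.prems(1)]
      homog_sing_kernel[OF kd(1)]) auto
  have "dir_deriv b (conv k f) = conv (kd b) f" if "b \<in> Basis" for b
  proof
    fix x
    have "dir_deriv b (conv k f) x = (\<Sum>c\<in>Basis. (b \<bullet> c) * conv (kd c) f x)" by (rule dir_deriv_eq[OF D])
    also have "\<dots> = (\<Sum>c\<in>Basis. if c = b then conv (kd c) f x else 0)"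
      using that by (intro sum.cong refl) (auto simp: inner_Basis)
    finally show "dir_deriv b (conv k f) x = conv (kd b) f x" using that by simp
  qed
  moreover have "Ck_on n UNIV (conv (kd b) f)" if "b \<in> Basis" for b
    by (rule Suc.IH[OF kd(1)[OF that]]) (use Suc.prems in auto)
  ultimately show ?case using D by (auto simp: differentiable_def)
qed

section \<open>The logarithmic kernel and the regularity of its potentials\<close>

definition log_kernel :: "'a::euclidean_space \<Rightarrow> real" where
  "log_kernel z = - ln (norm z)"

lemma log_kernel_derivative:
  assumes "z \<noteq> 0"
  shows "(log_kernel has_derivative (\<lambda>v. \<Sum>b\<in>Basis. (v \<bullet> b) * (- 1 * ((z \<bullet> b) * inverse (z \<bullet> z))))) (at z)"
proof -
  have "((\<lambda>z. - ln (norm z)) has_derivative (\<lambda>v. - (inverse (norm z) * (v \<bullet> sgn z)))) (at z)"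
    using has_derivative_minus[OF DERIV_compose_FDERIV[OF DERIV_ln has_derivative_norm]] assms
    by (simp add: mult.commute)
  also have "(\<lambda>v. - (inverse (norm z) * (v \<bullet> sgn z))) =
      (\<lambda>v. \<Sum>b\<in>Basis. (v \<bullet> b) * (- 1 * ((z \<bullet> b) * inverse (z \<bullet> z))))" (is "?L = ?R")
  proof
    fix v
    have "?R v = (\<Sum>b\<in>Basis. - inverse (z \<bullet> z) * ((v \<bullet> b) * (z \<bullet> b)))"
      by (intro sum.cong refl) (simp add: mult_ac)
    also have "\<dots> = - inverse (z \<bullet> z) * (v \<bullet> z)" unfolding euclidean_inner[of v z] by (simp only: sum_distrib_left)
    also have "\<dots> = ?L v" by (simp add: sgn_div_norm power2_norm_eq_inner[symmetric] power2_eq_square)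
    finally show "?L v = ?R v" ..
  qed
  finally show ?thesis by (simp add: log_kernel_def[abs_def])
qed

text \<open>The inequality ln t \<le> t - 1 serves twice: with t = 1/|z| near the origin, where it
  bounds the singularity by |z|^(-1), integrable in dimension at least 2, and with t = |z| far
  away.\<close>

lemma sing_kernel_log:
  assumes "2 \<le> DIM('a::euclidean_space)"
  shows "sing_kernel (log_kernel :: 'a \<Rightarrow> real)"
proof (rule sing_kernelI[of _ 1 1])
  show "continuous_on (- {0}) (log_kernel :: 'a \<Rightarrow> real)"
    unfolding log_kernel_def by (intro continuous_intros) auto
  show "\<bar>log_kernel z\<bar> \<le> 1 * norm z powr - 1" if "z \<noteq> 0" "norm z < 1" for z :: 'a
  proof -
    have "ln (1 / norm z) \<le> 1 / norm z - 1" using that by (intro ln_le_minus_one) simp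
    moreover have "ln (norm z) \<le> 0" using that by simp
    moreover have "ln (1 / norm z) = - ln (norm z)" using that by (simp add: ln_div)
    moreover have "norm z powr - 1 = 1 / norm z" using that by (simp add: powr_minus divide_inverse)
    ultimately show ?thesis by (simp add: log_kernel_def)
  qed
  show "\<bar>log_kernel z\<bar> \<le> 1 * norm z" if "1 \<le> norm z" for z :: 'a
  proof -
    have "ln (norm z) \<le> norm z - 1" using that by (intro ln_le_minus_one) linarith
    moreover have "z \<noteq> 0" using that by auto
    moreover have "0 \<le> ln (norm z)" using that by simp
    ultimately show ?thesis by (simp add: log_kernel_def)
  qed
qed (use assms in auto)

text \<open>The logarithm is not homogeneous, but its first derivatives have degree -1 and enter the
  homogeneous case at p = 1, which leaves room for \<open>DIM('a) - 2\<close> further derivatives.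
  In dimension 2m the total is 2m - 1, the regularity required of solutions.\<close>

lemma Ck_on_conv_log:
  fixes f :: "'a::euclidean_space \<Rightarrow> real"
  assumes dim: "2 \<le> DIM('a)" and f: "decaying f"
  shows "Ck_on (DIM('a) - 1) UNIV (conv log_kernel f)"
proof -
  define kd where "kd b z = - 1 * ((z \<bullet> b) * inverse (z \<bullet> z))" for b z :: 'a
  have h: "homog 1 (kd b)" for b
    using homog.mult[OF homog.const[of "-1"] homog.mult[OF homog.coord[of b] homog.inv]]
    unfolding kd_def[abs_def] by simp
  obtain n where n: "DIM('a) - 1 = Suc n" "1 + int n < int DIM('a)" using dim by (intro that[of "DIM('a) - 2"]) auto
  have D0: "(log_kernel has_derivative (\<lambda>v. \<Sum>b\<in>Basis. (v \<bullet> b) * kd b z)) (at z)" if "z \<noteq> 0" for z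
    unfolding kd_def by (rule log_kernel_derivative[OF that])
  have D: "(conv log_kernel f has_derivative (\<lambda>v. \<Sum>b\<in>Basis. (v \<bullet> b) * conv (kd b) f x)) (at x)" for x
    by (rule conv_has_derivative[OF dim sing_kernel_log[OF dim] homog_sing_kernel[OF h] f D0]) (use dim in auto)
  have "dir_deriv b (conv log_kernel f) = conv (kd b) f" if "b \<in> Basis" for b
  proof
    fix x
    have "dir_deriv b (conv log_kernel f) x = (\<Sum>c\<in>Basis. (b \<bullet> c) * conv (kd c) f x)" by (rule dir_deriv_eq[OF D])
    also have "\<dots> = (\<Sum>c\<in>Basis. if c = b then conv (kd c) f x else 0)"
      using that by (intro sum.cong refl) (auto simp: inner_Basis)
    finally show "dir_deriv b (conv log_kernel f) x = conv (kd b) f x" using that by simp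
  qed
  moreover have "Ck_on n UNIV (conv (kd b) f)" for b
    by (rule Ck_on_conv_homog[OF dim f h]) (use n in auto)
  ultimately show ?thesis unfolding n(1) using D by (auto simp: differentiable_def)
qed

section \<open>The fundamental solution of \<open>(-\<Delta>)\<^sup>m\<close>\<close>

context
  fixes y :: "'a::euclidean_space" and \<epsilon> :: real
  assumes \<epsilon>: "\<epsilon> > 0"
begin

text \<open>The squared distance regularised by \<epsilon>^2: -ln(rad)/2 is smooth, tends to the
  logarithmic kernel, and its iterated Laplacians are polynomials in 1/rad. With y = 0 and
  \<epsilon> = 1 the same function later represents the quadratic term of the solutions, up to a
  constant.\<close>

definition rad :: "'a \<Rightarrow> real" where
  "rad z = (z - y) \<bullet> (z - y) + \<epsilon>\<^sup>2"

lemma rad_pos: "rad z > 0"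
  using \<epsilon> by (simp add: rad_def add_nonneg_pos)

lemma dir_deriv_linear_diff:
  "(\<lambda>z. (z - y) \<bullet> b) differentiable (at z)"
  "b \<in> Basis \<Longrightarrow> dir_deriv b (\<lambda>z. (z - y) \<bullet> b) z = 1"
proof -
  have d: "((\<lambda>z. (z - y) \<bullet> b) has_derivative (\<lambda>v. v \<bullet> b)) (at z)"
    by (auto intro!: derivative_eq_intros)
  then show "(\<lambda>z. (z - y) \<bullet> b) differentiable (at z)" by (auto simp: differentiable_def)
  show "b \<in> Basis \<Longrightarrow> dir_deriv b (\<lambda>z. (z - y) \<bullet> b) z = 1"
    using dir_deriv_eq[OF d, of b] by simp
qed

lemma rad_deriv: "rad differentiable (at z)" "dir_deriv b rad z = 2 * ((z - y) \<bullet> b)"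
proof -
  have d: "(rad has_derivative (\<lambda>v. 2 * ((z - y) \<bullet> v))) (at z)"
    unfolding rad_def[abs_def] by (auto intro!: derivative_eq_intros simp: inner_commute)
  then show "rad differentiable (at z)" by (auto simp: differentiable_def)
  show "dir_deriv b rad z = 2 * ((z - y) \<bullet> b)" by (rule dir_deriv_eq[OF d])
qed

lemma smooth_rad: "smooth_on UNIV rad"
proof -
  have s: "smooth_on UNIV (\<lambda>z. z \<bullet> b + - (y \<bullet> b))" for b
    by (intro smooth_on_add smooth_on_linear smooth_on_const bounded_linear_inner_left open_UNIV)
  have "rad z = (\<Sum>b\<in>Basis. (z \<bullet> b + - (y \<bullet> b)) * (z \<bullet> b + - (y \<bullet> b))) + \<epsilon>\<^sup>2" for z
    unfolding rad_def euclidean_inner[of "z - y" "z - y"] by (simp add: inner_diff_left)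
  then have "rad = (\<lambda>z. (\<Sum>b\<in>Basis. (z \<bullet> b + - (y \<bullet> b)) * (z \<bullet> b + - (y \<bullet> b))) + \<epsilon>\<^sup>2)" by blast
  then show ?thesis by (simp only:) (intro smooth_on_add smooth_on_sum smooth_on_mult s smooth_on_const open_UNIV)
qed

lemma smooth_inverse_rad_power: "smooth_on UNIV (\<lambda>z. inverse (rad z) ^ s)"
  by (intro smooth_on_power smooth_on_inverse open_UNIV smooth_rad) (use rad_pos in \<open>simp add: less_imp_neq[symmetric]\<close>)

lemma smooth_ln_rad: "smooth_on UNIV (\<lambda>z. (-1/2) * ln (rad z))"
  by (intro smooth_on_cmult smooth_on_ln open_UNIV smooth_rad rad_pos)

lemma dir_deriv_inverse_rad_power:
  "dir_deriv b (\<lambda>z. inverse (rad z) ^ s) z = - 2 * real s * ((z - y) \<bullet> b) * inverse (rad z) ^ Suc s"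
proof -
  have "((\<lambda>t. inverse t ^ s) has_real_derivative - (real s * inverse t ^ Suc s)) (at t)" if "t \<noteq> 0" for t :: real
  proof (cases s)
    case (Suc n)
    show ?thesis unfolding Suc using DERIV_power[OF DERIV_inverse[OF that, of UNIV], of "Suc n"] by (simp add: mult_ac)
  qed simp
  from dir_deriv_chain[OF rad_deriv(1) this, of z b] show ?thesis
    using rad_pos[of z] by (simp add: rad_deriv)
qed

text \<open>Only the gradient of \<open>f\<close> enters, so the logarithm of \<open>rad\<close> and
  the powers of 1/rad are treated at once. The squared distance produced by the second
  differentiation is replaced by rad - \<epsilon>^2, which keeps the result among powers of
  1/rad.\<close>

lemma laplacian_radial_aux:
  fixes c :: real
  assumes "\<And>b z. dir_deriv b f z = c * (((z - y) \<bullet> b) * inverse (rad z) ^ Suc s)"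
  shows "laplacian f z = c * (real DIM('a) - 2 * real (Suc s)) * inverse (rad z) ^ Suc s
     + c * (2 * real (Suc s) * \<epsilon>\<^sup>2) * inverse (rad z) ^ Suc (Suc s)"
proof -
  let ?I = "inverse (rad z)"
  have f: "dir_deriv b f = (\<lambda>z. c * (((z - y) \<bullet> b) * inverse (rad z) ^ Suc s))" for b using assms by blast
  have di: "(\<lambda>z. inverse (rad z) ^ Suc s) differentiable (at z)" for z
    using smooth_on_differentiable[OF smooth_inverse_rad_power] by blast
  have "dir_deriv b (dir_deriv b f) z = c * (?I ^ Suc s - 2 * real (Suc s) * (((z - y) \<bullet> b) * ((z - y) \<bullet> b)) * ?I ^ Suc (Suc s))"
    if b: "b \<in> Basis" for b
  proof -
    have "(\<lambda>z. ((z - y) \<bullet> b) * inverse (rad z) ^ Suc s) differentiable (at z)"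
      by (intro differentiable_mult dir_deriv_linear_diff di)
    then have "dir_deriv b (dir_deriv b f) z = c * dir_deriv b (\<lambda>z. ((z - y) \<bullet> b) * inverse (rad z) ^ Suc s) z"
      unfolding f by (rule dir_deriv_cmult)
    also have "dir_deriv b (\<lambda>z. ((z - y) \<bullet> b) * inverse (rad z) ^ Suc s) z =
        ((z - y) \<bullet> b) * dir_deriv b (\<lambda>z. inverse (rad z) ^ Suc s) z + dir_deriv b (\<lambda>z. (z - y) \<bullet> b) z * ?I ^ Suc s"
      by (rule dir_deriv_mult[OF dir_deriv_linear_diff(1) di])
    also have "dir_deriv b (\<lambda>z. (z - y) \<bullet> b) z = 1" by (rule dir_deriv_linear_diff(2)[OF b])
    also have "dir_deriv b (\<lambda>z. inverse (rad z) ^ Suc s) z = - 2 * real (Suc s) * ((z - y) \<bullet> b) * ?I ^ Suc (Suc s)"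
      by (rule dir_deriv_inverse_rad_power)
    finally show ?thesis by (simp add: algebra_simps)
  qed
  then have "laplacian f z = (\<Sum>b\<in>Basis. c * (?I ^ Suc s - 2 * real (Suc s) * (((z - y) \<bullet> b) * ((z - y) \<bullet> b)) * ?I ^ Suc (Suc s)))"
    unfolding laplacian_def by (intro sum.cong refl)
  also have "\<dots> = c * (real DIM('a) * ?I ^ Suc s - 2 * real (Suc s) * ((z - y) \<bullet> (z - y)) * ?I ^ Suc (Suc s))"
    unfolding euclidean_inner[of "z - y" "z - y"]
    by (simp only: sum_distrib_left[symmetric] sum_distrib_right[symmetric] sum_subtractf sum_constant)
  also have "(z - y) \<bullet> (z - y) = rad z - \<epsilon>\<^sup>2" by (simp add: rad_def)
  also have "c * (real DIM('a) * ?I ^ Suc s - 2 * real (Suc s) * (rad z - \<epsilon>\<^sup>2) * ?I ^ Suc (Suc s)) =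
     c * (real DIM('a) * ?I ^ Suc s - 2 * real (Suc s) * ((rad z * ?I) * ?I ^ Suc s) + 2 * real (Suc s) * \<epsilon>\<^sup>2 * ?I ^ Suc (Suc s))"
    by (simp add: algebra_simps)
  also have "rad z * ?I = 1" using rad_pos[of z] by simp
  finally show ?thesis by (simp add: algebra_simps)
qed

lemma laplacian_inverse_rad_power:
  "laplacian (\<lambda>z. inverse (rad z) ^ s) z =
     - (2 * real s * (real DIM('a) - 2 * real s - 2)) * inverse (rad z) ^ Suc s
     - (4 * real s * real (Suc s) * \<epsilon>\<^sup>2) * inverse (rad z) ^ Suc (Suc s)"
  using laplacian_radial_aux[of "\<lambda>z. inverse (rad z) ^ s" "- 2 * real s" s z]
  by (simp add: dir_deriv_inverse_rad_power algebra_simps)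

lemma laplacian_ln_rad:
  "laplacian (\<lambda>z. (-1/2) * ln (rad z)) z =
     - (real DIM('a) - 2) * inverse (rad z) - 2 * \<epsilon>\<^sup>2 * inverse (rad z) ^ 2"
proof -
  have "dir_deriv b (\<lambda>z. (-1/2) * ln (rad z)) z = (-1) * (((z - y) \<bullet> b) * inverse (rad z) ^ Suc 0)" for b z
  proof -
    have D: "(ln has_real_derivative inverse (rad z)) (at (rad z))" by (rule DERIV_ln[OF rad_pos])
    have "(\<lambda>z. ln (rad z)) differentiable (at z)"
      using smooth_on_differentiable[OF smooth_on_ln[OF open_UNIV smooth_rad rad_pos], of z] by simp
    then show ?thesis using dir_deriv_chain[OF rad_deriv(1) D, of b]
      by (subst dir_deriv_cmult) (simp_all add: rad_deriv(2))
  qed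
  from laplacian_radial_aux[OF this, of z] show ?thesis by (simp add: power2_eq_square algebra_simps)
qed

context
  fixes m :: nat
  assumes dim: "DIM('a) = 2 * m" and m: "m \<ge> 1"
begin

text \<open>The factor with l = m - 1 is 0. Hence for j = m the product vanishes for every i < m and
  is empty for i = m, so that in the m-th iterate a single term survives. This is special to
  dimension 2m.\<close>

definition P_coeff :: "nat \<Rightarrow> nat \<Rightarrow> real" where
  "P_coeff j i = (\<Prod>l\<in>{i..<j}. real m - 1 - real l)"

text \<open>The coefficient of \<epsilon>^(2i) rad^(-(j+i)) in the j-th iterate: a closed solution
  of the recurrence produced by one application of -\<Delta>. It is used for j \<ge> 1, where the
  subtraction in the factorial is genuine.\<close>

definition c_coeff :: "nat \<Rightarrow> nat \<Rightarrow> real" where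
  "c_coeff j i = 1/2 * 4 ^ j * fact (j + i - 1) * real (j choose i) * P_coeff j i"

text \<open>Applying -\<Delta> to rad^(-s) gives 4s(m - 1 - s) rad^(-s-1) + 4s(s + 1) \<epsilon>^2
  rad^(-s-2); with s = j + i the two terms feed the indices i and i + 1 of the next iterate. The
  closed form obeys this by Pascal's rule and the absorption identity for binomial
  coefficients.\<close>

lemma c_coeff_rec:
  assumes j: "j \<ge> 1" and i: "i \<le> Suc j"
  shows "c_coeff (Suc j) i = c_coeff j i * (4 * real (j + i) * (real m - 1 - real (j + i))) +
    (if i = 0 then 0 else c_coeff j (i - 1) * (4 * real (j + i - 1) * real (j + i)))"
proof -
  have fr: "fact (j + i) = real (j + i) * fact (j + i - 1)" if "j + i \<ge> 1" for i
    using that by (intro fact_reduce) linarith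
  show ?thesis
  proof (cases i)
    case 0
    have "P_coeff (Suc j) 0 = P_coeff j 0 * (real m - 1 - real j)" by (simp add: P_coeff_def)
    then show ?thesis using 0 fr[of 0] j by (simp add: c_coeff_def)
  next
    case (Suc i')
    then have i': "i' \<le> j" using i by simp
    have f1: "fact (Suc j + i - 1) = real (j + i) * fact (j + i - 1)" using fr[of i] j by simp
    have f2: "fact (j + i - 1) = real (j + i - 1) * fact (j + i' - 1)" using fr[of i'] j Suc by simp
    show ?thesis
    \<comment> \<open>For i' = j the products over l are empty and the relation between neighbouring
      products, used in the other case, breaks down. This top coefficient is fed by the second term
      alone.\<close>
    proof (cases "i' = j")
      case True
      have P: "P_coeff (Suc j) i = 1" "P_coeff j i' = 1" using Suc True by (auto simp: P_coeff_def)
      have ch: "j choose i = 0" "j choose i' = 1" "Suc j choose i = 1" using Suc True by auto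
      have "c_coeff j i = 0" by (simp add: c_coeff_def ch)
      moreover have "c_coeff (Suc j) i = 1/2 * 4 ^ j * fact (j + i' - 1) * (4 * real (j + i - 1) * real (j + i))"
        unfolding c_coeff_def f1 f2 P ch by simp
      moreover have c: "1/2 * 4 ^ j * fact (j + i' - 1) = c_coeff j i'" unfolding c_coeff_def P ch by simp
      moreover have "i - 1 = i'" "(i = 0) = False" using Suc by auto
      ultimately show ?thesis by (simp only: if_False mult_zero_left add_0_left)
    next
      case False
      then have ij: "i \<le> j" "i' < j" using i' Suc by auto
      have P1: "P_coeff (Suc j) i = P_coeff j i * (real m - 1 - real j)"
        using ij by (simp add: P_coeff_def prod.atLeastLessThan_Suc)
      have "{i'..<j} = insert i' {i..<j}" using ij Suc by auto
      then have P2: "P_coeff j i' = (real m - real i) * P_coeff j i"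
        using Suc by (simp add: P_coeff_def)
      have ch: "real (Suc j choose i) * (real m - 1 - real j) =
          real (j choose i) * (real m - 1 - real (j + i)) + real (j choose i') * (real m - real i)"
      proof -
        have "i * (j choose i) = (j - i') * (j choose i')"
          unfolding Suc using binomial_absorb_comp[of j i'] binomial_absorption[of i' j]
          by (metis Suc binomial_absorb_comp binomial_absorption)
        then have "real i * real (j choose i) = (real j - real i') * real (j choose i')"
          using i' by (metis of_nat_mult of_nat_diff)
        then have "real i * real (j choose i) = (real j + 1 - real i) * real (j choose i')" using Suc by simp
        moreover have "real (Suc j choose i) = real (j choose i) + real (j choose i')" unfolding Suc by simp
        ultimately show ?thesis by (simp add: algebra_simps)
      qed
      have aux: "2 * q * (n * f) * p * (a * X + b * Y) = 1/2 * q * f * a * p * (4 * n * X) + 2 * q * (n * f) * b * (Y * p)"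
        for q n f a b p X Y :: real by (simp add: algebra_simps)
      have "c_coeff (Suc j) i = 2 * 4 ^ j * (real (j + i) * fact (j + i - 1)) * P_coeff j i *
          (real (Suc j choose i) * (real m - 1 - real j))"
        unfolding c_coeff_def f1 P1 by (simp add: mult_ac)
      also have "\<dots> = c_coeff j i * (4 * real (j + i) * (real m - 1 - real (j + i))) +
          2 * 4 ^ j * (real (j + i) * fact (j + i - 1)) * real (j choose i') * P_coeff j i'"
        unfolding ch c_coeff_def P2 by (rule aux)
      also have "2 * 4 ^ j * (real (j + i) * fact (j + i - 1)) * real (j choose i') * P_coeff j i' =
          c_coeff j i' * (4 * real (j + i - 1) * real (j + i))"
        unfolding c_coeff_def f2 by (simp add: mult_ac)
      finally show ?thesis using Suc by simp
    qed
  qed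
qed

text \<open>The first application of the operator removes the logarithm and leaves powers of 1/rad,
  so the induction starts at j = 1.\<close>

lemma neg_laplacian_power_ln_rad:
  assumes "j \<ge> 1"
  shows "(neg_laplacian ^^ j) (\<lambda>z. (-1/2) * ln (rad z)) =
    (\<lambda>z. \<Sum>i\<le>j. c_coeff j i * \<epsilon> ^ (2 * i) * inverse (rad z) ^ (j + i))"
  using assms
proof (induction j rule: nat_induct_at_least)
  case base
  define F where "F = (\<lambda>z. (-1/2) * ln (rad z))"
  have "(neg_laplacian ^^ 1) F = neg_laplacian F" by simp
  moreover have "neg_laplacian F z = (real DIM('a) - 2) * inverse (rad z) + 2 * \<epsilon>\<^sup>2 * inverse (rad z) ^ 2" for z
    unfolding neg_laplacian_def F_def laplacian_ln_rad by (simp add: algebra_simps)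
  moreover have "(\<Sum>i\<le>1. c_coeff 1 i * \<epsilon> ^ (2 * i) * inverse (rad z) ^ (1 + i)) =
      (real DIM('a) - 2) * inverse (rad z) + 2 * \<epsilon>\<^sup>2 * inverse (rad z) ^ 2" for z
    by (simp add: c_coeff_def P_coeff_def dim power2_eq_square algebra_simps)
  ultimately show ?case unfolding F_def by presburger
next
  case (Suc j)
  show ?case
  proof
    fix z
    let ?I = "inverse (rad z)"
    let ?T = "\<lambda>i. \<epsilon> ^ (2 * i) * ?I ^ (Suc j + i)"
    let ?A = "\<lambda>i. c_coeff j i * (4 * real (j + i) * (real m - 1 - real (j + i)))"
    let ?B = "\<lambda>i. c_coeff j i * (4 * real (j + i) * real (j + i + 1))"
    have "(neg_laplacian ^^ Suc j) (\<lambda>z. (-1/2) * ln (rad z)) z =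
        - laplacian (\<lambda>z. \<Sum>i\<le>j. c_coeff j i * \<epsilon> ^ (2 * i) * inverse (rad z) ^ (j + i)) z"
      unfolding funpow.simps o_apply Suc.IH by (simp only: neg_laplacian_def)
    also have "\<dots> = - (\<Sum>i\<le>j. c_coeff j i * \<epsilon> ^ (2 * i) * laplacian (\<lambda>z. inverse (rad z) ^ (j + i)) z)"
    proof -
      have "laplacian (\<lambda>z. c * inverse (rad z) ^ n) z = c * laplacian (\<lambda>z. inverse (rad z) ^ n) z" for c n
        by (rule laplacian_cmult[OF open_UNIV smooth_inverse_rad_power]) simp
      moreover have "smooth_on UNIV (\<lambda>z. c * inverse (rad z) ^ n)" for c n
        by (rule smooth_on_cmult[OF open_UNIV smooth_inverse_rad_power])
      ultimately show ?thesis by (subst laplacian_sum[OF open_UNIV]) simp_all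
    qed
    also have "\<dots> = (\<Sum>i\<le>j. ?A i * ?T i + ?B i * ?T (Suc i))"
      unfolding sum_negf[symmetric]
      by (intro sum.cong refl) (simp add: laplacian_inverse_rad_power dim algebra_simps power2_eq_square)
    also have "\<dots> = (\<Sum>i\<le>j. ?A i * ?T i) + (\<Sum>i\<le>j. ?B i * ?T (Suc i))" by (rule sum.distrib)
    \<comment> \<open>The first sum extends to i = j + 1, where the binomial coefficient is 0; the
      second is shifted by one. Then both run over the same powers.\<close>
    also have "(\<Sum>i\<le>j. ?A i * ?T i) = (\<Sum>i\<le>Suc j. ?A i * ?T i)"
      by (simp add: c_coeff_def binomial_eq_0)
    also have "(\<Sum>i\<le>j. ?B i * ?T (Suc i)) = (\<Sum>i\<le>Suc j. (if i = 0 then 0 else ?B (i - 1)) * ?T i)"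
      by (subst sum.atMost_Suc_shift) simp
    also have "(\<Sum>i\<le>Suc j. ?A i * ?T i) + (\<Sum>i\<le>Suc j. (if i = 0 then 0 else ?B (i - 1)) * ?T i) =
        (\<Sum>i\<le>Suc j. c_coeff (Suc j) i * ?T i)"
      unfolding sum.distrib[symmetric]
    proof (intro sum.cong refl)
      fix i assume "i \<in> {..Suc j}"
      then have i: "i \<le> Suc j" by simp
      have "?A i * ?T i + (if i = 0 then 0 else ?B (i - 1)) * ?T i = (?A i + (if i = 0 then 0 else ?B (i - 1))) * ?T i"
        by (rule distrib_right[symmetric])
      also have "?A i + (if i = 0 then 0 else ?B (i - 1)) = c_coeff (Suc j) i"
        unfolding c_coeff_rec[OF Suc.hyps i] by (cases i) auto
      finally show "?A i * ?T i + (if i = 0 then 0 else ?B (i - 1)) * ?T i = c_coeff (Suc j) i * ?T i" .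
    qed
    finally show "(neg_laplacian ^^ Suc j) (\<lambda>z. (-1/2) * ln (rad z)) z =
        (\<Sum>i\<le>Suc j. c_coeff (Suc j) i * \<epsilon> ^ (2 * i) * inverse (rad z) ^ (Suc j + i))"
      by (simp add: mult.assoc)
  qed
qed

text \<open>The surviving term is the standard bubble of width \<epsilon>. As \<epsilon> tends to 0
  it concentrates at y while its mass stays fixed, so it acts as an approximate identity.\<close>

lemma neg_laplacian_m_ln_rad:
  "(neg_laplacian ^^ m) (\<lambda>z. (-1/2) * ln (rad z)) z =
    fact (2 * m - 1) / 2 * (2 * \<epsilon> * inverse (rad z)) ^ (2 * m)"
proof -
  have "P_coeff m i = 0" if "i < m" for i
    unfolding P_coeff_def using that m by (intro prod_zero) (auto intro!: bexI[of _ "m - 1"] simp: of_nat_diff)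
  then have "c_coeff m i = 0" if "i < m" for i using that by (simp add: c_coeff_def)
  then have "(\<Sum>i\<le>m. c_coeff m i * \<epsilon> ^ (2 * i) * inverse (rad z) ^ (m + i)) =
      c_coeff m m * \<epsilon> ^ (2 * m) * inverse (rad z) ^ (m + m)"
    by (simp add: lessThan_Suc_atMost[symmetric])
  also have "c_coeff m m = fact (2 * m - 1) / 2 * 2 ^ (2 * m)"
  proof -
    have "(4::real) ^ m = 2 ^ (2 * m)" by (simp add: power_mult)
    then show ?thesis by (simp add: c_coeff_def P_coeff_def mult_2)
  qed
  finally show ?thesis
    unfolding neg_laplacian_power_ln_rad[OF m] power_mult_distrib mult_2[symmetric] by (simp only: mult_ac)
qed

end

end

lemma integral_lborel_affine:
  fixes g :: "'a::euclidean_space \<Rightarrow> real"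
  assumes [measurable]: "g \<in> borel_measurable borel" and c: "c > 0"
  shows "(\<integral>z. g z \<partial>lborel) = (\<integral>x. c ^ DIM('a) * g (t + c *\<^sub>R x) \<partial>lborel)"
proof -
  have "(\<integral>z. g z \<partial>lborel) = (\<integral>z. g z \<partial>density (distr lborel borel (\<lambda>x. t + c *\<^sub>R x)) (\<lambda>_. \<bar>c\<bar>^DIM('a)))"
    using c by (subst lborel_affine[of c t]) auto
  also have "\<dots> = (\<integral>z. \<bar>c\<bar>^DIM('a) * g z \<partial>distr lborel borel (\<lambda>x. t + c *\<^sub>R x))"
    by (subst integral_density) auto
  also have "\<dots> = (\<integral>x. c ^ DIM('a) * g (t + c *\<^sub>R x) \<partial>lborel)"
    using c by (subst integral_distr) auto
  finally show ?thesis .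
qed

text \<open>A domination uniform in \<epsilon>. If the argument of the logarithm is at least 1, ln t
  \<le> t - 1 gives the quadratic term; otherwise monotonicity compares it with 2 ln r.\<close>

lemma half_ln_bound:
  fixes r \<epsilon> :: real
  assumes "0 < r" "0 < \<epsilon>" "\<epsilon> \<le> 1"
  shows "\<bar>(-1/2) * ln (r\<^sup>2 + \<epsilon>\<^sup>2)\<bar> \<le> \<bar>ln r\<bar> + r\<^sup>2"
proof (cases "1 \<le> r\<^sup>2 + \<epsilon>\<^sup>2")
  case True
  have "\<epsilon>\<^sup>2 \<le> 1" using assms by (simp add: power_le_one)
  have "ln (r\<^sup>2 + \<epsilon>\<^sup>2) \<le> r\<^sup>2 + \<epsilon>\<^sup>2 - 1" using True by (intro ln_le_minus_one) linarith
  also have "\<dots> \<le> r\<^sup>2" using \<open>\<epsilon>\<^sup>2 \<le> 1\<close> by simp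
  finally have "ln (r\<^sup>2 + \<epsilon>\<^sup>2) \<le> r\<^sup>2" .
  moreover have "0 \<le> ln (r\<^sup>2 + \<epsilon>\<^sup>2)" using True by simp
  moreover have "0 \<le> r\<^sup>2" "0 \<le> \<bar>ln r\<bar>" by auto
  ultimately show ?thesis by (simp add: abs_mult)
next
  case False
  have p: "0 < r\<^sup>2 + \<epsilon>\<^sup>2" using assms by (simp add: add_pos_pos)
  have "ln (r\<^sup>2) \<le> ln (r\<^sup>2 + \<epsilon>\<^sup>2)" using assms p by (subst ln_le_cancel_iff) auto
  then have "2 * ln r \<le> ln (r\<^sup>2 + \<epsilon>\<^sup>2)" using assms by (simp add: ln_realpow)
  moreover have "ln (r\<^sup>2 + \<epsilon>\<^sup>2) \<le> 0" using False p by simp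
  moreover have "0 \<le> r\<^sup>2" by auto
  moreover have "\<bar>(-1/2) * ln (r\<^sup>2 + \<epsilon>\<^sup>2)\<bar> = \<bar>ln (r\<^sup>2 + \<epsilon>\<^sup>2)\<bar> / 2" by (simp add: abs_mult)
  ultimately show ?thesis by linarith
qed

lemma decaying_compact_support:
  fixes f :: "'a::euclidean_space \<Rightarrow> real"
  assumes "continuous_on UNIV f" "compact K" "\<And>x. x \<notin> K \<Longrightarrow> f x = 0"
  shows "decaying f"
  unfolding decaying_def
proof (intro conjI)
  show "f \<in> borel_measurable borel" using assms(1) by (rule borel_measurable_continuous_onI)
  have "bounded (f ` K)"
    by (intro compact_imp_bounded compact_continuous_image continuous_on_subset[OF assms(1)] assms(2)) auto
  then obtain M where "\<forall>w\<in>f ` K. norm w \<le> M" unfolding bounded_iff by blast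
  then have "\<bar>f y\<bar> \<le> max 0 M" for y using assms(3)[of y] by (cases "y \<in> K") (auto simp: le_max_iff_disj)
  then show "\<exists>M. \<forall>y. \<bar>f y\<bar> \<le> M" by blast
  show "integrable lborel (\<lambda>y. (1 + norm y) * \<bar>f y\<bar>)"
    by (rule integrable_continuous_compact_support[OF assms(2)])
      (use assms in \<open>auto intro!: continuous_intros continuous_on_subset[OF assms(1)]\<close>)
qed

text \<open>The logarithm is replaced by its regularisation, the operator is moved onto it and
  produces the bubble. The substitution z = y + \<epsilon> x makes the bubble independent of
  \<epsilon>, with total mass \<open>sphere_vol (2 * m)\<close>, and draws the argument of \<psi> to
  y. Dominated convergence applies to both sides as \<epsilon> tends to 0.\<close>

theorem log_kernel_fundamental_solution:
  fixes \<psi> :: "'a::euclidean_space \<Rightarrow> real"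
  assumes dim: "DIM('a) = 2 * m" and m: "m \<ge> 1" and \<psi>: "smooth_on UNIV \<psi>"
    and K: "compact K" "\<And>x. x \<notin> K \<Longrightarrow> \<psi> x = 0"
  shows "(\<integral>z. log_kernel (z - y) * (neg_laplacian ^^ m) \<psi> z \<partial>lborel) = Lambda1 m / 2 * \<psi> y"
proof -
  define \<eta> where "\<eta> = (neg_laplacian ^^ m) \<psi>"
  have \<eta>: "\<eta> z = (-1) ^ m * (laplacian ^^ m) \<psi> z" for z
    unfolding \<eta>_def by (rule neg_laplacian_power[OF open_UNIV \<psi>]) simp
  have c\<eta>: "continuous_on UNIV \<eta>"
    unfolding \<eta>[abs_def] by (intro continuous_intros smooth_on_continuous_on[OF smooth_on_laplacian_power[OF open_UNIV \<psi>]])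
  have z\<eta>: "\<eta> z = 0" if "z \<notin> K" for z
    using laplacian_power_zero_outside[OF K that] by (simp add: \<eta>)
  have c\<psi>: "continuous_on UNIV \<psi>" by (rule smooth_on_continuous_on[OF \<psi>])
  have [measurable]: "\<psi> \<in> borel_measurable borel" "\<eta> \<in> borel_measurable borel"
    using c\<psi> c\<eta> by (auto intro: borel_measurable_continuous_onI)
  let ?L = "\<lambda>\<epsilon> z. (-1/2) * ln ((norm (z - y))\<^sup>2 + \<epsilon>\<^sup>2)"
  let ?q = "\<lambda>x::'a. (2 / (1 + (norm x)\<^sup>2)) ^ (2 * m)"
  \<comment> \<open>Green's identity and then the rescaling; the Jacobian \<epsilon>^(2m) is
    absorbed into the power 2m of the bubble.\<close>
  have key: "(\<integral>z. ?L \<epsilon> z * \<eta> z \<partial>lborel) = fact (2 * m - 1) / 2 * (\<integral>x. ?q x * \<psi> (y + \<epsilon> *\<^sub>R x) \<partial>lborel)"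
    if \<epsilon>: "0 < \<epsilon>" for \<epsilon>
  proof -
    have rad: "rad y \<epsilon> z = (norm (z - y))\<^sup>2 + \<epsilon>\<^sup>2" for z
      by (simp add: rad_def[OF \<epsilon>] power2_norm_eq_inner)
    note sL = smooth_ln_rad[OF \<epsilon>, of y]
    have "(\<integral>z. ?L \<epsilon> z * \<eta> z \<partial>lborel) = (-1) ^ m * (LINT z:UNIV|lborel. ((-1/2) * ln (rad y \<epsilon> z)) * (laplacian ^^ m) \<psi> z)"
      by (simp add: set_lebesgue_integral_def \<eta> rad mult_ac flip: integral_mult_right_zero)
    also have "\<dots> = (-1) ^ m * (LINT z:UNIV|lborel. (laplacian ^^ m) (\<lambda>z. (-1/2) * ln (rad y \<epsilon> z)) z * \<psi> z)"
      by (subst Green_identity_power[OF open_UNIV sL \<psi> K(1) _ K(2)]) auto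
    also have "\<dots> = (\<integral>z. ((-1) ^ m * (laplacian ^^ m) (\<lambda>z. (-1/2) * ln (rad y \<epsilon> z)) z) * \<psi> z \<partial>lborel)"
      by (simp add: set_lebesgue_integral_def mult.assoc)
    also have "\<dots> = (\<integral>z. (neg_laplacian ^^ m) (\<lambda>z. (-1/2) * ln (rad y \<epsilon> z)) z * \<psi> z \<partial>lborel)"
      by (subst neg_laplacian_power[OF open_UNIV sL]) auto
    also have "\<dots> = (\<integral>z. fact (2 * m - 1) / 2 * ((2 * \<epsilon> / ((norm (z - y))\<^sup>2 + \<epsilon>\<^sup>2)) ^ (2 * m) * \<psi> z) \<partial>lborel)"
      unfolding neg_laplacian_m_ln_rad[OF \<epsilon> dim m] by (simp only: rad divide_inverse mult.assoc)
    also have "\<dots> = fact (2 * m - 1) / 2 * (\<integral>z. (2 * \<epsilon> / ((norm (z - y))\<^sup>2 + \<epsilon>\<^sup>2)) ^ (2 * m) * \<psi> z \<partial>lborel)"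
      by simp
    also have "(\<integral>z. (2 * \<epsilon> / ((norm (z - y))\<^sup>2 + \<epsilon>\<^sup>2)) ^ (2 * m) * \<psi> z \<partial>lborel) =
        (\<integral>x. \<epsilon> ^ DIM('a) * ((2 * \<epsilon> / ((norm (y + \<epsilon> *\<^sub>R x - y))\<^sup>2 + \<epsilon>\<^sup>2)) ^ (2 * m) * \<psi> (y + \<epsilon> *\<^sub>R x)) \<partial>lborel)"
      by (rule integral_lborel_affine[OF _ \<epsilon>]) measurable
    also have "\<dots> = (\<integral>x. ?q x * \<psi> (y + \<epsilon> *\<^sub>R x) \<partial>lborel)"
    proof (rule Bochner_Integration.integral_cong[OF refl])
      fix x :: 'a
      have p: "1 + (norm x)\<^sup>2 \<noteq> 0" by (smt (verit) zero_le_power2)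
      have "\<epsilon> * (2 * \<epsilon> / ((norm (y + \<epsilon> *\<^sub>R x - y))\<^sup>2 + \<epsilon>\<^sup>2)) = 2 / (1 + (norm x)\<^sup>2)"
      proof -
        have "(norm (y + \<epsilon> *\<^sub>R x - y))\<^sup>2 + \<epsilon>\<^sup>2 = \<epsilon> * (\<epsilon> * (1 + (norm x)\<^sup>2))"
          using \<epsilon> by (simp add: power_mult_distrib algebra_simps power2_eq_square)
        then show ?thesis using \<epsilon> p by simp
      qed
      then show "\<epsilon> ^ DIM('a) * ((2 * \<epsilon> / ((norm (y + \<epsilon> *\<^sub>R x - y))\<^sup>2 + \<epsilon>\<^sup>2)) ^ (2 * m) * \<psi> (y + \<epsilon> *\<^sub>R x)) =
          ?q x * \<psi> (y + \<epsilon> *\<^sub>R x)"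
        unfolding dim mult.assoc[symmetric] power_mult_distrib[symmetric] by simp
    qed
    finally show ?thesis .
  qed
  define e where "e n = 1 / real (Suc n)" for n
  have e: "0 < e n" "e n \<le> 1" for n by (auto simp: e_def)
  have e0: "e \<longlonglongrightarrow> 0" unfolding e_def using LIMSEQ_inverse_real_of_nat by (simp add: inverse_eq_divide)
  have dim2: "2 \<le> DIM('a)" using dim m by simp
  have lsym: "log_kernel (z - y) = log_kernel (y - z)" for z :: 'a
    by (simp add: log_kernel_def norm_minus_commute)
  have d\<eta>: "decaying \<eta>" by (rule decaying_compact_support[OF c\<eta> K(1) z\<eta>])
  have il: "integrable lborel (\<lambda>z. log_kernel (z - y) * \<eta> z)"
    unfolding lsym by (rule conv_integrable[OF sing_kernel_log[OF dim2] d\<eta>])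
  have lm[measurable]: "(log_kernel :: 'a \<Rightarrow> real) \<in> borel_measurable borel"
    by (rule sing_kernel_measurable[OF sing_kernel_log[OF dim2]])
  \<comment> \<open>The quadratic term of the dominating function is harmless because \<eta> has
    compact support.\<close>
  have lhs: "(\<lambda>n. \<integral>z. ?L (e n) z * \<eta> z \<partial>lborel) \<longlonglongrightarrow> (\<integral>z. log_kernel (z - y) * \<eta> z \<partial>lborel)"
  proof (rule integral_dominated_convergence[where w="\<lambda>z. \<bar>log_kernel (z - y) * \<eta> z\<bar> + (norm (z - y))\<^sup>2 * \<bar>\<eta> z\<bar>"])
    have "integrable lborel (\<lambda>z. (norm (z - y))\<^sup>2 * \<bar>\<eta> z\<bar>)"
      by (rule integrable_continuous_compact_support[OF K(1)])
        (use z\<eta> in \<open>auto intro!: continuous_intros continuous_on_subset[OF c\<eta>]\<close>)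
    with il show "integrable lborel (\<lambda>z. \<bar>log_kernel (z - y) * \<eta> z\<bar> + (norm (z - y))\<^sup>2 * \<bar>\<eta> z\<bar>)" by simp
    have ne: "AE z in lborel. z \<noteq> y" by (rule AE_lborel_singleton)
    show "AE z in lborel. (\<lambda>n. ?L (e n) z * \<eta> z) \<longlonglongrightarrow> log_kernel (z - y) * \<eta> z"
      using ne
    proof (rule eventually_mono)
      fix z assume z: "z \<noteq> y"
      have "(\<lambda>n. ?L (e n) z) \<longlonglongrightarrow> (-1/2) * ln ((norm (z - y))\<^sup>2 + 0\<^sup>2)"
        using z by (intro tendsto_intros e0) auto
      also have "(-1/2) * ln ((norm (z - y))\<^sup>2 + 0\<^sup>2) = log_kernel (z - y)"
        using z by (simp add: log_kernel_def ln_realpow)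
      finally show "(\<lambda>n. ?L (e n) z * \<eta> z) \<longlonglongrightarrow> log_kernel (z - y) * \<eta> z" by (rule tendsto_mult_right)
    qed
    show "AE z in lborel. norm (?L (e n) z * \<eta> z) \<le> \<bar>log_kernel (z - y) * \<eta> z\<bar> + (norm (z - y))\<^sup>2 * \<bar>\<eta> z\<bar>" for n
      using ne
    proof (rule eventually_mono)
      fix z assume z: "z \<noteq> y"
      have "\<bar>?L (e n) z\<bar> \<le> \<bar>log_kernel (z - y)\<bar> + (norm (z - y))\<^sup>2"
        using half_ln_bound[of "norm (z - y)" "e n"] z e[of n] by (simp add: log_kernel_def)
      from mult_right_mono[OF this, of "\<bar>\<eta> z\<bar>"]
      show "norm (?L (e n) z * \<eta> z) \<le> \<bar>log_kernel (z - y) * \<eta> z\<bar> + (norm (z - y))\<^sup>2 * \<bar>\<eta> z\<bar>"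
        by (simp add: abs_mult distrib_right)
    qed
  qed measurable
  have q0: "0 \<le> ?q x" for x by simp
  have sv: "0 \<le> sphere_vol (2 * m)" by (simp add: sphere_vol_def)
  have qi: "integrable lborel ?q" "(\<integral>x. ?q x \<partial>lborel) = sphere_vol (2 * m)"
  proof -
    show "integrable lborel ?q"
      by (rule integrableI_nonneg) (auto simp: nn_integral_bubble[OF dim m] simp del: power_divide)
    show "(\<integral>x. ?q x \<partial>lborel) = sphere_vol (2 * m)"
      by (subst integral_eq_nn_integral) (auto simp: nn_integral_bubble[OF dim m] sv simp del: power_divide)
  qed
  obtain M where M: "\<And>z. \<bar>\<psi> z\<bar> \<le> M"
    using decaying_compact_support[OF c\<psi> K] by (auto simp: decaying_def)
  have "(\<lambda>n. \<integral>x. ?q x * \<psi> (y + e n *\<^sub>R x) \<partial>lborel) \<longlonglongrightarrow> (\<integral>x. ?q x * \<psi> y \<partial>lborel)"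
  proof (rule integral_dominated_convergence[where w="\<lambda>x. ?q x * M"])
    show "integrable lborel (\<lambda>x. ?q x * M)" using qi by (intro integrable_mult_left) auto
    show "AE x in lborel. (\<lambda>n. ?q x * \<psi> (y + e n *\<^sub>R x)) \<longlonglongrightarrow> ?q x * \<psi> y"
    proof (intro AE_I2 tendsto_mult_left)
      fix x :: 'a
      have "(\<lambda>n. y + e n *\<^sub>R x) \<longlonglongrightarrow> y + 0 *\<^sub>R x" by (intro tendsto_intros e0)
      then have "(\<lambda>n. y + e n *\<^sub>R x) \<longlonglongrightarrow> y" by simp
      from continuous_on_tendsto_compose[OF c\<psi> this] show "(\<lambda>n. \<psi> (y + e n *\<^sub>R x)) \<longlonglongrightarrow> \<psi> y" by simp
    qed
    show "AE x in lborel. norm (?q x * \<psi> (y + e n *\<^sub>R x)) \<le> ?q x * M" for n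
    proof (rule AE_I2)
      fix x :: 'a
      have "\<bar>?q x\<bar> * \<bar>\<psi> (y + e n *\<^sub>R x)\<bar> \<le> \<bar>?q x\<bar> * M" using M by (intro mult_left_mono) auto
      then show "norm (?q x * \<psi> (y + e n *\<^sub>R x)) \<le> ?q x * M" using q0[of x] by (simp add: abs_mult)
    qed
  qed measurable
  then have "(\<lambda>n. fact (2 * m - 1) / 2 * (\<integral>x. ?q x * \<psi> (y + e n *\<^sub>R x) \<partial>lborel)) \<longlonglongrightarrow>
      fact (2 * m - 1) / 2 * (\<integral>x. ?q x * \<psi> y \<partial>lborel)" by (rule tendsto_mult_left)
  also have "fact (2 * m - 1) / 2 * (\<integral>x. ?q x * \<psi> y \<partial>lborel) = Lambda1 m / 2 * \<psi> y"
    using qi(2) by (simp add: Lambda1_def)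
  finally have "(\<lambda>n. \<integral>z. ?L (e n) z * \<eta> z \<partial>lborel) \<longlonglongrightarrow> Lambda1 m / 2 * \<psi> y"
    by (simp only: key[OF e(1)])
  with lhs show ?thesis unfolding \<eta>_def by (rule LIMSEQ_unique)
qed

section \<open>The mean field equation with logarithmic kernel\<close>

text \<open>Adding \<open>ln (1 + |x|) + ln (1 + |y|)\<close> makes the logarithmic kernel nonnegative; the
  added terms only change the weight and the normalisation.\<close>

definition pos_log :: "'a::euclidean_space \<Rightarrow> 'a \<Rightarrow> real" where
  "pos_log x y = ln (1 + norm x) + ln (1 + norm y) + log_kernel (x - y)"

text \<open>The factor contributed by -|x|^2 in the exponent of the solutions. Up to a constant it
  dominates all weights, and it is the reference density for exponential integrability.\<close>

definition gauss :: "'a::euclidean_space \<Rightarrow> real" where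
  "gauss x = exp (- (norm x)\<^sup>2)"

lemma one_plus_norm_pos [simp]: "0 < 1 + norm x"
  by (simp add: add_pos_nonneg)

lemma pos_log_sym: "pos_log x y = pos_log y x"
  by (simp add: pos_log_def log_kernel_def norm_minus_commute)

text \<open>The distance |x - y| is at most (1 + |x|)(1 + |y|), so the added terms outweigh the
  negative part of the kernel. On the diagonal the convention \<open>ln 0 = 0\<close> leaves only
  the added terms.\<close>

lemma pos_log_nonneg: "0 \<le> pos_log x y"
proof (cases "x = y")
  case False
  have "norm (x - y) \<le> (1 + norm x) * (1 + norm y)"
    using one_plus_norm_diff_le[of x y] by linarith
  then have "ln (norm (x - y)) \<le> ln ((1 + norm x) * (1 + norm y))"
    using False by (subst ln_le_cancel_iff) (simp_all add: mult_pos_pos)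
  also have "\<dots> = ln (1 + norm x) + ln (1 + norm y)"
    by (rule ln_mult_pos) simp_all
  finally show ?thesis by (simp add: pos_log_def log_kernel_def)
qed (simp add: pos_log_def log_kernel_def)

lemma exp_pos_log: "x \<noteq> y \<Longrightarrow> exp (pos_log x y) = (1 + norm x) * (1 + norm y) / norm (x - y)"
  by (simp add: pos_log_def log_kernel_def exp_add exp_diff)

lemma borel_measurable_log_kernel[measurable]:
  "(log_kernel :: 'a::euclidean_space \<Rightarrow> real) \<in> borel_measurable borel"
  unfolding log_kernel_def by measurable

lemma borel_measurable_pos_log1[measurable]: "pos_log x \<in> borel_measurable borel"
  unfolding pos_log_def by measurable

text \<open>After ln(1 + r) \<le> r, the square in q r - r^2 is completed.\<close>

lemma one_plus_powr_gauss: "(1 + r) powr q * exp (- r\<^sup>2) \<le> exp (q\<^sup>2 / 4)" if "0 \<le> r" "0 \<le> q" for r q :: real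
proof -
  have "q * ln (1 + r) \<le> q * r" using that ln_add_one_self_le_self[of r] by (intro mult_left_mono) auto
  moreover have "0 \<le> (r - q / 2)\<^sup>2" by simp
  then have "q * r - r\<^sup>2 \<le> q\<^sup>2 / 4" by (simp add: power2_eq_square algebra_simps)
  ultimately have "q * ln (1 + r) - r\<^sup>2 \<le> q\<^sup>2 / 4" by linarith
  moreover have "(1 + r) powr q * exp (- r\<^sup>2) = exp (q * ln (1 + r) - r\<^sup>2)"
    using that by (simp add: powr_def exp_add[symmetric])
  ultimately show ?thesis by simp
qed

text \<open>The constant has to be uniform in y although exp(s pos_log) contains the growing factor
  (1 + |y|)^s. That factor is traded for (1 + |x|)^s (1 + |x - y|)^s: the first is absorbed by the
  Gaussian, the second is harmless near x = y and far away cancels against |x - y|^(-s). What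
  remains is a Gaussian moment plus a translated singularity, integrable because s is below the
  dimension.\<close>

lemma nn_integral_exp_pos_log:
  fixes s :: real
  assumes s: "0 \<le> s" "s < DIM('a::euclidean_space)"
  shows "\<exists>C>0. \<forall>y::'a. (\<integral>\<^sup>+x. ennreal (gauss x * exp (s * pos_log x y)) \<partial>lborel) \<le> ennreal C"
proof -
  define A where "A = (\<integral>\<^sup>+z. ennreal ((1 + norm (z::'a)) powr (2 * s) * exp (- (norm z)\<^sup>2)) \<partial>lborel)"
  define S where "S = (\<integral>\<^sup>+z. indicator (ball 0 1) z * ennreal (norm (z::'a) powr (-s)) \<partial>lborel)"
  \<comment> \<open>The two summands belong to |x - y| \<ge> 1 and |x - y| < 1; exp(s^2) bounds (1 +
    |x|)^(2s) times the Gaussian.\<close>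
  define T where "T = ennreal (2 powr s) * (A + ennreal (exp (s\<^sup>2)) * S)"
  have "A < \<infinity>" unfolding A_def using s by (intro nn_integral_gaussian_finite) simp
  moreover have "S < \<infinity>" unfolding S_def by (rule nn_integral_singularity_finite[OF s])
  ultimately have T: "T < \<infinity>" by (simp add: T_def ennreal_mult_less_top)
  have "(\<integral>\<^sup>+x. ennreal (gauss x * exp (s * pos_log x y)) \<partial>lborel) \<le> T" for y :: 'a
  proof -
    let ?g = "\<lambda>x::'a. (1 + norm x) powr (2 * s) * exp (- (norm x)\<^sup>2)"
    let ?h = "\<lambda>x. indicator (ball 0 1) x * ennreal (norm (x::'a) powr (-s))"
    have le: "ennreal (gauss x * exp (s * pos_log x y)) \<le>
        ennreal (2 powr s) * (ennreal (?g x) + ennreal (exp (s\<^sup>2)) * ?h (y - x))" if "x \<noteq> y" for x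
    proof -
      let ?r = "norm (x - y)"
      have r: "0 < ?r" using that by simp
      have "norm y \<le> norm x + ?r" using norm_triangle_ineq2[of y x] by (simp add: norm_minus_commute)
      then have "1 + norm y \<le> (1 + norm x) * (1 + ?r)"
      proof -
        have "(1 + norm x) * (1 + ?r) = 1 + norm x + ?r + norm x * ?r" by (simp add: algebra_simps)
        moreover have "0 \<le> norm x * ?r" by simp
        ultimately show ?thesis using \<open>norm y \<le> norm x + ?r\<close> by linarith
      qed
      then have "(1 + norm x) * (1 + norm y) \<le> (1 + norm x) * ((1 + norm x) * (1 + ?r))"
        by (intro mult_left_mono) auto
      then have "exp (pos_log x y) \<le> (1 + norm x)\<^sup>2 * ((1 + ?r) / ?r)"
        using r by (simp add: exp_pos_log[OF that] power2_eq_square divide_right_mono mult_ac)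
      then have "exp (pos_log x y) powr s \<le> ((1 + norm x)\<^sup>2 * ((1 + ?r) / ?r)) powr s"
        using s by (intro powr_mono2) auto
      also have "exp (pos_log x y) powr s = exp (s * pos_log x y)" by (simp add: powr_def)
      also have "((1 + norm x)\<^sup>2 * ((1 + ?r) / ?r)) powr s = (1 + norm x) powr (2 * s) * ((1 + ?r) / ?r) powr s"
      proof -
        have "(1 + norm x)\<^sup>2 = (1 + norm x) powr 2" by simp
        then have "((1 + norm x)\<^sup>2) powr s = (1 + norm x) powr (2 * s)" by (simp only: powr_powr)
        then show ?thesis using r by (subst powr_mult) auto
      qed
      finally have e1: "gauss x * exp (s * pos_log x y) \<le> ?g x * ((1 + ?r) / ?r) powr s"
        using mult_left_mono[of _ _ "gauss x"] by (simp add: gauss_def mult_ac)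
      have g0: "0 \<le> ?g x" by simp
      show ?thesis
      proof (cases "?r < 1")
        case False
        have "((1 + ?r) / ?r) powr s \<le> 2 powr s" using s r False by (intro powr_mono2) (auto simp: field_simps)
        then have "?g x * ((1 + ?r) / ?r) powr s \<le> ?g x * 2 powr s" by (rule mult_left_mono[OF _ g0])
        with e1 have "gauss x * exp (s * pos_log x y) \<le> ?g x * 2 powr s" by (rule order_trans)
        then have "gauss x * exp (s * pos_log x y) \<le> 2 powr s * ?g x" by (simp only: mult.commute)
        then have "ennreal (gauss x * exp (s * pos_log x y)) \<le> ennreal (2 powr s) * ennreal (?g x)"
          by (simp add: ennreal_mult[symmetric] ennreal_leI)
        also have "\<dots> \<le> ennreal (2 powr s) * (ennreal (?g x) + ennreal (exp (s\<^sup>2)) * ?h (y - x))"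
          by (intro mult_left_mono) auto
        finally show ?thesis .
      next
        case True
        have "(1 + ?r) / ?r \<le> 2 / ?r" using r True by (intro divide_right_mono) auto
        then have "((1 + ?r) / ?r) powr s \<le> (2 / ?r) powr s" using s r by (intro powr_mono2) auto
        also have "\<dots> = 2 powr s * ?r powr (-s)" using r by (simp add: powr_divide powr_minus_divide)
        finally have "?g x * ((1 + ?r) / ?r) powr s \<le> exp (s\<^sup>2) * (2 powr s * ?r powr (-s))"
          using one_plus_powr_gauss[of "norm x" "2 * s"] s by (intro mult_mono) (auto simp: power_mult_distrib)
        with e1 have "gauss x * exp (s * pos_log x y) \<le> exp (s\<^sup>2) * (2 powr s * ?r powr (-s))" by (rule order_trans)
        then have "gauss x * exp (s * pos_log x y) \<le> 2 powr s * (exp (s\<^sup>2) * ?r powr (-s))"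
          by (simp only: mult.left_commute)
        then have "ennreal (gauss x * exp (s * pos_log x y)) \<le> ennreal (2 powr s) * (ennreal (exp (s\<^sup>2)) * ennreal (?r powr (-s)))"
          by (simp add: ennreal_mult[symmetric] ennreal_leI)
        also have "ennreal (?r powr (-s)) = ?h (y - x)" using True by (simp add: norm_minus_commute)
        also have "ennreal (2 powr s) * (ennreal (exp (s\<^sup>2)) * ?h (y - x)) \<le>
            ennreal (2 powr s) * (ennreal (?g x) + ennreal (exp (s\<^sup>2)) * ?h (y - x))"
          by (intro mult_left_mono) auto
        finally show ?thesis .
      qed
    qed
    have hm: "?h \<in> borel_measurable borel"
      by (intro borel_measurable_times_ennreal borel_measurable_indicator) auto
    then have hm2[measurable]: "(\<lambda>x. ?h (y - x)) \<in> borel_measurable borel"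
      by (rule measurable_compose[rotated]) measurable
    have "AE x in lborel. x \<noteq> y" by (rule AE_lborel_singleton)
    then have "(\<integral>\<^sup>+x. ennreal (gauss x * exp (s * pos_log x y)) \<partial>lborel) \<le>
       (\<integral>\<^sup>+x. ennreal (2 powr s) * (ennreal (?g x) + ennreal (exp (s\<^sup>2)) * ?h (y - x)) \<partial>lborel)"
      by (intro nn_integral_mono_AE) (auto elim!: eventually_mono intro: le)
    also have "\<dots> = ennreal (2 powr s) * (A + ennreal (exp (s\<^sup>2)) * (\<integral>\<^sup>+x. ?h (y - x) \<partial>lborel))"
      by (subst nn_integral_cmult, measurable, subst nn_integral_add, measurable, subst nn_integral_cmult, measurable)
        (simp add: A_def)
    also have "(\<integral>\<^sup>+x. ?h (y - x) \<partial>lborel) = S"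
      unfolding S_def by (rule nn_integral_lborel_reflect[OF hm])
    finally show ?thesis by (simp add: T_def)
  qed
  \<comment> \<open>Adding 1 makes the constant strictly positive.\<close>
  moreover have "T \<le> ennreal (enn2real T + 1)"
  proof -
    have "T = ennreal (enn2real T)" using T by simp
    also have "\<dots> \<le> ennreal (enn2real T + 1)" by (rule ennreal_leI) simp
    finally show ?thesis .
  qed
  ultimately show ?thesis by (intro exI[of _ "enn2real T + 1"]) (auto intro: order_trans add_nonneg_pos)
qed

text \<open>By the equation, U x is the mean of \<open>g x\<close> under the probability density
  proportional to exp(\<alpha> U), so convexity of the exponential applies. The inequality is kept
  multiplied by the partition function.\<close>

lemma mean_field_Jensen:
  fixes \<nu> :: "'a::euclidean_space measure"
  assumes fin: "finite_measure \<nu>" and sets[measurable_cong]: "sets \<nu> = sets borel" and pos: "measure \<nu> UNIV > 0"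
    and mf: "mean_field \<nu> \<alpha> g U" and U: "\<And>x. 0 \<le> U x \<and> U x \<le> N"
    and g: "\<And>x. g x \<in> borel_measurable borel" "\<And>x y. 0 \<le> g x y \<and> g x y \<le> N"
  shows "exp (\<beta> * U x) * (\<integral>y. exp (\<alpha> * U y) \<partial>\<nu>) \<le> (\<integral>y. exp (\<beta> * g x y) * exp (\<alpha> * U y) \<partial>\<nu>)"
    and "integrable \<nu> (\<lambda>y. exp (\<beta> * g x y) * exp (\<alpha> * U y))"
    and "integrable \<nu> (\<lambda>y. exp (\<alpha> * U y))" and "0 < (\<integral>y. exp (\<alpha> * U y) \<partial>\<nu>)"
proof -
  interpret finite_measure \<nu> by fact
  have sp: "space \<nu> = UNIV" using sets_eq_imp_space_eq[OF sets] by simp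
  have Ub: "U \<in> borel_measurable borel" using mf by (simp add: mean_field_def)
  have [measurable]: "U \<in> borel_measurable \<nu>" "g x \<in> borel_measurable \<nu>" for x
    using Ub g(1)[of x] measurable_cong_sets[OF sets refl, of "borel :: real measure"] by auto
  have N: "0 \<le> N" using U[of undefined] by linarith
  have bd: "exp (c * t) \<le> exp (\<bar>c\<bar> * N)" if "0 \<le> t" "t \<le> N" for c t :: real
  proof -
    have "c * t \<le> \<bar>c\<bar> * t" using that by (intro mult_right_mono) auto
    also have "\<dots> \<le> \<bar>c\<bar> * N" using that by (intro mult_left_mono) auto
    finally show ?thesis by simp
  qed
  show iE: "integrable \<nu> (\<lambda>y. exp (\<alpha> * U y))"
    by (rule integrable_const_bound[of _ "exp (\<bar>\<alpha>\<bar> * N)"]) (use bd U in auto)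
  define Z where "Z = (\<integral>y. exp (\<alpha> * U y) \<partial>\<nu>)"
  have igE: "integrable \<nu> (\<lambda>y. g x y * exp (\<alpha> * U y))"
  proof (rule integrable_const_bound[of _ "N * exp (\<bar>\<alpha>\<bar> * N)"])
    show "AE y in \<nu>. norm (g x y * exp (\<alpha> * U y)) \<le> N * exp (\<bar>\<alpha>\<bar> * N)"
      using bd U g(2) N by (intro AE_I2) (auto simp: abs_mult intro!: mult_mono)
  qed measurable
  show ieg: "integrable \<nu> (\<lambda>y. exp (\<beta> * g x y) * exp (\<alpha> * U y))"
  proof (rule integrable_const_bound[of _ "exp (\<bar>\<beta>\<bar> * N) * exp (\<bar>\<alpha>\<bar> * N)"])
    show "AE y in \<nu>. norm (exp (\<beta> * g x y) * exp (\<alpha> * U y)) \<le> exp (\<bar>\<beta>\<bar> * N) * exp (\<bar>\<alpha>\<bar> * N)"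
      using bd U g(2) N by (intro AE_I2) (auto simp: abs_mult intro!: mult_mono)
  qed measurable
  have Z0: "Z > 0"
  proof -
    have "exp (- (\<bar>\<alpha>\<bar> * N)) \<le> exp (\<alpha> * U y)" for y
      using bd[of "U y" "-\<alpha>"] U[of y] by simp
    then have "(\<integral>y. exp (- (\<bar>\<alpha>\<bar> * N)) \<partial>\<nu>) \<le> Z" unfolding Z_def using iE by (intro integral_mono) auto
    moreover have "(\<integral>y. exp (- (\<bar>\<alpha>\<bar> * N)) \<partial>\<nu>) > 0" using pos by (simp add: sp)
    ultimately show ?thesis by linarith
  qed
  then show "0 < (\<integral>y. exp (\<alpha> * U y) \<partial>\<nu>)" by (simp add: Z_def)
  have "U x = (\<integral>y. g x y * exp (\<alpha> * U y) \<partial>\<nu>) / Z"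
    using mf unfolding mean_field_def Z_def by blast
  then have UZ: "(\<integral>y. g x y * exp (\<alpha> * U y) \<partial>\<nu>) = U x * Z" using Z0 by (simp add: field_simps)
  \<comment> \<open>The integrand is the tangent of the exponential at \<beta> U x, evaluated at
    \<beta> g x y. By the equation its linear part integrates to 0, leaving exp(\<beta> U x)
    Z.\<close>
  have "exp (\<beta> * U x) * Z = (\<integral>y. exp (\<beta> * U x) * ((1 - \<beta> * U x) * exp (\<alpha> * U y) + \<beta> * (g x y * exp (\<alpha> * U y))) \<partial>\<nu>)"
  proof -
    have "(\<integral>y. exp (\<beta> * U x) * ((1 - \<beta> * U x) * exp (\<alpha> * U y) + \<beta> * (g x y * exp (\<alpha> * U y))) \<partial>\<nu>) =
        exp (\<beta> * U x) * ((1 - \<beta> * U x) * Z + \<beta> * (U x * Z))"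
      using iE igE
      by (subst integral_mult_right_zero, subst Bochner_Integration.integral_add)
        (simp_all add: UZ Z_def[symmetric])
    then show ?thesis by (simp add: algebra_simps)
  qed
  also have "\<dots> \<le> (\<integral>y. exp (\<beta> * g x y) * exp (\<alpha> * U y) \<partial>\<nu>)"
  proof (rule integral_mono)
    show "integrable \<nu> (\<lambda>y. exp (\<beta> * U x) * ((1 - \<beta> * U x) * exp (\<alpha> * U y) + \<beta> * (g x y * exp (\<alpha> * U y))))"
      using iE igE by (intro integrable_mult_right Bochner_Integration.integrable_add)
    fix y
    have "exp (\<beta> * U x) * (1 + (\<beta> * g x y - \<beta> * U x)) \<le> exp (\<beta> * U x) * exp (\<beta> * g x y - \<beta> * U x)"
      by (intro mult_left_mono exp_ge_add_one_self) auto
    also have "\<dots> = exp (\<beta> * g x y)" by (simp add: exp_add[symmetric])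
    finally have "exp (\<beta> * U x) * (1 + (\<beta> * g x y - \<beta> * U x)) * exp (\<alpha> * U y) \<le> exp (\<beta> * g x y) * exp (\<alpha> * U y)"
      by (intro mult_right_mono) auto
    then show "exp (\<beta> * U x) * ((1 - \<beta> * U x) * exp (\<alpha> * U y) + \<beta> * (g x y * exp (\<alpha> * U y))) \<le> exp (\<beta> * g x y) * exp (\<alpha> * U y)"
      by (simp add: algebra_simps)
  qed (rule ieg)
  finally show "exp (\<beta> * U x) * (\<integral>y. exp (\<alpha> * U y) \<partial>\<nu>) \<le> (\<integral>y. exp (\<beta> * g x y) * exp (\<alpha> * U y) \<partial>\<nu>)"
    by (simp add: Z_def)
qed

text \<open>Off the diagonal this is the minimum of \<open>pos_log\<close> and N. Truncating inside
  the logarithm makes it continuous across the diagonal, where it equals N.\<close>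

definition trunc_log :: "real \<Rightarrow> 'a::euclidean_space \<Rightarrow> 'a \<Rightarrow> real" where
  "trunc_log N x y = ln (1 + norm x) + ln (1 + norm y) -
     ln (max (norm (x - y)) (exp (- N) * ((1 + norm x) * (1 + norm y))))"

lemma trunc_log_props:
  fixes x y :: "'a::euclidean_space"
  assumes N: "0 \<le> N"
  shows "0 \<le> trunc_log N x y" "trunc_log N x y \<le> N" "trunc_log N x y = trunc_log N y x"
    "x \<noteq> y \<Longrightarrow> trunc_log N x y \<le> pos_log x y"
    "x \<noteq> y \<Longrightarrow> pos_log x y \<le> N \<Longrightarrow> trunc_log N x y = pos_log x y"
    "continuous_on UNIV (\<lambda>z::'a\<times>'a. trunc_log N (fst z) (snd z))"
proof -
  let ?p = "\<lambda>x y::'a. (1 + norm x) * (1 + norm y)"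
  have p: "0 < ?p x y" for x y by (intro mult_pos_pos one_plus_norm_pos)
  have lp: "ln (1 + norm x) + ln (1 + norm y) = ln (?p x y)" for x y :: 'a
    by (rule ln_mult_pos[symmetric]) simp_all
  let ?M = "\<lambda>x y. max (norm (x - y)) (exp (- N) * ?p x y)"
  have M: "0 < ?M x y" for x y using p[of x y] by (simp add: max.strict_coboundedI2)
  have nxy: "norm (x - y) \<le> ?p x y" using one_plus_norm_diff_le[of x y] by linarith
  have "exp (- N) * ?p x y \<le> 1 * ?p x y" using N p[of x y] by (intro mult_right_mono) auto
  then have "?M x y \<le> ?p x y" using nxy by simp
  then show "0 \<le> trunc_log N x y" using M p by (simp add: trunc_log_def lp del: max.bounded_iff)
  have "ln (exp (- N) * ?p x y) \<le> ln (?M x y)" using p M by (subst ln_le_cancel_iff) auto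
  moreover have "ln (exp (- N) * ?p x y) = - N + ln (?p x y)" using p[of x y] by (subst ln_mult_pos) auto
  ultimately show "trunc_log N x y \<le> N" by (simp add: trunc_log_def lp)
  show "trunc_log N x y = trunc_log N y x" by (simp add: trunc_log_def norm_minus_commute mult.commute)
  {
    assume ne: "x \<noteq> y"
    then have "ln (norm (x - y)) \<le> ln (?M x y)" using M by (subst ln_le_cancel_iff) auto
    then show "trunc_log N x y \<le> pos_log x y" by (simp add: trunc_log_def pos_log_def log_kernel_def)
    assume le: "pos_log x y \<le> N"
    have "exp (- N) * ?p x y \<le> norm (x - y)"
    proof -
      have "?p x y / norm (x - y) \<le> exp N" using le exp_pos_log[OF ne] by (metis exp_le_cancel_iff)
      then show ?thesis using ne by (simp add: exp_minus field_simps)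
    qed
    then show "trunc_log N x y = pos_log x y" by (simp add: trunc_log_def pos_log_def log_kernel_def max_absorb1)
  }
  have "1 + norm x \<noteq> 0" for x :: 'a using norm_ge_zero[of x] by linarith
  moreover have "?M x y \<noteq> 0" for x y using M[of x y] by simp
  ultimately show "continuous_on UNIV (\<lambda>z::'a\<times>'a. trunc_log N (fst z) (snd z))"
    unfolding trunc_log_def by (intro continuous_intros ballI) blast+
qed

text \<open>Jensen with exponent \<beta>, integrated against the Gaussian with the integrals
  exchanged, bounds the integral of exp(\<beta> U) by \<open>C\<close>, since the kernel integral is
  bounded uniformly in y. Jensen with exponent \<beta> - \<alpha> at a fixed x leaves the product of
  exp((\<beta> - \<alpha>) g) and exp(\<alpha> U), which is at most exp(\<beta> g) + exp(\<beta> U),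
  and both summands have just been bounded. Neither bound involves the truncation level N.\<close>

lemma mean_field_a_priori:
  fixes w :: "'a::euclidean_space \<Rightarrow> real"
  assumes w[measurable]: "w \<in> borel_measurable borel" and w0: "\<And>x. 0 \<le> w x" and wB: "\<And>x. w x \<le> B * gauss x"
    and wi: "integrable lborel w" and I: "0 < (\<integral>x. w x \<partial>lborel)"
    and ab: "0 \<le> \<alpha>" "\<alpha> < \<beta>" and C: "0 < C" "\<And>y::'a. (\<integral>\<^sup>+x. ennreal (gauss x * exp (\<beta> * pos_log x y)) \<partial>lborel) \<le> ennreal C"
    and N: "0 \<le> N" and mf: "mean_field (density lborel w) \<alpha> (trunc_log N) U" and U: "\<And>x. 0 \<le> U x \<and> U x \<le> N"
  shows "(\<integral>\<^sup>+x. ennreal (gauss x * exp (\<beta> * U x)) \<partial>lborel) \<le> ennreal C"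
    and "(\<beta> - \<alpha>) * U x \<le> ln (2 * B * C / (\<integral>x. w x \<partial>lborel))"
proof -
  let ?\<nu> = "density lborel (\<lambda>x. ennreal (w x))"
  let ?g = "trunc_log N :: 'a \<Rightarrow> 'a \<Rightarrow> real"
  define I where "I = (\<integral>x. w x \<partial>lborel)"
  have Ipos: "0 < I" using assms by (simp add: I_def)
  have em: "emeasure ?\<nu> UNIV = ennreal I"
    using wi w0 by (simp add: emeasure_density I_def nn_integral_eq_integral)
  have fin: "finite_measure ?\<nu>" by (rule finite_measureI) (simp add: em)
  have sets: "sets ?\<nu> = sets borel" by simp
  have mI: "measure ?\<nu> UNIV = I" using em Ipos by (simp add: measure_def)
  have [measurable]: "U \<in> borel_measurable borel" using mf by (simp add: mean_field_def)
  have tm2[measurable]: "(\<lambda>z. ?g (fst z) (snd z)) \<in> borel_measurable (borel \<Otimes>\<^sub>M borel)"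
    using borel_measurable_continuous_onI[OF trunc_log_props(6)[OF N]] by (simp add: borel_prod)
  have tm[measurable]: "?g x \<in> borel_measurable borel" for x
    unfolding trunc_log_def by measurable
  have tm'[measurable]: "(\<lambda>x. ?g x y) \<in> borel_measurable borel" for y
    unfolding trunc_log_def by measurable
  have gb: "0 \<le> ?g x y \<and> ?g x y \<le> N" for x y using trunc_log_props(1,2)[OF N] by blast
  note J = mean_field_Jensen[OF fin sets _ mf U tm gb]
  have posn: "0 < measure ?\<nu> UNIV" using mI Ipos by simp
  define Z where "Z = (\<integral>y. exp (\<alpha> * U y) \<partial>?\<nu>)"
  have Z0: "0 < Z" using J(4)[OF posn] by (simp add: Z_def)
  have IZ: "I \<le> Z"
  proof -
    have i1: "integrable ?\<nu> (\<lambda>y. 1 :: real)" using fin by (simp add: finite_measure.integrable_const)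
    have "(\<integral>y. 1 \<partial>?\<nu>) \<le> Z" unfolding Z_def
      using J(3)[OF posn] U ab(1) by (intro integral_mono i1) auto
    then show ?thesis using mI by simp
  qed
  have trunc_le: "AE x in lborel. ?g x y \<le> pos_log x y" for y
    using AE_lborel_singleton[of y] by (rule eventually_mono) (rule trunc_log_props(4)[OF N])
  have gC: "(\<integral>\<^sup>+x. ennreal (gauss x * exp (\<beta> * ?g x y)) \<partial>lborel) \<le> ennreal C" for y
  proof -
    have "(\<integral>\<^sup>+x. ennreal (gauss x * exp (\<beta> * ?g x y)) \<partial>lborel) \<le> (\<integral>\<^sup>+x. ennreal (gauss x * exp (\<beta> * pos_log x y)) \<partial>lborel)"
      using trunc_le[of y] ab by (intro nn_integral_mono_AE) (auto elim!: eventually_mono intro!: ennreal_leI simp: gauss_def)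
    with C(2)[of y] show ?thesis by (rule order_trans[rotated])
  qed
  have nu_nn: "(\<integral>\<^sup>+y. h y \<partial>?\<nu>) = (\<integral>\<^sup>+y. ennreal (w y) * h y \<partial>lborel)" if "h \<in> borel_measurable borel" for h
    using that by (intro nn_integral_density) auto
  have [measurable]: "(gauss :: 'a \<Rightarrow> real) \<in> borel_measurable borel" unfolding gauss_def by measurable
  \<comment> \<open>Rewritten with extended nonnegative integrals, so that the order of integration
    can be exchanged by Tonelli's theorem.\<close>
  have Jn: "ennreal (exp (\<gamma> * U x)) * ennreal Z \<le> (\<integral>\<^sup>+y. ennreal (exp (\<gamma> * ?g x y) * exp (\<alpha> * U y)) \<partial>?\<nu>)" for \<gamma> x
  proof -
    have "(\<integral>\<^sup>+y. ennreal (exp (\<gamma> * ?g x y) * exp (\<alpha> * U y)) \<partial>?\<nu>) = ennreal (\<integral>y. exp (\<gamma> * ?g x y) * exp (\<alpha> * U y) \<partial>?\<nu>)"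
      by (rule nn_integral_eq_integral[OF J(2)[OF posn]]) auto
    moreover have "ennreal (exp (\<gamma> * U x)) * ennreal Z = ennreal (exp (\<gamma> * U x) * Z)"
      using Z0 by (simp add: ennreal_mult)
    ultimately show ?thesis using J(1)[OF posn, of \<gamma> x] by (simp add: Z_def ennreal_leI)
  qed
  have ZE: "(\<integral>\<^sup>+y. ennreal (w y) * ennreal (exp (\<alpha> * U y)) \<partial>lborel) = ennreal Z"
    using nu_nn[of "\<lambda>y. ennreal (exp (\<alpha> * U y))"] nn_integral_eq_integral[OF J(3)[OF posn]] by (simp add: Z_def)
  show first: "(\<integral>\<^sup>+x. ennreal (gauss x * exp (\<beta> * U x)) \<partial>lborel) \<le> ennreal C"
  proof -
    have "(\<integral>\<^sup>+x. ennreal (gauss x * exp (\<beta> * U x)) \<partial>lborel) * ennreal Z =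
        (\<integral>\<^sup>+x. ennreal (gauss x) * (ennreal (exp (\<beta> * U x)) * ennreal Z) \<partial>lborel)"
      by (subst nn_integral_multc[symmetric]) (auto simp: ennreal_mult gauss_def mult.assoc)
    also have "\<dots> \<le> (\<integral>\<^sup>+x. ennreal (gauss x) * (\<integral>\<^sup>+y. ennreal (w y) * ennreal (exp (\<beta> * ?g x y) * exp (\<alpha> * U y)) \<partial>lborel) \<partial>lborel)"
      using Jn[of \<beta>] by (subst (asm) nu_nn) (auto intro!: nn_integral_mono mult_left_mono)
    also have "\<dots> = (\<integral>\<^sup>+x. \<integral>\<^sup>+y. ennreal (gauss x * exp (\<beta> * ?g x y)) * (ennreal (w y) * ennreal (exp (\<alpha> * U y))) \<partial>lborel \<partial>lborel)"
      by (subst nn_integral_cmult[symmetric]) (auto simp: ennreal_mult gauss_def mult_ac intro!: nn_integral_cong)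
    also have "\<dots> = (\<integral>\<^sup>+y. \<integral>\<^sup>+x. ennreal (gauss x * exp (\<beta> * ?g x y)) * (ennreal (w y) * ennreal (exp (\<alpha> * U y))) \<partial>lborel \<partial>lborel)"
      by (rule lborel_pair.Fubini'[symmetric]) (use tm2 in \<open>simp add: case_prod_unfold\<close>, measurable)
    also have "\<dots> = (\<integral>\<^sup>+y. (\<integral>\<^sup>+x. ennreal (gauss x * exp (\<beta> * ?g x y)) \<partial>lborel) * (ennreal (w y) * ennreal (exp (\<alpha> * U y))) \<partial>lborel)"
    proof (rule nn_integral_cong)
      fix y
      show "(\<integral>\<^sup>+x. ennreal (gauss x * exp (\<beta> * ?g x y)) * (ennreal (w y) * ennreal (exp (\<alpha> * U y))) \<partial>lborel) =
        (\<integral>\<^sup>+x. ennreal (gauss x * exp (\<beta> * ?g x y)) \<partial>lborel) * (ennreal (w y) * ennreal (exp (\<alpha> * U y)))"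
        by (intro nn_integral_multc) measurable
    qed
    also have "\<dots> \<le> (\<integral>\<^sup>+y. ennreal C * (ennreal (w y) * ennreal (exp (\<alpha> * U y))) \<partial>lborel)"
      by (intro nn_integral_mono mult_right_mono gC) auto
    also have "\<dots> = ennreal C * ennreal Z"
      by (subst nn_integral_cmult) (auto simp: ZE)
    finally show ?thesis using Z0
      by (subst (asm) (2) mult.commute, subst (asm) mult.commute) (simp add: ennreal_mult_le_mult_iff)
  qed
  show "(\<beta> - \<alpha>) * U x \<le> ln (2 * B * C / (\<integral>x. w x \<partial>lborel))"
  proof -
    have B0: "0 \<le> B * gauss z" for z :: 'a using w0[of z] wB[of z] by linarith
    then have Bn: "0 \<le> B" using B0[of 0] by (simp add: gauss_def)
    have "ennreal (exp ((\<beta> - \<alpha>) * U x)) * ennreal Z \<le>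
        (\<integral>\<^sup>+y. ennreal (w y) * ennreal (exp ((\<beta> - \<alpha>) * ?g x y) * exp (\<alpha> * U y)) \<partial>lborel)"
      using Jn[of "\<beta> - \<alpha>" x] by (subst (asm) nu_nn) auto
    also have "\<dots> \<le> (\<integral>\<^sup>+y. ennreal B * (ennreal (gauss y * exp (\<beta> * ?g y x)) + ennreal (gauss y * exp (\<beta> * U y))) \<partial>lborel)"
    proof (rule nn_integral_mono)
      fix y
      \<comment> \<open>The exponent (\<beta> - \<alpha>) a + \<alpha> b is at most \<beta> max(a,
        b); the cases decide which of the two is larger.\<close>
      have "exp ((\<beta> - \<alpha>) * ?g x y) * exp (\<alpha> * U y) \<le> exp (\<beta> * ?g x y) + exp (\<beta> * U y)"
      proof (cases "?g x y \<le> U y")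
        case True
        then have "(\<beta> - \<alpha>) * ?g x y \<le> (\<beta> - \<alpha>) * U y" using ab by (intro mult_left_mono) auto
        then have "(\<beta> - \<alpha>) * ?g x y + \<alpha> * U y \<le> \<beta> * U y" by (simp add: algebra_simps)
        then have "exp ((\<beta> - \<alpha>) * ?g x y + \<alpha> * U y) \<le> exp (\<beta> * U y)" by simp
        then show ?thesis unfolding exp_add using exp_gt_zero[of "\<beta> * ?g x y"] by linarith
      next
        case False
        then have "\<alpha> * U y \<le> \<alpha> * ?g x y" using ab by (intro mult_left_mono) auto
        then have "(\<beta> - \<alpha>) * ?g x y + \<alpha> * U y \<le> \<beta> * ?g x y" by (simp add: algebra_simps)
        then have "exp ((\<beta> - \<alpha>) * ?g x y + \<alpha> * U y) \<le> exp (\<beta> * ?g x y)" by simp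
        then show ?thesis unfolding exp_add using exp_gt_zero[of "\<beta> * U y"] by linarith
      qed
      then have "w y * (exp ((\<beta> - \<alpha>) * ?g x y) * exp (\<alpha> * U y)) \<le> (B * gauss y) * (exp (\<beta> * ?g x y) + exp (\<beta> * U y))"
        using w0[of y] wB[of y] B0[of y] by (intro mult_mono) auto
      also have "\<dots> = B * (gauss y * exp (\<beta> * ?g y x) + gauss y * exp (\<beta> * U y))"
        using trunc_log_props(3)[OF N, of x y] by (simp add: algebra_simps)
      finally have "ennreal (w y * (exp ((\<beta> - \<alpha>) * ?g x y) * exp (\<alpha> * U y))) \<le>
          ennreal (B * (gauss y * exp (\<beta> * ?g y x) + gauss y * exp (\<beta> * U y)))" by (rule ennreal_leI)
      then show "ennreal (w y) * ennreal (exp ((\<beta> - \<alpha>) * ?g x y) * exp (\<alpha> * U y)) \<le>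
          ennreal B * (ennreal (gauss y * exp (\<beta> * ?g y x)) + ennreal (gauss y * exp (\<beta> * U y)))"
        using w0[of y] Bn by (simp add: ennreal_mult[symmetric] ennreal_plus[symmetric] gauss_def del: ennreal_plus)
    qed
    also have "\<dots> = ennreal B * ((\<integral>\<^sup>+y. ennreal (gauss y * exp (\<beta> * ?g y x)) \<partial>lborel) + (\<integral>\<^sup>+y. ennreal (gauss y * exp (\<beta> * U y)) \<partial>lborel))"
      by (subst nn_integral_cmult, measurable, subst nn_integral_add, measurable)
    also have "\<dots> \<le> ennreal B * (ennreal C + ennreal C)"
      by (intro mult_left_mono add_mono gC first) auto
    also have "\<dots> = ennreal (2 * B * C)"
      using Bn C(1) by (simp add: ennreal_mult[symmetric] ennreal_plus[symmetric] del: ennreal_plus)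
    finally have "ennreal (exp ((\<beta> - \<alpha>) * U x) * Z) \<le> ennreal (2 * B * C)"
      using Z0 by (simp add: ennreal_mult)
    then have le: "exp ((\<beta> - \<alpha>) * U x) * Z \<le> 2 * B * C" using Bn C(1) by (subst (asm) ennreal_le_iff) auto
    have "exp ((\<beta> - \<alpha>) * U x) * I \<le> exp ((\<beta> - \<alpha>) * U x) * Z" using IZ by (intro mult_left_mono) auto
    also note le
    finally have "exp ((\<beta> - \<alpha>) * U x) \<le> 2 * B * C / I" using Ipos by (simp only: pos_le_divide_eq)
    then have "ln (exp ((\<beta> - \<alpha>) * U x)) \<le> ln (2 * B * C / I)"
      by (subst ln_le_cancel_iff) (auto intro: less_le_trans[OF exp_gt_zero])
    then show ?thesis by (simp add: I_def)
  qed
qed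

lemma decaying_weight:
  fixes w :: "'a::euclidean_space \<Rightarrow> real"
  assumes w[measurable]: "w \<in> borel_measurable borel" and wB: "\<And>x. \<bar>w x\<bar> \<le> B * gauss x"
  shows "decaying w" and "integrable lborel w"
proof -
  have B: "0 \<le> B" using wB[of 0] by (simp add: gauss_def)
  have g: "integrable lborel (\<lambda>y::'a. (1 + norm y) * gauss y)"
  proof (rule integrableI_nonneg)
    have "(\<integral>\<^sup>+y. ennreal ((1 + norm (y::'a)) * gauss y) \<partial>lborel) =
        (\<integral>\<^sup>+y. ennreal ((1 + norm (y::'a)) powr 1 * exp (- (norm y)\<^sup>2)) \<partial>lborel)"
      by (simp add: gauss_def less_imp_le)
    also have "\<dots> < \<infinity>" by (rule nn_integral_gaussian_finite) simp
    finally show "(\<integral>\<^sup>+y. ennreal ((1 + norm (y::'a)) * gauss y) \<partial>lborel) < \<infinity>" .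
  qed (auto simp: gauss_def)
  have le: "(1 + norm y) * \<bar>w y\<bar> \<le> B * ((1 + norm y) * gauss y)" for y
    using mult_left_mono[OF wB, of "1 + norm y" y] by (simp add: mult_ac less_imp_le)
  have gi: "integrable lborel (\<lambda>y. B * ((1 + norm y) * gauss (y::'a)))" by (intro integrable_mult_right g)
  have d: "integrable lborel (\<lambda>y. (1 + norm y) * \<bar>w y\<bar>)"
  proof (rule Bochner_Integration.integrable_bound[OF gi])
    show "AE y in lborel. norm ((1 + norm y) * \<bar>w y\<bar>) \<le> norm (B * ((1 + norm y) * gauss y))"
      using le B by (intro AE_I2) (simp add: abs_mult gauss_def)
  qed measurable
  have "gauss y \<le> 1" for y :: 'a by (simp add: gauss_def)
  then have "\<bar>w y\<bar> \<le> B" for y using wB[of y] mult_left_mono[of "gauss y" 1 B] B by fastforce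
  then show "decaying w" unfolding decaying_def using d w by blast
  show "integrable lborel w"
  proof (rule Bochner_Integration.integrable_bound[OF d])
    show "AE y in lborel. norm (w y) \<le> norm ((1 + norm y) * \<bar>w y\<bar>)"
      by (intro AE_I2) (simp add: abs_mult distrib_right)
  qed measurable
qed

text \<open>Solutions for the kernels truncated at n obey bounds independent of n: a common upper
  bound, which permits the passage to the limit, and the exponential bound, which survives by
  Fatou's lemma. The truncated kernels converge in mean because \<open>pos_log\<close> dominates
  them and is integrable against the weight.\<close>

theorem log_mean_field_exists:
  fixes w :: "'a::euclidean_space \<Rightarrow> real"
  assumes dim: "2 \<le> DIM('a)"
    and w[measurable]: "w \<in> borel_measurable borel" and w0: "\<And>x. 0 \<le> w x" and wB: "\<And>x. w x \<le> B * gauss x"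
    and Ipos: "0 < (\<integral>x. w x \<partial>lborel)"
    and ab: "0 \<le> \<alpha>" "\<alpha> < \<beta>" and C: "0 < C" "\<And>y::'a. (\<integral>\<^sup>+x. ennreal (gauss x * exp (\<beta> * pos_log x y)) \<partial>lborel) \<le> ennreal C"
  obtains U where "mean_field (density lborel w) \<alpha> pos_log U" "\<And>x. 0 \<le> U x"
    "\<And>x. (\<beta> - \<alpha>) * U x \<le> ln (2 * B * C / (\<integral>x. w x \<partial>lborel))"
    "(\<integral>\<^sup>+x. ennreal (gauss x * exp (\<beta> * U x)) \<partial>lborel) \<le> ennreal C"
proof -
  let ?\<nu> = "density lborel (\<lambda>x. ennreal (w x))"
  define I where "I = (\<integral>x. w x \<partial>lborel)"
  have wabs: "\<bar>w x\<bar> \<le> B * gauss x" for x using w0[of x] wB[of x] by simp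
  have dec: "decaying w" and wi: "integrable lborel w" using decaying_weight[OF w wabs] by auto
  have em: "emeasure ?\<nu> UNIV = ennreal I"
    using wi w0 by (simp add: emeasure_density I_def nn_integral_eq_integral)
  have fin: "finite_measure ?\<nu>" by (rule finite_measureI) (simp add: em)
  have sets: "sets ?\<nu> = sets borel" by simp
  have pos: "0 < measure ?\<nu> UNIV" using em Ipos by (simp add: measure_def I_def)
  have [measurable]: "(gauss :: 'a \<Rightarrow> real) \<in> borel_measurable borel" unfolding gauss_def by measurable
  let ?g = "\<lambda>n. trunc_log (real n) :: 'a \<Rightarrow> 'a \<Rightarrow> real"
  have tm[measurable]: "?g n x \<in> borel_measurable borel" for n x
    unfolding trunc_log_def by measurable
  have "\<exists>U. mean_field ?\<nu> \<alpha> (?g n) U \<and> (\<forall>x. 0 \<le> U x \<and> U x \<le> real n)" for n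
  proof -
    have n0: "0 \<le> real n" by simp
    show ?thesis
      by (rule mean_field_bounded_kernel[OF fin sets pos ab(1) trunc_log_props(3)[OF n0] trunc_log_props(1)[OF n0]
            trunc_log_props(2)[OF n0] trunc_log_props(6)[OF n0]]) blast
  qed
  then obtain U where U: "\<And>n. mean_field ?\<nu> \<alpha> (?g n) (U n)" "\<And>n x. 0 \<le> U n x \<and> U n x \<le> real n" by metis
  have n0: "0 \<le> real n" for n by simp
  note ap = mean_field_a_priori[OF w w0 wB wi Ipos ab C n0 U(1) U(2)]
  \<comment> \<open>Unlike the bound n with which the n-th solution was constructed,
    \<open>M\<close> does not depend on the truncation.\<close>
  define M where "M = ln (2 * B * C / I) / (\<beta> - \<alpha>)"
  have UM: "0 \<le> U n x \<and> U n x \<le> M" for n x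
    using ap(2)[of n x] U(2)[of n x] ab by (simp add: M_def I_def field_simps)
  have nui: "integrable ?\<nu> h \<longleftrightarrow> integrable lborel (\<lambda>y. w y * h y)"
    and nuI: "(\<integral>y. h y \<partial>?\<nu>) = (\<integral>y. w y * h y \<partial>lborel)" if "h \<in> borel_measurable borel" for h :: "'a \<Rightarrow> real"
    using that w0 by (auto simp: integrable_density integral_density)
  have Gint: "integrable ?\<nu> (pos_log x)" for x
  proof -
    have "integrable lborel (\<lambda>y. w y * pos_log x y)"
    proof (rule integrableI_nonneg)
      have \<beta>: "0 < \<beta>" using ab by linarith
      have B: "0 \<le> B" using w0[of 0] wB[of 0] by (simp add: gauss_def)
      have "(\<integral>\<^sup>+y. ennreal (w y * pos_log x y) \<partial>lborel) \<le> (\<integral>\<^sup>+y. ennreal (B / \<beta>) * ennreal (gauss y * exp (\<beta> * pos_log y x)) \<partial>lborel)"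
      proof (rule nn_integral_mono)
        fix y
        \<comment> \<open>The inequality t \<le> exp(\<beta> t)/\<beta> reduces integrability of the
          kernel to its exponential bound.\<close>
        have "\<beta> * pos_log x y \<le> exp (\<beta> * pos_log x y)"
          using exp_ge_add_one_self[of "\<beta> * pos_log x y"] by linarith
        then have "pos_log x y \<le> exp (\<beta> * pos_log y x) / \<beta>" using \<beta> by (simp add: field_simps pos_log_sym)
        then have "w y * pos_log x y \<le> B * gauss y * (exp (\<beta> * pos_log y x) / \<beta>)"
          using w0[of y] wB[of y] pos_log_nonneg[of x y] by (intro mult_mono) auto
        also have "\<dots> = (B / \<beta>) * (gauss y * exp (\<beta> * pos_log y x))" by simp
        finally have "ennreal (w y * pos_log x y) \<le> ennreal ((B / \<beta>) * (gauss y * exp (\<beta> * pos_log y x)))" by (rule ennreal_leI)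
        then show "ennreal (w y * pos_log x y) \<le> ennreal (B / \<beta>) * ennreal (gauss y * exp (\<beta> * pos_log y x))"
          using B \<beta> by (simp add: ennreal_mult[symmetric] gauss_def)
      qed
      also have "\<dots> = ennreal (B / \<beta>) * (\<integral>\<^sup>+y. ennreal (gauss y * exp (\<beta> * pos_log y x)) \<partial>lborel)"
        by (rule nn_integral_cmult) (unfold pos_log_def, measurable)
      also have "\<dots> \<le> ennreal (B / \<beta>) * ennreal C" by (intro mult_left_mono C(2)) auto
      also have "\<dots> < \<infinity>" by (simp add: ennreal_mult_less_top)
      finally show "(\<integral>\<^sup>+y. ennreal (w y * pos_log x y) \<partial>lborel) < \<infinity>" .
    qed (use w0 pos_log_nonneg in \<open>auto intro!: mult_nonneg_nonneg\<close>)
    then show ?thesis by (simp add: nui)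
  qed
  have "norm (?g n x y) \<le> real n" for n x y
    using trunc_log_props(1,2)[OF n0[of n], of x y] by simp
  then have gint: "integrable ?\<nu> (?g n x)" for n x
    by (intro finite_measure.integrable_const_bound[OF fin, of _ "real n"] AE_I2) auto
  have AEne: "AE y in ?\<nu>. y \<noteq> x" for x
    using AE_lborel_singleton[of x] by (subst AE_density) (auto elim: eventually_mono)
  have conv: "(\<lambda>n. \<integral>y. \<bar>?g n x y - pos_log x y\<bar> \<partial>?\<nu>) \<longlonglongrightarrow> 0" for x
  proof -
    have "(\<lambda>n. \<integral>y. \<bar>?g n x y - pos_log x y\<bar> \<partial>?\<nu>) \<longlonglongrightarrow> (\<integral>y. 0 \<partial>?\<nu>)"
    proof (rule integral_dominated_convergence[where w="pos_log x"])
      show "AE y in ?\<nu>. (\<lambda>n. \<bar>?g n x y - pos_log x y\<bar>) \<longlonglongrightarrow> 0"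
        using AEne[of x]
      proof (rule eventually_mono)
        fix y assume "y \<noteq> x"
        obtain n1 where n1: "pos_log x y \<le> real n1" using real_arch_simple by blast
        have "\<bar>?g n x y - pos_log x y\<bar> = 0" if "n \<ge> n1" for n
          using trunc_log_props(5)[OF n0[of n], of x y] \<open>y \<noteq> x\<close> n1 that by fastforce
        then show "(\<lambda>n. \<bar>?g n x y - pos_log x y\<bar>) \<longlonglongrightarrow> 0"
          by (intro tendsto_eventually eventually_sequentiallyI[of n1])
      qed
      show "AE y in ?\<nu>. norm \<bar>?g n x y - pos_log x y\<bar> \<le> pos_log x y" for n
        using AEne[of x]
      proof (rule eventually_mono)
        fix y assume "y \<noteq> x"
        then show "norm \<bar>?g n x y - pos_log x y\<bar> \<le> pos_log x y"
          using trunc_log_props(1)[OF n0[of n], of x y] trunc_log_props(4)[OF n0[of n], of x y]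
          by (simp add: abs_if)
      qed
    qed (use Gint in auto)
    then show ?thesis by simp
  qed
  \<comment> \<open>The term ln(1 + |y|) cancels in the difference. The term ln(1 + |x|) contributes
    its increment times the mass of the weight, and the rest is a difference of translates of the
    logarithm.\<close>
  have cont: "(\<lambda>n. \<integral>y. \<bar>pos_log (X n) y - pos_log x y\<bar> \<partial>?\<nu>) \<longlonglongrightarrow> 0" if X: "X \<longlonglongrightarrow> x" for x X
  proof (rule Lim_null_comparison)
    let ?a = "\<lambda>n. \<bar>ln (1 + norm (X n)) - ln (1 + norm x)\<bar>"
    let ?k = "\<lambda>n y. \<bar>log_kernel (X n - y) - log_kernel (x - y)\<bar> * \<bar>w y\<bar>"
    have "(\<lambda>n. ln (1 + norm (X n)) - ln (1 + norm x)) \<longlonglongrightarrow> ln (1 + norm x) - ln (1 + norm x)"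
      using one_plus_norm_pos[of x] by (intro tendsto_intros X) linarith
    then have "?a \<longlonglongrightarrow> 0" by (simp add: tendsto_rabs_zero)
    then have "(\<lambda>n. I * ?a n + (\<integral>y. ?k n y \<partial>lborel)) \<longlonglongrightarrow> I * 0 + 0"
      by (intro tendsto_intros sing_kernel_L1_continuous[OF sing_kernel_log[OF dim] dec X])
    then show "(\<lambda>n. I * ?a n + (\<integral>y. ?k n y \<partial>lborel)) \<longlonglongrightarrow> 0" by simp
    have "norm (\<integral>y. \<bar>pos_log (X n) y - pos_log x y\<bar> \<partial>?\<nu>) \<le> I * ?a n + (\<integral>y. ?k n y \<partial>lborel)" for n
    proof -
      have ki: "integrable lborel (?k n)"
        using integrable_norm[OF Bochner_Integration.integrable_diff[OF
              conv_integrable[OF sing_kernel_log[OF dim] dec, of "X n"] conv_integrable[OF sing_kernel_log[OF dim] dec, of x]]]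
        by (simp add: left_diff_distrib[symmetric] abs_mult)
      have "norm (\<integral>y. \<bar>pos_log (X n) y - pos_log x y\<bar> \<partial>?\<nu>) = (\<integral>y. w y * \<bar>pos_log (X n) y - pos_log x y\<bar> \<partial>lborel)"
        by (subst nuI[symmetric]) auto
      also have "\<dots> \<le> (\<integral>y. ?a n * w y + ?k n y \<partial>lborel)"
      proof (rule integral_mono)
        show "integrable lborel (\<lambda>y. w y * \<bar>pos_log (X n) y - pos_log x y\<bar>)"
          by (subst nui[symmetric]) (use Gint in auto)
        show "integrable lborel (\<lambda>y. ?a n * w y + ?k n y)"
          by (intro Bochner_Integration.integrable_add integrable_mult_right wi ki)
        fix y
        have "\<bar>pos_log (X n) y - pos_log x y\<bar> \<le> ?a n + \<bar>log_kernel (X n - y) - log_kernel (x - y)\<bar>"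
          unfolding pos_log_def by linarith
        from mult_left_mono[OF this w0[of y]] w0[of y]
        show "w y * \<bar>pos_log (X n) y - pos_log x y\<bar> \<le> ?a n * w y + ?k n y" by (simp add: algebra_simps)
      qed
      also have "\<dots> = I * ?a n + (\<integral>y. ?k n y \<partial>lborel)"
        using wi ki by (subst Bochner_Integration.integral_add) (auto simp: I_def)
      finally show ?thesis .
    qed
    then show "\<forall>\<^sub>F n in sequentially. norm (\<integral>y. \<bar>pos_log (X n) y - pos_log x y\<bar> \<partial>?\<nu>) \<le> I * ?a n + (\<integral>y. ?k n y \<partial>lborel)"
      by (intro always_eventually allI)
  qed
  show ?thesis
  proof (rule mean_field_limit[OF fin sets pos ab(1) U(1) UM Gint gint conv cont])
  fix r :: "nat \<Rightarrow> nat" and V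
  assume r: "strict_mono r" and V: "\<And>x. (\<lambda>n. U (r n) x) \<longlonglongrightarrow> V x"
    and mf: "mean_field ?\<nu> \<alpha> pos_log V" and VM: "\<And>x. 0 \<le> V x \<and> V x \<le> M"
  have [measurable]: "U n \<in> borel_measurable borel" for n using U(1)[of n] by (simp add: mean_field_def)
  \<comment> \<open>Fatou's lemma along the subsequence.\<close>
  have "(\<integral>\<^sup>+x. ennreal (gauss x * exp (\<beta> * V x)) \<partial>lborel) =
      (\<integral>\<^sup>+x. liminf (\<lambda>n. ennreal (gauss x * exp (\<beta> * U (r n) x))) \<partial>lborel)"
  proof (rule nn_integral_cong)
    fix x
    have "(\<lambda>n. ennreal (gauss x * exp (\<beta> * U (r n) x))) \<longlonglongrightarrow> ennreal (gauss x * exp (\<beta> * V x))"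
      by (intro tendsto_ennrealI tendsto_intros V)
    from lim_imp_Liminf[OF _ this] show "ennreal (gauss x * exp (\<beta> * V x)) = liminf (\<lambda>n. ennreal (gauss x * exp (\<beta> * U (r n) x)))"
      by simp
  qed
  also have "\<dots> \<le> liminf (\<lambda>n. \<integral>\<^sup>+x. ennreal (gauss x * exp (\<beta> * U (r n) x)) \<partial>lborel)"
    by (rule nn_integral_liminf) measurable
  also have "\<dots> \<le> liminf (\<lambda>n. ennreal C)" by (intro Liminf_mono always_eventually allI ap(1))
  also have "\<dots> = ennreal C" by (simp add: Liminf_const)
  finally have VC: "(\<integral>\<^sup>+x. ennreal (gauss x * exp (\<beta> * V x)) \<partial>lborel) \<le> ennreal C" .
  have VL: "(\<beta> - \<alpha>) * V x \<le> ln (2 * B * C / (\<integral>x. w x \<partial>lborel))" for x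
    using VM[of x] ab by (simp add: M_def I_def field_simps)
  show thesis by (rule that[OF mf _ VL VC]) (use VM in blast)
  qed
qed

section \<open>Construction of solutions\<close>

text \<open>Fubini's theorem moves the convolution from \<open>f\<close> to the test function, where
  the fundamental solution evaluates it pointwise. The exchange is justified by the linear bound for
  the absolute convolution, multiplied by a compactly supported factor.\<close>

lemma weak_log_potential:
  fixes f \<psi> :: "'a::euclidean_space \<Rightarrow> real"
  assumes dim: "DIM('a) = 2 * m" and m: "m \<ge> 1" and f: "decaying f" and \<psi>: "smooth_on UNIV \<psi>"
    and K: "compact K" "\<And>x. x \<notin> K \<Longrightarrow> \<psi> x = 0"
  shows "(\<integral>x. conv log_kernel f x * (neg_laplacian ^^ m) \<psi> x \<partial>lborel) = Lambda1 m / 2 * (\<integral>y. f y * \<psi> y \<partial>lborel)"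
proof -
  define \<eta> where "\<eta> = (neg_laplacian ^^ m) \<psi>"
  have \<eta>: "\<eta> z = (-1) ^ m * (laplacian ^^ m) \<psi> z" for z
    unfolding \<eta>_def by (rule neg_laplacian_power[OF open_UNIV \<psi>]) simp
  have c\<eta>: "continuous_on UNIV \<eta>"
    unfolding \<eta>[abs_def] by (intro continuous_intros smooth_on_continuous_on[OF smooth_on_laplacian_power[OF open_UNIV \<psi>]])
  have z\<eta>: "\<eta> z = 0" if "z \<notin> K" for z
    using laplacian_power_zero_outside[OF K that] by (simp add: \<eta>)
  have d\<eta>: "decaying \<eta>" by (rule decaying_compact_support[OF c\<eta> K(1) z\<eta>])
  have [measurable]: "f \<in> borel_measurable borel" "\<eta> \<in> borel_measurable borel"
    using f d\<eta> by (auto simp: decaying_def)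
  have dim2: "2 \<le> DIM('a)" using dim m by simp
  note sk = sing_kernel_log[OF dim2]
  obtain A where A': "0 \<le> A" "\<And>x. integrable lborel (\<lambda>y. log_kernel (x - y) * f y)"
    "\<And>x. (\<integral>y. \<bar>log_kernel (x - y) * f y\<bar> \<partial>lborel) \<le> A * (1 + norm x)"
    using conv_bound[OF sk f] by blast
  note A = A'(1,3)
  have int: "integrable (lborel \<Otimes>\<^sub>M lborel) (\<lambda>(x, y). log_kernel (x - y) * f y * \<eta> x)"
  proof (rule lborel_pair.Fubini_integrable)
    show "(\<lambda>(x, y). log_kernel (x - y) * f y * \<eta> x) \<in> borel_measurable (lborel \<Otimes>\<^sub>M lborel)" by measurable
    have eq: "(\<integral>y. norm (case (x, y) of (x, y) \<Rightarrow> log_kernel (x - y) * f y * \<eta> x) \<partial>lborel) =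
        (\<integral>y. \<bar>log_kernel (x - y) * f y\<bar> \<partial>lborel) * \<bar>\<eta> x\<bar>" for x
      by (simp add: abs_mult)
    have "integrable lborel (\<lambda>x. (\<integral>y. \<bar>log_kernel (x - y) * f y\<bar> \<partial>lborel) * \<bar>\<eta> x\<bar>)"
    proof (rule Bochner_Integration.integrable_bound)
      show "integrable lborel (\<lambda>x. A * ((1 + norm x) * \<bar>\<eta> x\<bar>))"
        using d\<eta> by (intro integrable_mult_right) (simp add: decaying_def)
      have "(\<lambda>x. \<integral>y. \<bar>log_kernel (x - y) * f y\<bar> \<partial>lborel) \<in> borel_measurable (lborel :: 'a measure)"
        by (rule lborel.borel_measurable_lebesgue_integral) measurable
      then show "(\<lambda>x. (\<integral>y. \<bar>log_kernel (x - y) * f y\<bar> \<partial>lborel) * \<bar>\<eta> x\<bar>) \<in> borel_measurable lborel" by measurable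
      show "AE x in lborel. norm ((\<integral>y. \<bar>log_kernel (x - y) * f y\<bar> \<partial>lborel) * \<bar>\<eta> x\<bar>) \<le> norm (A * ((1 + norm x) * \<bar>\<eta> x\<bar>))"
      proof (rule AE_I2)
        fix x :: 'a
        have "0 \<le> (\<integral>y. \<bar>log_kernel (x - y) * f y\<bar> \<partial>lborel)" by simp
        moreover have "(\<integral>y. \<bar>log_kernel (x - y) * f y\<bar> \<partial>lborel) * \<bar>\<eta> x\<bar> \<le> A * (1 + norm x) * \<bar>\<eta> x\<bar>"
          by (intro mult_right_mono A) auto
        ultimately show "norm ((\<integral>y. \<bar>log_kernel (x - y) * f y\<bar> \<partial>lborel) * \<bar>\<eta> x\<bar>) \<le> norm (A * ((1 + norm x) * \<bar>\<eta> x\<bar>))"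
          using A(1) by (simp add: abs_mult mult.assoc)
      qed
    qed
    then show "integrable lborel (\<lambda>x. \<integral>y. norm (case (x, y) of (x, y) \<Rightarrow> log_kernel (x - y) * f y * \<eta> x) \<partial>lborel)"
      unfolding eq .
    show "AE x in lborel. integrable lborel (\<lambda>y. case (x, y) of (x, y) \<Rightarrow> log_kernel (x - y) * f y * \<eta> x)"
      using conv_integrable[OF sk f] by (intro AE_I2) simp
  qed
  have "(\<integral>x. conv log_kernel f x * \<eta> x \<partial>lborel) = (\<integral>x. \<integral>y. log_kernel (x - y) * f y * \<eta> x \<partial>lborel \<partial>lborel)"
    by (simp add: conv_def)
  also have "\<dots> = (\<integral>y. \<integral>x. log_kernel (x - y) * f y * \<eta> x \<partial>lborel \<partial>lborel)"
    by (rule lborel_pair.Fubini_integral[OF int, symmetric])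
  also have "\<dots> = (\<integral>y. f y * (\<integral>x. log_kernel (x - y) * \<eta> x \<partial>lborel) \<partial>lborel)"
  proof (rule Bochner_Integration.integral_cong[OF refl])
    fix y
    have "(\<lambda>x. log_kernel (x - y) * f y * \<eta> x) = (\<lambda>x. f y * (log_kernel (x - y) * \<eta> x))" by (simp add: mult_ac)
    then show "(\<integral>x. log_kernel (x - y) * f y * \<eta> x \<partial>lborel) = f y * (\<integral>x. log_kernel (x - y) * \<eta> x \<partial>lborel)" by simp
  qed
  also have "\<dots> = (\<integral>y. f y * (Lambda1 m / 2 * \<psi> y) \<partial>lborel)"
  proof -
    have "(\<integral>x. log_kernel (x - y) * \<eta> x \<partial>lborel) = Lambda1 m / 2 * \<psi> y" for y
      unfolding \<eta>_def by (rule log_kernel_fundamental_solution[OF dim m \<psi> K])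
    then show ?thesis by (simp only:)
  qed
  also have "\<dots> = (\<integral>y. Lambda1 m / 2 * (f y * \<psi> y) \<partial>lborel)" by (simp only: mult.left_commute)
  also have "\<dots> = Lambda1 m / 2 * (\<integral>y. f y * \<psi> y \<partial>lborel)" by simp
  finally show ?thesis by (simp add: \<eta>_def)
qed

lemma AE_lebesgueI: "AE x in lborel. P x \<Longrightarrow> AE x in lebesgue. P x"
  by (rule AE_completion)

text \<open>Against test functions the polyharmonic part \<open>h\<close> disappears by Green's
  identity, and the potential contributes t \<open>Lambda1 m / 2\<close> f, which the pointwise
  equation identifies with the nonlinearity. As \<open>V\<close> is only Lebesgue measurable, the
  computation runs with a function \<open>Vb\<close> that agrees with it almost everywhere. The
  factor t may be 0, which covers vanishing \<open>V\<close> together with u = 0.\<close>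

lemma liouville_solutionI:
  fixes u h f V Vb :: "'a::euclidean_space \<Rightarrow> real"
  assumes dim: "DIM('a) = 2 * m" and m: "m \<ge> 1" and \<Omega>: "open \<Omega>"
    and V: "V \<in> borel_measurable (lebesgue_on \<Omega>)" and VVb: "AE x in lebesgue. x \<in> \<Omega> \<longrightarrow> V x = Vb x"
    and h: "smooth_on \<Omega> h" "\<And>x. x \<in> \<Omega> \<Longrightarrow> (laplacian ^^ m) h x = 0"
    and f: "decaying f" "\<And>x. x \<notin> \<Omega> \<Longrightarrow> f x = 0"
    and u: "\<And>x. x \<in> \<Omega> \<Longrightarrow> u x = h x + t * conv log_kernel f x"
    and eq: "\<And>x. x \<in> \<Omega> \<Longrightarrow> Vb x * exp (2 * real m * u x) = t * (Lambda1 m / 2) * f x"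
  shows "liouville_solution m \<Omega> V u"
    and "set_integrable lebesgue \<Omega> (\<lambda>x. V x * exp (2 * real m * u x))"
    and "(LINT x:\<Omega>|lebesgue. V x * exp (2 * real m * u x)) = t * (Lambda1 m / 2) * (\<integral>x. f x \<partial>lborel)"
proof -
  let ?\<gamma> = "Lambda1 m / 2"
  have dim2: "2 \<le> DIM('a)" using dim m by simp
  have \<Omega>s: "\<Omega> \<in> sets lebesgue" "\<Omega> \<in> sets borel" using \<Omega> by auto
  have fm[measurable]: "f \<in> borel_measurable borel" using f by (simp add: decaying_def)
  have fi: "integrable lborel f"
  proof -
    have i: "integrable lborel (\<lambda>y. (1 + norm y) * \<bar>f y\<bar>)" using f by (simp add: decaying_def)
    show ?thesis
      by (rule Bochner_Integration.integrable_bound[OF i])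
        (auto intro!: AE_I2 simp: abs_mult distrib_right)
  qed
  have Cc: "Ck_on (2 * m - 1) \<Omega> (\<lambda>x. h x + t * conv log_kernel f x)"
    using Ck_on_conv_log[OF dim2 f(1)] unfolding dim
    by (intro Ck_on_add Ck_on_cmult \<Omega> smooth_onD[OF h(1)]) (auto intro: Ck_on_subset)
  then have Cu: "Ck_on (2 * m - 1) \<Omega> u" using Ck_on_cong[OF \<Omega>, of u "\<lambda>x. h x + t * conv log_kernel f x"] u by blast
  have cu: "continuous_on \<Omega> u" by (rule Ck_on_imp_continuous[OF Cu])
  have Vm: "(\<lambda>x. indicator \<Omega> x *\<^sub>R (V x * g x)) \<in> borel_measurable lebesgue" if g: "continuous_on \<Omega> g" for g
  proof -
    have "g \<in> borel_measurable (lebesgue_on \<Omega>)"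
      by (rule continuous_imp_measurable_on_sets_lebesgue[OF g \<Omega>s(1)])
    then have "(\<lambda>x. V x * g x) \<in> borel_measurable (lebesgue_on \<Omega>)" using V by simp
    then show ?thesis using \<Omega>s(1) by (subst (asm) borel_measurable_restrict_space_iff) auto
  qed
  \<comment> \<open>One statement for bounded continuous \<psi> serves twice: \<psi> = 1 gives the
    total mass, test functions give the weak equation.\<close>
  have main: "set_integrable lebesgue \<Omega> (\<lambda>x. V x * exp (2 * real m * u x) * \<psi> x) \<and>
      (LINT x:\<Omega>|lebesgue. V x * exp (2 * real m * u x) * \<psi> x) = t * ?\<gamma> * (\<integral>x. f x * \<psi> x \<partial>lborel)"
    if c: "continuous_on UNIV \<psi>" and b: "\<And>x. \<bar>\<psi> x\<bar> \<le> M" for \<psi> :: "'a \<Rightarrow> real" and M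
  proof -
    have cg: "continuous_on \<Omega> (\<lambda>x. exp (2 * real m * u x) * \<psi> x)"
      by (intro continuous_intros cu continuous_on_subset[OF c]) auto
    have m1: "(\<lambda>x. indicator \<Omega> x *\<^sub>R (V x * exp (2 * real m * u x) * \<psi> x)) \<in> borel_measurable lebesgue"
      using Vm[OF cg] by (simp add: mult.assoc)
    have [measurable]: "\<psi> \<in> borel_measurable borel" using c by (rule borel_measurable_continuous_onI)
    have m2: "(\<lambda>x. t * ?\<gamma> * (f x * \<psi> x)) \<in> borel_measurable lborel" by measurable
    have ae: "AE x in lebesgue. indicator \<Omega> x *\<^sub>R (V x * exp (2 * real m * u x) * \<psi> x) = t * ?\<gamma> * (f x * \<psi> x)"
      using VVb
    proof (rule eventually_mono)
      fix x assume "x \<in> \<Omega> \<longrightarrow> V x = Vb x"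
      then show "indicator \<Omega> x *\<^sub>R (V x * exp (2 * real m * u x) * \<psi> x) = t * ?\<gamma> * (f x * \<psi> x)"
        using eq[of x] f(2)[of x] by (cases "x \<in> \<Omega>") auto
    qed
    have "integrable lborel (\<lambda>x. f x * \<psi> x)"
      by (rule integrable_mult_bounded(1)[OF fi _ b]) measurable
    then have i2: "integrable lebesgue (\<lambda>x. t * ?\<gamma> * (f x * \<psi> x))"
      using m2 by (simp add: integrable_completion)
    have i1: "integrable lebesgue (\<lambda>x. indicator \<Omega> x *\<^sub>R (V x * exp (2 * real m * u x) * \<psi> x))"
      using integrable_cong_AE[THEN iffD2, OF m1 _ ae i2] i2 by auto
    have "(LINT x:\<Omega>|lebesgue. V x * exp (2 * real m * u x) * \<psi> x) = (\<integral>x. t * ?\<gamma> * (f x * \<psi> x) \<partial>lebesgue)"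
      unfolding set_lebesgue_integral_def using i2 by (intro integral_cong_AE m1 ae) auto
    also have "\<dots> = (\<integral>x. t * ?\<gamma> * (f x * \<psi> x) \<partial>lborel)" using m2 by (rule integral_completion)
    also have "\<dots> = t * ?\<gamma> * (\<integral>x. f x * \<psi> x \<partial>lborel)" by simp
    finally show ?thesis using i1 by (simp add: set_integrable_def)
  qed
  from main[of "\<lambda>_. 1" 1]
  show "set_integrable lebesgue \<Omega> (\<lambda>x. V x * exp (2 * real m * u x))"
    and "(LINT x:\<Omega>|lebesgue. V x * exp (2 * real m * u x)) = t * ?\<gamma> * (\<integral>x. f x \<partial>lborel)" by auto
  show "liouville_solution m \<Omega> V u"
    unfolding liouville_solution_def
  proof (intro conjI Cu allI impI)
    fix \<psi> assume "test_function \<Omega> \<psi>"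
    then obtain K where \<psi>: "smooth_on UNIV \<psi>" and K: "compact K" "K \<subseteq> \<Omega>" "\<And>x. x \<notin> K \<Longrightarrow> \<psi> x = 0"
      unfolding test_function_def by blast
    have c\<psi>: "continuous_on UNIV \<psi>" by (rule smooth_on_continuous_on[OF \<psi>])
    obtain M where M: "\<And>z. \<bar>\<psi> z\<bar> \<le> M"
      using decaying_compact_support[OF c\<psi> K(1,3)] by (auto simp: decaying_def)
    note mm = main[OF c\<psi> M]
    then show "set_integrable lebesgue \<Omega> (\<lambda>x. V x * exp (2 * real m * u x) * \<psi> x)" by blast
    define \<eta> where "\<eta> = (neg_laplacian ^^ m) \<psi>"
    have \<eta>: "\<eta> z = (-1) ^ m * (laplacian ^^ m) \<psi> z" for z
      unfolding \<eta>_def by (rule neg_laplacian_power[OF open_UNIV \<psi>]) simp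
    have c\<eta>: "continuous_on UNIV \<eta>"
      unfolding \<eta>[abs_def] by (intro continuous_intros smooth_on_continuous_on[OF smooth_on_laplacian_power[OF open_UNIV \<psi>]])
    have z\<eta>: "\<eta> z = 0" if "z \<notin> K" for z
      using laplacian_power_zero_outside[OF K(1,3) that] by (simp add: \<eta>)
    have cl: "continuous_on \<Omega> (conv log_kernel f)" by (rule conv_continuous[OF sing_kernel_log[OF dim2] f(1)])
    have ch: "continuous_on \<Omega> h" by (rule smooth_on_continuous_on[OF h(1)])
    note si = set_integrable_mult_compact_support[OF _ c\<eta> K(1,2) z\<eta>]
    have um: "(\<lambda>x. indicator \<Omega> x *\<^sub>R (u x * \<eta> x)) \<in> borel_measurable lborel"
      using si[OF cu] by (simp add: set_integrable_def)
    have "(LINT x:\<Omega>|lebesgue. u x * \<eta> x) = (LINT x:\<Omega>|lborel. u x * \<eta> x)"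
      unfolding set_lebesgue_integral_def by (rule integral_completion[OF um])
    also have "\<dots> = (LINT x:\<Omega>|lborel. h x * \<eta> x + t * (conv log_kernel f x * \<eta> x))"
      using \<Omega>s by (intro set_lebesgue_integral_cong) (auto simp: u algebra_simps)
    also have "\<dots> = (LINT x:\<Omega>|lborel. h x * \<eta> x) + t * (LINT x:\<Omega>|lborel. conv log_kernel f x * \<eta> x)"
      using si[OF ch] si[OF cl] by (subst set_integral_add) auto
    also have "(LINT x:\<Omega>|lborel. h x * \<eta> x) = (-1)^m * (LINT x:\<Omega>|lborel. h x * (laplacian ^^ m) \<psi> x)"
      unfolding \<eta> set_integral_mult_right[symmetric] by (simp only: mult.left_commute)
    also have "(LINT x:\<Omega>|lborel. h x * (laplacian ^^ m) \<psi> x) = (LINT x:\<Omega>|lborel. (laplacian ^^ m) h x * \<psi> x)"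
      by (rule Green_identity_power[OF \<Omega> h(1) \<psi> K])
    also have "\<dots> = (LINT x:\<Omega>|lborel. 0)"
      using \<Omega>s h(2) by (intro set_lebesgue_integral_cong) auto
    also have "\<dots> = 0" by (simp add: set_lebesgue_integral_def)
    also have "(LINT x:\<Omega>|lborel. conv log_kernel f x * \<eta> x) = (\<integral>x. conv log_kernel f x * \<eta> x \<partial>lborel)"
      unfolding set_lebesgue_integral_def
      by (intro Bochner_Integration.integral_cong refl) (use K z\<eta> in \<open>auto simp: indicator_def\<close>)
    also have "\<dots> = ?\<gamma> * (\<integral>y. f y * \<psi> y \<partial>lborel)"
      unfolding \<eta>_def by (rule weak_log_potential[OF dim m f(1) \<psi> K(1,3)])
    finally show "(LINT x:\<Omega>|lebesgue. u x * (neg_laplacian ^^ m) \<psi> x) = (LINT x:\<Omega>|lebesgue. V x * exp (2 * real m * u x) * \<psi> x)"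
      using mm by (simp add: \<eta>_def)
  qed
qed

text \<open>The factor (1 + |x|)^(-\<alpha>) in the weight is the price of replacing the logarithmic
  kernel by \<open>pos_log\<close>; subtracting ln(1 + |x|) from U undoes the change. The two
  formulas for u serve different purposes: the first shows the normalising constant next to a
  controlled potential, the second the structure of polyharmonic part plus logarithmic
  potential.\<close>

lemma solution_from_weight:
  fixes H Vb :: "'a::euclidean_space \<Rightarrow> real" and L \<alpha> \<beta> b C :: real
  assumes dim: "2 \<le> DIM('a)" and m: "m \<ge> 1" and L: "0 < L" and \<gamma>: "0 < \<gamma>" and \<alpha>: "\<alpha> = 2 * real m * L / \<gamma>" "\<alpha> < \<beta>"
    and C: "0 < C" "\<And>y::'a. (\<integral>\<^sup>+x. ennreal (gauss x * exp (\<beta> * pos_log x y)) \<partial>lborel) \<le> ennreal C"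
    and Vb[measurable]: "Vb \<in> borel_measurable borel" and Vb0: "\<And>x. 0 \<le> Vb x \<and> Vb x \<le> b"
    and H[measurable]: "H \<in> borel_measurable borel" and HW: "\<And>x. H x \<le> - (norm x)\<^sup>2"
    and w: "w = (\<lambda>x. Vb x * exp (2 * real m * H x) * (1 + norm x) powr (- \<alpha>))"
    and I: "0 < (\<integral>x. w x \<partial>lborel)"
  shows "\<exists>u f U Z c.
    (\<forall>x. u x = H x + L / \<gamma> * (U x - ln (1 + norm x)) + ln (L / Z) / (2 * real m)) \<and>
    (\<forall>x. u x = H x + c + L / \<gamma> * conv log_kernel f x) \<and>
    decaying f \<and> (\<integral>x. f x \<partial>lborel) = 1 \<and> (\<forall>x. Vb x * exp (2 * real m * u x) = L * f x) \<and>
    (\<forall>x. 0 \<le> U x) \<and> (\<forall>x. (\<beta> - \<alpha>) * U x \<le> ln (2 * b * C / (\<integral>x. w x \<partial>lborel))) \<and>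
    U \<in> borel_measurable borel \<and> Z = (\<integral>x. w x * exp (\<alpha> * U x) \<partial>lborel) \<and>
    integrable lborel (\<lambda>x. w x * exp (\<alpha> * U x)) \<and> (\<integral>x. w x \<partial>lborel) \<le> Z \<and>
    (\<integral>\<^sup>+x. ennreal (gauss x * exp (\<beta> * U x)) \<partial>lborel) \<le> ennreal C"
proof -
  have \<alpha>0: "0 \<le> \<alpha>" using L \<gamma> by (simp add: \<alpha>)
  have wm[measurable]: "w \<in> borel_measurable borel" unfolding w by measurable
  have w0: "0 \<le> w x" for x using Vb0[of x] by (simp add: w)
  have wB: "w x \<le> b * gauss x" for x
  proof -
    have "2 * real m * H x \<le> 2 * real m * (- (norm x)\<^sup>2)" using HW[of x] by (intro mult_left_mono) auto
    also have "\<dots> \<le> - (norm x)\<^sup>2"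
    proof -
      have "1 * (norm x)\<^sup>2 \<le> 2 * real m * (norm x)\<^sup>2" using m by (intro mult_right_mono) auto
      then show ?thesis by simp
    qed
    finally have "exp (2 * real m * H x) \<le> gauss x" by (simp add: gauss_def)
    moreover have "(1 + norm x) powr (- \<alpha>) \<le> 1"
      using powr_mono[of "- \<alpha>" 0 "1 + norm x"] \<alpha>0 one_plus_norm_pos[of x] by simp
    ultimately have "Vb x * exp (2 * real m * H x) * (1 + norm x) powr (- \<alpha>) \<le> (b * gauss x) * 1"
      using Vb0[of x] by (intro mult_mono) (auto simp: gauss_def)
    then show ?thesis by (simp add: w)
  qed
  have wabs: "\<bar>w x\<bar> \<le> b * gauss x" for x using w0[of x] wB[of x] by simp
  show ?thesis
  proof (rule log_mean_field_exists[OF dim wm w0 wB I \<alpha>0 \<alpha>(2) C])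
    fix U
    assume mf: "mean_field (density lborel w) \<alpha> pos_log U" and U0: "\<And>x. 0 \<le> U x"
      and UL: "\<And>x. (\<beta> - \<alpha>) * U x \<le> ln (2 * b * C / (\<integral>x. w x \<partial>lborel))"
      and UC: "(\<integral>\<^sup>+x. ennreal (gauss x * exp (\<beta> * U x)) \<partial>lborel) \<le> ennreal C"
    have Um[measurable]: "U \<in> borel_measurable borel" using mf by (simp add: mean_field_def)
    define M where "M = ln (2 * b * C / (\<integral>x. w x \<partial>lborel)) / (\<beta> - \<alpha>)"
    have UM: "U x \<le> M" for x using UL[of x] \<alpha>(2) by (simp add: M_def field_simps)
    define F where "F x = w x * exp (\<alpha> * U x)" for x
    have Fm[measurable]: "F \<in> borel_measurable borel" unfolding F_def by measurable
    have Fabs: "\<bar>F x\<bar> \<le> (b * exp (\<alpha> * M)) * gauss x" for x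
    proof -
      have "\<alpha> * U x \<le> \<alpha> * M" using UM \<alpha>0 by (intro mult_left_mono)
      then have "\<bar>w x\<bar> * exp (\<alpha> * U x) \<le> (b * gauss x) * exp (\<alpha> * M)"
        using wabs[of x] order_trans[OF abs_ge_zero wabs[of x]] by (intro mult_mono) auto
      then show ?thesis by (simp add: F_def abs_mult mult_ac)
    qed
    have Fd: "decaying F" and Fi: "integrable lborel F" using decaying_weight[OF Fm Fabs] by auto
    define Z where "Z = (\<integral>x. F x \<partial>lborel)"
    have wi: "integrable lborel w" using decaying_weight(2)[OF wm wabs] .
    have IZ: "(\<integral>x. w x \<partial>lborel) \<le> Z" unfolding Z_def
    proof (rule integral_mono[OF wi Fi])
      fix x
      have "1 \<le> exp (\<alpha> * U x)" using \<alpha>0 U0[of x] by simp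
      from mult_left_mono[OF this w0[of x]] show "w x \<le> F x" by (simp add: F_def)
    qed
    then have Z0: "0 < Z" using I by linarith
    define f where "f x = F x / Z" for x
    have fm[measurable]: "f \<in> borel_measurable borel" unfolding f_def by measurable
    have fabs: "\<bar>f x\<bar> \<le> (b * exp (\<alpha> * M) / Z) * gauss x" for x
      using divide_right_mono[OF Fabs[of x], of Z] Z0 by (simp add: f_def)
    have fd: "decaying f" and fi: "integrable lborel f" using decaying_weight[OF fm fabs] by auto
    have f1: "(\<integral>x. f x \<partial>lborel) = 1" using Z0 by (simp add: f_def Z_def)
    have dens: "(\<integral>y. g y \<partial>density lborel w) = (\<integral>y. w y * g y \<partial>lborel)" if "g \<in> borel_measurable borel" for g :: "'a \<Rightarrow> real"
      using that w0 by (simp add: integral_density)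
    have Ux: "U x = (\<integral>y. pos_log x y * f y \<partial>lborel)" for x
    proof -
      have "U x = (\<integral>y. pos_log x y * exp (\<alpha> * U y) \<partial>density lborel w) / (\<integral>y. exp (\<alpha> * U y) \<partial>density lborel w)"
        using mf unfolding mean_field_def by blast
      also have "(\<integral>y. exp (\<alpha> * U y) \<partial>density lborel w) = Z" by (subst dens) (auto simp: Z_def F_def)
      also have "(\<integral>y. pos_log x y * exp (\<alpha> * U y) \<partial>density lborel w) = (\<integral>y. pos_log x y * F y \<partial>lborel)"
        by (subst dens) (auto simp: F_def mult_ac)
      also have "\<dots> / Z = (\<integral>y. pos_log x y * f y \<partial>lborel)" by (simp add: f_def)
      finally show ?thesis .
    qed
    \<comment> \<open>The constant to which the term ln(1 + |y|) of the kernel integrates.\<close>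
    define l where "l = (\<integral>y. ln (1 + norm y) * f y \<partial>lborel)"
    have li: "integrable lborel (\<lambda>y. ln (1 + norm y) * f y)"
    proof (rule Bochner_Integration.integrable_bound)
      show "integrable lborel (\<lambda>y. (1 + norm y) * \<bar>f y\<bar>)" using fd by (simp add: decaying_def)
      have "\<bar>ln (1 + norm y)\<bar> \<le> 1 + norm y" for y :: 'a
        using ln_add_one_self_le_self[of "norm y"] by simp
      then show "AE y in lborel. norm (ln (1 + norm y) * f y) \<le> norm ((1 + norm y) * \<bar>f y\<bar>)"
        by (intro AE_I2) (simp add: abs_mult mult_right_mono)
    qed measurable
    have Uc: "U x - ln (1 + norm x) = l + conv log_kernel f x" for x
    proof -
      have "U x = (\<integral>y. ln (1 + norm x) * f y + (ln (1 + norm y) * f y + log_kernel (x - y) * f y) \<partial>lborel)"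
        unfolding Ux by (simp add: pos_log_def algebra_simps)
      also have "\<dots> = (\<integral>y. ln (1 + norm x) * f y \<partial>lborel) + (l + conv log_kernel f x)"
        unfolding l_def conv_def using fi li conv_integrable[OF sing_kernel_log[OF dim] fd, of x]
        by (subst Bochner_Integration.integral_add, simp, simp, subst Bochner_Integration.integral_add) auto
      finally show ?thesis using f1 by simp
    qed
    \<comment> \<open>The last summand normalises the mass: multiplied by 2m and exponentiated it
      becomes the factor L/Z, so that the nonlinearity equals L F / Z.\<close>
    define u where "u x = H x + L / \<gamma> * (U x - ln (1 + norm x)) + ln (L / Z) / (2 * real m)" for x
    define c where "c = L / \<gamma> * l + ln (L / Z) / (2 * real m)"
    have u2: "u x = H x + c + L / \<gamma> * conv log_kernel f x" for x
      unfolding u_def Uc c_def by (simp add: algebra_simps)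
    have eq: "Vb x * exp (2 * real m * u x) = L * f x" for x
    proof -
      have "2 * real m * u x = 2 * real m * H x + \<alpha> * U x + (- \<alpha>) * ln (1 + norm x) + ln (L / Z)"
        using m by (simp add: u_def \<alpha>(1) algebra_simps)
      moreover have "exp (ln (L / Z)) = L / Z" using L Z0 by simp
      ultimately have "exp (2 * real m * u x) = exp (2 * real m * H x) * exp (\<alpha> * U x) * exp ((- \<alpha>) * ln (1 + norm x)) * (L / Z)"
        by (simp only: exp_add)
      moreover have "exp ((- \<alpha>) * ln (1 + norm x)) = (1 + norm x) powr (- \<alpha>)"
      proof -
        have "1 + norm x \<noteq> 0" using norm_ge_zero[of x] by linarith
        then show ?thesis by (simp add: powr_def)
      qed
      ultimately show ?thesis by (simp add: f_def F_def w)
    qed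
    show ?thesis
      by (intro exI[of _ u] exI[of _ f] exI[of _ U] exI[of _ Z] exI[of _ c] conjI allI u2 fd f1 eq U0 UL Um IZ UC)
        (use Fi in \<open>auto simp: u_def Z_def F_def[abs_def]\<close>)
  qed
qed

section \<open>Concentration\<close>

lemma exp_split_at_level:
  fixes \<alpha> \<beta> U \<tau> p :: real
  assumes "0 \<le> \<alpha>" "\<alpha> < \<beta>" "p \<le> 0"
  shows "exp p * exp (\<alpha> * U) \<le> exp (\<alpha> * \<tau>) * exp p + exp (- (\<beta> - \<alpha>) * \<tau>) * exp (\<beta> * U)"
proof (cases "U \<le> \<tau>")
  case True
  then have "\<alpha> * U \<le> \<alpha> * \<tau>" using assms by (intro mult_left_mono)
  then have "exp p * exp (\<alpha> * U) \<le> exp p * exp (\<alpha> * \<tau>)" by simp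
  then show ?thesis by (simp add: mult.commute add_increasing2)
next
  case False
  then have "(\<beta> - \<alpha>) * \<tau> \<le> (\<beta> - \<alpha>) * U" using assms by (intro mult_left_mono) auto
  then have "p + \<alpha> * U \<le> - (\<beta> - \<alpha>) * \<tau> + \<beta> * U" using assms(3) by (simp add: algebra_simps)
  then have "exp p * exp (\<alpha> * U) \<le> exp (- (\<beta> - \<alpha>) * \<tau>) * exp (\<beta> * U)" by (simp only: exp_add[symmetric] exp_le_cancel_iff)
  moreover have "0 \<le> exp (\<alpha> * \<tau>) * exp p" by simp
  ultimately show ?thesis by linarith
qed

lemma gauss_measurable[measurable]: "(gauss :: 'a::euclidean_space \<Rightarrow> real) \<in> borel_measurable borel"
  unfolding gauss_def by measurable

lemma gauss_integrable: "integrable lborel (gauss :: 'a::euclidean_space \<Rightarrow> real)"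
  by (rule decaying_weight(2)[of _ 1]) (auto simp: gauss_def)

text \<open>Since \<open>\<phi> < 0\<close> almost everywhere, the weights \<open>exp (2 m k \<phi>)\<close> kill the
  normalising constants, while the exponential integrability of \<open>U\<close> is uniform in \<open>k\<close>.\<close>

lemma normalisation_tendsto_zero:
  fixes p :: "'a::euclidean_space \<Rightarrow> real" and U w :: "nat \<Rightarrow> 'a \<Rightarrow> real"
  assumes ab: "0 \<le> \<alpha>" "\<alpha> < \<beta>" and q: "0 < q" and b: "0 \<le> b" and C: "0 \<le> C"
    and \<Omega>: "\<Omega> \<in> sets borel" and p[measurable]: "p \<in> borel_measurable borel" and p0: "\<And>x. p x \<le> 0"
    and pneg: "AE x in lborel. x \<in> \<Omega> \<longrightarrow> p x < 0"
    and w: "\<And>k x. k \<in> A \<Longrightarrow> 0 \<le> w k x \<and> w k x \<le> b * (gauss x * (indicator \<Omega> x * exp (q * (real k * p x))))"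
    and U: "\<And>k. k \<in> A \<Longrightarrow> U k \<in> borel_measurable borel"
    and UC: "\<And>k. k \<in> A \<Longrightarrow> (\<integral>\<^sup>+x. ennreal (gauss x * exp (\<beta> * U k x)) \<partial>lborel) \<le> ennreal C"
    and int: "\<And>k. k \<in> A \<Longrightarrow> integrable lborel (\<lambda>x. w k x * exp (\<alpha> * U k x))"
    and e: "0 < e"
  shows "\<forall>\<^sub>F k in sequentially. k \<in> A \<longrightarrow> (\<integral>x. w k x * exp (\<alpha> * U k x) \<partial>lborel) < e"
proof -
  note \<Omega>[measurable]
  define D where "D k = (\<integral>x. gauss x * (indicator \<Omega> x * exp (q * (real k * p x))) \<partial>lborel)" for k
  have Dle: "gauss x * (indicator \<Omega> x * exp (q * (real k * p x))) \<le> gauss x"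
    and D0: "0 \<le> gauss x * (indicator \<Omega> x * exp (q * (real k * p x)))" for k and x :: 'a
  proof -
    have "q * (real k * p x) \<le> 0" using q p0[of x] by (intro mult_nonneg_nonpos) (auto simp: mult_nonneg_nonpos)
    then have "indicator \<Omega> x * exp (q * (real k * p x)) \<le> 1" by (auto simp: indicator_def)
    then show "gauss x * (indicator \<Omega> x * exp (q * (real k * p x))) \<le> gauss x"
      using mult_left_mono[of _ 1 "gauss x"] by (simp add: gauss_def)
    show "0 \<le> gauss x * (indicator \<Omega> x * exp (q * (real k * p x)))" by (simp add: gauss_def)
  qed
  have Dm[measurable]: "(\<lambda>x. gauss x * (indicator \<Omega> x * exp (q * (real k * p x)))) \<in> borel_measurable borel" for k
    using \<Omega> by measurable
  have "D \<longlonglongrightarrow> (\<integral>x. 0 \<partial>(lborel :: 'a measure))" unfolding D_def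
  proof (rule integral_dominated_convergence[where w = gauss])
    show "AE x in lborel. (\<lambda>k. gauss x * (indicator \<Omega> x * exp (q * (real k * p x)))) \<longlonglongrightarrow> 0"
      using pneg
    proof (rule eventually_mono)
      fix x assume x: "x \<in> \<Omega> \<longrightarrow> p x < 0"
      show "(\<lambda>k. gauss x * (indicator \<Omega> x * exp (q * (real k * p x)))) \<longlonglongrightarrow> 0"
      proof (cases "x \<in> \<Omega>")
        case True
        then have "exp (q * p x) < 1" using x q by (simp add: mult_pos_neg)
        then have "(\<lambda>k. exp (q * p x) ^ k) \<longlonglongrightarrow> 0" by (intro LIMSEQ_power_zero) simp
        then have "(\<lambda>k. gauss x * (indicator \<Omega> x * exp (q * p x) ^ k)) \<longlonglongrightarrow> gauss x * (indicator \<Omega> x * 0)"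
          by (intro tendsto_mult_left)
        moreover have "exp (q * p x) ^ k = exp (q * (real k * p x))" for k
          by (simp add: exp_of_nat_mult[symmetric] mult_ac)
        ultimately show ?thesis by simp
      qed simp
    qed
    show "AE x in lborel. norm (gauss x * (indicator \<Omega> x * exp (q * (real k * p x)))) \<le> gauss x" for k
      using Dle D0 by (intro AE_I2) simp
  qed (auto simp: gauss_integrable)
  then have Dl: "D \<longlonglongrightarrow> 0" by simp
  have Di: "integrable lborel (\<lambda>x. gauss x * (indicator \<Omega> x * exp (q * (real k * p x))))" for k
    by (rule Bochner_Integration.integrable_bound[OF gauss_integrable])
      (use Dle D0 in \<open>auto simp: gauss_def intro!: AE_I2\<close>)
  \<comment> \<open>The first term carries the integral \<open>D k\<close>, which tends to 0; the
    second is small through \<tau>, uniformly in k.\<close>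
  have bound: "(\<integral>x. w k x * exp (\<alpha> * U k x) \<partial>lborel) \<le> b * exp (\<alpha> * \<tau>) * D k + b * C * exp (- (\<beta> - \<alpha>) * \<tau>)"
    if k: "k \<in> A" for k \<tau>
  proof -
    have [measurable]: "U k \<in> borel_measurable borel" by (rule U[OF k])
    have gi: "integrable lborel (\<lambda>x. gauss x * exp (\<beta> * U k x))"
    proof (rule integrableI_nonneg)
      show "(\<integral>\<^sup>+x. ennreal (gauss x * exp (\<beta> * U k x)) \<partial>lborel) < \<infinity>" using UC[OF k] le_less_trans ennreal_less_top by fastforce
    qed (auto simp: gauss_def)
    have gC: "(\<integral>x. gauss x * exp (\<beta> * U k x) \<partial>lborel) \<le> C"
      using UC[OF k] C by (subst (asm) nn_integral_eq_integral[OF gi]) (auto simp: gauss_def)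
    have "(\<integral>x. w k x * exp (\<alpha> * U k x) \<partial>lborel) \<le>
      (\<integral>x. b * exp (\<alpha> * \<tau>) * (gauss x * (indicator \<Omega> x * exp (q * (real k * p x)))) + b * exp (- (\<beta> - \<alpha>) * \<tau>) * (gauss x * exp (\<beta> * U k x)) \<partial>lborel)"
    proof (rule integral_mono[OF int[OF k]])
      show "integrable lborel (\<lambda>x. b * exp (\<alpha> * \<tau>) * (gauss x * (indicator \<Omega> x * exp (q * (real k * p x)))) + b * exp (- (\<beta> - \<alpha>) * \<tau>) * (gauss x * exp (\<beta> * U k x)))"
        by (intro Bochner_Integration.integrable_add integrable_mult_right Di gi)
      fix x
      let ?P = "q * (real k * p x)"
      have P: "?P \<le> 0" using q p0[of x] by (intro mult_nonneg_nonpos) (auto simp: mult_nonneg_nonpos)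
      have "w k x * exp (\<alpha> * U k x) \<le> b * (gauss x * (indicator \<Omega> x * exp ?P)) * exp (\<alpha> * U k x)"
        using w[OF k, of x] by (intro mult_right_mono) auto
      also have "\<dots> = b * gauss x * indicator \<Omega> x * (exp ?P * exp (\<alpha> * U k x))" by (simp add: mult_ac)
      also have "\<dots> \<le> b * gauss x * indicator \<Omega> x * (exp (\<alpha> * \<tau>) * exp ?P + exp (- (\<beta> - \<alpha>) * \<tau>) * exp (\<beta> * U k x))"
        using b by (intro mult_left_mono exp_split_at_level ab P) (auto simp: gauss_def)
      also have "\<dots> = b * exp (\<alpha> * \<tau>) * (gauss x * (indicator \<Omega> x * exp ?P)) + indicator \<Omega> x * (b * exp (- (\<beta> - \<alpha>) * \<tau>) * (gauss x * exp (\<beta> * U k x)))"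
        by (simp add: algebra_simps)
      also have "indicator \<Omega> x * (b * exp (- (\<beta> - \<alpha>) * \<tau>) * (gauss x * exp (\<beta> * U k x))) \<le> b * exp (- (\<beta> - \<alpha>) * \<tau>) * (gauss x * exp (\<beta> * U k x))"
        using b by (intro mult_left_le_one_le) (auto simp: gauss_def indicator_def)
      finally show "w k x * exp (\<alpha> * U k x) \<le> b * exp (\<alpha> * \<tau>) * (gauss x * (indicator \<Omega> x * exp ?P)) + b * exp (- (\<beta> - \<alpha>) * \<tau>) * (gauss x * exp (\<beta> * U k x))"
        by simp
    qed
    also have "\<dots> = b * exp (\<alpha> * \<tau>) * D k + b * exp (- (\<beta> - \<alpha>) * \<tau>) * (\<integral>x. gauss x * exp (\<beta> * U k x) \<partial>lborel)"
      unfolding D_def using Di gi by (subst Bochner_Integration.integral_add) auto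
    also have "\<dots> \<le> b * exp (\<alpha> * \<tau>) * D k + b * exp (- (\<beta> - \<alpha>) * \<tau>) * C"
      using b gC by (intro add_left_mono mult_left_mono) auto
    finally show ?thesis by (simp add: mult_ac)
  qed
  \<comment> \<open>The level \<tau> is fixed first, for the second term; only then k is taken large
    for the first.\<close>
  have "((\<lambda>\<tau>. b * C * exp (- (\<beta> - \<alpha>) * \<tau>)) \<longlongrightarrow> 0) at_top"
    using ab by real_asymp
  then have "\<forall>\<^sub>F \<tau> in at_top. b * C * exp (- (\<beta> - \<alpha>) * \<tau>) < e / 2"
    by (rule order_tendstoD) (use e in simp)
  then obtain \<tau> where \<tau>: "b * C * exp (- (\<beta> - \<alpha>) * \<tau>) < e / 2"
    using eventually_happens[of _ "at_top :: real filter"] by auto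
  have "(\<lambda>k. b * exp (\<alpha> * \<tau>) * D k) \<longlonglongrightarrow> b * exp (\<alpha> * \<tau>) * 0" by (intro tendsto_intros Dl)
  then have "(\<lambda>k. b * exp (\<alpha> * \<tau>) * D k) \<longlonglongrightarrow> 0" by simp
  then have "\<forall>\<^sub>F k in sequentially. b * exp (\<alpha> * \<tau>) * D k < e / 2"
    by (rule order_tendstoD) (use e in simp)
  then show ?thesis
  proof (rule eventually_mono, intro impI)
    fix k assume "b * exp (\<alpha> * \<tau>) * D k < e / 2" "k \<in> A"
    with bound[OF \<open>k \<in> A\<close>, of \<tau>] \<tau> show "(\<integral>x. w k x * exp (\<alpha> * U k x) \<partial>lborel) < e" by linarith
  qed
qed

section \<open>The quadratic term, Borel representatives and the extended zero set\<close>

lemma laplacian_rad: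
  assumes "0 < \<epsilon>"
  shows "laplacian (rad y \<epsilon>) = (\<lambda>z::'a::euclidean_space. 2 * real DIM('a))"
proof
  fix z :: 'a
  have "dir_deriv b (dir_deriv b (rad y \<epsilon>)) z = 2" if b: "b \<in> Basis" for b
  proof -
    have e: "dir_deriv b (rad y \<epsilon>) = (\<lambda>z. 2 * ((z - y) \<bullet> b))" by (rule ext) (rule rad_deriv(2)[OF assms])
    show ?thesis unfolding e
      using dir_deriv_cmult[OF dir_deriv_linear_diff(1)[OF assms, of y b z], of b 2] dir_deriv_linear_diff(2)[OF assms b, of y z]
      by simp
  qed
  then show "laplacian (rad y \<epsilon>) z = 2 * real DIM('a)" by (simp add: laplacian_def)
qed

lemma laplacian_power_rad:
  assumes "0 < \<epsilon>" "m \<ge> 2"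
  shows "(laplacian ^^ m) (rad y \<epsilon>) = (\<lambda>z. 0)"
proof -
  obtain n where n: "m = Suc (Suc n)" using assms(2) by (metis add_2_eq_Suc le_Suc_ex)
  have "(laplacian ^^ n) (\<lambda>z::'a. 0) = (\<lambda>z. 0)"
    by (induction n) (simp_all add: laplacian_const)
  then show ?thesis unfolding n funpow_Suc_right o_apply laplacian_rad[OF assms(1)] laplacian_const .
qed

text \<open>Clamping a Borel representative between 0 and b and cutting it off outside \<Omega>
  makes the bounds valid at every point, while it still agrees with \<open>V\<close> almost
  everywhere in \<Omega>.\<close>

lemma borel_version:
  fixes V :: "'a::euclidean_space \<Rightarrow> real"
  assumes \<Omega>: "open \<Omega>" and V: "V \<in> borel_measurable (lebesgue_on \<Omega>)" and b: "\<And>x. x \<in> \<Omega> \<Longrightarrow> 0 \<le> V x \<and> V x \<le> b"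
    and b0: "0 \<le> b"
  shows "\<exists>Vb\<in>borel_measurable borel. (\<forall>x. 0 \<le> Vb x \<and> Vb x \<le> b) \<and> (\<forall>x. x \<notin> \<Omega> \<longrightarrow> Vb x = 0) \<and>
    (AE x in lebesgue. x \<in> \<Omega> \<longrightarrow> V x = Vb x)"
proof -
  have "\<Omega> \<in> sets lebesgue" "\<Omega> \<in> sets borel" using \<Omega> by auto
  then have "(\<lambda>x. indicator \<Omega> x *\<^sub>R V x) \<in> borel_measurable lebesgue"
    using V by (subst (asm) borel_measurable_restrict_space_iff) auto
  from completion_ex_borel_measurable_real[OF this]
  obtain g where g: "g \<in> borel_measurable lborel" "AE x in lborel. indicator \<Omega> x *\<^sub>R V x = g x" by blast
  have gb[measurable]: "g \<in> borel_measurable borel" using g(1) by simp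
  note \<open>\<Omega> \<in> sets borel\<close>[measurable]
  define Vb where "Vb x = indicator \<Omega> x * max 0 (min b (g x))" for x
  have "Vb \<in> borel_measurable borel" unfolding Vb_def by measurable
  moreover have "0 \<le> Vb x \<and> Vb x \<le> b" for x using b0 by (auto simp: Vb_def indicator_def)
  moreover have "Vb x = 0" if "x \<notin> \<Omega>" for x using that by (simp add: Vb_def)
  moreover have "AE x in lebesgue. x \<in> \<Omega> \<longrightarrow> V x = Vb x"
    using AE_lebesgueI[OF g(2)]
  proof (rule eventually_mono)
    fix x assume "indicator \<Omega> x *\<^sub>R V x = g x"
    then show "x \<in> \<Omega> \<longrightarrow> V x = Vb x" using b[of x] by (auto simp: Vb_def)
  qed
  ultimately show ?thesis by blast
qed

lemma zero_set_star_cases: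
  assumes "open \<Omega>" "x \<in> zero_set_star \<Omega> \<phi>"
  shows "x \<in> \<Omega> \<and> \<phi> x = 0 \<or> x \<notin> \<Omega> \<and> (\<phi> \<longlongrightarrow> 0) (at x within \<Omega>)"
proof (cases "x \<in> zero_set \<Omega> \<phi>")
  case False
  then have "x \<in> frontier \<Omega>" "(\<phi> \<longlongrightarrow> 0) (at x within \<Omega>)" using assms(2) by (auto simp: zero_set_star_def)
  moreover have "x \<notin> \<Omega>" using \<open>x \<in> frontier \<Omega>\<close> assms(1) by (simp add: frontier_def interior_open)
  ultimately show ?thesis by blast
qed (auto simp: zero_set_def)

lemma near_zero_set_star:
  assumes \<Omega>: "open \<Omega>" and c: "continuous_on \<Omega> \<phi>" and x: "x \<in> zero_set_star \<Omega> \<phi>" and e: "0 < (e::real)"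
  obtains r where "0 < r" "\<And>y. y \<in> \<Omega> \<Longrightarrow> dist y x < r \<Longrightarrow> \<bar>\<phi> y\<bar> < e"
proof -
  consider "x \<in> \<Omega>" "\<phi> x = 0" | "x \<notin> \<Omega>" "(\<phi> \<longlongrightarrow> 0) (at x within \<Omega>)"
    using zero_set_star_cases[OF \<Omega> x] by blast
  then show ?thesis
  proof cases
    case 1
    then obtain d where "d > 0" "\<And>y. y \<in> \<Omega> \<Longrightarrow> dist y x < d \<Longrightarrow> dist (\<phi> y) (\<phi> x) < e"
      using c e unfolding continuous_on_iff by blast
    with 1 that[of d] show ?thesis by simp
  next
    case 2
    then obtain d where "d > 0" "\<And>y. y \<in> \<Omega> \<Longrightarrow> 0 < dist y x \<and> dist y x < d \<Longrightarrow> dist (\<phi> y) 0 < e"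
      using e unfolding Lim_within by blast
    with 2(1) that[of d] show ?thesis by (metis dist_real_def diff_zero zero_less_dist_iff)
  qed
qed

text \<open>At a boundary point of the extended zero set the function is 0, and nearby it is either
  0, outside \<Omega>, or small, because \<phi> tends to 0 there. This supplies the continuity of
  the solutions up to such boundary points.\<close>

lemma continuous_on_extension:
  assumes \<Omega>: "open \<Omega>" and c: "continuous_on \<Omega> \<phi>"
  shows "continuous_on (\<Omega> \<union> zero_set_star \<Omega> \<phi>) (\<lambda>x. indicator \<Omega> x * \<phi> x :: real)"
  unfolding continuous_on_iff
proof (intro ballI allI impI)
  let ?S = "\<Omega> \<union> zero_set_star \<Omega> \<phi>" and ?p = "\<lambda>x. indicator \<Omega> x * \<phi> x"
  fix x and e :: real assume x: "x \<in> ?S" and e: "0 < e"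
  show "\<exists>d>0. \<forall>y\<in>?S. dist y x < d \<longrightarrow> dist (?p y) (?p x) < e"
  proof (cases "x \<in> \<Omega>")
    case True
    obtain d where d: "d > 0" "\<And>y. y \<in> \<Omega> \<Longrightarrow> dist y x < d \<Longrightarrow> dist (\<phi> y) (\<phi> x) < e"
      using c e True unfolding continuous_on_iff by blast
    obtain r where r: "r > 0" "\<And>y. dist y x < r \<Longrightarrow> y \<in> \<Omega>"
      using \<Omega> True unfolding open_dist by blast
    show ?thesis
      by (rule exI[of _ "min d r"]) (use d r True in auto)
  next
    case False
    then have xs: "x \<in> zero_set_star \<Omega> \<phi>" using x by blast
    obtain r where r: "0 < r" "\<And>y. y \<in> \<Omega> \<Longrightarrow> dist y x < r \<Longrightarrow> \<bar>\<phi> y\<bar> < e"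
      using near_zero_set_star[OF \<Omega> c xs e] by blast
    have "dist (?p y) (?p x) < e" if "dist y x < r" for y
      using r(2)[of y] that e False by (cases "y \<in> \<Omega>") auto
    then show ?thesis using r(1) by blast
  qed
qed

text \<open>Near x0 the values of \<phi> exceed -\<epsilon>, so exp(2m k \<phi>) is at least exp(-2m
  \<epsilon> k) there; the remaining factors are bounded below on a bounded ball, and the mass of
  \<open>V k\<close> near x0 eventually stays above some \<delta>. Since \<epsilon> is arbitrary,
  the decay is slower than any exponential.\<close>

lemma weight_integral_lower_bound:
  fixes V Vb w :: "nat \<Rightarrow> 'a::euclidean_space \<Rightarrow> real"
  assumes \<Omega>: "open \<Omega>" and Vb[measurable]: "\<And>k. Vb k \<in> borel_measurable borel"
    and Vb0: "\<And>k x. 0 \<le> Vb k x \<and> Vb k x \<le> b"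
    and V: "\<And>k. V k \<in> borel_measurable (lebesgue_on \<Omega>)" "\<And>k. AE x in lebesgue. x \<in> \<Omega> \<longrightarrow> V k x = Vb k x"
    and near: "\<And>\<epsilon>. 0 < \<epsilon> \<Longrightarrow> \<exists>r>0. \<forall>y\<in>\<Omega>. dist y x0 < r \<longrightarrow> \<bar>\<phi> y\<bar> < \<epsilon>"
    and liminf: "\<And>\<epsilon>. \<epsilon> > 0 \<Longrightarrow> liminf (\<lambda>k. ereal (LINT x:ball x0 \<epsilon> \<inter> \<Omega>|lebesgue. V k x)) > 0"
    and w: "\<And>k x. w k x = Vb k x * exp (2 * real m * (real k * (indicator \<Omega> x * \<phi> x) - (norm x)\<^sup>2)) * (1 + norm x) powr (- \<alpha>)"
    and wi: "\<And>k. integrable lborel (w k)" and \<alpha>: "0 \<le> \<alpha>" and \<eta>: "0 < \<eta>"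
  shows "\<forall>\<^sub>F k in sequentially. exp (- \<eta> * real k) \<le> (\<integral>x. w k x \<partial>lborel)"
proof -
  \<comment> \<open>Half of the rate \<eta> is spent on \<phi>, through 2m \<epsilon> \<le>
    \<eta>/2; the other half eventually absorbs the constant c \<delta>.\<close>
  define \<epsilon> where "\<epsilon> = \<eta> / (4 * (real m + 1))"
  have \<epsilon>: "0 < \<epsilon>" and m\<epsilon>: "2 * real m * \<epsilon> \<le> \<eta> / 2" using \<eta> by (auto simp: \<epsilon>_def field_simps)
  obtain r' where r': "0 < r'" "\<And>y. y \<in> \<Omega> \<Longrightarrow> dist y x0 < r' \<Longrightarrow> \<bar>\<phi> y\<bar> < \<epsilon>" using near[OF \<epsilon>] by blast
  \<comment> \<open>A radius of at most 1 ensures |x| \<le> |x0| + 1 = R on the ball, which is where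
    the constant \<open>c\<close> comes from.\<close>
  define r where "r = min r' 1"
  have r: "0 < r" using r' by (simp add: r_def)
  define S where "S = ball x0 r \<inter> \<Omega>"
  have Ss[measurable]: "S \<in> sets borel" unfolding S_def using \<Omega> by auto
  define R where "R = norm x0 + 1"
  have R: "0 \<le> R" by (simp add: R_def)
  define c where "c = exp (2 * real m * (- R\<^sup>2)) * (1 + R) powr (- \<alpha>)"
  have c: "0 < c" using R by (simp add: c_def)
  obtain \<delta> where \<delta>: "0 < ereal \<delta>" "ereal \<delta> < liminf (\<lambda>k. ereal (LINT x:S|lebesgue. V k x))"
    using ereal_dense2[OF liminf[OF r]] unfolding S_def by blast
  have ev1: "\<forall>\<^sub>F k in sequentially. \<delta> < (LINT x:S|lebesgue. V k x)"
    using less_LiminfD[OF \<delta>(2)] by simp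
  have \<delta>0: "0 < \<delta>" using \<delta>(1) by simp
  have "((\<lambda>k. exp (- (\<eta> / 2) * real k)) \<longlongrightarrow> 0) sequentially" using \<eta> by real_asymp
  then have ev2: "\<forall>\<^sub>F k in sequentially. exp (- (\<eta> / 2) * real k) < c * \<delta>"
    by (rule order_tendstoD) (use c \<delta>0 in simp)
  from ev1 ev2 show ?thesis
  proof eventually_elim
    fix k assume k1: "\<delta> < (LINT x:S|lebesgue. V k x)" and k2: "exp (- (\<eta> / 2) * real k) < c * \<delta>"
    have S\<Omega>: "S \<subseteq> \<Omega>" by (simp add: S_def)
    have Vm: "(\<lambda>x. indicator S x *\<^sub>R V k x) \<in> borel_measurable lebesgue"
    proof -
      have "(\<lambda>x. indicator \<Omega> x *\<^sub>R V k x) \<in> borel_measurable lebesgue"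
        using V(1)[of k] \<Omega> by (subst (asm) borel_measurable_restrict_space_iff) auto
      moreover have "indicator S \<in> borel_measurable lebesgue" using Ss by (intro borel_measurable_indicator) simp
      ultimately have "(\<lambda>x. indicator S x * (indicator \<Omega> x *\<^sub>R V k x)) \<in> borel_measurable lebesgue"
        by (intro borel_measurable_times)
      also have "(\<lambda>x. indicator S x * (indicator \<Omega> x *\<^sub>R V k x)) = (\<lambda>x. indicator S x *\<^sub>R V k x)"
        using S\<Omega> by (auto simp: indicator_def fun_eq_iff)
      finally show ?thesis .
    qed
    have bm: "(\<lambda>x. indicator S x * Vb k x) \<in> borel_measurable lborel" by measurable
    have "(LINT x:S|lebesgue. V k x) = (\<integral>x. indicator S x * Vb k x \<partial>lebesgue)"
      unfolding set_lebesgue_integral_def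
    proof (rule integral_cong_AE[OF Vm])
      show "(\<lambda>x. indicator S x * Vb k x) \<in> borel_measurable lebesgue" using bm by (rule measurable_completion)
      show "AE x in lebesgue. indicator S x *\<^sub>R V k x = indicator S x * Vb k x"
        using V(2)[of k] by (rule eventually_mono) (use S\<Omega> in \<open>auto simp: indicator_def\<close>)
    qed
    also have "\<dots> = (\<integral>x. indicator S x * Vb k x \<partial>lborel)" by (rule integral_completion[OF bm])
    finally have k3: "\<delta> < (\<integral>x. indicator S x * Vb k x \<partial>lborel)" using k1 by simp
    let ?q = "c * exp (- (\<eta> / 2) * real k)"
    have q: "0 \<le> ?q" using c by simp
    have le: "?q * (indicator S x * Vb k x) \<le> w k x" for x
    proof (cases "x \<in> S")
      case True
      then have x\<Omega>: "x \<in> \<Omega>" and d: "dist x x0 < r" by (auto simp: S_def dist_commute)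
      have "norm x \<le> R" using d norm_triangle_sub[of x x0] by (simp add: R_def r_def dist_norm)
      then have n2: "(norm x)\<^sup>2 \<le> R\<^sup>2" and "1 + norm x \<le> 1 + R" by (auto intro: power_mono)
      have "- \<epsilon> \<le> \<phi> x" using r'(2)[OF x\<Omega>] d by (simp add: r_def)
      then have "real k * (- \<epsilon>) \<le> real k * \<phi> x" by (intro mult_left_mono) auto
      moreover have "2 * real m * (real k * (- \<epsilon>) - R\<^sup>2) \<le> 2 * real m * (real k * (indicator \<Omega> x * \<phi> x) - (norm x)\<^sup>2)"
      proof (rule mult_left_mono)
        have i: "indicator \<Omega> x * \<phi> x = \<phi> x" using x\<Omega> by simp
        show "real k * (- \<epsilon>) - R\<^sup>2 \<le> real k * (indicator \<Omega> x * \<phi> x) - (norm x)\<^sup>2"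
          unfolding i using \<open>real k * (- \<epsilon>) \<le> real k * \<phi> x\<close> n2 by linarith
      qed simp
      moreover have "- (\<eta> / 2) * real k + 2 * real m * (- R\<^sup>2) \<le> 2 * real m * (real k * (- \<epsilon>) - R\<^sup>2)"
        using mult_right_mono[OF m\<epsilon>, of "real k"] by (simp add: algebra_simps)
      ultimately have e1: "exp (- (\<eta> / 2) * real k + 2 * real m * (- R\<^sup>2)) \<le> exp (2 * real m * (real k * (indicator \<Omega> x * \<phi> x) - (norm x)\<^sup>2))"
        by simp
      have e2: "(1 + R) powr (- \<alpha>) \<le> (1 + norm x) powr (- \<alpha>)"
        using \<alpha> \<open>1 + norm x \<le> 1 + R\<close> by (intro powr_mono2') auto
      have "?q = exp (- (\<eta> / 2) * real k + 2 * real m * (- R\<^sup>2)) * (1 + R) powr (- \<alpha>)"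
        unfolding c_def exp_add by (simp only: mult_ac)
      also have "\<dots> \<le> exp (2 * real m * (real k * (indicator \<Omega> x * \<phi> x) - (norm x)\<^sup>2)) * (1 + norm x) powr (- \<alpha>)"
        by (intro mult_mono e1 e2) auto
      finally have "?q * Vb k x \<le> exp (2 * real m * (real k * (indicator \<Omega> x * \<phi> x) - (norm x)\<^sup>2)) * (1 + norm x) powr (- \<alpha>) * Vb k x"
        using Vb0[of k x] by (intro mult_right_mono) auto
      then show ?thesis using True by (simp add: w mult_ac)
    next
      case False
      then show ?thesis using Vb0[of k x] by (simp add: w)
    qed
    have "exp (- \<eta> * real k) = exp (- (\<eta> / 2) * real k) * exp (- (\<eta> / 2) * real k)"
      by (simp add: exp_add[symmetric])
    also have "\<dots> \<le> (c * \<delta>) * exp (- (\<eta> / 2) * real k)" using k2 by (intro mult_right_mono) auto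
    also have "\<dots> = ?q * \<delta>" by (simp add: mult_ac)
    also have "\<dots> \<le> ?q * (\<integral>x. indicator S x * Vb k x \<partial>lborel)" using k3 q by (intro mult_left_mono) auto
    also have "\<dots> = (\<integral>x. ?q * (indicator S x * Vb k x) \<partial>lborel)" by simp
    also have "\<dots> \<le> (\<integral>x. w k x \<partial>lborel)"
    proof (rule integral_mono[OF _ wi])
      show "integrable lborel (\<lambda>x. ?q * (indicator S x * Vb k x))"
      proof (rule Bochner_Integration.integrable_bound[OF wi[of k]])
        show "AE x in lborel. norm (?q * (indicator S x * Vb k x)) \<le> norm (w k x)"
        proof (rule AE_I2)
          fix x
          have "0 \<le> ?q * (indicator S x * Vb k x)" using q c Vb0[of k x] by (intro mult_nonneg_nonneg) auto
          then show "norm (?q * (indicator S x * Vb k x)) \<le> norm (w k x)" using le[of x] unfolding real_norm_def by linarith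
        qed
      qed measurable
    qed (rule le)
    finally show "exp (- \<eta> * real k) \<le> (\<integral>x. w k x \<partial>lborel)" .
  qed
qed

section \<open>The sequence of solutions and its divergence on and off the zero set\<close>

theorem theorem2:
  fixes m :: nat
    and \<Lambda> b :: real
    and \<Omega> :: "(real ^ 'n) set"
    and \<phi> :: "real ^ 'n \<Rightarrow> real"
    and V :: "nat \<Rightarrow> real ^ 'n \<Rightarrow> real"
    and x0 :: "real ^ 'n"
  assumes "m \<ge> 2"
    and "CARD('n) = 2 * m"
    and "0 < \<Lambda>" and "\<Lambda> < Lambda1 m / 2"
    and "open \<Omega>"
    and "\<phi> \<in> K_class m \<Omega>"
    and "\<And>C. C \<in> components \<Omega> \<Longrightarrow> \<exists>x\<in>C. \<phi> x \<noteq> 0"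
    and "\<And>k. V k \<in> borel_measurable (lebesgue_on \<Omega>)"
    and "\<And>k x. x \<in> \<Omega> \<Longrightarrow> 0 \<le> V k x \<and> V k x \<le> b"
    and "x0 \<in> zero_set_star \<Omega> \<phi>"
    and "\<And>\<epsilon>. \<epsilon> > 0 \<Longrightarrow> liminf (\<lambda>k. ereal (LINT x:ball x0 \<epsilon> \<inter> \<Omega>|lebesgue. V k x)) > 0"
  shows "\<exists>u :: nat \<Rightarrow> real ^ 'n \<Rightarrow> real.
     (\<forall>k. liouville_solution m \<Omega> (V k) (u k)) \<and>
     (\<forall>k. continuous_on (\<Omega> \<union> zero_set_star \<Omega> \<phi>) (u k)) \<and>
     (\<forall>k. \<not> (AE x in lebesgue_on \<Omega>. V k x = 0) \<longrightarrow>
        set_integrable lebesgue \<Omega> (\<lambda>x. V k x * exp (2 * real m * u k x)) \<and>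
        (LINT x:\<Omega>|lebesgue. V k x * exp (2 * real m * u k x)) = \<Lambda>) \<and>
     diverges_to_minus_infinity_locally_uniformly_on (\<Omega> - zero_set \<Omega> \<phi>) u \<and>
     diverges_to_infinity_locally_uniformly_on (zero_set_star \<Omega> \<phi>) u"
proof -
  note \<Omega> = \<open>open \<Omega>\<close>
  have m1: "m \<ge> 1" using \<open>m \<ge> 2\<close> by simp
  have dim: "DIM(real ^ 'n) = 2 * m" using \<open>CARD('n) = 2 * m\<close> by simp
  then have dim2: "2 \<le> DIM(real ^ 'n)" using m1 by simp
  have \<phi>: "smooth_on \<Omega> \<phi>" "\<And>x. x \<in> \<Omega> \<Longrightarrow> \<phi> x \<le> 0" "\<exists>x\<in>\<Omega>. \<phi> x \<noteq> 0" "\<And>x. x \<in> \<Omega> \<Longrightarrow> (laplacian ^^ m) \<phi> x = 0"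
    using \<open>\<phi> \<in> K_class m \<Omega>\<close> by (auto simp: K_class_def)
  have c\<phi>: "continuous_on \<Omega> \<phi>" by (rule smooth_on_continuous_on[OF \<phi>(1)])
  have b0: "0 \<le> b" using \<phi>(3) assms(9) order_trans by blast
  have \<Omega>b[measurable]: "\<Omega> \<in> sets borel" using \<Omega> by simp
  \<comment> \<open>Extension by 0: at boundary points of the extended zero set this is the limit of
    \<phi>, so \<open>p\<close> vanishes on all of \<open>zero_set_star\<close>.\<close>
  define p where "p x = indicator \<Omega> x * \<phi> x" for x
  have pm[measurable]: "p \<in> borel_measurable borel"
    using borel_measurable_continuous_on_indicator[OF \<Omega>b c\<phi>] by (simp add: p_def[abs_def])
  have p0: "p x \<le> 0" for x using \<phi>(2)[of x] by (simp add: p_def indicator_def)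
  have pneg: "AE x in lborel. x \<in> \<Omega> \<longrightarrow> p x < 0"
    using polyharmonic_nonpos_AE_neg[OF \<Omega> \<phi>(1) m1 \<phi>(2) _ assms(7)] \<phi>(4) by (simp add: p_def)
  define \<gamma> where "\<gamma> = Lambda1 m / 2"
  have \<gamma>: "0 < \<gamma>" "\<Lambda> < \<gamma>" using assms(3,4) by (auto simp: \<gamma>_def)
  define \<alpha> where "\<alpha> = 2 * real m * \<Lambda> / \<gamma>"
  have \<alpha>0: "0 \<le> \<alpha>" using assms(3) \<gamma> by (simp add: \<alpha>_def)
  have "\<alpha> < 2 * real m" using \<gamma> m1 by (simp add: \<alpha>_def field_simps)
  \<comment> \<open>The midpoint of \<alpha> and the dimension 2m, strictly between them because
    \<Lambda> < \<gamma>.\<close>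
  define \<beta> where "\<beta> = (\<alpha> + 2 * real m) / 2"
  have \<beta>: "\<alpha> < \<beta>" "0 \<le> \<beta>" "\<beta> < real DIM(real ^ 'n)" using \<open>\<alpha> < 2 * real m\<close> \<alpha>0 unfolding dim by (auto simp: \<beta>_def)
  obtain C where C: "0 < C" "\<And>y::real^'n. (\<integral>\<^sup>+x. ennreal (gauss x * exp (\<beta> * pos_log x y)) \<partial>lborel) \<le> ennreal C"
    using nn_integral_exp_pos_log[OF \<beta>(2,3)] by blast
  have "\<forall>k. \<exists>W. W \<in> borel_measurable borel \<and> (\<forall>x. 0 \<le> W x \<and> W x \<le> b) \<and> (\<forall>x. x \<notin> \<Omega> \<longrightarrow> W x = 0) \<and>
    (AE x in lebesgue. x \<in> \<Omega> \<longrightarrow> V k x = W x)"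
  proof
    fix k
    show "\<exists>W. W \<in> borel_measurable borel \<and> (\<forall>x. 0 \<le> W x \<and> W x \<le> b) \<and> (\<forall>x. x \<notin> \<Omega> \<longrightarrow> W x = 0) \<and>
      (AE x in lebesgue. x \<in> \<Omega> \<longrightarrow> V k x = W x)"
      using borel_version[OF \<Omega> assms(8)[of k] assms(9)[of _ k] b0] by blast
  qed
  from choice[OF this] obtain Vb where Vb: "\<forall>k. Vb k \<in> borel_measurable borel \<and> (\<forall>x. 0 \<le> Vb k x \<and> Vb k x \<le> b) \<and>
    (\<forall>x. x \<notin> \<Omega> \<longrightarrow> Vb k x = 0) \<and> (AE x in lebesgue. x \<in> \<Omega> \<longrightarrow> V k x = Vb k x)" ..
  have Vbm[measurable]: "Vb k \<in> borel_measurable borel" and Vb0: "0 \<le> Vb k x \<and> Vb k x \<le> b"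
    and VVb: "AE x in lebesgue. x \<in> \<Omega> \<longrightarrow> V k x = Vb k x" for k x using Vb by blast+
  have Vbz: "Vb k x = 0" if "x \<notin> \<Omega>" for k x using Vb that by blast
  define H where "H k x = real k * p x - (norm x)\<^sup>2" for k x
  have Hm[measurable]: "H k \<in> borel_measurable borel" for k unfolding H_def by measurable
  have HW: "H k x \<le> - (norm x)\<^sup>2" for k x using mult_nonneg_nonpos[OF of_nat_0_le_iff p0, of k x] by (simp add: H_def)
  define w where "w k = (\<lambda>x. Vb k x * exp (2 * real m * H k x) * (1 + norm x) powr (- \<alpha>))" for k
  have wm[measurable]: "w k \<in> borel_measurable borel" for k unfolding w_def by measurable
  have w0: "0 \<le> w k x" for k x using Vb0[of k x] by (simp add: w_def)
  have wle: "w k x \<le> b * (gauss x * (indicator \<Omega> x * exp (2 * real m * (real k * p x))))" for k x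
  proof (cases "x \<in> \<Omega>")
    case True
    have "1 * (norm x)\<^sup>2 \<le> 2 * real m * (norm x)\<^sup>2" using m1 by (intro mult_right_mono) auto
    then have "2 * real m * H k x \<le> - (norm x)\<^sup>2 + 2 * real m * (real k * p x)" by (simp add: H_def algebra_simps)
    then have "exp (2 * real m * H k x) \<le> gauss x * exp (2 * real m * (real k * p x))"
      unfolding gauss_def exp_add[symmetric] by simp
    moreover have "(1 + norm x) powr (- \<alpha>) \<le> 1"
      using powr_mono[of "- \<alpha>" 0 "1 + norm x"] \<alpha>0 one_plus_norm_pos[of x] by simp
    ultimately have "Vb k x * exp (2 * real m * H k x) * (1 + norm x) powr (- \<alpha>) \<le> (b * (gauss x * exp (2 * real m * (real k * p x)))) * 1"
      using Vb0[of k x] b0 by (intro mult_mono) (auto simp: gauss_def)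
    then show ?thesis using True by (simp add: w_def)
  qed (simp add: w_def Vbz)
  have wabs: "\<bar>w k x\<bar> \<le> b * gauss x" for k x
  proof -
    have "2 * real m * (real k * p x) \<le> 0" using p0[of x] by (simp add: mult_nonneg_nonpos)
    then have "indicator \<Omega> x * exp (2 * real m * (real k * p x)) \<le> 1" by (auto simp: indicator_def)
    then have "b * (gauss x * (indicator \<Omega> x * exp (2 * real m * (real k * p x)))) \<le> b * (gauss x * 1)"
      using b0 by (intro mult_left_mono) (auto simp: gauss_def)
    with wle[of k x] w0[of k x] show ?thesis by simp
  qed
  have wi: "integrable lborel (w k)" for k by (rule decaying_weight(2)[OF wm wabs])
  \<comment> \<open>The indices whose mass can be prescribed; for all others \<open>V k\<close>
    vanishes almost everywhere in \<Omega>.\<close>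
  define A where "A = {k. \<not> (AE x in lebesgue_on \<Omega>. V k x = 0)}"
  have Ipos: "0 < (\<integral>x. w k x \<partial>lborel)" if k: "k \<in> A" for k
  proof (rule ccontr)
    assume "\<not> 0 < (\<integral>x. w k x \<partial>lborel)"
    moreover have "0 \<le> (\<integral>x. w k x \<partial>lborel)" using w0 by simp
    ultimately have "(\<integral>x. w k x \<partial>lborel) = 0" by linarith
    then have "AE x in lborel. w k x = 0"
      using integral_nonneg_eq_0_iff_AE[OF wi[of k]] w0 by simp
    then have "AE x in lebesgue. w k x = 0" by (rule AE_lebesgueI)
    with VVb[of k] have "AE x in lebesgue. x \<in> \<Omega> \<longrightarrow> V k x = 0"
    proof eventually_elim
      fix x assume 1: "x \<in> \<Omega> \<longrightarrow> V k x = Vb k x" and 2: "w k x = 0"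
      have "(1 + norm x) powr (- \<alpha>) \<noteq> 0" using one_plus_norm_pos[of x] by (metis less_irrefl powr_eq_0_iff)
      then have "Vb k x = 0" using 2 by (simp add: w_def)
      then show "x \<in> \<Omega> \<longrightarrow> V k x = 0" using 1 by simp
    qed
    then have "AE x in lebesgue_on \<Omega>. V k x = 0"
      using \<Omega> by (subst AE_restrict_space_iff) auto
    with k show False by (simp add: A_def)
  qed
  \<comment> \<open>Everything needed for the asymptotics is visible in this form: U will be
    nonnegative and bounded above through the mass of the weight, and the last summand grows as the
    partition function shrinks.\<close>
  define rep where "rep k U x = H k x + \<Lambda> / \<gamma> * (U x - ln (1 + norm x)) +
      ln (\<Lambda> / (\<integral>x. w k x * exp (\<alpha> * U x) \<partial>lborel)) / (2 * real m)" for k and U :: "real^'n \<Rightarrow> real" and x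
  \<comment> \<open>All properties of one solution are collected in a predicate of k and U, so that
    a single choice over \<open>A\<close> yields the sequence.\<close>
  define good where "good k U \<longleftrightarrow> liouville_solution m \<Omega> (V k) (rep k U) \<and>
      continuous_on (\<Omega> \<union> zero_set_star \<Omega> \<phi>) (rep k U) \<and>
      set_integrable lebesgue \<Omega> (\<lambda>x. V k x * exp (2 * real m * rep k U x)) \<and>
      (LINT x:\<Omega>|lebesgue. V k x * exp (2 * real m * rep k U x)) = \<Lambda> \<and>
      (\<forall>x. 0 \<le> U x) \<and> (\<forall>x. (\<beta> - \<alpha>) * U x \<le> ln (2 * b * C / (\<integral>x. w k x \<partial>lborel))) \<and>
      U \<in> borel_measurable borel \<and> integrable lborel (\<lambda>x. w k x * exp (\<alpha> * U x)) \<and>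
      (\<integral>x. w k x \<partial>lborel) \<le> (\<integral>x. w k x * exp (\<alpha> * U x) \<partial>lborel) \<and>
      (\<integral>\<^sup>+x. ennreal (gauss x * exp (\<beta> * U x)) \<partial>lborel) \<le> ennreal C" for k U
  have "\<exists>U. good k U" if k: "k \<in> A" for k
  proof -
    obtain u f U Z c where
      u1: "\<forall>x. u x = H k x + \<Lambda> / \<gamma> * (U x - ln (1 + norm x)) + ln (\<Lambda> / Z) / (2 * real m)"
      and u2: "\<forall>x. u x = H k x + c + \<Lambda> / \<gamma> * conv log_kernel f x"
      and f: "decaying f" "(\<integral>x. f x \<partial>lborel) = 1" and eq: "\<forall>x. Vb k x * exp (2 * real m * u x) = \<Lambda> * f x"
      and U: "\<forall>x. 0 \<le> U x" "\<forall>x. (\<beta> - \<alpha>) * U x \<le> ln (2 * b * C / (\<integral>x. w k x \<partial>lborel))"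
        "U \<in> borel_measurable borel" and Z: "Z = (\<integral>x. w k x * exp (\<alpha> * U x) \<partial>lborel)"
      and i: "integrable lborel (\<lambda>x. w k x * exp (\<alpha> * U x))" "(\<integral>x. w k x \<partial>lborel) \<le> Z"
        "(\<integral>\<^sup>+x. ennreal (gauss x * exp (\<beta> * U x)) \<partial>lborel) \<le> ennreal C"
      using solution_from_weight[OF dim2 m1 assms(3) \<gamma>(1) \<alpha>_def \<beta>(1) C Vbm[of k] Vb0[of k] Hm[of k] HW[of k] w_def[of k] Ipos[OF k]]
      by (elim exE conjE) (rule that)
    have ur: "u = rep k U" using u1 unfolding rep_def Z by blast
    \<comment> \<open>\<open>rad 0 1\<close> is |x|^2 + 1, hence the compensating constant c + 1;
      this form lets the Laplacians computed for \<open>rad\<close> be reused for the quadratic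
      term.\<close>
    define h where "h x = real k * \<phi> x + ((-1) * rad 0 1 x + (c + 1))" for x
    have rad: "rad 0 1 x = (norm x)\<^sup>2 + 1" for x :: "real^'n"
      using rad_def[of 1 0 x] by (simp add: power2_norm_eq_inner)
    have sr: "smooth_on \<Omega> (rad 0 1)" using smooth_rad[of 1 "0 :: real^'n"] smooth_on_subset by fastforce
    have s1: "smooth_on \<Omega> (\<lambda>x. (-1) * rad 0 1 x)" by (rule smooth_on_cmult[OF \<Omega> sr])
    have s2: "smooth_on \<Omega> (\<lambda>x. (-1) * rad 0 1 x + (c + 1))" by (rule smooth_on_add[OF \<Omega> s1 smooth_on_const])
    have s3: "smooth_on \<Omega> (\<lambda>x. real k * \<phi> x)" by (rule smooth_on_cmult[OF \<Omega> \<phi>(1)])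
    have sh: "smooth_on \<Omega> h" unfolding h_def by (rule smooth_on_add[OF \<Omega> s3 s2])
    have lc: "(laplacian ^^ m) (\<lambda>x::real^'n. c + 1) = (\<lambda>_. 0)"
    proof -
      obtain n where n: "m = Suc n" using m1 by (metis not0_implies_Suc not_one_le_zero)
      have "(laplacian ^^ n) (\<lambda>x::real^'n. 0) = (\<lambda>_. 0)" by (induction n) (simp_all add: laplacian_const)
      then show ?thesis unfolding n funpow_Suc_right o_apply laplacian_const .
    qed
    have lh: "(laplacian ^^ m) h x = 0" if x: "x \<in> \<Omega>" for x
    proof -
      have "(laplacian ^^ m) h x = (laplacian ^^ m) (\<lambda>x. real k * \<phi> x) x + (laplacian ^^ m) (\<lambda>x. (-1) * rad 0 1 x + (c + 1)) x"
        unfolding h_def by (rule laplacian_power_add[OF \<Omega> s3 s2 x])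
      also have "(laplacian ^^ m) (\<lambda>x. (-1) * rad 0 1 x + (c + 1)) x = (laplacian ^^ m) (\<lambda>x. (-1) * rad 0 1 x) x + (laplacian ^^ m) (\<lambda>x. c + 1) x"
        by (rule laplacian_power_add[OF \<Omega> s1 smooth_on_const x])
      also have "(laplacian ^^ m) (\<lambda>x. (-1) * rad 0 1 x) x = (-1) * (laplacian ^^ m) (rad 0 1) x"
        by (rule laplacian_power_cmult[OF \<Omega> sr x])
      also have "(laplacian ^^ m) (\<lambda>x. real k * \<phi> x) x = real k * (laplacian ^^ m) \<phi> x"
        by (rule laplacian_power_cmult[OF \<Omega> \<phi>(1) x])
      finally show ?thesis by (simp add: \<phi>(4)[OF x] lc laplacian_power_rad[OF zero_less_one \<open>m \<ge> 2\<close>])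
    qed
    have uh: "u x = h x + \<Lambda> / \<gamma> * conv log_kernel f x" if "x \<in> \<Omega>" for x
      using u2 that by (simp add: h_def H_def p_def rad)
    have fz: "f x = 0" if "x \<notin> \<Omega>" for x
      using eq[rule_format, of x] Vbz[OF that, of k] assms(3) by simp
    have e\<gamma>: "\<Lambda> / \<gamma> * (Lambda1 m / 2) = \<Lambda>" using \<gamma>(1) by (simp add: \<gamma>_def)
    have eq': "Vb k x * exp (2 * real m * u x) = \<Lambda> / \<gamma> * (Lambda1 m / 2) * f x" if "x \<in> \<Omega>" for x
      unfolding e\<gamma> using eq by blast
    note sol = liouville_solutionI[OF dim m1 \<Omega> assms(8)[of k] VVb[of k] sh lh f(1) fz uh eq']
    have "continuous_on (\<Omega> \<union> zero_set_star \<Omega> \<phi>) (\<lambda>x. H k x + c + \<Lambda> / \<gamma> * conv log_kernel f x)"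
      unfolding H_def p_def
      by (intro continuous_intros continuous_on_extension \<Omega> c\<phi> conv_continuous[OF sing_kernel_log[OF dim2] f(1)])
    moreover have "u = (\<lambda>x. H k x + c + \<Lambda> / \<gamma> * conv log_kernel f x)" using u2 by blast
    ultimately have cu: "continuous_on (\<Omega> \<union> zero_set_star \<Omega> \<phi>) u" by simp
    have "good k U" unfolding good_def ur[symmetric]
      using sol cu U i unfolding e\<gamma> f(2) Z by simp
    then show ?thesis by blast
  qed
  then have "\<forall>k\<in>A. \<exists>U. good k U" by blast
  from bchoice[OF this] obtain U where U: "\<forall>k\<in>A. good k (U k)" by blast
  \<comment> \<open>Outside \<open>A\<close> the zero function is a solution. Almost all indices
    will turn out to lie in \<open>A\<close>, so these defaults do not affect the limits.\<close>
  define u where "u k = (if k \<in> A then rep k (U k) else (\<lambda>x. 0))" for k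
  define I where "I k = (\<integral>x. w k x \<partial>lborel)" for k
  define Z where "Z k = (\<integral>x. w k x * exp (\<alpha> * U k x) \<partial>lborel)" for k
  have g: "good k (U k)" if "k \<in> A" for k using U that by blast
  have U0: "0 \<le> U k x" if "k \<in> A" for k x
    using g[OF that] unfolding good_def by (elim conjE) (erule allE, assumption)
  have UL: "(\<beta> - \<alpha>) * U k x \<le> ln (2 * b * C / I k)" if "k \<in> A" for k x
    using g[OF that] unfolding good_def I_def by (elim conjE) (erule allE, assumption)
  have IZ: "I k \<le> Z k" if "k \<in> A" for k
    using g[OF that] unfolding good_def I_def Z_def by (elim conjE)
  have near: "\<exists>r>0. \<forall>y\<in>\<Omega>. dist y x0 < r \<longrightarrow> \<bar>\<phi> y\<bar> < e" if "0 < e" for e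
    by (rule near_zero_set_star[OF \<Omega> c\<phi> assms(10) that]) blast
  \<comment> \<open>Used with rate 1 to see that almost all indices lie in \<open>A\<close>, and
    with a small rate for the divergence to minus infinity.\<close>
  have Ilow: "\<forall>\<^sub>F k in sequentially. exp (- \<eta> * real k) \<le> I k" if "0 < \<eta>" for \<eta>
    unfolding I_def
    by (rule weight_integral_lower_bound[where m = m, OF \<Omega> Vbm Vb0 assms(8) VVb near assms(11) _ wi \<alpha>0 that])
      (assumption | simp add: w_def H_def p_def)+
  have inA: "\<forall>\<^sub>F k in sequentially. k \<in> A"
    using Ilow[OF zero_less_one]
  proof (rule eventually_mono)
    fix k assume I1: "exp (- 1 * real k) \<le> I k"
    show "k \<in> A"
    proof (rule ccontr)
      assume "k \<notin> A"
      then have "AE x in lebesgue. x \<in> \<Omega> \<longrightarrow> V k x = 0"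
        using \<Omega> unfolding A_def by (subst (asm) AE_restrict_space_iff) auto
      with VVb[of k] have ae: "AE x in lebesgue. w k x = 0"
      proof eventually_elim
        fix x assume "x \<in> \<Omega> \<longrightarrow> V k x = Vb k x" "x \<in> \<Omega> \<longrightarrow> V k x = 0"
        then show "w k x = 0" using Vbz[of x k] by (auto simp: w_def)
      qed
      have wl: "w k \<in> borel_measurable lborel" by measurable
      have "I k = (\<integral>x. w k x \<partial>lebesgue)" unfolding I_def by (rule integral_completion[OF wl, symmetric])
      also have "\<dots> = (\<integral>x. 0 \<partial>(lebesgue :: (real^'n) measure))"
        by (rule integral_cong_AE[OF measurable_completion[OF wl] _ ae]) simp
      finally have "I k = 0" by simp
      with I1 show False using exp_gt_zero[of "- 1 * real k"] by linarith
    qed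
  qed
  have Zsmall: "\<forall>\<^sub>F k in sequentially. k \<in> A \<longrightarrow> Z k < e" if "0 < e" for e
    unfolding Z_def
  proof (rule normalisation_tendsto_zero[where q = "2 * real m" and b = b and C = C and \<beta> = \<beta>, OF \<alpha>0 \<beta>(1) _ b0 _ \<Omega>b pm p0 pneg])
    show "0 < 2 * real m" using m1 by simp
    show "0 \<le> C" using C(1) by simp
    show "0 \<le> w k x \<and> w k x \<le> b * (gauss x * (indicator \<Omega> x * exp (2 * real m * (real k * p x))))" for k x
      using w0 wle by blast
    show "U k \<in> borel_measurable borel" if "k \<in> A" for k
      using g[OF that] unfolding good_def by (elim conjE)
    show "(\<integral>\<^sup>+x. ennreal (gauss x * exp (\<beta> * U k x)) \<partial>lborel) \<le> ennreal C" if "k \<in> A" for k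
      using g[OF that] unfolding good_def by (elim conjE)
    show "integrable lborel (\<lambda>x. w k x * exp (\<alpha> * U k x))" if "k \<in> A" for k
      using g[OF that] unfolding good_def by (elim conjE)
  qed (rule that)
  have Zpos: "0 < Z k" if "k \<in> A" for k using IZ[OF that] Ipos[OF that] unfolding I_def by linarith
  have P1: "liouville_solution m \<Omega> (V k) (u k)" for k
  proof (cases "k \<in> A")
    case True
    then show ?thesis using g[OF True] by (simp add: good_def u_def)
  next
    case False
    have z: "(laplacian ^^ m) (\<lambda>_::real^'n. 0) = (\<lambda>_. 0)" by (induction m) (simp_all add: laplacian_const)
    have ae: "AE x in lebesgue. x \<in> \<Omega> \<longrightarrow> V k x = 0"
      using False \<Omega> unfolding A_def by simp (subst (asm) AE_restrict_space_iff, auto)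
    \<comment> \<open>The degenerate case t = 0 of the criterion, with 0 as the representative of
      \<open>V k\<close>.\<close>
    have "liouville_solution m \<Omega> (V k) (\<lambda>x. 0)"
      by (rule liouville_solutionI(1)[where h = "\<lambda>x. 0" and f = "\<lambda>x. 0" and t = 0 and Vb = "\<lambda>x. 0", OF dim m1 \<Omega> assms(8) ae])
        (auto simp: smooth_on_const z decaying_def)
    then show ?thesis using False by (simp add: u_def)
  qed
  have P2: "continuous_on (\<Omega> \<union> zero_set_star \<Omega> \<phi>) (u k)" for k
  proof (cases "k \<in> A")
    case True
    have "continuous_on (\<Omega> \<union> zero_set_star \<Omega> \<phi>) (rep k (U k))" using g[OF True] unfolding good_def by (elim conjE)
    then show ?thesis using True by (simp add: u_def)
  qed (simp add: u_def)
  have P3: "set_integrable lebesgue \<Omega> (\<lambda>x. V k x * exp (2 * real m * u k x)) \<and>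
        (LINT x:\<Omega>|lebesgue. V k x * exp (2 * real m * u k x)) = \<Lambda>" if "\<not> (AE x in lebesgue_on \<Omega>. V k x = 0)" for k
  proof -
    have k: "k \<in> A" using that by (simp add: A_def)
    then show ?thesis using g[OF k] by (simp add: good_def u_def)
  qed
  have u_eq: "u k x = real k * p x - (norm x)\<^sup>2 + \<Lambda> / \<gamma> * (U k x - ln (1 + norm x)) + ln (\<Lambda> / Z k) / (2 * real m)"
    if "k \<in> A" for k x using that by (simp add: u_def rep_def H_def Z_def)
  have ratio: "0 < \<Lambda> / \<gamma>" using assms(3) \<gamma>(1) by simp
  have P4: "diverges_to_minus_infinity_locally_uniformly_on (\<Omega> - zero_set \<Omega> \<phi>) u"
    unfolding diverges_to_minus_infinity_locally_uniformly_on_def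
  proof
    fix x assume "x \<in> \<Omega> - zero_set \<Omega> \<phi>"
    then have x: "x \<in> \<Omega>" "\<phi> x < 0" using \<phi>(2)[of x] by (auto simp: zero_set_def less_le)
    \<comment> \<open>By continuity \<phi> stays below -c on a ball around x, so there the leading
      term k \<phi> is at most -c k.\<close>
    define c where "c = - \<phi> x / 2"
    have c: "0 < c" using x by (simp add: c_def)
    obtain d where d: "d > 0" "\<And>y. y \<in> \<Omega> \<Longrightarrow> dist y x < d \<Longrightarrow> dist (\<phi> y) (\<phi> x) < c"
      using c\<phi> x(1) c unfolding continuous_on_iff by blast
    have pc: "p y \<le> - c" if "y \<in> \<Omega>" "dist y x < d" for y
      using d(2)[OF that] that(1) by (simp add: p_def c_def dist_real_def abs_less_iff)
    \<comment> \<open>\<open>a\<close> collects the factors with which -ln(I k) enters the upper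
      bound for \<open>u k\<close>: once through the supremum of the potential, once through
      ln(\<Lambda> / Z k)/(2m). The rate \<eta> = c/(2a) limits these losses to half of the gain c
      k.\<close>
    define a where "a = \<Lambda> / \<gamma> / (\<beta> - \<alpha>) + 1 / (2 * real m)"
    have "0 < \<Lambda> / \<gamma> / (\<beta> - \<alpha>)" using \<beta>(1) by (intro divide_pos_pos[OF ratio]) simp
    then have a: "0 < a" using m1 by (simp add: a_def add_pos_pos)
    define \<eta> where "\<eta> = c / (2 * a)"
    have \<eta>: "0 < \<eta>" using a c by (simp add: \<eta>_def)
    define B where "B = \<Lambda> / \<gamma> / (\<beta> - \<alpha>) * ln (2 * b * C) + ln \<Lambda> / (2 * real m)"
    have upper: "u k y \<le> B - c / 2 * real k" if k: "k \<in> A" and I: "exp (- \<eta> * real k) \<le> I k" and y: "y \<in> \<Omega>" "dist y x < d" for k y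
    proof -
      have Ip: "0 < I k" using Ipos[OF k] by (simp add: I_def)
      have lnI: "- ln (I k) \<le> \<eta> * real k"
      proof -
        have "ln (exp (- \<eta> * real k)) \<le> ln (I k)" using I Ip by (subst ln_le_cancel_iff) auto
        then show ?thesis by simp
      qed
      have b1: "0 < b"
      proof (rule ccontr)
        assume "\<not> 0 < b"
        then have "b = 0" using b0 by simp
        then have "w k z = 0" for z using wabs[of k z] by simp
        then show False using Ip by (simp add: I_def)
      qed
      have "(\<beta> - \<alpha>) * U k y \<le> ln (2 * b * C) - ln (I k)"
        using UL[OF k, of y] b1 C(1) Ip by (simp add: ln_div)
      then have "(\<beta> - \<alpha>) * U k y \<le> ln (2 * b * C) + \<eta> * real k" using lnI by linarith
      then have "U k y \<le> (ln (2 * b * C) + \<eta> * real k) / (\<beta> - \<alpha>)" using \<beta>(1) by (simp add: field_simps)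
      then have t1: "\<Lambda> / \<gamma> * U k y \<le> \<Lambda> / \<gamma> * ((ln (2 * b * C) + \<eta> * real k) / (\<beta> - \<alpha>))"
        using ratio by (intro mult_left_mono) auto
      have "0 \<le> ln (1 + norm y)" by simp
      then have t2: "\<Lambda> / \<gamma> * (U k y - ln (1 + norm y)) \<le> \<Lambda> / \<gamma> * U k y"
        using ratio by (intro mult_left_mono) auto
      have "ln (I k) \<le> ln (Z k)" using IZ[OF k] Ip Zpos[OF k] by (subst ln_le_cancel_iff) auto
      then have "ln (\<Lambda> / Z k) \<le> ln \<Lambda> + \<eta> * real k" using lnI Zpos[OF k] assms(3) by (simp add: ln_div)
      then have t3: "ln (\<Lambda> / Z k) / (2 * real m) \<le> (ln \<Lambda> + \<eta> * real k) / (2 * real m)"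
        using m1 by (intro divide_right_mono) auto
      have t4: "real k * p y \<le> real k * (- c)" using pc[OF y] by (intro mult_left_mono) auto
      have "0 \<le> (norm y)\<^sup>2" by simp
      with t1 t2 t3 t4 have "u k y \<le> real k * (- c) + \<Lambda> / \<gamma> * ((ln (2 * b * C) + \<eta> * real k) / (\<beta> - \<alpha>)) + (ln \<Lambda> + \<eta> * real k) / (2 * real m)"
        unfolding u_eq[OF k] by linarith
      also have "\<dots> = B + a * \<eta> * real k - c * real k"
        by (simp add: B_def a_def add_divide_distrib algebra_simps)
      also have "a * \<eta> = c / 2" using a by (simp add: \<eta>_def)
      finally show ?thesis by (simp add: algebra_simps)
    qed
    show "\<exists>r>0. \<forall>M. \<forall>\<^sub>F k in sequentially. \<forall>y\<in>(\<Omega> - zero_set \<Omega> \<phi>) \<inter> ball x r. u k y < M"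
    proof (intro exI[of _ d] conjI allI d(1))
      fix M
      have "filterlim (\<lambda>k. B - c / 2 * real k) at_bot sequentially" using c by real_asymp
      then have "\<forall>\<^sub>F k in sequentially. B - c / 2 * real k < M" by (simp add: filterlim_at_bot_dense)
      with inA Ilow[OF \<eta>] show "\<forall>\<^sub>F k in sequentially. \<forall>y\<in>(\<Omega> - zero_set \<Omega> \<phi>) \<inter> ball x d. u k y < M"
      proof eventually_elim
        fix k assume k: "k \<in> A" and I: "exp (- \<eta> * real k) \<le> I k" and M: "B - c / 2 * real k < M"
        show "\<forall>y\<in>(\<Omega> - zero_set \<Omega> \<phi>) \<inter> ball x d. u k y < M"
        proof
          fix y assume "y \<in> (\<Omega> - zero_set \<Omega> \<phi>) \<inter> ball x d"
          then have "y \<in> \<Omega>" "dist y x < d" by (auto simp: dist_commute)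
          from upper[OF k I this] M show "u k y < M" by linarith
        qed
      qed
    qed
  qed
  have P5: "diverges_to_infinity_locally_uniformly_on (zero_set_star \<Omega> \<phi>) u"
    unfolding diverges_to_infinity_locally_uniformly_on_def
  proof
    fix x assume "x \<in> zero_set_star \<Omega> \<phi>"
    define R where "R = norm x + 1"
    have R: "0 \<le> R" by (simp add: R_def)
    show "\<exists>r>0. \<forall>M. \<forall>\<^sub>F k in sequentially. \<forall>y\<in>zero_set_star \<Omega> \<phi> \<inter> ball x r. M < u k y"
    proof (intro exI[of _ 1] conjI allI zero_less_one)
      fix M
      \<comment> \<open>Chosen so that Z k < e makes ln(\<Lambda> / Z k)/(2m) exceed |M| plus R^2
        and (\<Lambda>/\<gamma>) R, the largest possible losses from the quadratic term and from
        -ln(1 + |y|) on the unit ball around x.\<close>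
      define e where "e = \<Lambda> * exp (- (2 * real m * (\<bar>M\<bar> + R\<^sup>2 + \<Lambda> / \<gamma> * R)))"
      have e: "0 < e" using assms(3) by (simp add: e_def)
      from inA Zsmall[OF e] show "\<forall>\<^sub>F k in sequentially. \<forall>y\<in>zero_set_star \<Omega> \<phi> \<inter> ball x 1. M < u k y"
      proof eventually_elim
        fix k assume k: "k \<in> A" and "k \<in> A \<longrightarrow> Z k < e"
        then have Ze: "Z k < e" by blast
        have "ln (Z k) < ln e" using Ze Zpos[OF k] e by (subst ln_less_cancel_iff) auto
        also have "ln e = ln \<Lambda> - 2 * real m * (\<bar>M\<bar> + R\<^sup>2 + \<Lambda> / \<gamma> * R)"
          unfolding e_def using assms(3) by (subst ln_mult_pos) auto
        finally have "2 * real m * (\<bar>M\<bar> + R\<^sup>2 + \<Lambda> / \<gamma> * R) < ln (\<Lambda> / Z k)"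
          using Zpos[OF k] assms(3) by (simp add: ln_div)
        then have lower: "\<bar>M\<bar> + R\<^sup>2 + \<Lambda> / \<gamma> * R < ln (\<Lambda> / Z k) / (2 * real m)"
          using m1 by (subst pos_less_divide_eq) (auto simp: mult.commute)
        show "\<forall>y\<in>zero_set_star \<Omega> \<phi> \<inter> ball x 1. M < u k y"
        proof
          fix y assume y: "y \<in> zero_set_star \<Omega> \<phi> \<inter> ball x 1"
          have "p y = 0" using zero_set_star_cases[OF \<Omega>, of y \<phi>] y by (auto simp: p_def)
          moreover have nR: "norm y \<le> R" using y norm_triangle_sub[of y x] by (simp add: R_def dist_norm norm_minus_commute)
          then have "(norm y)\<^sup>2 \<le> R\<^sup>2" by (simp add: power_mono)
          moreover have "- (\<Lambda> / \<gamma> * R) \<le> \<Lambda> / \<gamma> * (U k y - ln (1 + norm y))"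
          proof -
            have "- R \<le> U k y - ln (1 + norm y)"
              using U0[OF k, of y] ln_add_one_self_le_self[of "norm y"] nR by simp
            from mult_left_mono[OF this, of "\<Lambda> / \<gamma>"] ratio show ?thesis by simp
          qed
          ultimately show "M < u k y" using lower unfolding u_eq[OF k] by simp
        qed
      qed
    qed
  qed
  show ?thesis using P1 P2 P3 P4 P5 by blast
qed

end
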